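(* Let $\widetilde M\in\widetilde{\mathcal O}$ and put $M=T(\widetilde M)$, $\overline M=\overline T(\widetilde M)$. For every $n\ge0$: (i) $T(H_n(\widetilde{\mathfrak u}_-;\widetilde M))\cong H_n(\mathfrak u_-;M)$ as $\mathfrak l$-modules; (ii) $\overline T(H_n(\widetilde{\mathfrak u}_-;\widetilde M))\cong H_n(\overline{\mathfrak u}_-;\overline M)$ as $\overline{\mathfrak l}$-modules.
   Context: **Lie superalgebras.** Everything is over $\mathbb C$; $\mathbb N=\{1,2,\dots\}$, $\mathbb Z_+=\{0,1,\dots\}$. Fix $m\in\mathbb Z_+$ and a type $x\in\{\mathfrak b,\mathfrak b^\bullet,\mathfrak c,\mathfrak d\}$. Put $\widetilde I^+=\{-m,\dots,-1\}\cup\frac12\mathbb N$, $I^+=\{-m,\dots,-1\}\cup\mathbb N$, $\overline I^+=\{-m,\dots,-1\}\cup(\frac12+\mathbb Z_+)$. Let $\widetilde V$ be the superspace with basis $v_r,v_{\bar r}$ ($r\in\widetilde I^+$) and, for types $\mathfrak b,\mathfrak b^\bullet$ only, one more vector $v_{\bar 0}$; $v_r,v_{\bar r}$ are even if $r\in\mathbb Z$ and odd otherwise; $v_{\bar0}$ is even for $\mathfrak b$ and odd for $\mathfrak b^\bullet$. Let $\kappa=1$ for $\mathfrak b,\mathfrak d$ and $\kappa=-1$ for $\mathfrak b^\bullet,\mathfrak c$; define a bilinear form by $(v_r|v_s)=(v_{\bar r}|v_{\bar s})=0$, $(v_r|v_{\bar s})=\delta_{rs}=\kappa(-1)^{|v_r||v_s|}(v_{\bar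 s}|v_r)$ for $r,s\in\widetilde I^+$, $(v_{\bar0}|v_{\bar0})=1$, and $v_{\bar0}$ orthogonal to all other basis vectors. Let $G$ be the Lie superalgebra of finitely supported matrices $X\in\mathfrak{gl}(\widetilde V)$ preserving the form. Let $\widetilde{\mathfrak g}=\{\widehat X: X\in G\}\oplus\mathbb CK$ with $K$ central and $[\widehat X,\widehat Y]=\widehat{[X,Y]}+\mathrm{Str}([J,X]Y)K$, where $J=E_{\bar0\bar0}$ (if present) $+\sum_{r\in\frac12\mathbb N}E_{\bar r\bar r}$. Let $\mathfrak g$ (resp. $\overline{\mathfrak g}$) be the subalgebra of $\widetilde{\mathfrak g}$ spanned by $K$ and the $\widehat X$ with $X$ supported in rows and columns indexed by $\bar0$ and $r,\bar r$ with $r\in I^+$ (resp. $r\in\overline I^+$). **Cartan, Borel, Levi.** $\widetilde{\mathfrak h}$ has basis $K$, $\widehat E_r$ ($r\in\widetilde I^+$), where $E_r=E_{rr}-E_{\bar r\bar r}$; $\widetilde{\mathfrak h}^*$ denotes the restricted dual, i.e. the span of the dual basis $\Lambda_0,\epsilon_r$. $\mathfrak h=\widetilde{\mathfrak h}\cap\mathfrak g$, $\overline{\mathfrak h}=\widetilde{\mathfrak h}\cap\overline{\mathfrak g}$, and $\mathfrak h^*$, $\overline{\mathfrak h}^*\subset\widetilde{\mathfrak h}^*$ are the spans of $\Lambda_0$ and $\epsilon_r$ with $r\in I^+$, resp. $r\in\overline I^+$. Order indices by $\cdots<\overline{3/2}<\overline1<\overline{1/2}<\overline{-1}<\cdots<\overline{-m}<\overline0<-m<\cdots<-1<\frac12<1<\frac32<\cdots$;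 the Borel $\widetilde{\mathfrak b}$ is spanned by $K$ and $\widehat X$ with $X$ upper triangular; $\mathfrak b=\widetilde{\mathfrak b}\cap\mathfrak g$, $\overline{\mathfrak b}=\widetilde{\mathfrak b}\cap\overline{\mathfrak g}$. These define positive roots. Let $A=\{\epsilon_j-\epsilon_{j+1}:-m\le j\le-2\}$ and $\Pi(\mathfrak k)=A\cup\{-\epsilon_{-m}\}$ for $\mathfrak b,\mathfrak b^\bullet$, $A\cup\{-2\epsilon_{-m}\}$ for $\mathfrak c$, $A\cup\{-\epsilon_{-m}-\epsilon_{-m+1}\}$ for $\mathfrak d$; $\Pi(\mathfrak k)=\emptyset$ if $m=0$ or if $x=\mathfrak d$, $m=1$. Fix an arbitrary $Y_0\subset\Pi(\mathfrak k)$. The Levi subalgebra $\widetilde{\mathfrak l}$ is $\widetilde{\mathfrak h}$ plus the root spaces for roots in the $\mathbb Z$-span of $Y_0\cup\{\epsilon_r-\epsilon_{r+1/2}:r\in\frac12\mathbb N\}$; $\widetilde{\mathfrak p}=\widetilde{\mathfrak l}+\widetilde{\mathfrak b}$, with nilradical $\widetilde{\mathfrak u}$ and opposite nilradical $\widetilde{\mathfrak u}_-$. Intersecting with $\mathfrak g$ (resp. $\overline{\mathfrak g}$) gives $\mathfrak l,\mathfrak p,\mathfrak u,\mathfrak u_-$ (resp. $\overline{\mathfrak l},\overline{\mathfrak p},\overline{\mathfrak u},\overline{\mathfrak u}_-$). **Weights.** For a partition $\mu$ with conjugate $\mu'$ put $\theta(\mu)_{i-1/2}=\max\{\mu'_i-i+1,0\}$,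 $\theta(\mu)_i=\max\{\mu_i-i,0\}$, $i\in\mathbb N$. $P^+\subset\mathfrak h^*$ is the set of $\lambda=\sum_{i=-m}^{-1}\lambda_i\epsilon_i+\sum_{j\in\mathbb N}\lambda^+_j\epsilon_j+d\Lambda_0$ with $d,\lambda_i\in\mathbb C$, $\lambda^+$ a partition, and $\langle\sum_{i<0}\lambda_i\epsilon_i,h_\alpha\rangle\in\mathbb Z_+$ for all $\alpha\in Y_0$ ($h_\alpha$ the coroot; for the odd root $\alpha=-\epsilon_{-m}$ in type $\mathfrak b^\bullet$ the condition reads $-\lambda_{-m}\in\mathbb Z_+$). For $\lambda\in P^+$ put $\lambda^\theta=\sum_{i<0}\lambda_i\epsilon_i+\sum_{r\in\frac12\mathbb N}\theta(\lambda^+)_r\epsilon_r+d\Lambda_0\in\widetilde{\mathfrak h}^*$. $L(\widetilde{\mathfrak l},\lambda^\theta)$ is the irreducible $\widetilde{\mathfrak l}$-module of highest weight $\lambda^\theta$ (w.r.t. $\widetilde{\mathfrak b}\cap\widetilde{\mathfrak l}$). **Category.** $\widetilde{\mathcal O}$ is the category of $\widetilde{\mathfrak g}$-modules $\widetilde M$ that are $\widetilde{\mathfrak h}$-semisimple with finite dimensional weight spaces such that (i) $\widetilde M$ is over $\widetilde{\mathfrak l}$ a direct sum of modules $L(\widetilde{\mathfrak l},\mu^\theta)$, $\mu\in P^+$; (ii) there are finitely many $\lambda_1,\dots,\lambda_k\in P^+$ such that each weight of $\widetilde M$ lies in some $\lambda_i^\theta-\widetilde Q_+$, $\widetilde Q_+$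 the $\mathbb Z_+$-span of the positive roots of $\widetilde{\mathfrak g}$. **Functors and homology.** For an $\widetilde{\mathfrak h}$-semisimple $\widetilde M=\bigoplus_{\gamma\in\widetilde{\mathfrak h}^*}\widetilde M_\gamma$ put $T(\widetilde M)=\bigoplus_{\gamma\in\mathfrak h^*}\widetilde M_\gamma$ and $\overline T(\widetilde M)=\bigoplus_{\gamma\in\overline{\mathfrak h}^*}\widetilde M_\gamma$. If $\widetilde M$ is a module over $\widetilde{\mathfrak g}$ (resp. $\widetilde{\mathfrak l}$), then $T(\widetilde M)$ is a $\mathfrak g$- (resp. $\mathfrak l$-) submodule and $\overline T(\widetilde M)$ a $\overline{\mathfrak g}$- (resp. $\overline{\mathfrak l}$-) submodule. $H_n(\mathfrak u_-;M)$ denotes Lie superalgebra homology, computed by the standard (Chevalley–Eilenberg) complex $\Lambda^n(\mathfrak u_-)\otimes M$ with $\Lambda$ the super exterior algebra; it is an $\mathfrak l$-module (similarly for bar and tilde). *)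

theory Defs
  imports
    Complex_Main
    "HOL-Library.Poly_Mapping"
    "HOL-Library.Product_Plus"
    "HOL-Computational_Algebra.Group_Closure"
    "HOL-Algebra.AbelCoset"
    "HOL-Algebra.Module"
begin

section \<open>Free vector spaces\<close>

text \<open>
  \<^typ>\<open>'b \<Rightarrow>\<^sub>0 complex\<close> (finitely supported functions) is the complex vector space with basis \<^typ>\<open>'b\<close>;
  the basis vector of \<open>b\<close> is \<open>bas b\<close>. It serves for vectors, finitely supported matrices, weights
  and chains.
\<close>

abbreviation bas :: "'b \<Rightarrow> 'b \<Rightarrow>\<^sub>0 complex"
  where "bas b \<equiv> Poly_Mapping.single b 1"

abbreviation coef :: "('b \<Rightarrow>\<^sub>0 complex) \<Rightarrow> 'b \<Rightarrow> complex"
  where "coef \<equiv> Poly_Mapping.lookup"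

abbreviation supp :: "('b \<Rightarrow>\<^sub>0 complex) \<Rightarrow> 'b set"
  where "supp \<equiv> Poly_Mapping.keys"

definition pscale :: "complex \<Rightarrow> ('b \<Rightarrow>\<^sub>0 complex) \<Rightarrow> ('b \<Rightarrow>\<^sub>0 complex)"
  where "pscale c f = Poly_Mapping.map ((*) c) f"

definition linext :: "('b \<Rightarrow> ('c \<Rightarrow>\<^sub>0 complex)) \<Rightarrow> ('b \<Rightarrow>\<^sub>0 complex) \<Rightarrow> ('c \<Rightarrow>\<^sub>0 complex)"
  where "linext f z = (\<Sum>b\<in>supp z. pscale (coef z b) (f b))"


section \<open>Indices, parities and the bilinear form\<close>

datatype ltype = TB | TBbul | TC | TD

text \<open>\<open>Ix r\<close>, \<open>Bar r\<close>, \<open>Bar0\<close> index the basis vectors $v_r$, $v_{\bar r}$, $v_{\bar 0}$.\<close>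

datatype index = Ix rat | Bar rat | Bar0

definition negI :: "nat \<Rightarrow> rat set"
  where "negI m = {of_int i | i::int. - int m \<le> i \<and> i \<le> -1}"

definition halfN :: "rat set"
  where "halfN = {of_nat n / 2 | n::nat. n \<ge> 1}"

definition I_tilde :: "nat \<Rightarrow> rat set"
  where "I_tilde m = negI m \<union> halfN"

definition I_plus :: "nat \<Rightarrow> rat set"
  where "I_plus m = negI m \<union> {of_nat n | n::nat. n \<ge> 1}"

definition I_bar :: "nat \<Rightarrow> rat set"
  where "I_bar m = negI m \<union> {1 / 2 + of_nat n | n::nat. True}"

definition indices :: "ltype \<Rightarrow> nat \<Rightarrow> index set"
  where "indices x m = Ix ` I_tilde m \<union> Bar ` I_tilde m \<union> (if x = TB \<or> x = TBbul then {Bar0} else {})"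

text \<open>Parities are the numbers 0 (even) and 1 (odd).\<close>

fun ipar :: "ltype \<Rightarrow> index \<Rightarrow> nat" where
  "ipar x (Ix r) = (if r \<in> \<int> then 0 else 1)"
| "ipar x (Bar r) = (if r \<in> \<int> then 0 else 1)"
| "ipar x Bar0 = (if x = TBbul then 1 else 0)"

definition kappa :: "ltype \<Rightarrow> complex"
  where "kappa x = (if x = TB \<or> x = TD then 1 else -1)"

fun form :: "ltype \<Rightarrow> index \<Rightarrow> index \<Rightarrow> complex" where
  "form x (Ix r) (Bar s) = (if r = s then 1 else 0)"
| "form x (Bar s) (Ix r) = (if r = s then kappa x * (-1) ^ (ipar x (Ix r) * ipar x (Ix s)) else 0)"
| "form x Bar0 Bar0 = 1"
| "form x _ _ = 0"

definition bform :: "ltype \<Rightarrow> (index \<Rightarrow>\<^sub>0 complex) \<Rightarrow> (index \<Rightarrow>\<^sub>0 complex) \<Rightarrow> complex"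
  where "bform x v w = (\<Sum>a\<in>supp v. \<Sum>b\<in>supp w. coef v a * coef w b * form x a b)"


section \<open>Matrices and the Lie superalgebras\<close>

text \<open>The coefficient at \<open>(a, b)\<close> is the matrix entry in row \<open>a\<close> and column \<open>b\<close>.\<close>

type_synonym mat = "(index \<times> index) \<Rightarrow>\<^sub>0 complex"

definition mapply :: "mat \<Rightarrow> (index \<Rightarrow>\<^sub>0 complex) \<Rightarrow> (index \<Rightarrow>\<^sub>0 complex)"
  where "mapply X v = linext (\<lambda>(a, b). Poly_Mapping.single a (coef v b)) X"

definition mmult :: "mat \<Rightarrow> mat \<Rightarrow> mat"
  where "mmult X Y = linext (\<lambda>(a, b). linext (\<lambda>(c, d). if b = c then bas (a, d) else 0) Y) X"

definition mat_hom :: "ltype \<Rightarrow> nat \<Rightarrow> mat set"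
  where "mat_hom x p = {X. \<forall>(a, b)\<in>supp X. (ipar x a + ipar x b) mod 2 = p}"

definition mat_comp :: "ltype \<Rightarrow> nat \<Rightarrow> mat \<Rightarrow> mat"
  where "mat_comp x p X = linext (\<lambda>(a, b). if (ipar x a + ipar x b) mod 2 = p then bas (a, b) else 0) X"

definition mat_bracket :: "ltype \<Rightarrow> mat \<Rightarrow> mat \<Rightarrow> mat"
  where "mat_bracket x X Y = (\<Sum>p<2. \<Sum>q<2.
    mmult (mat_comp x p X) (mat_comp x q Y)
    - pscale ((-1) ^ (p * q)) (mmult (mat_comp x q Y) (mat_comp x p X)))"

definition Str :: "ltype \<Rightarrow> mat \<Rightarrow> complex"
  where "Str x X = (\<Sum>(a, b)\<in>supp X. if a = b then (-1) ^ ipar x a * coef X (a, b) else 0)"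

text \<open>
  $J$ is diagonal and even but not finitely supported. Its diagonal entries are given by \<open>Jdiag\<close>,
  and $[J,X]$ has the entries $(J_a - J_b)\,X_{ab}$.
\<close>

fun Jdiag :: "index \<Rightarrow> complex" where
  "Jdiag (Ix r) = 0"
| "Jdiag (Bar r) = (if r \<in> halfN then 1 else 0)"
| "Jdiag Bar0 = 1"

definition J_bracket :: "mat \<Rightarrow> mat"
  where "J_bracket X = linext (\<lambda>(a, b). pscale (Jdiag a - Jdiag b) (bas (a, b))) X"

definition G_hom :: "ltype \<Rightarrow> nat \<Rightarrow> nat \<Rightarrow> mat set"
  where "G_hom x m p = {X \<in> mat_hom x p. supp X \<subseteq> indices x m \<times> indices x m \<and>
    (\<forall>b\<in>indices x m. \<forall>c\<in>indices x m.
      bform x (mapply X (bas b)) (bas c) + (-1) ^ (p * ipar x b) * bform x (bas b) (mapply X (bas c)) = 0)}"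

definition G_alg :: "ltype \<Rightarrow> nat \<Rightarrow> mat set"
  where "G_alg x m = {X0 + X1 | X0 X1. X0 \<in> G_hom x m 0 \<and> X1 \<in> G_hom x m 1}"

text \<open>\<open>(X, k)\<close> stands for $\widehat X + kK$.\<close>

type_synonym gt = "mat \<times> complex"

definition gscale :: "complex \<Rightarrow> gt \<Rightarrow> gt"
  where "gscale c X = (pscale c (fst X), c * snd X)"

abbreviation gspan :: "gt set \<Rightarrow> gt set"
  where "gspan \<equiv> Modules.module.span gscale"

definition bracket :: "ltype \<Rightarrow> gt \<Rightarrow> gt \<Rightarrow> gt"
  where "bracket x X Y =
    (mat_bracket x (fst X) (fst Y), Str x (mmult (J_bracket (fst X)) (fst Y)))"

definition gt_hom :: "ltype \<Rightarrow> nat \<Rightarrow> gt set"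
  where "gt_hom x p = {X. fst X \<in> mat_hom x p \<and> (p \<noteq> 0 \<longrightarrow> snd X = 0)}"

definition gt_comp :: "ltype \<Rightarrow> nat \<Rightarrow> gt \<Rightarrow> gt"
  where "gt_comp x p X = (mat_comp x p (fst X), if p = 0 then snd X else 0)"

text \<open>The degree of a homogeneous element (with the convention that 0 has degree 0).\<close>

definition deg :: "ltype \<Rightarrow> gt \<Rightarrow> nat"
  where "deg x X = (if X \<noteq> 0 \<and> X \<in> gt_hom x 1 then 1 else 0)"

definition g_tilde :: "ltype \<Rightarrow> nat \<Rightarrow> gt set"
  where "g_tilde x m = {X. fst X \<in> G_alg x m}"

definition g_supported :: "ltype \<Rightarrow> nat \<Rightarrow> rat set \<Rightarrow> gt set"
  where "g_supported x m I = {X \<in> g_tilde x m.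
    supp (fst X) \<subseteq> ({Bar0} \<union> Ix ` I \<union> Bar ` I) \<times> ({Bar0} \<union> Ix ` I \<union> Bar ` I)}"

definition g_plus :: "ltype \<Rightarrow> nat \<Rightarrow> gt set"
  where "g_plus x m = g_supported x m (I_plus m)"

definition g_bar :: "ltype \<Rightarrow> nat \<Rightarrow> gt set"
  where "g_bar x m = g_supported x m (I_bar m)"


section \<open>Cartan subalgebra, weights, roots, Borel and Levi subalgebras\<close>

definition KK :: gt
  where "KK = (0, 1)"

definition E_hat :: "rat \<Rightarrow> gt"
  where "E_hat r = (bas (Ix r, Ix r) - bas (Bar r, Bar r), 0)"

definition cartan :: "nat \<Rightarrow> gt set"
  where "cartan m = gspan (insert KK (E_hat ` I_tilde m))"

text \<open>\<open>(\<gamma>, d)\<close> stands for $\sum_r \gamma_r \epsilon_r + d\Lambda_0$.\<close>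

type_synonym weight = "(rat \<Rightarrow>\<^sub>0 complex) \<times> complex"

definition eps :: "rat \<Rightarrow> weight"
  where "eps r = (bas r, 0)"

text \<open>The span of $\Lambda_0$ and the $\epsilon_r$ with \<open>r \<in> I\<close>.\<close>

definition hdual :: "rat set \<Rightarrow> weight set"
  where "hdual I = {\<gamma>. supp (fst \<gamma>) \<subseteq> I}"

definition root_space :: "ltype \<Rightarrow> nat \<Rightarrow> weight \<Rightarrow> gt set"
  where "root_space x m \<alpha> = {X \<in> g_tilde x m. bracket x KK X = gscale (snd \<alpha>) X \<and>
    (\<forall>r\<in>I_tilde m. bracket x (E_hat r) X = gscale (coef (fst \<alpha>) r) X)}"

definition roots :: "ltype \<Rightarrow> nat \<Rightarrow> weight set"
  where "roots x m = {\<alpha> \<in> hdual (I_tilde m). \<alpha> \<noteq> 0 \<and> root_space x m \<alpha> \<noteq> {0}}"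

fun idx_less :: "index \<Rightarrow> index \<Rightarrow> bool" where
  "idx_less (Bar r) (Bar s) \<longleftrightarrow> s < r"
| "idx_less (Bar r) Bar0 \<longleftrightarrow> True"
| "idx_less (Bar r) (Ix s) \<longleftrightarrow> True"
| "idx_less Bar0 (Ix s) \<longleftrightarrow> True"
| "idx_less (Ix r) (Ix s) \<longleftrightarrow> r < s"
| "idx_less _ _ \<longleftrightarrow> False"

definition borel :: "ltype \<Rightarrow> nat \<Rightarrow> gt set"
  where "borel x m = {X \<in> g_tilde x m. \<forall>(a, b)\<in>supp (fst X). a = b \<or> idx_less a b}"

definition pos_roots :: "ltype \<Rightarrow> nat \<Rightarrow> weight set"
  where "pos_roots x m = {\<alpha> \<in> roots x m. root_space x m \<alpha> \<subseteq> borel x m}"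

definition Q_plus :: "ltype \<Rightarrow> nat \<Rightarrow> weight set"
  where "Q_plus x m = {sum_list \<alpha>s | \<alpha>s. set \<alpha>s \<subseteq> pos_roots x m}"

definition Pi_k :: "ltype \<Rightarrow> nat \<Rightarrow> weight set"
  where "Pi_k x m = (if m = 0 \<or> (x = TD \<and> m = 1) then {} else
    {eps (of_int j) - eps (of_int (j + 1)) | j::int. - int m \<le> j \<and> j \<le> -2} \<union>
    {case x of TB \<Rightarrow> - eps (- of_nat m)
             | TBbul \<Rightarrow> - eps (- of_nat m)
             | TC \<Rightarrow> - (eps (- of_nat m) + eps (- of_nat m))
             | TD \<Rightarrow> - eps (- of_nat m) - eps (- of_nat m + 1)})"

definition levi_lattice :: "weight set \<Rightarrow> weight set"
  where "levi_lattice Y0 = group_closure (Y0 \<union> {eps r - eps (r + 1 / 2) | r. r \<in> halfN})"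

definition levi_tilde :: "ltype \<Rightarrow> nat \<Rightarrow> weight set \<Rightarrow> gt set"
  where "levi_tilde x m Y0 =
    gspan (cartan m \<union> (\<Union>\<alpha>\<in>roots x m \<inter> levi_lattice Y0. root_space x m \<alpha>))"

text \<open>
  The opposite nilradical of the parabolic subalgebra \<open>levi_tilde + borel\<close> is the sum of the root
  spaces of the negative roots that are not roots of the Levi subalgebra.
\<close>

definition u_tilde_minus :: "ltype \<Rightarrow> nat \<Rightarrow> weight set \<Rightarrow> gt set"
  where "u_tilde_minus x m Y0 =
    gspan (\<Union>\<alpha>\<in>{\<alpha> \<in> roots x m. - \<alpha> \<in> pos_roots x m \<and> \<alpha> \<notin> levi_lattice Y0}. root_space x m \<alpha>)"

definition levi_plus :: "ltype \<Rightarrow> nat \<Rightarrow> weight set \<Rightarrow> gt set"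
  where "levi_plus x m Y0 = levi_tilde x m Y0 \<inter> g_plus x m"

definition levi_bar :: "ltype \<Rightarrow> nat \<Rightarrow> weight set \<Rightarrow> gt set"
  where "levi_bar x m Y0 = levi_tilde x m Y0 \<inter> g_bar x m"

definition u_plus_minus :: "ltype \<Rightarrow> nat \<Rightarrow> weight set \<Rightarrow> gt set"
  where "u_plus_minus x m Y0 = u_tilde_minus x m Y0 \<inter> g_plus x m"

definition u_bar_minus :: "ltype \<Rightarrow> nat \<Rightarrow> weight set \<Rightarrow> gt set"
  where "u_bar_minus x m Y0 = u_tilde_minus x m Y0 \<inter> g_bar x m"


section \<open>Dominant weights\<close>

text \<open>Partitions are functions on the positive integers; the value at 0 is irrelevant.\<close>

definition is_partition :: "(nat \<Rightarrow> nat) \<Rightarrow> bool"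
  where "is_partition \<mu> \<longleftrightarrow> (\<forall>i\<ge>1. \<mu> (Suc i) \<le> \<mu> i) \<and> finite {i. i \<ge> 1 \<and> \<mu> i \<noteq> 0}"

definition conj_part :: "(nat \<Rightarrow> nat) \<Rightarrow> nat \<Rightarrow> nat"
  where "conj_part \<mu> j = card {i. i \<ge> 1 \<and> \<mu> i \<ge> j}"

text \<open>
  \<open>r\<close> is $i$ or $i - 1/2$ for \<open>i = nat \<lceil>r\<rceil>\<close>; the truncated subtraction of natural numbers
  provides the maximum with 0.
\<close>

definition theta_part :: "(nat \<Rightarrow> nat) \<Rightarrow> rat \<Rightarrow> nat"
  where "theta_part \<mu> r = (let i = nat \<lceil>r\<rceil> in
    if r \<in> \<int> then \<mu> i - i else (conj_part \<mu> i + 1) - i)"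

text \<open>
  \<open>\<langle>\<lambda>, h\<^sub>\<alpha>\<rangle> = 2(\<lambda>|\<alpha>) / (\<alpha>|\<alpha>)\<close> for the form with $(\epsilon_r|\epsilon_s) = \delta_{rs}$. The elements of
  \<^term>\<open>Pi_k x m\<close> only involve $\epsilon_i$ with $i<0$, so only these components of \<open>\<lambda>\<close> enter.
\<close>

definition coroot_pairing :: "weight \<Rightarrow> weight \<Rightarrow> complex"
  where "coroot_pairing lam \<alpha> =
    2 * (\<Sum>r\<in>supp (fst \<alpha>). coef (fst lam) r * coef (fst \<alpha>) r) / (\<Sum>r\<in>supp (fst \<alpha>). (coef (fst \<alpha>) r)\<^sup>2)"

definition P_plus :: "ltype \<Rightarrow> nat \<Rightarrow> weight set \<Rightarrow> weight set"
  where "P_plus x m Y0 = {lam \<in> hdual (I_plus m).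
    (\<exists>\<mu>. is_partition \<mu> \<and> (\<forall>j\<ge>1. coef (fst lam) (of_nat j) = of_nat (\<mu> j))) \<and>
    (\<forall>\<alpha>\<in>Y0. (if x = TBbul \<and> \<alpha> = - eps (- of_nat m) then - coef (fst lam) (- of_nat m)
             else coroot_pairing lam \<alpha>) \<in> \<nat>)}"

definition plus_part :: "weight \<Rightarrow> nat \<Rightarrow> nat"
  where "plus_part lam j = (THE k. coef (fst lam) (of_nat j) = of_nat k)"

definition theta :: "weight \<Rightarrow> weight"
  where "theta lam =
    ((\<Sum>r\<in>{r \<in> supp (fst lam). r < 0}. Poly_Mapping.single r (coef (fst lam) r))
     + (\<Sum>r\<in>{r \<in> halfN. theta_part (plus_part lam) r \<noteq> 0}.
          Poly_Mapping.single r (of_nat (theta_part (plus_part lam) r))),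
     snd lam)"


section \<open>Modules over Lie superalgebras\<close>

definition CC :: "complex ring"
  where "CC = \<lparr>carrier = UNIV, mult = (*), one = 1, zero = 0, add = (+)\<rparr>"

text \<open>
  A superspace with an action; \<open>gr M 0\<close> and \<open>gr M 1\<close> are the even and the odd part. The fields
  \<^const>\<open>mult\<close> and \<^const>\<open>one\<close> inherited from \<^typ>\<open>(complex, 'v) module\<close> are not used.
\<close>

record 'v smod = "(complex, 'v) module" +
  gr :: "nat \<Rightarrow> 'v set"
  act :: "gt \<Rightarrow> 'v \<Rightarrow> 'v"

definition mspan :: "'v smod \<Rightarrow> 'v set \<Rightarrow> 'v set"
  where "mspan M S = (\<lambda>N. submodule N CC M) hull S"

definition is_smodule :: "ltype \<Rightarrow> gt set \<Rightarrow> 'v smod \<Rightarrow> bool"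
  where "is_smodule x L M \<longleftrightarrow>
    module CC M \<and>
    submodule (gr M 0) CC M \<and> submodule (gr M 1) CC M \<and> gr M 0 \<inter> gr M 1 = {\<zero>\<^bsub>M\<^esub>} \<and>
    (\<forall>v\<in>carrier M. \<exists>v0\<in>gr M 0. \<exists>v1\<in>gr M 1. v = v0 \<oplus>\<^bsub>M\<^esub> v1) \<and>
    (\<forall>X\<in>L. \<forall>v\<in>carrier M. act M X v \<in> carrier M) \<and>
    (\<forall>X\<in>L. \<forall>v\<in>carrier M. \<forall>w\<in>carrier M. act M X (v \<oplus>\<^bsub>M\<^esub> w) = act M X v \<oplus>\<^bsub>M\<^esub> act M X w) \<and>
    (\<forall>X\<in>L. \<forall>v\<in>carrier M. \<forall>c. act M X (c \<odot>\<^bsub>M\<^esub> v) = c \<odot>\<^bsub>M\<^esub> act M X v) \<and>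
    (\<forall>X\<in>L. \<forall>Y\<in>L. \<forall>v\<in>carrier M. act M (X + Y) v = act M X v \<oplus>\<^bsub>M\<^esub> act M Y v) \<and>
    (\<forall>X\<in>L. \<forall>v\<in>carrier M. \<forall>c. act M (gscale c X) v = c \<odot>\<^bsub>M\<^esub> act M X v) \<and>
    (\<forall>p<2. \<forall>q<2. \<forall>X\<in>L \<inter> gt_hom x p. \<forall>v\<in>gr M q. act M X v \<in> gr M ((p + q) mod 2)) \<and>
    (\<forall>p<2. \<forall>q<2. \<forall>X\<in>L \<inter> gt_hom x p. \<forall>Y\<in>L \<inter> gt_hom x q. \<forall>v\<in>carrier M.
      act M (bracket x X Y) v =
        act M X (act M Y v) \<ominus>\<^bsub>M\<^esub> ((-1) ^ (p * q)) \<odot>\<^bsub>M\<^esub> act M Y (act M X v))"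

definition is_subsmod :: "gt set \<Rightarrow> 'v smod \<Rightarrow> 'v set \<Rightarrow> bool"
  where "is_subsmod L M N \<longleftrightarrow>
    submodule N CC M \<and>
    (\<forall>v\<in>N. \<exists>v0\<in>gr M 0 \<inter> N. \<exists>v1\<in>gr M 1 \<inter> N. v = v0 \<oplus>\<^bsub>M\<^esub> v1) \<and>
    (\<forall>X\<in>L. \<forall>v\<in>N. act M X v \<in> N)"

definition restr :: "'v smod \<Rightarrow> 'v set \<Rightarrow> 'v smod"
  where "restr M N = M\<lparr>carrier := N, gr := (\<lambda>p. gr M p \<inter> N)\<rparr>"

text \<open>The quotient by a submodule \<open>B\<close>: all operations are induced on the cosets of \<open>B\<close>.\<close>

definition quot :: "'v smod \<Rightarrow> 'v set \<Rightarrow> 'v set smod"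
  where "quot M B = \<lparr>carrier = a_rcosets\<^bsub>M\<^esub> B, mult = undefined, one = undefined,
    zero = B, add = set_add M,
    smult = (\<lambda>c C. \<Union>z\<in>C. B +>\<^bsub>M\<^esub> (c \<odot>\<^bsub>M\<^esub> z)),
    gr = (\<lambda>p. (\<lambda>z. B +>\<^bsub>M\<^esub> z) ` gr M p),
    act = (\<lambda>X C. \<Union>z\<in>C. B +>\<^bsub>M\<^esub> act M X z)\<rparr>"

definition smod_iso :: "gt set \<Rightarrow> 'v smod \<Rightarrow> 'w smod \<Rightarrow> bool"
  where "smod_iso L M N \<longleftrightarrow> (\<exists>f.
    bij_betw f (carrier M) (carrier N) \<and>
    (\<forall>v\<in>carrier M. \<forall>w\<in>carrier M. f (v \<oplus>\<^bsub>M\<^esub> w) = f v \<oplus>\<^bsub>N\<^esub> f w) \<and>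
    (\<forall>c. \<forall>v\<in>carrier M. f (c \<odot>\<^bsub>M\<^esub> v) = c \<odot>\<^bsub>N\<^esub> f v) \<and>
    (\<forall>X\<in>L. \<forall>v\<in>carrier M. f (act M X v) = act N X (f v)) \<and>
    (\<forall>p<2. f ` gr M p = gr N p))"

definition weight_space :: "nat \<Rightarrow> 'v smod \<Rightarrow> weight \<Rightarrow> 'v set"
  where "weight_space m M \<gamma> = {v \<in> carrier M. act M KK v = snd \<gamma> \<odot>\<^bsub>M\<^esub> v \<and>
    (\<forall>r\<in>I_tilde m. act M (E_hat r) v = coef (fst \<gamma>) r \<odot>\<^bsub>M\<^esub> v)}"

definition truncate :: "nat \<Rightarrow> rat set \<Rightarrow> 'v smod \<Rightarrow> 'v smod"
  where "truncate m I M = restr M (mspan M (\<Union>\<gamma>\<in>hdual I. weight_space m M \<gamma>))"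

definition T_plus :: "nat \<Rightarrow> 'v smod \<Rightarrow> 'v smod"
  where "T_plus m = truncate m (I_plus m)"

definition T_bar :: "nat \<Rightarrow> 'v smod \<Rightarrow> 'v smod"
  where "T_bar m = truncate m (I_bar m)"


section \<open>The category of \<open>g_tilde\<close>-modules\<close>

text \<open>
  The submodule \<open>N\<close> of \<open>M\<close> is a copy of $L(\widetilde{\mathfrak l},\lambda)$, up to a shift of parity:
  it is irreducible and contains a highest weight vector of weight \<open>lam\<close>.
\<close>

definition is_irred_hw :: "ltype \<Rightarrow> nat \<Rightarrow> weight set \<Rightarrow> 'v smod \<Rightarrow> 'v set \<Rightarrow> weight \<Rightarrow> bool"
  where "is_irred_hw x m Y0 M N lam \<longleftrightarrow>
    is_subsmod (levi_tilde x m Y0) M N \<and> N \<noteq> {\<zero>\<^bsub>M\<^esub>} \<and>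
    (\<forall>N'. is_subsmod (levi_tilde x m Y0) M N' \<and> N' \<subseteq> N \<longrightarrow> N' = {\<zero>\<^bsub>M\<^esub>} \<or> N' = N) \<and>
    (\<exists>v\<in>N \<inter> weight_space m M lam. v \<noteq> \<zero>\<^bsub>M\<^esub> \<and>
      (\<forall>\<alpha>\<in>pos_roots x m. \<forall>X\<in>root_space x m \<alpha> \<inter> levi_tilde x m Y0. act M X v = \<zero>\<^bsub>M\<^esub>))"

definition internal_direct_sum :: "'v smod \<Rightarrow> 'v set set \<Rightarrow> bool"
  where "internal_direct_sum M \<N> \<longleftrightarrow>
    mspan M (\<Union>\<N>) = carrier M \<and> (\<forall>N\<in>\<N>. N \<inter> mspan M (\<Union>(\<N> - {N})) = {\<zero>\<^bsub>M\<^esub>})"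

definition in_O_tilde :: "ltype \<Rightarrow> nat \<Rightarrow> weight set \<Rightarrow> 'v smod \<Rightarrow> bool"
  where "in_O_tilde x m Y0 M \<longleftrightarrow>
    is_smodule x (g_tilde x m) M \<and>
    mspan M (\<Union>\<gamma>\<in>hdual (I_tilde m). weight_space m M \<gamma>) = carrier M \<and>
    (\<forall>\<gamma>\<in>hdual (I_tilde m). \<exists>B. finite B \<and> B \<subseteq> carrier M \<and> weight_space m M \<gamma> = mspan M B) \<and>
    (\<exists>\<N>. internal_direct_sum M \<N> \<and>
      (\<forall>N\<in>\<N>. \<exists>\<mu>\<in>P_plus x m Y0. is_irred_hw x m Y0 M N (theta \<mu>))) \<and>
    (\<exists>\<Lambda>. finite \<Lambda> \<and> \<Lambda> \<subseteq> P_plus x m Y0 \<and>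
      (\<forall>\<gamma>\<in>hdual (I_tilde m). weight_space m M \<gamma> \<noteq> {\<zero>\<^bsub>M\<^esub>} \<longrightarrow>
        (\<exists>lam\<in>\<Lambda>. \<exists>\<beta>\<in>Q_plus x m. \<gamma> = theta lam - \<beta>)))"


section \<open>Lie superalgebra homology\<close>

text \<open>
  The space $\Lambda^n(U)\otimes M$ is the quotient of the free vector space on the symbols
  $(x_1,\dots,x_n,v)$, with homogeneous $x_i\in U$ and $v\in M$, by the relations of multilinearity
  and $x_i x_{i+1} = -(-1)^{|x_i||x_{i+1}|} x_{i+1} x_i$.
\<close>

definition gens :: "ltype \<Rightarrow> gt set \<Rightarrow> 'v smod \<Rightarrow> nat \<Rightarrow> (gt list \<times> 'v) set"
  where "gens x U M n = {(xs, v). length xs = n \<and> set xs \<subseteq> U \<inter> (gt_hom x 0 \<union> gt_hom x 1) \<and> v \<in> carrier M}"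

definition wedge_rels :: "ltype \<Rightarrow> gt set \<Rightarrow> 'v smod \<Rightarrow> nat \<Rightarrow> (gt list \<times> 'v \<Rightarrow>\<^sub>0 complex) set"
  where "wedge_rels x U M n = Modules.module.span pscale (
    {bas (xs[i := X + Y], v) - bas (xs[i := X], v) - bas (xs[i := Y], v) | xs v i X Y p.
       (xs, v) \<in> gens x U M n \<and> i < n \<and> p < 2 \<and> X \<in> U \<inter> gt_hom x p \<and> Y \<in> U \<inter> gt_hom x p} \<union>
    {bas (xs[i := gscale c X], v) - pscale c (bas (xs[i := X], v)) | xs v i X c p.
       (xs, v) \<in> gens x U M n \<and> i < n \<and> p < 2 \<and> X \<in> U \<inter> gt_hom x p} \<union>
    {bas (xs, v \<oplus>\<^bsub>M\<^esub> w) - bas (xs, v) - bas (xs, w) | xs v w.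
       (xs, v) \<in> gens x U M n \<and> (xs, w) \<in> gens x U M n} \<union>
    {bas (xs, c \<odot>\<^bsub>M\<^esub> v) - pscale c (bas (xs, v)) | xs v c. (xs, v) \<in> gens x U M n} \<union>
    {bas (xs, v) + pscale ((-1) ^ (deg x (xs ! i) * deg x (xs ! Suc i)))
                     (bas (xs[i := xs ! Suc i, Suc i := xs ! i], v)) | xs v i.
       (xs, v) \<in> gens x U M n \<and> Suc i < n})"

text \<open>
  The action of \<open>X\<close> on symbols, \<open>\<Sum>\<^sub>i (-1)^(|X| (|x\<^sub>1|+\<dots>+|x\<^sub>i\<^sub>-\<^sub>1|)) x\<^sub>1\<dots>[X,x\<^sub>i]\<dots>x\<^sub>n \<otimes> v\<close> plus
  \<open>(-1)^(|X| (|x\<^sub>1|+\<dots>+|x\<^sub>n|)) x\<^sub>1\<dots>x\<^sub>n \<otimes> Xv\<close>, for the homogeneous components of \<open>X\<close>.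
  List positions count from 0.
\<close>

definition symbol_act :: "ltype \<Rightarrow> 'v smod \<Rightarrow> gt \<Rightarrow> gt list \<times> 'v \<Rightarrow> (gt list \<times> 'v \<Rightarrow>\<^sub>0 complex)"
  where "symbol_act x M X = (\<lambda>(xs, v). \<Sum>p<2.
    (\<Sum>i<length xs. pscale ((-1) ^ (p * (\<Sum>j<i. deg x (xs ! j))))
       (bas (xs[i := bracket x (gt_comp x p X) (xs ! i)], v)))
    + pscale ((-1) ^ (p * (\<Sum>j<length xs. deg x (xs ! j)))) (bas (xs, act M (gt_comp x p X) v)))"

definition free_chains :: "ltype \<Rightarrow> gt set \<Rightarrow> 'v smod \<Rightarrow> nat \<Rightarrow> (gt list \<times> 'v \<Rightarrow>\<^sub>0 complex) smod"
  where "free_chains x U M n = \<lparr>carrier = {f. supp f \<subseteq> gens x U M n},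
    mult = undefined, one = undefined, zero = 0, add = (+), smult = pscale,
    gr = (\<lambda>p. {f. supp f \<subseteq> {(xs, v) \<in> gens x U M n.
                 \<exists>q<2. v \<in> gr M q \<and> (sum_list (map (deg x) xs) + q) mod 2 = p}}),
    act = (\<lambda>X. linext (symbol_act x M X))\<rparr>"

definition chains :: "ltype \<Rightarrow> gt set \<Rightarrow> 'v smod \<Rightarrow> nat \<Rightarrow> (gt list \<times> 'v \<Rightarrow>\<^sub>0 complex) set smod"
  where "chains x U M n = quot (free_chains x U M n) (wedge_rels x U M n)"

text \<open>
  With $x_1,\dots,x_n$ numbered from 1, the boundary of $x_1\cdots x_n\otimes v$ is
  \<open>\<Sum>\<^bsub>s<t\<^esub> (-1)^(s + t + |x\<^sub>s| \<Sum>\<^bsub>i<s\<^esub> |x\<^sub>i| + |x\<^sub>t| \<Sum>\<^bsub>j<t\<^esub> |x\<^sub>j| + |x\<^sub>s||x\<^sub>t|) [x\<^sub>s,x\<^sub>t] x\<^sub>1\<dots>x\<^sub>n \<otimes> v\<close>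
  (with \<open>x\<^sub>s\<close> and \<open>x\<^sub>t\<close> omitted from \<open>x\<^sub>1\<dots>x\<^sub>n\<close>) plus
  \<open>\<Sum>\<^sub>s (-1)^(s + |x\<^sub>s| \<Sum>\<^bsub>i>s\<^esub> |x\<^sub>i|) x\<^sub>1\<dots>x\<^sub>n \<otimes> x\<^sub>sv\<close> (with \<open>x\<^sub>s\<close> omitted). Below, \<open>s\<close> and \<open>t\<close> count from 0.
\<close>

definition symbol_boundary :: "ltype \<Rightarrow> 'v smod \<Rightarrow> gt list \<times> 'v \<Rightarrow> (gt list \<times> 'v \<Rightarrow>\<^sub>0 complex)"
  where "symbol_boundary x M = (\<lambda>(xs, v).
    (\<Sum>t<length xs. \<Sum>s<t.
       pscale ((-1) ^ (s + t + deg x (xs ! s) * (\<Sum>i<s. deg x (xs ! i))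
                 + deg x (xs ! t) * (\<Sum>j<t. deg x (xs ! j)) + deg x (xs ! s) * deg x (xs ! t)))
         (bas (bracket x (xs ! s) (xs ! t) # nths xs (- {s, t}), v)))
    + (\<Sum>s<length xs.
       pscale ((-1) ^ (Suc s + deg x (xs ! s) * (\<Sum>i\<in>{s<..<length xs}. deg x (xs ! i))))
         (bas (nths xs (- {s}), act M (xs ! s) v))))"

text \<open>
  The boundary map from \<open>n\<close>-chains to \<open>(n - 1)\<close>-chains. For \<open>n = 0\<close> it is the zero map, as
  \<^const>\<open>symbol_boundary\<close> vanishes on symbols without \<open>x\<^sub>i\<close>.
\<close>

definition boundary :: "ltype \<Rightarrow> gt set \<Rightarrow> 'v smod \<Rightarrow> nat \<Rightarrow>
    (gt list \<times> 'v \<Rightarrow>\<^sub>0 complex) set \<Rightarrow> (gt list \<times> 'v \<Rightarrow>\<^sub>0 complex) set"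
  where "boundary x U M n C = (\<Union>z\<in>C.
    wedge_rels x U M (n - 1) +>\<^bsub>free_chains x U M (n - 1)\<^esub> linext (symbol_boundary x M) z)"

definition homology :: "ltype \<Rightarrow> gt set \<Rightarrow> 'v smod \<Rightarrow> nat \<Rightarrow>
    (gt list \<times> 'v \<Rightarrow>\<^sub>0 complex) set set smod"
  where "homology x U M n =
    quot (restr (chains x U M n)
            {C \<in> carrier (chains x U M n). boundary x U M n C = \<zero>\<^bsub>chains x U M (n - 1)\<^esub>})
         (boundary x U M (n + 1) ` carrier (chains x U M (n + 1)))"

end

theory Submission
  imports Defs
begin

text \<open>
  The functor $T$ is realised on chains by a projection that truncates matrices to the indices in
  $I$ and projects $\widetilde M$ to the weight spaces with weight in the span of $\Lambda_0$ and the
  $\epsilon_r$, $r\in I$. The point is that it is a chain map. All weights of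
  $\widetilde{\mathfrak u}_-$ and of $\widetilde M$ have nonnegative coefficients at
  $\epsilon_r$, $r>0$, so a product of weight vectors has a weight supported on $I$ only if every factor
  has: such products are fixed by the projection and all others are killed, and both kinds are stable
  under the weight-preserving boundary map. Taking weight components modulo boundaries identifies
  $T(H_n(\widetilde{\mathfrak u}_-;\widetilde M))$ with $H_n(\mathfrak u_-;M)$.

  That $L(\widetilde{\mathfrak l},\lambda^\theta)$ has only weights with nonnegative coefficients follows by moving
  an index $a$ behind all others that occur in a given weight, alternating odd and even reflections; the
  hook shape of $\lambda^\theta$ keeps the coefficients of the successive highest weights nonnegative, and
  for the final ordering the sum of the coefficients at $a$ and at the later indices is smallest at the
  highest weight.
\<close>

section \<open>Linear algebra of finitely supported functions\<close>

text \<open>The obstacle is that truncation is not a homomorphism: cutting a matrix down to the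
  indices in \<open>I\<close> does not respect brackets, so compatibility with the boundary cannot
  be checked on arbitrary symbols. It appears only after symbols have been expanded into weight
  vectors, and that expansion, like most identities between chains, is valid only modulo the
  multilinearity and exchange relations. Chains are therefore kept in the free space, with the
  relations as an explicit subspace, and homology is treated as a subquotient of it.

  Two further points shape the work. The boundary is given by a signed double sum; it is replaced by
  a recursion on the first factor, d(Yz) = -Y.z - Y dz, from which compatibility with the relations,
  equivariance and dd = 0 follow by induction on the number of factors. And the summands of the
  module over the Levi subalgebra are known only as irreducible modules containing a highest weight
  vector, without a model; their weights have to be controlled through changes of ordering, and each
  ordering is encoded by a real functional on weights.\<close>

lemma coef_pscale [simp]: "coef (pscale c f) b = c * coef f b"
  by (simp add: pscale_def Poly_Mapping.map.rep_eq when_def)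

global_interpretation pv: vector_space pscale
  by unfold_locales (auto intro!: poly_mapping_eqI simp: lookup_add algebra_simps)

global_interpretation gv: vector_space gscale
  by unfold_locales (auto simp: gscale_def algebra_simps pv.scale_right_distrib pv.scale_left_distrib)

lemma pscale_bas [simp]: "pscale c (Poly_Mapping.single b d) = Poly_Mapping.single b (c * d)"
  by (rule poly_mapping_eqI) (simp add: lookup_single when_def)

lemma supp_pscale: "supp (pscale c f) \<subseteq> supp f"
  by (auto simp: in_keys_iff)

lemma supp_sum: "supp (sum f A) \<subseteq> (\<Union>a\<in>A. supp (f a))"
proof
  fix b assume "b \<in> supp (sum f A)"
  hence "(\<Sum>a\<in>A. coef (f a) b) \<noteq> 0" by (simp add: in_keys_iff lookup_sum)
  then obtain a where "a \<in> A" "coef (f a) b \<noteq> 0" by (meson sum.neutral)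
  thus "b \<in> (\<Union>a\<in>A. supp (f a))" by (auto simp: in_keys_iff)
qed

lemma supp_linext: "supp (linext f z) \<subseteq> (\<Union>b\<in>supp z. supp (f b))"
proof -
  have "supp (linext f z) \<subseteq> (\<Union>b\<in>supp z. supp (pscale (coef z b) (f b)))"
    unfolding linext_def by (rule supp_sum)
  also have "\<dots> \<subseteq> (\<Union>b\<in>supp z. supp (f b))"
    by (intro UN_mono subset_refl supp_pscale)
  finally show ?thesis .
qed

lemma linext_superset:
  assumes "finite S" "supp z \<subseteq> S"
  shows "linext f z = (\<Sum>b\<in>S. pscale (coef z b) (f b))"
  unfolding linext_def
  by (rule sum.mono_neutral_left) (use assms in \<open>auto simp: in_keys_iff\<close>)

lemma linext_add: "linext f (z + w) = linext f z + linext f w"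
proof -
  have "supp (z + w) \<subseteq> supp z \<union> supp w" by (rule keys_add)
  thus ?thesis
    by (simp add: linext_superset[of "supp z \<union> supp w"] lookup_add pv.scale_left_distrib sum.distrib)
qed

lemma linext_pscale: "linext f (pscale c z) = pscale c (linext f z)"
  using supp_pscale[of c z]
  by (simp add: linext_superset[of "supp z"] pv.scale_sum_right)

lemma linext_bas [simp]: "linext f (bas b) = f b"
  by (simp add: linext_def)

lemma linext_0 [simp]: "linext f 0 = 0"
  by (simp add: linext_def)

lemma linear_linext: "Vector_Spaces.linear pscale pscale (linext f)"
  by unfold_locales (simp_all add: linext_add linext_pscale)

lemma linext_uminus: "linext f (- z) = - linext f z"
  using linext_pscale[of f "-1" z] by simp

lemma linext_diff: "linext f (z - w) = linext f z - linext f w"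
  using linext_add[of f z "- w"] by (simp add: linext_uminus)

lemma linext_sum: "linext f (sum g A) = (\<Sum>a\<in>A. linext f (g a))"
  by (induction A rule: infinite_finite_induct) (auto simp: linext_add)

lemmas linext_simps = linext_add linext_pscale linext_uminus linext_diff linext_sum

lemma bas_expand: "z = (\<Sum>b\<in>supp z. pscale (coef z b) (bas b))"
  by (rule poly_mapping_eqI)
    (auto simp: lookup_sum lookup_single when_def in_keys_iff sum.delta' sum.delta)

lemma linext_bas_id [simp]: "linext bas z = z"
  unfolding linext_def by (rule bas_expand[symmetric])

lemma mem_span_supp: "supp z \<subseteq> S \<Longrightarrow> z \<in> pv.span (bas ` S)"
proof -
  assume "supp z \<subseteq> S"
  hence "(\<Sum>b\<in>supp z. pscale (coef z b) (bas b)) \<in> pv.span (bas ` S)"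
    by (intro pv.span_sum pv.span_scale pv.span_base) auto
  thus ?thesis by (simp only: bas_expand[symmetric])
qed

text \<open>Agreement is asked for on the support of \<open>z\<close> only. This local form matters
  where the two maps differ on other basis vectors, as in \<open>coef_mmult\<close>, whose summation
  range covers only the columns that occur.\<close>

lemma linear_eq_on_bas:
  assumes "Vector_Spaces.linear pscale s f" "Vector_Spaces.linear pscale s g"
    and eq: "\<And>b. b \<in> supp z \<Longrightarrow> f (bas b) = g (bas b)"
  shows "f z = g z"
proof -
  have "z \<in> pv.span (bas ` supp z)" by (rule mem_span_supp) simp
  interpret f: Vector_Spaces.linear pscale s f by fact
  interpret g: Vector_Spaces.linear pscale s g by fact
  from \<open>z \<in> _\<close> show ?thesis
    by (induction rule: pv.span_induct_alt) (auto simp: f.add f.scale g.add g.scale eq)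
qed

lemma linear_pI:
  "(\<And>z w. f (z + w) = f z + f w) \<Longrightarrow> (\<And>c z. f (pscale c z) = pscale c (f z))
    \<Longrightarrow> Vector_Spaces.linear pscale pscale f"
  by unfold_locales auto

lemma linear_cI:
  "(\<And>z w. f (z + w) = f z + f w) \<Longrightarrow> (\<And>c z. f (pscale c z) = c * f z)
    \<Longrightarrow> Vector_Spaces.linear pscale ((*) :: complex \<Rightarrow> _) f"
  by unfold_locales (simp_all add: distrib_left distrib_right)

lemma bilinear_eq_on_bas:
  fixes f g :: "('a \<Rightarrow>\<^sub>0 complex) \<Rightarrow> ('b \<Rightarrow>\<^sub>0 complex) \<Rightarrow> ('c \<Rightarrow>\<^sub>0 complex)"
  assumes "\<And>w. Vector_Spaces.linear pscale pscale (\<lambda>z. f z w)" "\<And>z. Vector_Spaces.linear pscale pscale (f z)"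
    and "\<And>w. Vector_Spaces.linear pscale pscale (\<lambda>z. g z w)" "\<And>z. Vector_Spaces.linear pscale pscale (g z)"
    and eq: "\<And>a b. a \<in> supp z \<Longrightarrow> b \<in> supp w \<Longrightarrow> f (bas a) (bas b) = g (bas a) (bas b)"
  shows "f z w = g z w"
proof (rule linear_eq_on_bas[OF assms(1,3)])
  fix a assume "a \<in> supp z"
  thus "f (bas a) w = g (bas a) w"
    by (rule linear_eq_on_bas[OF assms(2,4) eq])
qed

text \<open>The linear functional with prescribed values \<open>w\<close> on the basis. One notion
  serves for supertraces of matrices and for functionals on weights.\<close>

definition dotp :: "('b \<Rightarrow> complex) \<Rightarrow> ('b \<Rightarrow>\<^sub>0 complex) \<Rightarrow> complex"
  where "dotp w z = (\<Sum>b\<in>supp z. coef z b * w b)"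

lemma dotp_superset:
  assumes "finite S" "supp z \<subseteq> S"
  shows "dotp w z = (\<Sum>b\<in>S. coef z b * w b)"
  unfolding dotp_def
  by (rule sum.mono_neutral_left) (use assms in \<open>auto simp: in_keys_iff\<close>)

lemma dotp_add: "dotp w (y + z) = dotp w y + dotp w z"
proof -
  have "supp (y + z) \<subseteq> supp y \<union> supp z" by (rule keys_add)
  thus ?thesis
    by (simp add: dotp_superset[of "supp y \<union> supp z"] lookup_add distrib_right sum.distrib)
qed

lemma dotp_pscale: "dotp w (pscale c z) = c * dotp w z"
  using supp_pscale[of c z]
  by (simp add: dotp_superset[of "supp z"] sum_distrib_left mult.assoc)

lemma dotp_single [simp]: "dotp w (Poly_Mapping.single b c) = c * w b"
  by (simp add: dotp_def)

lemma dotp_0 [simp]: "dotp w 0 = 0"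
  by (simp add: dotp_def)

lemma dotp_uminus: "dotp w (- z) = - dotp w z"
  using dotp_pscale[of w "-1" z] by simp

lemma dotp_diff: "dotp w (y - z) = dotp w y - dotp w z"
  using dotp_add[of w y "- z"] by (simp add: dotp_uminus)

lemmas dotp_simps = dotp_add dotp_pscale dotp_uminus dotp_diff

section \<open>Matrices and their superbracket\<close>

lemma sum_lt_2: "(\<Sum>p<2. f p) = f 0 + f (Suc 0)"
  by (simp add: numeral_2_eq_2)

lemma lt_2_cases: "p < 2 \<Longrightarrow> p = 0 \<or> p = Suc 0" for p :: nat
  by auto

lemma linext_fun_add: "linext (\<lambda>b. f b + g b) z = linext f z + linext g z"
  by (simp add: linext_def pv.scale_right_distrib sum.distrib)

lemma linext_fun_pscale: "linext (\<lambda>b. pscale c (f b)) z = pscale c (linext f z)"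
  by (simp add: linext_def pv.scale_sum_right mult.commute)

lemma linext_cong: "(\<And>b. b \<in> supp z \<Longrightarrow> f b = g b) \<Longrightarrow> linext f z = linext g z"
  by (simp add: linext_def)

lemma mmult_add: "mmult (X + X') Y = mmult X Y + mmult X' Y" "mmult X (Y + Y') = mmult X Y + mmult X Y'"
  by (simp_all add: mmult_def linext_simps case_prod_unfold linext_fun_add)

lemma mmult_pscale: "mmult (pscale c X) Y = pscale c (mmult X Y)" "mmult X (pscale c Y) = pscale c (mmult X Y)"
  by (simp_all add: mmult_def linext_simps case_prod_unfold linext_fun_pscale)

lemma mmult_0 [simp]: "mmult 0 Y = 0" "mmult X 0 = 0"
  by (simp_all add: mmult_def linext_def case_prod_unfold)

lemma mmult_uminus: "mmult (- X) Y = - mmult X Y" "mmult X (- Y) = - mmult X Y"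
  using mmult_pscale(1)[where c="-1" and X=X] mmult_pscale(2)[where c="-1" and Y=Y] by simp_all

lemma mmult_diff: "mmult (X - X') Y = mmult X Y - mmult X' Y" "mmult X (Y - Y') = mmult X Y - mmult X Y'"
  using mmult_add(1)[of X "- X'"] mmult_add(2)[of X Y "- Y'"] by (simp_all add: mmult_uminus)

lemmas mmult_simps = mmult_add mmult_pscale mmult_uminus mmult_diff

lemma mmult_bas: "mmult (bas ab) (bas cd) = (if snd ab = fst cd then bas (fst ab, snd cd) else 0)"
  by (simp add: mmult_def case_prod_unfold)

lemma mmult_assoc: "mmult (mmult X Y) Z = mmult X (mmult Y Z)"
proof (rule linear_eq_on_bas[of _ "\<lambda>Z. mmult (mmult X Y) Z" "\<lambda>Z. mmult X (mmult Y Z)"])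
  fix c :: "index \<times> index"
  show "mmult (mmult X Y) (bas c) = mmult X (mmult Y (bas c))"
    by (rule bilinear_eq_on_bas[of "\<lambda>X Y. mmult (mmult X Y) (bas c)" "\<lambda>X Y. mmult X (mmult Y (bas c))"])
      (auto intro!: linear_pI simp: mmult_simps mmult_bas)
qed (auto intro!: linear_pI simp: mmult_simps)

lemma supp_mmult:
  "supp (mmult X Y) \<subseteq> {(a, d). \<exists>b. (a, b) \<in> supp X \<and> (b, d) \<in> supp Y}"
proof
  fix e assume "e \<in> supp (mmult X Y)"
  from subsetD[OF supp_linext this[unfolded mmult_def]]
  obtain ab where ab: "ab \<in> supp X"
    and e: "e \<in> supp (linext (\<lambda>(c, d). if snd ab = c then bas (fst ab, d) else 0) Y)"
    by (auto simp: case_prod_unfold)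
  from subsetD[OF supp_linext e]
  obtain cd where cd: "cd \<in> supp Y" and "e \<in> supp (if snd ab = fst cd then bas (fst ab, snd cd) else 0)"
    by (auto simp: case_prod_unfold)
  hence "snd ab = fst cd" "e = (fst ab, snd cd)" by (auto split: if_splits)
  with ab cd show "e \<in> {(a, d). \<exists>b. (a, b) \<in> supp X \<and> (b, d) \<in> supp Y}"
    by (metis (mono_tags, lifting) case_prodI mem_Collect_eq prod.collapse)
qed

section \<open>Parity components and the superbracket of matrices\<close>

abbreviation ppar :: "ltype \<Rightarrow> index \<times> index \<Rightarrow> nat"
  where "ppar x ab \<equiv> (ipar x (fst ab) + ipar x (snd ab)) mod 2"

lemma mat_hom_iff: "X \<in> mat_hom x p \<longleftrightarrow> (\<forall>ab\<in>supp X. ppar x ab = p)"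
  by (auto simp: mat_hom_def)

lemma coef_linext: "coef (linext f z) c = (\<Sum>b\<in>supp z. coef z b * coef (f b) c)"
  by (simp add: linext_def lookup_sum)

text \<open>Parity projections, the adjoint action of \<open>E_hat r\<close> and the truncation
  \<open>ptr\<close> are all diagonal in the matrix units; their entries are read off from this
  formula.\<close>

lemma coef_linext_diag:
  "coef (linext (\<lambda>b. pscale (k b) (bas b)) z) c = coef z c * k c"
proof -
  have "coef (linext (\<lambda>b. pscale (k b) (bas b)) z) c = (\<Sum>b\<in>supp z. if b = c then coef z b * k b else 0)"
    unfolding coef_linext by (rule sum.cong) (auto simp: lookup_single when_def)
  also have "\<dots> = coef z c * k c"
    by (auto simp: sum.delta in_keys_iff)
  finally show ?thesis .
qed

lemma coef_mat_comp: "coef (mat_comp x p X) ab = (if ppar x ab = p then coef X ab else 0)"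
proof -
  have "mat_comp x p X = linext (\<lambda>ab. pscale (if ppar x ab = p then 1 else 0) (bas ab)) X"
    unfolding mat_comp_def by (rule linext_cong) (auto split: prod.splits)
  thus ?thesis by (simp add: coef_linext_diag del: pscale_bas)
qed

lemma mat_comp_add: "mat_comp x p (X + Y) = mat_comp x p X + mat_comp x p Y"
  and mat_comp_pscale: "mat_comp x p (pscale c X) = pscale c (mat_comp x p X)"
  by (auto intro!: poly_mapping_eqI simp: coef_mat_comp lookup_add)

lemma mat_comp_hom: "mat_comp x p X \<in> mat_hom x p"
  by (auto simp: mat_hom_iff in_keys_iff coef_mat_comp split: if_splits)

lemma mat_comp_of_hom:
  assumes "X \<in> mat_hom x p"
  shows "mat_comp x q X = (if q = p then X else 0)"
proof (rule poly_mapping_eqI)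
  fix ab
  show "coef (mat_comp x q X) ab = coef (if q = p then X else 0) ab"
    using assms by (cases "ab \<in> supp X") (auto simp: coef_mat_comp mat_hom_iff in_keys_iff)
qed

lemma mat_comp_sum: "mat_comp x 0 X + mat_comp x (Suc 0) X = X"
proof (rule poly_mapping_eqI)
  fix ab
  show "coef (mat_comp x 0 X + mat_comp x (Suc 0) X) ab = coef X ab"
    using mod_less_divisor[of 2 "ipar x (fst ab) + ipar x (snd ab)"] lt_2_cases[of "ppar x ab"]
    by (auto simp: coef_mat_comp lookup_add)
qed

lemma mat_hom_add: "X \<in> mat_hom x p \<Longrightarrow> Y \<in> mat_hom x p \<Longrightarrow> X + Y \<in> mat_hom x p"
  using keys_add[of X Y] by (auto simp: mat_hom_iff)

lemma mat_hom_pscale: "X \<in> mat_hom x p \<Longrightarrow> pscale c X \<in> mat_hom x p"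
  using supp_pscale[of c X] by (auto simp: mat_hom_iff)

lemma mat_hom_0 [simp]: "0 \<in> mat_hom x p"
  by (simp add: mat_hom_iff)

lemma mat_hom_uminus: "X \<in> mat_hom x p \<Longrightarrow> - X \<in> mat_hom x p"
  using mat_hom_pscale[of X x p "-1"] by simp

lemma mat_hom_diff: "X \<in> mat_hom x p \<Longrightarrow> Y \<in> mat_hom x p \<Longrightarrow> X - Y \<in> mat_hom x p"
  using mat_hom_add[of X x p "- Y"] mat_hom_uminus by fastforce

lemma mat_hom_mmult:
  assumes "X \<in> mat_hom x p" "Y \<in> mat_hom x q"
  shows "mmult X Y \<in> mat_hom x ((p + q) mod 2)"
  unfolding mat_hom_iff
proof
  fix ad assume "ad \<in> supp (mmult X Y)"
  from subsetD[OF supp_mmult this] obtain b where b: "(fst ad, b) \<in> supp X" "(b, snd ad) \<in> supp Y"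
    by (auto simp: case_prod_unfold)
  have "p = (ipar x (fst ad) + ipar x b) mod 2" "q = (ipar x b + ipar x (snd ad)) mod 2"
    using bspec[OF assms(1)[unfolded mat_hom_iff] b(1)] bspec[OF assms(2)[unfolded mat_hom_iff] b(2)]
    by auto
  thus "ppar x ad = (p + q) mod 2"
    by (simp add: mod2_eq_if)
qed

lemma mat_bracket_add:
  "mat_bracket x (X + X') Y = mat_bracket x X Y + mat_bracket x X' Y"
  "mat_bracket x X (Y + Y') = mat_bracket x X Y + mat_bracket x X Y'"
  by (simp_all add: mat_bracket_def sum_lt_2 mat_comp_add mmult_simps pv.scale_right_distrib)

lemma mat_bracket_pscale:
  "mat_bracket x (pscale c X) Y = pscale c (mat_bracket x X Y)"
  "mat_bracket x X (pscale c Y) = pscale c (mat_bracket x X Y)"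
  by (simp_all add: mat_bracket_def sum_lt_2 mat_comp_pscale mmult_simps pv.scale_right_distrib
      pv.scale_right_diff_distrib)

lemma mat_bracket_linear:
  "Vector_Spaces.linear pscale pscale (\<lambda>X. mat_bracket x X Y)"
  "Vector_Spaces.linear pscale pscale (mat_bracket x X)"
  by (intro linear_pI; simp add: mat_bracket_add mat_bracket_pscale)+

lemma mat_bracket_0 [simp]: "mat_bracket x 0 Y = 0" "mat_bracket x X 0 = 0"
  using mat_bracket_pscale(1)[of x 0 X Y] mat_bracket_pscale(2)[of x X 0 Y] by simp_all

lemma mat_bracket_hom:
  assumes "X \<in> mat_hom x p" "Y \<in> mat_hom x q" "p < 2" "q < 2"
  shows "mat_bracket x X Y = mmult X Y - pscale ((-1) ^ (p * q)) (mmult Y X)"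
  using lt_2_cases[OF assms(3)] lt_2_cases[OF assms(4)]
  by (auto simp: mat_bracket_def sum_lt_2 mat_comp_of_hom[OF assms(1)] mat_comp_of_hom[OF assms(2)])

lemma mat_bracket_in_hom:
  assumes "X \<in> mat_hom x p" "Y \<in> mat_hom x q" "p < 2" "q < 2"
  shows "mat_bracket x X Y \<in> mat_hom x ((p + q) mod 2)"
  using mat_hom_mmult[OF assms(1,2)] mat_hom_mmult[OF assms(2,1)]
  unfolding mat_bracket_hom[OF assms] by (auto intro!: mat_hom_diff mat_hom_pscale simp: add.commute)

lemma mat_bracket_antisym:
  assumes "X \<in> mat_hom x p" "Y \<in> mat_hom x q" "p < 2" "q < 2"
  shows "mat_bracket x Y X = pscale (- ((-1) ^ (p * q))) (mat_bracket x X Y)"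
  using lt_2_cases[OF assms(3)] lt_2_cases[OF assms(4)]
  by (auto simp: mat_bracket_hom[OF assms] mat_bracket_hom[OF assms(2,1,4,3)])

text \<open>For homogeneous arguments each bracket is a signed commutator. In each of the eight
  parity patterns the signs become numbers, and associativity of \<open>mmult\<close>
  finishes.\<close>

lemma mat_jacobi:
  assumes "X \<in> mat_hom x p" "Y \<in> mat_hom x q" "Z \<in> mat_hom x r" "p < 2" "q < 2" "r < 2"
  shows "mat_bracket x X (mat_bracket x Y Z) =
    mat_bracket x (mat_bracket x X Y) Z + pscale ((-1) ^ (p * q)) (mat_bracket x Y (mat_bracket x X Z))"
proof -
  have m: "(a + b) mod 2 < 2" for a b :: nat by simp
  have *: "mat_bracket x X (mat_bracket x Y Z) =
     mmult X (mat_bracket x Y Z) - pscale ((-1) ^ (p * ((q + r) mod 2))) (mmult (mat_bracket x Y Z) X)"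
    by (rule mat_bracket_hom) (use assms m mat_bracket_in_hom in auto)
  have **: "mat_bracket x (mat_bracket x X Y) Z =
     mmult (mat_bracket x X Y) Z - pscale ((-1) ^ (((p + q) mod 2) * r)) (mmult Z (mat_bracket x X Y))"
    by (rule mat_bracket_hom) (use assms m mat_bracket_in_hom in auto)
  have ***: "mat_bracket x Y (mat_bracket x X Z) =
     mmult Y (mat_bracket x X Z) - pscale ((-1) ^ (q * ((p + r) mod 2))) (mmult (mat_bracket x X Z) Y)"
    by (rule mat_bracket_hom) (use assms m mat_bracket_in_hom in auto)
  note e = mat_bracket_hom[OF assms(1,2,4,5)] mat_bracket_hom[OF assms(2,3,5,6)] mat_bracket_hom[OF assms(1,3,4,6)]
  show ?thesis
    unfolding * ** ***
    unfolding e
    using lt_2_cases[OF assms(4)] lt_2_cases[OF assms(5)] lt_2_cases[OF assms(6)]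
    by (elim disjE) (simp_all add: mmult_simps mmult_assoc pv.scale_right_distrib pv.scale_right_diff_distrib)
qed

section \<open>The supertrace and the cocycle of the central extension\<close>

lemma Str_dotp: "Str x X = dotp (\<lambda>(a, b). if a = b then (-1) ^ ipar x a else 0) X"
  unfolding Str_def dotp_def by (rule sum.cong) auto

definition StrJ :: "ltype \<Rightarrow> mat \<Rightarrow> complex"
  where "StrJ x X = dotp (\<lambda>(a, b). if a = b then (-1) ^ ipar x a * Jdiag a else 0) X"

lemma StrJ_simps: "StrJ x (X + Y) = StrJ x X + StrJ x Y" "StrJ x (X - Y) = StrJ x X - StrJ x Y"
  "StrJ x (pscale c X) = c * StrJ x X" "StrJ x 0 = 0" "StrJ x (- X) = - StrJ x X"
  by (simp_all add: StrJ_def dotp_simps)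

lemma StrJ_odd: "X \<in> mat_hom x (Suc 0) \<Longrightarrow> StrJ x X = 0"
  unfolding StrJ_def dotp_def by (rule sum.neutral) (force simp: mat_hom_iff)

lemma J_bracket_add: "J_bracket (X + Y) = J_bracket X + J_bracket Y"
  and J_bracket_pscale: "J_bracket (pscale c X) = pscale c (J_bracket X)"
  by (simp_all add: J_bracket_def linext_simps)

lemma mat_bracket_bas:
  "mat_bracket x (bas ab) (bas cd) = (if snd ab = fst cd then bas (fst ab, snd cd) else 0)
    - pscale ((-1) ^ (ppar x ab * ppar x cd)) (if snd cd = fst ab then bas (fst cd, snd ab) else 0)"
  by (subst mat_bracket_hom[of _ x "ppar x ab" _ "ppar x cd"])
    (auto simp: mat_hom_iff mmult_bas)

text \<open>
  Although $J$ is not finitely supported, $\mathrm{Str}(J Z)$ makes sense for finitely supported \<open>Z\<close>.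
  Hence the cocycle of the central extension is a coboundary on \<^const>\<open>G_alg\<close>.
\<close>

lemma cocycle_coboundary: "Str x (mmult (J_bracket X) Y) = StrJ x (mat_bracket x X Y)"
proof -
  have b: "Str x (mmult (J_bracket (bas ab)) (bas cd)) = StrJ x (mat_bracket x (bas ab) (bas cd))" for ab cd
  proof -
    obtain a b c d where [simp]: "ab = (a, b)" "cd = (c, d)" by (cases ab, cases cd)
    have J: "J_bracket (bas (a, b)) = pscale (Jdiag a - Jdiag b) (bas (a, b))"
      unfolding J_bracket_def by simp
    have "(-1::complex) ^ (ppar x (a, b) * ppar x (b, a)) * (-1) ^ ipar x b = (-1) ^ ipar x a"
      by (cases a; cases b) auto
    thus ?thesis
      unfolding mat_bracket_bas
      by (auto simp: J Str_dotp StrJ_def mmult_simps mmult_bas dotp_simps algebra_simps simp del: pscale_bas)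
  qed
  have lin: "Vector_Spaces.linear pscale (*) (\<lambda>Y. Str x (mmult X Y))"
    "Vector_Spaces.linear pscale (*) (\<lambda>Y. StrJ x (mat_bracket x X Y))"
    "Vector_Spaces.linear pscale (*) (\<lambda>X. Str x (mmult (J_bracket X) Z))"
    "Vector_Spaces.linear pscale (*) (\<lambda>X. StrJ x (mat_bracket x X Z))" for X Z
    by (intro linear_cI; simp add: Str_dotp mmult_simps dotp_simps mat_bracket_add mat_bracket_pscale StrJ_simps
      J_bracket_add J_bracket_pscale)+
  show ?thesis
  proof (rule linear_eq_on_bas[OF lin(3,4)])
    fix ab
    show "Str x (mmult (J_bracket (bas ab)) Y) = StrJ x (mat_bracket x (bas ab) Y)"
      by (rule linear_eq_on_bas[OF lin(1,2)]) (rule b)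
  qed
qed

section \<open>The superbracket of the central extension\<close>

text \<open>Because the cocycle is a coboundary, the central component of a bracket is a linear
  function of its matrix component. Antisymmetry and the Jacobi identity are therefore inherited
  from matrices.\<close>

lemma bracket_eq: "bracket x X Y = (mat_bracket x (fst X) (fst Y), StrJ x (mat_bracket x (fst X) (fst Y)))"
  by (simp add: bracket_def cocycle_coboundary)

lemma gscale_simps [simp]: "fst (gscale c X) = pscale c (fst X)" "snd (gscale c X) = c * snd X"
  by (simp_all add: gscale_def)

lemma bracket_add: "bracket x (X + X') Y = bracket x X Y + bracket x X' Y"
  "bracket x X (Y + Y') = bracket x X Y + bracket x X Y'"
  by (simp_all add: bracket_eq mat_bracket_add StrJ_simps)

lemma bracket_gscale: "bracket x (gscale c X) Y = gscale c (bracket x X Y)"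
  "bracket x X (gscale c Y) = gscale c (bracket x X Y)"
  by (simp_all add: bracket_eq mat_bracket_pscale StrJ_simps gscale_def)

lemma bracket_0 [simp]: "bracket x 0 Y = 0" "bracket x X 0 = 0"
  by (simp_all add: bracket_eq StrJ_simps zero_prod_def)

lemma gt_hom_iff: "X \<in> gt_hom x p \<longleftrightarrow> fst X \<in> mat_hom x p \<and> (p \<noteq> 0 \<longrightarrow> snd X = 0)"
  by (simp add: gt_hom_def)

lemma gt_hom_0 [simp]: "0 \<in> gt_hom x p"
  by (simp add: gt_hom_iff)

lemma gt_hom_add: "X \<in> gt_hom x p \<Longrightarrow> Y \<in> gt_hom x p \<Longrightarrow> X + Y \<in> gt_hom x p"
  by (simp add: gt_hom_iff mat_hom_add)

lemma gt_hom_gscale: "X \<in> gt_hom x p \<Longrightarrow> gscale c X \<in> gt_hom x p"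
  by (simp add: gt_hom_iff mat_hom_pscale)

lemma gt_comp_hom [simp]: "gt_comp x p X \<in> gt_hom x p"
  by (simp add: gt_hom_iff gt_comp_def mat_comp_hom)

lemma gt_comp_of_hom: "X \<in> gt_hom x p \<Longrightarrow> gt_comp x q X = (if q = p then X else 0)"
  by (cases X) (auto simp: gt_comp_def gt_hom_iff mat_comp_of_hom zero_prod_def)

lemma gt_comp_sum: "gt_comp x 0 X + gt_comp x (Suc 0) X = X"
  by (cases X) (simp add: gt_comp_def mat_comp_sum)

lemma gt_comp_add: "gt_comp x p (X + Y) = gt_comp x p X + gt_comp x p Y"
  and gt_comp_gscale: "gt_comp x p (gscale c X) = gscale c (gt_comp x p X)"
  by (auto simp: gt_comp_def mat_comp_add mat_comp_pscale gscale_def)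

lemma gt_comp_0 [simp]: "gt_comp x p 0 = 0"
  using gt_comp_gscale[of x p 0 0] by simp

lemma bracket_in_hom:
  assumes "X \<in> gt_hom x p" "Y \<in> gt_hom x q" "p < 2" "q < 2"
  shows "bracket x X Y \<in> gt_hom x ((p + q) mod 2)"
proof -
  have *: "mat_bracket x (fst X) (fst Y) \<in> mat_hom x ((p + q) mod 2)"
    using assms by (intro mat_bracket_in_hom) (auto simp: gt_hom_iff)
  moreover have "StrJ x (mat_bracket x (fst X) (fst Y)) = 0" if "(p + q) mod 2 \<noteq> 0"
    using * that by (intro StrJ_odd) (metis One_nat_def not_mod_2_eq_0_eq_1)
  ultimately show ?thesis by (simp add: gt_hom_iff bracket_eq)
qed

lemma bracket_antisym:
  assumes "X \<in> gt_hom x p" "Y \<in> gt_hom x q" "p < 2" "q < 2"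
  shows "bracket x Y X = gscale (- ((-1) ^ (p * q))) (bracket x X Y)"
  using mat_bracket_antisym[of "fst X" x p "fst Y" q] assms
  by (simp add: bracket_eq gt_hom_iff gscale_def StrJ_simps)

lemma bracket_jacobi:
  assumes "X \<in> gt_hom x p" "Y \<in> gt_hom x q" "Z \<in> gt_hom x r" "p < 2" "q < 2" "r < 2"
  shows "bracket x X (bracket x Y Z) =
    bracket x (bracket x X Y) Z + gscale ((-1) ^ (p * q)) (bracket x Y (bracket x X Z))"
  using mat_jacobi[of "fst X" x p "fst Y" q "fst Z" r] assms
  by (simp add: bracket_eq gt_hom_iff gscale_def StrJ_simps)

text \<open>Zero is homogeneous of both parities while \<open>deg\<close> assigns it 0, so degree
  and parity agree for nonzero elements only. This is the reason for the separate treatment of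
  vanishing factors in the arguments on chains.\<close>

lemma deg_eq: "X \<in> gt_hom x p \<Longrightarrow> p < 2 \<Longrightarrow> X \<noteq> 0 \<Longrightarrow> deg x X = p"
proof -
  assume a: "X \<in> gt_hom x p" "p < 2" "X \<noteq> 0"
  have "X = 0" if "X \<in> gt_hom x 0" "X \<in> gt_hom x (Suc 0)"
    using gt_comp_of_hom[OF that(1), of 0] gt_comp_of_hom[OF that(2), of 0] by simp
  thus ?thesis using a lt_2_cases[of p] by (auto simp: deg_def)
qed

lemma deg_lt_2 [simp]: "deg x X < 2"
  by (simp add: deg_def)

lemma in_hom_deg: "X \<in> gt_hom x 0 \<union> gt_hom x 1 \<Longrightarrow> X \<in> gt_hom x (deg x X)"
  by (auto simp: deg_def)

section \<open>Closure properties of the Lie superalgebra\<close>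

text \<open>The dual index: the form pairs the basis vector of \<open>a\<close> nontrivially with
  that of \<open>istar a\<close> and with no other.\<close>

fun istar :: "index \<Rightarrow> index" where
  "istar (Ix r) = Bar r"
| "istar (Bar r) = Ix r"
| "istar Bar0 = Bar0"

lemma istar_istar [simp]: "istar (istar a) = a"
  by (cases a) auto

lemma istar_eq_iff [simp]: "istar a = istar b \<longleftrightarrow> a = b"
  by (metis istar_istar)

lemma ipar_istar [simp]: "ipar x (istar a) = ipar x a"
  by (cases a) auto

lemma istar_indices [simp]: "istar a \<in> indices x m \<longleftrightarrow> a \<in> indices x m"
  by (cases a) (auto simp: indices_def)

definition gform :: "ltype \<Rightarrow> index \<Rightarrow> complex"
  where "gform x c = form x (istar c) c"

lemma form_eq: "form x a c = (if a = istar c then gform x c else 0)"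
  by (cases a; cases c) (auto simp: gform_def)

lemma mapply_bas: "coef (mapply X (bas b)) a = coef X (a, b)"
proof -
  have "coef (mapply X (bas b)) a = (\<Sum>ab\<in>supp X. if ab = (a, b) then coef X ab else 0)"
    unfolding mapply_def coef_linext
    by (rule sum.cong) (auto simp: lookup_single when_def split: prod.splits)
  also have "\<dots> = coef X (a, b)"
    by (auto simp: sum.delta in_keys_iff)
  finally show ?thesis .
qed

lemma bform_bas_right: "bform x v (bas c) = coef v (istar c) * gform x c"
proof -
  have "bform x v (bas c) = (\<Sum>a\<in>supp v. if a = istar c then coef v a * gform x c else 0)"
    unfolding bform_def by (rule sum.cong) (auto simp: form_eq)
  also have "\<dots> = coef v (istar c) * gform x c"
    by (auto simp: sum.delta in_keys_iff)
  finally show ?thesis .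
qed

lemma bform_bas_left: "bform x (bas b) v = coef v (istar b) * gform x (istar b)"
proof -
  have "bform x (bas b) v = (\<Sum>a\<in>supp v. coef v a * form x b a)"
    by (simp add: bform_def)
  also have "\<dots> = (\<Sum>a\<in>supp v. if a = istar b then coef v a * gform x (istar b) else 0)"
    by (rule sum.cong) (auto simp: form_eq)
  also have "\<dots> = coef v (istar b) * gform x (istar b)"
    by (auto simp: sum.delta in_keys_iff)
  finally show ?thesis .
qed

text \<open>On basis vectors each of the two terms of the invariance condition picks out a single
  matrix entry, so invariance ties the entry at \<open>(istar c, b)\<close> to the one at
  \<open>(istar b, c)\<close>.\<close>

lemma G_hom_iff: "X \<in> G_hom x m p \<longleftrightarrow> X \<in> mat_hom x p \<and> supp X \<subseteq> indices x m \<times> indices x m \<and>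
  (\<forall>b\<in>indices x m. \<forall>c\<in>indices x m.
    gform x c * coef X (istar c, b) + (-1) ^ (p * ipar x b) * gform x (istar b) * coef X (istar b, c) = 0)"
  by (simp add: G_hom_def bform_bas_left bform_bas_right mapply_bas mult_ac)

lemma G_hom_eq: "X \<in> G_hom x m p \<Longrightarrow> b \<in> indices x m \<Longrightarrow> c \<in> indices x m \<Longrightarrow>
    gform x c * coef X (istar c, b) = - ((-1) ^ (p * ipar x b)) * gform x (istar b) * coef X (istar b, c)"
  by (auto simp: G_hom_iff add_eq_0_iff2)

lemma G_hom_mat_hom: "X \<in> G_hom x m p \<Longrightarrow> X \<in> mat_hom x p"
  by (simp add: G_hom_iff)

lemma G_hom_supp: "X \<in> G_hom x m p \<Longrightarrow> supp X \<subseteq> indices x m \<times> indices x m"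
  by (simp add: G_hom_iff)

lemma G_hom_add: "X \<in> G_hom x m p \<Longrightarrow> Y \<in> G_hom x m p \<Longrightarrow> X + Y \<in> G_hom x m p"
proof -
  assume a: "X \<in> G_hom x m p" "Y \<in> G_hom x m p"
  have "gform x c * coef (X + Y) (istar c, b) +
      (-1) ^ (p * ipar x b) * gform x (istar b) * coef (X + Y) (istar b, c) = 0"
    if "b \<in> indices x m" "c \<in> indices x m" for b c
  proof -
    have "gform x c * coef (X + Y) (istar c, b) +
      (-1) ^ (p * ipar x b) * gform x (istar b) * coef (X + Y) (istar b, c) =
      (gform x c * coef X (istar c, b) + (-1) ^ (p * ipar x b) * gform x (istar b) * coef X (istar b, c)) +
      (gform x c * coef Y (istar c, b) + (-1) ^ (p * ipar x b) * gform x (istar b) * coef Y (istar b, c))"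
      by (simp add: lookup_add algebra_simps)
    thus ?thesis using a that by (simp add: G_hom_iff)
  qed
  thus ?thesis using a keys_add[of X Y] by (auto simp: G_hom_iff mat_hom_add)
qed

lemma G_hom_pscale: "X \<in> G_hom x m p \<Longrightarrow> pscale k X \<in> G_hom x m p"
proof -
  assume a: "X \<in> G_hom x m p"
  have "gform x c * coef (pscale k X) (istar c, b) +
      (-1) ^ (p * ipar x b) * gform x (istar b) * coef (pscale k X) (istar b, c) = 0"
    if "b \<in> indices x m" "c \<in> indices x m" for b c
  proof -
    have "gform x c * coef (pscale k X) (istar c, b) +
      (-1) ^ (p * ipar x b) * gform x (istar b) * coef (pscale k X) (istar b, c) =
      k * (gform x c * coef X (istar c, b) + (-1) ^ (p * ipar x b) * gform x (istar b) * coef X (istar b, c))"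
      by (simp add: algebra_simps)
    thus ?thesis using a that by (simp add: G_hom_iff)
  qed
  thus ?thesis using a supp_pscale[of k X] by (auto simp: G_hom_iff mat_hom_pscale)
qed

lemma G_hom_0 [simp]: "0 \<in> G_hom x m p"
  by (simp add: G_hom_iff)

text \<open>The range \<open>S\<close> is left free so that in \<open>G_hom_mmult\<close> one set
  closed under \<open>istar\<close> can serve for both products.\<close>

lemma coef_mmult:
  assumes "finite S" "snd ` supp X \<subseteq> S"
  shows "coef (mmult X Y) (a, d) = (\<Sum>b\<in>S. coef X (a, b) * coef Y (b, d))"
proof (rule linear_eq_on_bas[of "(*)" "\<lambda>X. coef (mmult X Y) (a, d)"
      "\<lambda>X. \<Sum>b\<in>S. coef X (a, b) * coef Y (b, d)"])
  fix ab assume "ab \<in> supp X"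
  hence b: "snd ab \<in> S" using assms by auto
  show "coef (mmult (bas ab) Y) (a, d) = (\<Sum>b\<in>S. coef (bas ab) (a, b) * coef Y (b, d))"
  proof (rule linear_eq_on_bas[of "(*)" "\<lambda>Y. coef (mmult (bas ab) Y) (a, d)"
        "\<lambda>Y. \<Sum>b\<in>S. coef (bas ab) (a, b) * coef Y (b, d)"])
    fix cd
    have "(\<Sum>b\<in>S. coef (bas ab) (a, b) * coef (bas cd) (b, d)) =
      (\<Sum>b\<in>S. if b = snd ab then (if ab = (a, snd ab) \<and> cd = (snd ab, d) then 1 else 0) else 0)"
      by (rule sum.cong) (auto simp: lookup_single when_def)
    also have "\<dots> = (if ab = (a, snd ab) \<and> cd = (snd ab, d) then 1 else 0)"
      using b assms(1) by (simp add: sum.delta)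
    also have "\<dots> = coef (mmult (bas ab) (bas cd)) (a, d)"
      by (cases ab; cases cd) (auto simp: mmult_bas lookup_single when_def)
    finally show "coef (mmult (bas ab) (bas cd)) (a, d) = (\<Sum>b\<in>S. coef (bas ab) (a, b) * coef (bas cd) (b, d))"
      by simp
  qed (auto intro!: linear_cI simp: mmult_simps lookup_add algebra_simps sum.distrib sum_distrib_left)
qed (auto intro!: linear_cI simp: mmult_simps lookup_add algebra_simps sum.distrib sum_distrib_left)

text \<open>Both factors are skew for the form. Moving them to the other argument reverses their
  order and replaces the summation index \<open>d\<close> by \<open>istar d\<close>, which turns an
  entry of \<open>XY\<close> into one of \<open>YX\<close>.\<close>

lemma G_hom_mmult:
  assumes X: "X \<in> G_hom x m p" and Y: "Y \<in> G_hom x m q" and bc: "b \<in> indices x m" "c \<in> indices x m"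
  shows "gform x c * coef (mmult X Y) (istar c, b) =
    (-1) ^ (p * q) * (-1) ^ ((p + q) * ipar x b) * gform x (istar b) * coef (mmult Y X) (istar b, c)"
proof -
  define W where "W = snd ` supp X \<union> snd ` supp Y"
  define S where "S = W \<union> istar ` W"
  have S: "finite S" "snd ` supp X \<subseteq> S" "snd ` supp Y \<subseteq> S" by (auto simp: S_def W_def)
  have SI: "S \<subseteq> indices x m" using G_hom_supp[OF X] G_hom_supp[OF Y] by (auto simp: S_def W_def)
  have inv: "bij_betw istar S S"
    by (rule bij_betw_byWitness[of _ istar]) (auto simp: S_def)
  have step: "gform x c * (coef X (istar c, d) * coef Y (d, b)) =
     (-1) ^ (p * q) * (-1) ^ ((p + q) * ipar x b) * gform x (istar b) *
       (coef Y (istar b, istar d) * coef X (istar d, c))" if "d \<in> S" for d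
  proof -
    have d: "d \<in> indices x m" "istar d \<in> indices x m" using that SI by auto
    have 1: "gform x c * coef X (istar c, d) = - ((-1) ^ (p * ipar x d)) * gform x (istar d) * coef X (istar d, c)"
      using G_hom_eq[OF X d(1) bc(2)] by simp
    have 2: "gform x (istar d) * coef Y (d, b) = - ((-1) ^ (q * ipar x b)) * gform x (istar b) * coef Y (istar b, istar d)"
      using G_hom_eq[OF Y bc(1) d(2)] by simp
    \<comment> \<open>A nonzero entry of \<open>Y\<close> at \<open>(d, b)\<close> forces the parity
      of \<open>d\<close> to be \<open>q\<close> plus that of \<open>b\<close>; this removes the
      sign that still depends on the summation index.\<close>
    have 3: "(-1::complex) ^ (p * ipar x d) * coef Y (d, b) = (-1) ^ (p * q) * (-1) ^ (p * ipar x b) * coef Y (d, b)"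
    proof (cases "(d, b) \<in> supp Y")
      case True
      hence "(ipar x d + ipar x b) mod 2 = q" using G_hom_mat_hom[OF Y] by (auto simp: mat_hom_iff)
      hence "(-1::complex) ^ (p * ipar x d) = (-1) ^ (p * q) * (-1) ^ (p * ipar x b)"
        by (auto simp: minus_one_power_iff mod2_eq_if split: if_splits)
      thus ?thesis by simp
    qed (simp add: in_keys_iff)
    have "gform x c * (coef X (istar c, d) * coef Y (d, b)) = (gform x c * coef X (istar c, d)) * coef Y (d, b)"
      by simp
    also have "\<dots> = - ((-1) ^ (p * ipar x d) * coef Y (d, b)) * gform x (istar d) * coef X (istar d, c)"
      unfolding 1 by (simp add: mult_ac)
    also have "\<dots> = - ((-1) ^ (p * q) * (-1) ^ (p * ipar x b)) * (gform x (istar d) * coef Y (d, b)) * coef X (istar d, c)"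
      unfolding 3 by (simp add: algebra_simps)
    also have "\<dots> = (-1) ^ (p * q) * (-1) ^ ((p + q) * ipar x b) * gform x (istar b) *
       (coef Y (istar b, istar d) * coef X (istar d, c))"
      unfolding 2 by (simp add: algebra_simps power_add)
    finally show ?thesis .
  qed
  have "gform x c * coef (mmult X Y) (istar c, b) = (\<Sum>d\<in>S. gform x c * (coef X (istar c, d) * coef Y (d, b)))"
    by (simp add: coef_mmult[OF S(1,2)] sum_distrib_left)
  also have "\<dots> = (\<Sum>d\<in>S. (-1) ^ (p * q) * (-1) ^ ((p + q) * ipar x b) * gform x (istar b) *
       (coef Y (istar b, istar d) * coef X (istar d, c)))"
    by (rule sum.cong[OF refl step])
  also have "\<dots> = (-1) ^ (p * q) * (-1) ^ ((p + q) * ipar x b) * gform x (istar b) *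
       (\<Sum>d\<in>S. coef Y (istar b, istar d) * coef X (istar d, c))"
    by (simp add: sum_distrib_left)
  also have "(\<Sum>d\<in>S. coef Y (istar b, istar d) * coef X (istar d, c)) = (\<Sum>d\<in>S. coef Y (istar b, d) * coef X (d, c))"
    by (rule sum.reindex_bij_betw[OF inv])
  also have "\<dots> = coef (mmult Y X) (istar b, c)"
    by (simp add: coef_mmult[OF S(1,3)])
  finally show ?thesis .
qed

lemma supp_diff: "supp (X - Y) \<subseteq> supp X \<union> supp Y"
  using keys_add[of X "- Y"] supp_pscale[of "-1" Y] by auto

text \<open>Passing to the other argument of the form exchanges \<open>XY\<close> and
  \<open>YX\<close> at the cost of the sign \<open>(-1)^(p*q)\<close>, which is exactly the sign in
  the supercommutator; hence the commutator is skew again.\<close>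

lemma G_hom_bracket:
  assumes X: "X \<in> G_hom x m p" and Y: "Y \<in> G_hom x m q" and pq: "p < 2" "q < 2"
  shows "mat_bracket x X Y \<in> G_hom x m ((p + q) mod 2)"
proof -
  note h = G_hom_mat_hom[OF X] G_hom_mat_hom[OF Y] pq
  have "supp (mmult X Y) \<subseteq> indices x m \<times> indices x m" "supp (mmult Y X) \<subseteq> indices x m \<times> indices x m"
    using supp_mmult[of X Y] supp_mmult[of Y X] G_hom_supp[OF X] G_hom_supp[OF Y] by blast+
  hence "supp (mat_bracket x X Y) \<subseteq> indices x m \<times> indices x m"
    unfolding mat_bracket_hom[OF h] using supp_diff[of "mmult X Y"] supp_pscale by fast
  moreover have "gform x c * coef (mat_bracket x X Y) (istar c, b) + (-1) ^ ((p + q) mod 2 * ipar x b)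
      * gform x (istar b) * coef (mat_bracket x X Y) (istar b, c) = 0"
    if bc: "b \<in> indices x m" "c \<in> indices x m" for b c
  proof -
    define s :: complex where "s = (-1) ^ (p * q)"
    define t :: complex where "t = (-1) ^ ((p + q) * ipar x b)"
    have ss: "s * s = 1" by (simp add: s_def flip: power_add mult_2)
    have t: "(-1) ^ ((p + q) mod 2 * ipar x b) = t"
      unfolding t_def by (simp add: minus_one_power_iff)
    have 1: "gform x c * coef (mmult X Y) (istar c, b) = s * t * gform x (istar b) * coef (mmult Y X) (istar b, c)"
      using G_hom_mmult[OF X Y bc] by (simp add: s_def t_def)
    have 2: "gform x c * coef (mmult Y X) (istar c, b) = s * t * gform x (istar b) * coef (mmult X Y) (istar b, c)"
      using G_hom_mmult[OF Y X bc] by (simp add: s_def t_def add.commute mult.commute)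
    have "gform x c * coef (mat_bracket x X Y) (istar c, b) =
        gform x c * coef (mmult X Y) (istar c, b) - s * (gform x c * coef (mmult Y X) (istar c, b))"
      by (simp add: mat_bracket_hom[OF h] lookup_minus s_def algebra_simps)
    also have "\<dots> = s * t * gform x (istar b) * coef (mmult Y X) (istar b, c)
        - (s * s) * t * gform x (istar b) * coef (mmult X Y) (istar b, c)"
      unfolding 1 2 by (simp add: algebra_simps)
    also have "\<dots> = - (t * gform x (istar b) * coef (mat_bracket x X Y) (istar b, c))"
      unfolding ss by (simp add: mat_bracket_hom[OF h] lookup_minus algebra_simps flip: s_def)
    finally show ?thesis unfolding t by simp
  qed
  ultimately show ?thesis
    using mat_bracket_in_hom[OF h] by (simp add: G_hom_iff)
qed

lemma G_alg_iff: "X \<in> G_alg x m \<longleftrightarrow> mat_comp x 0 X \<in> G_hom x m 0 \<and> mat_comp x (Suc 0) X \<in> G_hom x m (Suc 0)"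
proof
  assume "X \<in> G_alg x m"
  then obtain X0 X1 where X: "X = X0 + X1" "X0 \<in> G_hom x m 0" "X1 \<in> G_hom x m (Suc 0)"
    by (auto simp: G_alg_def)
  show "mat_comp x 0 X \<in> G_hom x m 0 \<and> mat_comp x (Suc 0) X \<in> G_hom x m (Suc 0)"
    using X(2,3) by (simp add: X(1) mat_comp_add mat_comp_of_hom[OF G_hom_mat_hom[OF X(2)]]
        mat_comp_of_hom[OF G_hom_mat_hom[OF X(3)]])
next
  assume "mat_comp x 0 X \<in> G_hom x m 0 \<and> mat_comp x (Suc 0) X \<in> G_hom x m (Suc 0)"
  moreover have "X = mat_comp x 0 X + mat_comp x (Suc 0) X" by (simp add: mat_comp_sum)
  ultimately show "X \<in> G_alg x m" unfolding G_alg_def mem_Collect_eq One_nat_def by blast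
qed

lemma G_hom_in_G_alg: "X \<in> G_hom x m p \<Longrightarrow> p < 2 \<Longrightarrow> X \<in> G_alg x m"
  using lt_2_cases[of p] by (auto simp: G_alg_iff mat_comp_of_hom[OF G_hom_mat_hom])

lemma G_alg_comp: "X \<in> G_alg x m \<Longrightarrow> p < 2 \<Longrightarrow> mat_comp x p X \<in> G_hom x m p"
  using lt_2_cases[of p] by (auto simp: G_alg_iff)

lemma G_alg_hom: "X \<in> G_alg x m \<Longrightarrow> X \<in> mat_hom x p \<Longrightarrow> p < 2 \<Longrightarrow> X \<in> G_hom x m p"
  using G_alg_comp[of X x m p] mat_comp_of_hom[of X x p p] by simp

lemma G_alg_add: "X \<in> G_alg x m \<Longrightarrow> Y \<in> G_alg x m \<Longrightarrow> X + Y \<in> G_alg x m"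
  by (simp add: G_alg_iff mat_comp_add G_hom_add)

lemma G_alg_pscale: "X \<in> G_alg x m \<Longrightarrow> pscale c X \<in> G_alg x m"
  by (simp add: G_alg_iff mat_comp_pscale G_hom_pscale)

lemma G_alg_0 [simp]: "0 \<in> G_alg x m"
  by (rule G_hom_in_G_alg[of _ _ _ 0]) auto

lemma G_alg_supp: "X \<in> G_alg x m \<Longrightarrow> supp X \<subseteq> indices x m \<times> indices x m"
proof -
  assume X: "X \<in> G_alg x m"
  have "supp X \<subseteq> supp (mat_comp x 0 X) \<union> supp (mat_comp x (Suc 0) X)"
    using keys_add[of "mat_comp x 0 X" "mat_comp x (Suc 0) X"] by (simp add: mat_comp_sum)
  thus ?thesis using X G_hom_supp unfolding G_alg_iff by fast
qed

lemma G_alg_bracket: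
  assumes "X \<in> G_alg x m" "Y \<in> G_alg x m"
  shows "mat_bracket x X Y \<in> G_alg x m"
proof -
  have *: "mat_bracket x (mat_comp x p X) (mat_comp x q Y) \<in> G_alg x m" if "p < 2" "q < 2" for p q
    by (rule G_hom_in_G_alg[OF G_hom_bracket[OF G_alg_comp G_alg_comp]]) (use that assms in auto)
  have "mat_bracket x X Y = mat_bracket x (mat_comp x 0 X + mat_comp x (Suc 0) X) (mat_comp x 0 Y + mat_comp x (Suc 0) Y)"
    by (simp add: mat_comp_sum)
  also have "\<dots> \<in> G_alg x m"
    unfolding mat_bracket_add by (intro G_alg_add *) auto
  finally show ?thesis .
qed

lemma g_tilde_iff: "X \<in> g_tilde x m \<longleftrightarrow> fst X \<in> G_alg x m"
  by (simp add: g_tilde_def)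

lemma g_tilde_subspace: "gv.subspace (g_tilde x m)"
  by (simp add: gv.subspace_def g_tilde_iff G_alg_add G_alg_pscale)

lemma g_tilde_bracket: "X \<in> g_tilde x m \<Longrightarrow> Y \<in> g_tilde x m \<Longrightarrow> bracket x X Y \<in> g_tilde x m"
  by (simp add: g_tilde_iff bracket_eq G_alg_bracket)

lemma g_tilde_comp: "X \<in> g_tilde x m \<Longrightarrow> p < 2 \<Longrightarrow> gt_comp x p X \<in> g_tilde x m"
  by (simp add: g_tilde_iff gt_comp_def G_hom_in_G_alg[OF G_alg_comp])

lemma KK_g_tilde: "KK \<in> g_tilde x m"
  by (simp add: KK_def g_tilde_iff)

section \<open>Weights of matrix entries and root spaces\<close>

text \<open>The weight of a basis vector under the elements $E_r$. Accordingly \<open>dwt\<close>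
  below is the weight of a matrix unit under the adjoint action.\<close>

fun iwt :: "index \<Rightarrow> (rat \<Rightarrow>\<^sub>0 complex)" where
  "iwt (Ix r) = bas r"
| "iwt (Bar r) = - bas r"
| "iwt Bar0 = 0"

lemma iwt_istar: "iwt (istar a) = - iwt a"
  by (cases a) auto

definition dwt :: "index \<times> index \<Rightarrow> (rat \<Rightarrow>\<^sub>0 complex)"
  where "dwt ab = iwt (fst ab) - iwt (snd ab)"

lemma coef_iwt: "coef (iwt (Ix r)) t = (if t = r then 1 else 0)"
  "coef (iwt (Bar r)) t = (if t = r then -1 else 0)"
  "coef (iwt Bar0) t = 0"
  by (auto simp: lookup_single when_def)

lemma supp_iwt: "a \<in> indices x m \<Longrightarrow> supp (iwt a) \<subseteq> I_tilde m"
  by (cases a) (auto simp: indices_def in_keys_iff lookup_single when_def split: if_splits)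

lemma supp_dwt: "ab \<in> indices x m \<times> indices x m \<Longrightarrow> supp (dwt ab) \<subseteq> I_tilde m"
  unfolding dwt_def by (rule order_trans[OF supp_diff]) (auto intro!: Un_least supp_iwt simp: mem_Times_iff)

lemma E_hat_hom: "E_hat r \<in> gt_hom x 0"
proof -
  have "bas (Ix r, Ix r) - bas (Bar r, Bar r) \<in> mat_hom x 0"
    by (intro mat_hom_diff) (auto simp: mat_hom_iff)
  thus ?thesis by (simp add: gt_hom_iff E_hat_def)
qed

lemma KK_hom: "KK \<in> gt_hom x 0"
  by (simp add: gt_hom_iff KK_def)

lemma bracket_KK [simp]: "bracket x KK X = 0" "bracket x X KK = 0"
  by (simp_all add: bracket_eq KK_def StrJ_simps zero_prod_def)

lemma mat_bracket_E:
  "mat_bracket x (bas (Ix r, Ix r) - bas (Bar r, Bar r)) X = linext (\<lambda>ab. pscale (coef (dwt ab) r) (bas ab)) X"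
proof (rule linear_eq_on_bas[OF mat_bracket_linear(2) linear_linext])
  fix ab :: "index \<times> index"
  obtain a b where ab: "ab = (a, b)" by (cases ab)
  have h: "bas (Ix r, Ix r) - bas (Bar r, Bar r) \<in> mat_hom x 0" "bas ab \<in> mat_hom x (ppar x ab)"
    using E_hat_hom[of r x] by (auto simp: mat_hom_iff gt_hom_iff E_hat_def)
  have p: "ppar x ab < 2" by simp
  have "mat_bracket x (bas (Ix r, Ix r) - bas (Bar r, Bar r)) (bas ab) =
     mmult (bas (Ix r, Ix r) - bas (Bar r, Bar r)) (bas ab) - mmult (bas ab) (bas (Ix r, Ix r) - bas (Bar r, Bar r))"
    using mat_bracket_hom[OF h _ p] by simp
  also have "\<dots> = pscale (coef (dwt ab) r) (bas ab)"
    by (rule poly_mapping_eqI, cases a; cases b)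
      (auto simp: ab mmult_diff mmult_bas dwt_def lookup_add lookup_minus coef_iwt lookup_single when_def simp del: iwt.simps)
  finally show "mat_bracket x (bas (Ix r, Ix r) - bas (Bar r, Bar r)) (bas ab) =
    linext (\<lambda>ab. pscale (coef (dwt ab) r) (bas ab)) (bas ab)"
    by simp
qed

lemma bracket_E_hat: "bracket x (E_hat r) X = (linext (\<lambda>ab. pscale (coef (dwt ab) r) (bas ab)) (fst X), 0)"
proof -
  \<comment> \<open>No central term arises: the supertrace sees diagonal entries only, and diagonal
    matrix units have weight 0.\<close>
  have "StrJ x (linext (\<lambda>ab. pscale (coef (dwt ab) r) (bas ab)) (fst X)) = 0"
    unfolding StrJ_def dotp_def
    by (rule sum.neutral) (auto simp: coef_linext_diag dwt_def simp del: pscale_bas split: if_splits)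
  thus ?thesis
    by (simp add: bracket_eq E_hat_def mat_bracket_E del: pscale_bas)
qed

text \<open>The elements \<open>E_hat r\<close> act diagonally on matrix units and kill the central
  element, and \<open>KK\<close> kills everything. The conditions for \<open>r\<close> in
  \<open>I_tilde m\<close> determine the whole weight, because entries of elements of
  \<open>g_tilde\<close> and \<open>\<alpha>\<close> itself have no coefficients elsewhere.\<close>

lemma root_space_iff:
  assumes "\<alpha> \<in> hdual (I_tilde m)"
  shows "X \<in> root_space x m \<alpha> \<longleftrightarrow> X \<in> g_tilde x m \<and> (X \<noteq> 0 \<longrightarrow> snd \<alpha> = 0) \<and>
    (\<forall>ab\<in>supp (fst X). dwt ab = fst \<alpha>) \<and> (fst \<alpha> \<noteq> 0 \<longrightarrow> snd X = 0)"
proof -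
  have 1: "bracket x KK X = gscale (snd \<alpha>) X \<longleftrightarrow> (X \<noteq> 0 \<longrightarrow> snd \<alpha> = 0)"
    using gv.scale_eq_0_iff[of "snd \<alpha>" X] by auto
  have 2: "bracket x (E_hat r) X = gscale (coef (fst \<alpha>) r) X \<longleftrightarrow>
    (\<forall>ab\<in>supp (fst X). coef (dwt ab) r = coef (fst \<alpha>) r) \<and> coef (fst \<alpha>) r * snd X = 0" for r
    by (auto simp: bracket_E_hat prod_eq_iff poly_mapping_eq_iff fun_eq_iff coef_linext_diag in_keys_iff
        simp del: pscale_bas)
  have 3: "(\<forall>r\<in>I_tilde m. \<forall>ab\<in>supp (fst X). coef (dwt ab) r = coef (fst \<alpha>) r) \<longleftrightarrow> (\<forall>ab\<in>supp (fst X). dwt ab = fst \<alpha>)"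
    if X: "X \<in> g_tilde x m"
  proof -
    have "coef (dwt ab) r = coef (fst \<alpha>) r" if "ab \<in> supp (fst X)" "r \<notin> I_tilde m" for r ab
    proof -
      have "ab \<in> indices x m \<times> indices x m" using G_alg_supp[of "fst X" x m] X that by (auto simp: g_tilde_iff)
      from supp_dwt[OF this] assms that(2) have "r \<notin> supp (dwt ab)" "r \<notin> supp (fst \<alpha>)"
        by (auto simp: hdual_def)
      thus ?thesis by (simp add: in_keys_iff)
    qed
    thus ?thesis by (auto intro!: poly_mapping_eqI)
  qed
  have 4: "(\<forall>r\<in>I_tilde m. coef (fst \<alpha>) r * snd X = 0) \<longleftrightarrow> (fst \<alpha> \<noteq> 0 \<longrightarrow> snd X = 0)"
    using assms by (auto simp: hdual_def in_keys_iff poly_mapping_eq_iff fun_eq_iff subset_iff)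
  show ?thesis unfolding root_space_def mem_Collect_eq 1 2 using 3 4 by blast
qed

lemma root_space_subspace: "gv.subspace (root_space x m \<alpha>)"
  unfolding gv.subspace_def root_space_def
  using gv.subspace_add[OF g_tilde_subspace] gv.subspace_0[OF g_tilde_subspace]
    gv.subspace_scale[OF g_tilde_subspace]
  by (auto simp: bracket_add bracket_gscale gv.scale_right_distrib mult.commute simp del: bracket_KK)

lemma root_space_g_tilde: "X \<in> root_space x m \<alpha> \<Longrightarrow> X \<in> g_tilde x m"
  by (simp add: root_space_def)

lemma hdual_add: "\<alpha> \<in> hdual I \<Longrightarrow> \<beta> \<in> hdual I \<Longrightarrow> \<alpha> + \<beta> \<in> hdual I"
  using keys_add[of "fst \<alpha>" "fst \<beta>"] by (auto simp: hdual_def)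

lemma hdual_uminus: "\<alpha> \<in> hdual I \<Longrightarrow> - \<alpha> \<in> hdual I"
  by (auto simp: hdual_def in_keys_iff)

lemma hdual_0 [simp]: "0 \<in> hdual I"
  by (simp add: hdual_def)

lemma hdual_mono: "I \<subseteq> I' \<Longrightarrow> hdual I \<subseteq> hdual I'"
  by (auto simp: hdual_def)

lemma supp_mmult_relcomp: "supp (mmult X Y) \<subseteq> supp X O supp Y"
  using supp_mmult[of X Y] by (auto simp: relcomp_unfold)

lemma supp_mat_comp: "supp (mat_comp x p X) \<subseteq> supp X"
  by (auto simp: in_keys_iff coef_mat_comp split: if_splits)

lemma supp_mat_bracket: "supp (mat_bracket x X Y) \<subseteq> supp X O supp Y \<union> supp Y O supp X"
proof -
  have 1: "supp (mmult (mat_comp x p X) (mat_comp x q Y)) \<subseteq> supp X O supp Y" for p q X Y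
    by (rule order_trans[OF supp_mmult_relcomp relcomp_mono[OF supp_mat_comp supp_mat_comp]])
  have 2: "supp (mmult (mat_comp x p X) (mat_comp x q Y) - pscale k (mmult (mat_comp x q Y) (mat_comp x p X)))
      \<subseteq> supp X O supp Y \<union> supp Y O supp X" for p q k
    by (rule order_trans[OF supp_diff Un_mono[OF 1 order_trans[OF supp_pscale 1]]])
  show ?thesis
    unfolding mat_bracket_def
    by (intro order_trans[OF supp_sum] UN_least 2)
qed

lemma root_space_bracket:
  assumes a: "\<alpha> \<in> hdual (I_tilde m)" "\<beta> \<in> hdual (I_tilde m)"
    and X: "X \<in> root_space x m \<alpha>" and Y: "Y \<in> root_space x m \<beta>"
  shows "bracket x X Y \<in> root_space x m (\<alpha> + \<beta>)"
proof -
  note x = X[unfolded root_space_iff[OF a(1)]] and y = Y[unfolded root_space_iff[OF a(2)]]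
  have s: "dwt ab = fst (\<alpha> + \<beta>)" if "ab \<in> supp (mat_bracket x (fst X) (fst Y))" for ab
  proof -
    from subsetD[OF supp_mat_bracket that] consider
      b where "(fst ab, b) \<in> supp (fst X)" "(b, snd ab) \<in> supp (fst Y)"
      | b where "(fst ab, b) \<in> supp (fst Y)" "(b, snd ab) \<in> supp (fst X)"
      by (auto simp: relcomp_unfold)
    thus ?thesis
    proof cases
      case 1
      hence "dwt (fst ab, b) = fst \<alpha>" "dwt (b, snd ab) = fst \<beta>" using x y by auto
      moreover have "dwt ab = dwt (fst ab, b) + dwt (b, snd ab)" by (simp add: dwt_def)
      ultimately show ?thesis by simp
    next
      case 2
      hence "dwt (fst ab, b) = fst \<beta>" "dwt (b, snd ab) = fst \<alpha>" using x y by auto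
      moreover have "dwt ab = dwt (fst ab, b) + dwt (b, snd ab)" by (simp add: dwt_def)
      ultimately show ?thesis by simp
    qed
  qed
  \<comment> \<open>Entries of nonzero weight lie off the diagonal, where the supertrace does not
    see them.\<close>
  have "StrJ x (mat_bracket x (fst X) (fst Y)) = 0" if "fst (\<alpha> + \<beta>) \<noteq> 0"
    unfolding StrJ_def dotp_def
  proof (rule sum.neutral, rule ballI)
    fix ab assume "ab \<in> supp (mat_bracket x (fst X) (fst Y))"
    from s[OF this] that have "fst ab \<noteq> snd ab" by (auto simp: dwt_def)
    thus "coef (mat_bracket x (fst X) (fst Y)) ab * (case ab of (a, b) \<Rightarrow> if a = b then (- 1) ^ ipar x a * Jdiag a else 0) = 0"
      by (auto split: prod.splits)
  qed
  moreover have "snd (\<alpha> + \<beta>) = 0" if "bracket x X Y \<noteq> 0"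
  proof -
    have "X \<noteq> 0" "Y \<noteq> 0" using that by auto
    thus ?thesis using x y by simp
  qed
  ultimately show ?thesis
    unfolding root_space_iff[OF hdual_add[OF a]] using s x y g_tilde_bracket by (auto simp: bracket_eq)
qed

lemma root_space_comp:
  assumes "\<alpha> \<in> hdual (I_tilde m)" "X \<in> root_space x m \<alpha>" "p < 2"
  shows "gt_comp x p X \<in> root_space x m \<alpha>"
proof -
  have "supp (mat_comp x p (fst X)) \<subseteq> supp (fst X)"
    by (auto simp: in_keys_iff coef_mat_comp split: if_splits)
  moreover have "X \<noteq> 0" if "gt_comp x p X \<noteq> 0" using that by auto
  ultimately show ?thesis using assms(2,3) g_tilde_comp[of X x m p]
    unfolding root_space_iff[OF assms(1)] by (auto simp: gt_comp_def)
qed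

text \<open>The second matrix unit and its sign are forced by the invariance of the form; see
  \<open>root_space_eps_diff\<close>.\<close>

definition Emat :: "ltype \<Rightarrow> rat \<Rightarrow> rat \<Rightarrow> mat"
  where "Emat x r s = bas (Ix r, Ix s)
    - pscale ((-1) ^ ((ipar x (Ix r) + ipar x (Ix s)) mod 2 * ipar x (Ix s))) (bas (Bar s, Bar r))"

lemma Emat_hom: "Emat x r s \<in> mat_hom x ((ipar x (Ix r) + ipar x (Ix s)) mod 2)"
  unfolding Emat_def by (intro mat_hom_diff mat_hom_pscale) (auto simp: mat_hom_iff)

lemma kappa_sq [simp]: "kappa x * kappa x = 1" "kappa x * (kappa x * z) = z"
  by (auto simp: kappa_def)

lemma gform_simps [simp]: "gform x (Bar r) = 1" "gform x (Ix r) = kappa x * (-1) ^ ipar x (Ix r)"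
  "gform x Bar0 = 1"
  by (auto simp: gform_def)

lemma Emat_G_hom:
  assumes "r \<in> I_tilde m" "s \<in> I_tilde m"
  shows "Emat x r s \<in> G_hom x m ((ipar x (Ix r) + ipar x (Ix s)) mod 2)"
  unfolding G_hom_iff
proof (intro conjI Emat_hom ballI)
  have "supp (Emat x r s) \<subseteq> {(Ix r, Ix s), (Bar s, Bar r)}"
    unfolding Emat_def using supp_diff by (auto simp: in_keys_iff lookup_minus lookup_single when_def split: if_splits)
  thus "supp (Emat x r s) \<subseteq> indices x m \<times> indices x m"
    using assms by (auto simp: indices_def)
  fix b c
  show "gform x c * coef (Emat x r s) (istar c, b) +
      (- 1) ^ ((ipar x (Ix r) + ipar x (Ix s)) mod 2 * ipar x b) * gform x (istar b) * coef (Emat x r s) (istar b, c) = 0"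
    by (cases b; cases c) (auto simp: Emat_def lookup_minus lookup_single when_def)
qed

definition Eroot :: "ltype \<Rightarrow> rat \<Rightarrow> rat \<Rightarrow> gt"
  where "Eroot x r s = (Emat x r s, 0)"

lemma E_hat_Eroot: "E_hat r = Eroot x r r"
  by (simp add: E_hat_def Eroot_def Emat_def)

lemma Eroot_g_tilde: "r \<in> I_tilde m \<Longrightarrow> s \<in> I_tilde m \<Longrightarrow> Eroot x r s \<in> g_tilde x m"
  by (auto simp: g_tilde_iff Eroot_def intro!: G_hom_in_G_alg[OF Emat_G_hom])

lemma E_hat_g_tilde: "r \<in> I_tilde m \<Longrightarrow> E_hat r \<in> g_tilde x m"
  by (simp add: E_hat_Eroot[of r x] Eroot_g_tilde)

lemma Eroot_hom: "Eroot x r s \<in> gt_hom x ((ipar x (Ix r) + ipar x (Ix s)) mod 2)"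
  using Emat_hom[of x r s] by (simp add: gt_hom_iff Eroot_def del: ipar.simps)

lemma Eroot_neq_0: "Eroot x r s \<noteq> 0"
proof -
  have "coef (Emat x r s) (Ix r, Ix s) = 1"
    by (simp add: Emat_def lookup_minus lookup_single)
  thus ?thesis by (auto simp: Eroot_def zero_prod_def)
qed

lemma bas_eq_iff [simp]: "bas r = bas s \<longleftrightarrow> r = s"
proof
  assume "bas r = bas s"
  hence "coef (bas r) r = coef (bas s) r" by simp
  thus "r = s" by (simp add: lookup_single when_def split: if_splits)
qed simp

lemma fst_eps [simp]: "fst (eps r) = bas r" "snd (eps r) = 0"
  by (simp_all add: eps_def)

lemma eps_hdual: "r \<in> I \<Longrightarrow> eps r \<in> hdual I"
  by (simp add: hdual_def)

lemma eps_diff_hdual: "r \<in> I \<Longrightarrow> s \<in> I \<Longrightarrow> eps r - eps s \<in> hdual I"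
  using hdual_add[of "eps r" I "- eps s"] by (simp add: eps_hdual hdual_uminus)

lemma eps_diff_neq_0: "r \<noteq> s \<Longrightarrow> eps r - eps s \<noteq> 0"
  by (auto simp: eps_def prod_eq_iff)

lemma Eroot_root_space:
  assumes "r \<in> I_tilde m" "s \<in> I_tilde m"
  shows "Eroot x r s \<in> root_space x m (eps r - eps s)"
proof -
  have "dwt ab = bas r - bas s" if "ab \<in> supp (Emat x r s)" for ab
  proof -
    have "ab \<in> {(Ix r, Ix s), (Bar s, Bar r)}"
      using that unfolding Emat_def by (auto simp: in_keys_iff lookup_minus lookup_single when_def split: if_splits)
    thus ?thesis by (auto simp: dwt_def)
  qed
  thus ?thesis
    unfolding root_space_iff[OF eps_diff_hdual[OF assms]]
    using Eroot_g_tilde[OF assms] by (auto simp: Eroot_def)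
qed

lemma dwt_eq_eps_diff:
  assumes "dwt ab = bas r - bas s" "r \<noteq> s"
  shows "ab = (Ix r, Ix s) \<or> ab = (Bar s, Bar r)"
proof -
  obtain a b where ab: "ab = (a, b)" by (cases ab)
  have "coef (dwt ab) t = coef (bas r - bas s) t" for t using assms by simp
  hence e: "coef (iwt a) t - coef (iwt b) t = (if t = r then 1 else 0) - (if t = s then 1 else 0)" for t
    by (auto simp: ab dwt_def lookup_minus lookup_single when_def)
  show ?thesis using e[of r] e[of s] assms(2) unfolding ab
    by (cases a; cases b) (auto simp: coef_iwt simp del: iwt.simps split: if_splits)
qed

text \<open>Only two matrix units have this weight and the invariance of the form ties their
  coefficients. Multiplicity one lets the reflections below work with a single pair of root vectors
  \<open>e\<close>, \<open>f\<close>.\<close>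

lemma root_space_eps_diff:
  assumes r: "r \<in> I_tilde m" "s \<in> I_tilde m" "r \<noteq> s" and X: "X \<in> root_space x m (eps r - eps s)"
  shows "\<exists>c. X = gscale c (Eroot x r s)"
proof -
  let ?p = "(ipar x (Ix r) + ipar x (Ix s)) mod 2"
  note X' = X[unfolded root_space_iff[OF eps_diff_hdual[OF r(1,2)]]]
  have nz: "bas r - bas s \<noteq> (0 :: rat \<Rightarrow>\<^sub>0 complex)"
    using eps_diff_neq_0[OF r(3)] by (auto simp: prod_eq_iff eps_def)
  have s: "supp (fst X) \<subseteq> {(Ix r, Ix s), (Bar s, Bar r)}"
    using X' dwt_eq_eps_diff[OF _ r(3)] by auto
  have "fst X \<in> mat_hom x ?p"
    using s by (auto simp: mat_hom_iff add.commute)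
  hence G: "fst X \<in> G_hom x m ?p"
    using X' by (intro G_alg_hom) (auto simp: g_tilde_iff)
  have idx: "Ix s \<in> indices x m" "Bar r \<in> indices x m" using r by (auto simp: indices_def)
  from G_hom_eq[OF G idx(2) idx(1)]
  have 1: "kappa x * (-1) ^ ipar x (Ix s) * coef (fst X) (Bar s, Bar r) =
     - ((-1) ^ (?p * ipar x (Ix r))) * (kappa x * (-1) ^ ipar x (Ix r)) * coef (fst X) (Ix r, Ix s)"
    by simp
  have 2: "coef (fst X) (Bar s, Bar r) = - ((-1) ^ (?p * ipar x (Ix s))) * coef (fst X) (Ix r, Ix s)"
  proof -
    have *: "a = - b" if "- a = b" for a b :: complex using that by auto
    show ?thesis using 1 by (auto simp: kappa_def intro: * split: if_splits)
  qed
  have "fst X = pscale (coef (fst X) (Ix r, Ix s)) (Emat x r s)"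
  proof (rule poly_mapping_eqI)
    fix ab
    show "coef (fst X) ab = coef (pscale (coef (fst X) (Ix r, Ix s)) (Emat x r s)) ab"
    proof (cases "ab \<in> {(Ix r, Ix s), (Bar s, Bar r)}")
      case True
      thus ?thesis using 2 by (auto simp: Emat_def lookup_minus lookup_single when_def)
    next
      case False
      thus ?thesis using s by (auto simp: Emat_def lookup_minus lookup_single when_def in_keys_iff)
    qed
  qed
  moreover have "snd X = 0" using X' nz by simp
  ultimately show ?thesis by (intro exI[of _ "coef (fst X) (Ix r, Ix s)"]) (simp add: gscale_def Eroot_def prod_eq_iff)
qed

text \<open>The central term cancels: $J$ is 1 at both barred indices, and the sign in front of
  \<open>E_hat s\<close> makes the two supertraces opposite.\<close>

lemma bracket_Eroot:
  assumes rs: "r \<in> halfN" "s \<in> halfN" "r \<noteq> s"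
  shows "bracket x (Eroot x r s) (Eroot x s r) =
    E_hat r - gscale ((-1) ^ ((ipar x (Ix r) + ipar x (Ix s)) mod 2)) (E_hat s)"
proof -
  let ?p = "(ipar x (Ix r) + ipar x (Ix s)) mod 2"
  have "mat_bracket x (Emat x r s) (Emat x s r) =
     mmult (Emat x r s) (Emat x s r) - pscale ((-1) ^ (?p * ?p)) (mmult (Emat x s r) (Emat x r s))"
    using Emat_hom[of x s r] by (intro mat_bracket_hom Emat_hom) (auto simp: add.commute)
  also have "\<dots> = fst (E_hat r) - pscale ((-1) ^ ?p) (fst (E_hat s))"
    using rs(3) by (auto simp: Emat_def E_hat_def mmult_simps mmult_bas pv.scale_right_diff_distrib
        simp del: pscale_bas)
  finally have *: "mat_bracket x (Emat x r s) (Emat x s r) = fst (E_hat r) - pscale ((-1) ^ ?p) (fst (E_hat s))" .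
  have "StrJ x (fst (E_hat r) - pscale ((-1) ^ ?p) (fst (E_hat s))) = 0"
    using rs by (auto simp: StrJ_def dotp_simps E_hat_def simp del: pscale_bas)
  thus ?thesis
    by (simp add: bracket_eq Eroot_def * prod_eq_iff) (simp add: E_hat_def)
qed

section \<open>Roots\<close>

text \<open>Weights have complex coefficients; the real part of the pairing with a real function
  \<open>l\<close> gives an additive real function by which roots can be called positive or
  negative. The coefficient of $\<Lambda>_0$ is ignored; for roots it vanishes by
  \<open>roots_snd\<close>.\<close>

definition lf :: "(rat \<Rightarrow> real) \<Rightarrow> weight \<Rightarrow> real"
  where "lf l \<gamma> = Re (dotp (\<lambda>r. of_real (l r)) (fst \<gamma>))"

lemma lf_simps: "lf l (\<alpha> + \<beta>) = lf l \<alpha> + lf l \<beta>" "lf l (\<alpha> - \<beta>) = lf l \<alpha> - lf l \<beta>"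
  "lf l (- \<alpha>) = - lf l \<alpha>" "lf l 0 = 0" "lf l (eps r) = l r"
  by (simp_all add: lf_def dotp_simps)

definition ival :: "(rat \<Rightarrow> real) \<Rightarrow> index \<Rightarrow> real"
  where "ival l a = lf l (iwt a, 0)"

lemma ival_simps [simp]: "ival l (Ix r) = l r" "ival l (Bar r) = - l r" "ival l Bar0 = 0"
  by (simp_all add: ival_def lf_def dotp_simps)

lemma lf_dwt: "lf l (dwt ab, d) = ival l (fst ab) - ival l (snd ab)"
  by (simp add: ival_def lf_def dwt_def dotp_diff)

lemma negI_int: "r \<in> negI m \<Longrightarrow> \<exists>i::int. r = of_int i \<and> - int m \<le> i \<and> i \<le> -1"
  by (auto simp: negI_def)

lemma I_tilde_cases:
  assumes "r \<in> I_tilde m"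
  obtains i where "r = of_int i" "- int m \<le> i" "i \<le> -1" | n where "r = of_nat n / 2" "n \<ge> 1"
  using assms by (auto simp: I_tilde_def negI_def halfN_def)

lemma halfN_pos: "r \<in> halfN \<Longrightarrow> r > 0"
  by (auto simp: halfN_def)

lemma halfN_I_tilde: "r \<in> halfN \<Longrightarrow> r \<in> I_tilde m"
  by (simp add: I_tilde_def)

lemma I_tilde_pos: "r \<in> I_tilde m \<Longrightarrow> r > 0 \<Longrightarrow> r \<in> halfN"
  by (auto simp: I_tilde_def negI_def)

lemma I_tilde_neg: "r \<in> I_tilde m \<Longrightarrow> r \<le> 0 \<Longrightarrow> r \<in> negI m"
  using halfN_pos by (force simp: I_tilde_def)

text \<open>An integer-valued functional whose values decrease along the order of the indices.\<close>

definition phi :: "nat \<Rightarrow> rat \<Rightarrow> real"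
  where "phi m r = of_rat (if r < 0 then - (r + of_nat m + 1) else - (of_nat m + 2 * r))"

lemma phi_strict: "r \<in> I_tilde m \<Longrightarrow> s \<in> I_tilde m \<Longrightarrow> r < s \<Longrightarrow> phi m s < phi m r"
  by (elim I_tilde_cases) (auto simp: phi_def of_rat_less)

lemma phi_neg: "r \<in> I_tilde m \<Longrightarrow> phi m r < 0"
proof -
  assume "r \<in> I_tilde m"
  hence "(if r < 0 then - (r + of_nat m + 1) else - (of_nat m + 2 * r)) < 0"
  proof (cases rule: I_tilde_cases)
    case (1 i)
    have "of_int (- int m) \<le> (of_int i :: rat)" using 1 by (subst of_int_le_iff)
    thus ?thesis using 1 by simp
  qed auto
  thus ?thesis unfolding phi_def by simp
qed

lemma phi_int: "r \<in> I_tilde m \<Longrightarrow> phi m r \<in> \<int>"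
proof (cases rule: I_tilde_cases, assumption)
  fix i assume "r = of_int i" "i \<le> -1"
  hence "(if r < 0 then - (r + of_nat m + 1) else - (of_nat m + 2 * r)) = of_int (- (i + int m + 1))" by simp
  thus ?thesis unfolding phi_def of_rat_of_int_eq by (metis Ints_of_int of_rat_of_int_eq)
next
  fix n assume "r = of_nat n / 2" "n \<ge> 1"
  hence "(if r < 0 then - (r + of_nat m + 1) else - (of_nat m + 2 * r)) = of_int (- (int m + int n))" by simp
  thus ?thesis unfolding phi_def by (metis Ints_of_int of_rat_of_int_eq)
qed

text \<open>On \<open>I_tilde m\<close> the function \<open>phi\<close> is negative and strictly
  decreasing. Hence its values are positive at barred indices, 0 at \<open>Bar0\<close> and negative
  at the remaining ones, in the required order.\<close>

lemma idx_less_iff: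
  assumes "a \<in> indices x m" "b \<in> indices x m"
  shows "idx_less a b \<longleftrightarrow> ival (phi m) b < ival (phi m) a"
proof -
  have s: "r < s \<longleftrightarrow> phi m s < phi m r" if "r \<in> I_tilde m" "s \<in> I_tilde m" for r s
    using phi_strict[of r m s] phi_strict[of s m r] that by (cases r s rule: linorder_cases) auto
  have n: "phi m r < 0" if "r \<in> I_tilde m" for r using phi_neg that by blast
  have n2: "phi m r + phi m s < 0" if "r \<in> I_tilde m" "s \<in> I_tilde m" for r s
    using n[OF that(1)] n[OF that(2)] by simp
  show ?thesis
    using assms s n n2 by (cases a; cases b) (force simp: indices_def not_less split: if_splits)+
qed

lemma ival_phi_inj:
  assumes "a \<in> indices x m" "b \<in> indices x m" "a \<noteq> b"
  shows "ival (phi m) a \<noteq> ival (phi m) b"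
proof -
  have "idx_less a b \<or> idx_less b a" using assms(3) by (cases a; cases b) auto
  thus ?thesis using assms by (auto simp: idx_less_iff)
qed

lemma roots_hdual: "\<alpha> \<in> roots x m \<Longrightarrow> \<alpha> \<in> hdual (I_tilde m)"
  by (simp add: roots_def)

lemma g_tilde_supp: "X \<in> g_tilde x m \<Longrightarrow> supp (fst X) \<subseteq> indices x m \<times> indices x m"
  by (simp add: g_tilde_iff G_alg_supp)

lemma roots_snd:
  assumes "\<alpha> \<in> roots x m"
  shows "snd \<alpha> = 0" "fst \<alpha> \<noteq> 0"
proof -
  have "root_space x m \<alpha> \<noteq> {0}" "0 \<in> root_space x m \<alpha>"
    using assms gv.subspace_0[OF root_space_subspace] by (auto simp: roots_def)
  then obtain X where "X \<in> root_space x m \<alpha>" "X \<noteq> 0" by blast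
  thus "snd \<alpha> = 0" using root_space_iff[OF roots_hdual[OF assms]] by auto
  thus "fst \<alpha> \<noteq> 0" using assms by (auto simp: roots_def prod_eq_iff)
qed

lemma root_space_entry:
  assumes "\<alpha> \<in> roots x m" "X \<in> root_space x m \<alpha>" "ab \<in> supp (fst X)"
  shows "fst ab \<in> indices x m" "snd ab \<in> indices x m" "fst ab \<noteq> snd ab" "\<alpha> = (dwt ab, 0)"
proof -
  note X = assms(2)[unfolded root_space_iff[OF roots_hdual[OF assms(1)]]]
  show "fst ab \<in> indices x m" "snd ab \<in> indices x m"
    using g_tilde_supp[of X x m] X assms(3) by (auto simp: mem_Times_iff)
  show "\<alpha> = (dwt ab, 0)" using X assms(3) roots_snd[OF assms(1)] by (simp add: prod_eq_iff)
  thus "fst ab \<noteq> snd ab" using roots_snd[OF assms(1)] by (auto simp: dwt_def)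
qed

lemma root_space_snd: "\<alpha> \<in> roots x m \<Longrightarrow> X \<in> root_space x m \<alpha> \<Longrightarrow> snd X = 0"
  using roots_snd root_space_iff[OF roots_hdual] by blast

lemma roots_obtain:
  assumes "\<alpha> \<in> roots x m"
  obtains X ab where "X \<in> root_space x m \<alpha>" "ab \<in> supp (fst X)"
proof -
  have "root_space x m \<alpha> \<noteq> {0}" "0 \<in> root_space x m \<alpha>"
    using assms gv.subspace_0[OF root_space_subspace] by (auto simp: roots_def)
  then obtain X where X: "X \<in> root_space x m \<alpha>" "X \<noteq> 0" by blast
  hence "fst X \<noteq> 0" using root_space_snd[OF assms] by (auto simp: prod_eq_iff)
  hence "supp (fst X) \<noteq> {}" by (metis keys_eq_empty)
  thus ?thesis using that X by blast
qed

lemma rootsI: "\<alpha> \<in> hdual (I_tilde m) \<Longrightarrow> \<alpha> \<noteq> 0 \<Longrightarrow> X \<in> root_space x m \<alpha> \<Longrightarrow> X \<noteq> 0 \<Longrightarrow> \<alpha> \<in> roots x m"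
  by (auto simp: roots_def)

lemma roots_phi:
  assumes "\<alpha> \<in> roots x m"
  shows "lf (phi m) \<alpha> \<noteq> 0" "lf (phi m) \<alpha> \<in> \<int>"
proof -
  obtain X ab where X: "X \<in> root_space x m \<alpha>" "ab \<in> supp (fst X)" by (rule roots_obtain[OF assms])
  note e = root_space_entry[OF assms X]
  show "lf (phi m) \<alpha> \<noteq> 0" using ival_phi_inj[OF e(1-3)] by (simp add: e(4) lf_dwt)
  have "ival (phi m) a \<in> \<int>" if "a \<in> indices x m" for a
    using that phi_int by (cases a) (auto simp: indices_def split: if_splits)
  thus "lf (phi m) \<alpha> \<in> \<int>" using e(1,2) by (simp add: e(4) lf_dwt)
qed

text \<open>All entries of a root vector have the same weight, so the sign of \<open>phi\<close> on
  that weight decides for all of them at once on which side of the diagonal they lie.\<close>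

lemma pos_roots_iff: "\<alpha> \<in> pos_roots x m \<longleftrightarrow> \<alpha> \<in> roots x m \<and> lf (phi m) \<alpha> > 0"
proof (cases "\<alpha> \<in> roots x m")
  case True
  have "root_space x m \<alpha> \<subseteq> borel x m \<longleftrightarrow> lf (phi m) \<alpha> > 0"
  proof
    assume b: "root_space x m \<alpha> \<subseteq> borel x m"
    obtain X ab where X: "X \<in> root_space x m \<alpha>" "ab \<in> supp (fst X)" by (rule roots_obtain[OF True])
    note e = root_space_entry[OF True X]
    have "fst ab = snd ab \<or> idx_less (fst ab) (snd ab)" using b X by (auto simp: borel_def case_prod_unfold)
    thus "lf (phi m) \<alpha> > 0" using e idx_less_iff[OF e(1,2)] lf_dwt[of "phi m" ab 0] by auto
  next
    assume p: "lf (phi m) \<alpha> > 0"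
    have "X \<in> borel x m" if X: "X \<in> root_space x m \<alpha>" for X
    proof -
      have "idx_less (fst ab) (snd ab)" if "ab \<in> supp (fst X)" for ab
        using root_space_entry[OF True X that] p lf_dwt[of "phi m" ab 0] by (simp add: idx_less_iff)
      thus ?thesis using root_space_g_tilde[OF X] by (force simp: borel_def)
    qed
    thus "root_space x m \<alpha> \<subseteq> borel x m" by blast
  qed
  thus ?thesis using True by (simp add: pos_roots_def)
qed (simp add: pos_roots_def)

text \<open>
  Conjugation with the isometry of the form that exchanges $v_r$ and $v_{\bar r}$ up to scalars
  maps the root space of \<open>\<alpha>\<close> to that of \<open>- \<alpha>\<close>.
\<close>

definition swp_coef :: "ltype \<Rightarrow> index \<Rightarrow> complex"
  where "swp_coef x a = (case a of Bar r \<Rightarrow> kappa x * (-1) ^ ipar x a | _ \<Rightarrow> 1)"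

definition swp :: "ltype \<Rightarrow> mat \<Rightarrow> mat"
  where "swp x X = linext (\<lambda>ab. pscale (swp_coef x (fst ab) / swp_coef x (snd ab)) (bas (istar (fst ab), istar (snd ab)))) X"

lemma coef_swp: "coef (swp x X) ab =
  swp_coef x (istar (fst ab)) / swp_coef x (istar (snd ab)) * coef X (istar (fst ab), istar (snd ab))"
proof -
  have "coef (swp x X) ab = (\<Sum>cd\<in>supp X. if cd = (istar (fst ab), istar (snd ab)) then
     swp_coef x (fst cd) / swp_coef x (snd cd) * coef X cd else 0)"
    unfolding swp_def coef_linext by (rule sum.cong) (auto simp: lookup_single when_def)
  also have "\<dots> = swp_coef x (istar (fst ab)) / swp_coef x (istar (snd ab)) * coef X (istar (fst ab), istar (snd ab))"
    by (auto simp: sum.delta in_keys_iff)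
  finally show ?thesis .
qed

lemma swp_coef_ne_0 [simp]: "swp_coef x a \<noteq> 0"
  by (auto simp: swp_coef_def kappa_def split: index.splits)

text \<open>The isometry condition: the product of the scalars at dual indices exchanges the two
  values of the form on this pair.\<close>

lemma swp_coef_eq: "swp_coef x c * swp_coef x (istar c) * gform x c = gform x (istar c)"
  by (cases c) (auto simp: swp_coef_def)

lemma gform_ne_0 [simp]: "gform x a \<noteq> 0"
  by (cases a) (auto simp: kappa_def)

lemma supp_swp: "ab \<in> supp (swp x X) \<longleftrightarrow> (istar (fst ab), istar (snd ab)) \<in> supp X"
  by (simp add: in_keys_iff coef_swp)

lemma swp_G_hom:
  assumes "X \<in> G_hom x m p"
  shows "swp x X \<in> G_hom x m p"
  unfolding G_hom_iff
proof (intro conjI ballI)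
  show "swp x X \<in> mat_hom x p"
    using G_hom_mat_hom[OF assms] by (auto simp: mat_hom_iff supp_swp dest: bspec)
  show "supp (swp x X) \<subseteq> indices x m \<times> indices x m"
    using G_hom_supp[OF assms] by (auto simp: supp_swp)
  fix b c assume bc: "b \<in> indices x m" "c \<in> indices x m"
  let ?t = "swp_coef x"
  have e: "gform x (istar c) * coef X (c, istar b) = - ((-1) ^ (p * ipar x b)) * gform x b * coef X (b, istar c)"
    using G_hom_eq[OF assms, of "istar b" "istar c"] bc by simp
  have "gform x c * coef (swp x X) (istar c, b) = (?t c * ?t (istar c) * gform x c) * coef X (c, istar b) / (?t (istar b) * ?t (istar c))"
    by (simp add: coef_swp field_simps)
  also have "\<dots> = (gform x (istar c) * coef X (c, istar b)) / (?t (istar b) * ?t (istar c))"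
    by (simp only: swp_coef_eq)
  also have "\<dots> = - ((-1) ^ (p * ipar x b)) * gform x b * coef X (b, istar c) / (?t (istar b) * ?t (istar c))"
    by (simp only: e)
  also have "gform x b = gform x (istar b) * (?t b * ?t (istar b))"
    using swp_coef_eq[of x "istar b"] by (simp add: mult_ac)
  finally show "gform x c * coef (swp x X) (istar c, b) +
      (- 1) ^ (p * ipar x b) * gform x (istar b) * coef (swp x X) (istar b, c) = 0"
    by (simp add: coef_swp field_simps)
qed

lemma roots_uminus:
  assumes "\<alpha> \<in> roots x m"
  shows "- \<alpha> \<in> roots x m"
proof -
  obtain X ab where X: "X \<in> root_space x m \<alpha>" "ab \<in> supp (fst X)" by (rule roots_obtain[OF assms])
  note X' = X(1)[unfolded root_space_iff[OF roots_hdual[OF assms]]]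
  have a: "- \<alpha> \<in> hdual (I_tilde m)" using hdual_uminus[OF roots_hdual[OF assms]] .
  have "swp x (fst X) = swp x (mat_comp x 0 (fst X)) + swp x (mat_comp x (Suc 0) (fst X))"
    by (simp add: swp_def mat_comp_sum flip: linext_add)
  moreover have "swp x (mat_comp x p (fst X)) \<in> G_alg x m" if "p < 2" for p
    using X' that by (intro G_hom_in_G_alg[OF swp_G_hom[OF G_alg_comp]]) (auto simp: g_tilde_iff)
  ultimately have "swp x (fst X) \<in> G_alg x m"
    using G_alg_add by simp
  moreover have "dwt cd = - fst \<alpha>" if "cd \<in> supp (swp x (fst X))" for cd
  proof -
    have "dwt (istar (fst cd), istar (snd cd)) = fst \<alpha>"
      using that X' by (simp add: supp_swp)
    moreover have "dwt cd = - dwt (istar (fst cd), istar (snd cd))" by (simp add: dwt_def iwt_istar)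
    ultimately show ?thesis by (simp only:)
  qed
  ultimately have "(swp x (fst X), 0) \<in> root_space x m (- \<alpha>)"
    using roots_snd[OF assms] unfolding root_space_iff[OF a] by (simp add: g_tilde_iff)
  moreover have "(istar (fst ab), istar (snd ab)) \<in> supp (swp x (fst X))"
    using X(2) by (simp add: supp_swp)
  hence "(swp x (fst X), 0) \<noteq> 0" by (auto simp: zero_prod_def)
  ultimately show ?thesis using a roots_snd[OF assms] by (intro rootsI) (auto simp: prod_eq_iff)
qed

section \<open>A functional vanishing on the Levi roots\<close>

lemma levi_lattice_base: "\<alpha> \<in> Y0 \<Longrightarrow> \<alpha> \<in> levi_lattice Y0"
  by (simp add: levi_lattice_def group_closure.base)

lemma levi_lattice_0: "0 \<in> levi_lattice Y0"
  by (simp add: levi_lattice_def)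

lemma levi_lattice_add: "\<alpha> \<in> levi_lattice Y0 \<Longrightarrow> \<beta> \<in> levi_lattice Y0 \<Longrightarrow> \<alpha> + \<beta> \<in> levi_lattice Y0"
  by (simp add: levi_lattice_def group_closure_add)

lemma levi_lattice_uminus [simp]: "- \<alpha> \<in> levi_lattice Y0 \<longleftrightarrow> \<alpha> \<in> levi_lattice Y0"
  by (simp add: levi_lattice_def)

lemma levi_lattice_pos:
  assumes "r \<in> halfN" "s \<in> halfN"
  shows "eps r - eps s \<in> levi_lattice Y0"
proof -
  have 1: "eps (of_nat n / 2) - eps (of_nat (n + k) / 2) \<in> levi_lattice Y0" if "n \<ge> 1" for n k :: nat
  proof (induction k)
    case 0 show ?case by (simp add: levi_lattice_0)
  next
    case (Suc k)
    have t: "a - c = (a - b) + (b - c)" for a b c :: weight by simp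
    have "eps (of_nat (n + k) / 2) - eps (of_nat (n + k) / 2 + 1 / 2) \<in> levi_lattice Y0"
    proof -
      have "of_nat (n + k) / 2 \<in> halfN" unfolding halfN_def mem_Collect_eq using that by (intro exI[of _ "n + k"]) simp
      thus ?thesis unfolding levi_lattice_def by (intro group_closure.base) blast
    qed
    also have "(of_nat (n + k) / 2 + 1 / 2 :: rat) = of_nat (n + Suc k) / 2" by (simp add: field_simps)
    finally show ?case by (subst t[of _ _ "eps (of_nat (n + k) / 2)"]) (rule levi_lattice_add[OF Suc])
  qed
  obtain n n' where n: "r = of_nat n / 2" "n \<ge> 1" "s = of_nat n' / 2" "n' \<ge> 1"
    using assms by (auto simp: halfN_def)
  show ?thesis
  proof (cases "n \<le> n'")
    case True thus ?thesis using 1[OF n(2), of "n' - n"] unfolding n by simp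
  next
    case False
    hence "eps s - eps r \<in> levi_lattice Y0" using 1[OF n(4), of "n - n'"] unfolding n by simp
    thus ?thesis by (metis levi_lattice_uminus minus_diff_eq)
  qed
qed

text \<open>In type d the form is symmetric on even vectors, so this entry, whose weight is
  $-2\<epsilon>_r$, equals its own negative.\<close>

lemma TD_root:
  assumes "\<alpha> \<in> roots TD m" "X \<in> root_space TD m \<alpha>" "r \<in> negI m"
  shows "(Bar r, Ix r) \<notin> supp (fst X)"
proof -
  have int: "r \<in> \<int>" using assms(3) by (auto simp: negI_def)
  have idx: "Ix r \<in> indices TD m" using assms(3) by (auto simp: indices_def I_tilde_def)
  have "mat_comp TD 0 (fst X) \<in> G_hom TD m 0"
    using root_space_g_tilde[OF assms(2)] by (intro G_alg_comp) (auto simp: g_tilde_iff)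
  from G_hom_eq[OF this idx idx] int have "coef (mat_comp TD 0 (fst X)) (Bar r, Ix r) = 0"
    by (simp add: kappa_def)
  thus ?thesis using int by (simp add: coef_mat_comp in_keys_iff)
qed

text \<open>The functional takes prescribed values 0 or 1 on the simple roots with negative indices,
  according to membership in \<open>Y0\<close>, is 0 on the simple roots with positive indices, and
  is positive on the one linking the two groups. Every positive root is a sum of roots with
  nonnegative values, so it can have value 0 only if all its summands lie in the lattice.\<close>

lemma levi_functional:
  assumes Y: "Y0 \<subseteq> Pi_k x m"
  obtains l where "\<And>\<alpha>. \<alpha> \<in> levi_lattice Y0 \<Longrightarrow> lf l \<alpha> = 0"
    "\<And>\<alpha>. \<alpha> \<in> pos_roots x m \<Longrightarrow> lf l \<alpha> \<ge> 0"
    "\<And>\<alpha>. \<alpha> \<in> pos_roots x m \<Longrightarrow> lf l \<alpha> = 0 \<Longrightarrow> \<alpha> \<in> levi_lattice Y0"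
proof -
  define \<delta> :: "int \<Rightarrow> weight" where "\<delta> j = eps (of_int j) - eps (of_int (j + 1))" for j
  define \<sigma> :: weight where "\<sigma> = (case x of TB \<Rightarrow> - eps (- of_nat m) | TBbul \<Rightarrow> - eps (- of_nat m)
             | TC \<Rightarrow> - (eps (- of_nat m) + eps (- of_nat m))
             | TD \<Rightarrow> - eps (- of_nat m) - eps (- of_nat m + 1))"
  define cc :: "int \<Rightarrow> real" where "cc j = (if \<delta> j \<in> Y0 then 0 else 1)" for j
  define c0 :: real where "c0 = (if \<sigma> \<in> Y0 then 0 else 1)"
  \<comment> \<open>The value at $\<epsilon>_{-m}$, found by solving
    \<open>lf l \<sigma> = c0\<close>. In type d, \<sigma> also involves $\<epsilon>_{-m+1}$, whose
    value is \<open>b - cc (- int m)\<close>; for \<open>m = 1\<close> there is no such simple root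
    and any value will do.\<close>
  define b where "b = (case x of TB \<Rightarrow> - c0 | TBbul \<Rightarrow> - c0 | TC \<Rightarrow> - c0 / 2 | TD \<Rightarrow> (if m = 1 then 0 else (cc (- int m) - c0) / 2))"
  \<comment> \<open>On negative indices $|l|$ is at most \<open>m + 1\<close>. The constant
    \<open>- (m + 3)\<close> lies beyond that bound, so every positive root that involves both kinds
    of index, or a sum of two positive ones, gets a positive value.\<close>
  define l where "l r = (if r < 0 then b - (\<Sum>j\<in>{- int m..<\<lfloor>r\<rfloor>}. cc j) else - real (m + 3))" for r :: rat
  \<comment> \<open>The two conclusions combined are stable under addition: nonnegative values with
    sum 0 are both 0. It therefore suffices to decompose positive roots into generators.\<close>
  define P where "P \<alpha> \<longleftrightarrow> lf l \<alpha> \<ge> 0 \<and> (lf l \<alpha> = 0 \<longrightarrow> \<alpha> \<in> levi_lattice Y0)" for \<alpha>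
  have Padd: "P (\<alpha> + \<beta>)" if "P \<alpha>" "P \<beta>" for \<alpha> \<beta>
    using that levi_lattice_add[of \<alpha> Y0 \<beta>] by (auto simp: P_def lf_simps add_nonneg_eq_0_iff)
  have P0: "P 0" by (simp add: P_def lf_simps levi_lattice_0)
  have Ppos: "P \<alpha>" if "lf l \<alpha> > 0" for \<alpha> using that by (simp add: P_def)
  have cc: "0 \<le> cc j" "cc j \<le> 1" for j by (auto simp: cc_def)
  have c0: "0 \<le> c0" "c0 \<le> 1" by (auto simp: c0_def)
  have b: "\<bar>b\<bar> \<le> 1" using cc[of "- int m"] c0 by (auto simp: b_def split: ltype.splits)
  have l_int: "l (of_int i) = b - (\<Sum>j\<in>{- int m..<i}. cc j)" if "i \<le> -1" for i
    using that by (simp add: l_def)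
  have l_delta: "lf l (\<delta> j) = cc j" if "- int m \<le> j" "j \<le> -2" for j
  proof -
    have 1: "{- int m..<j + 1} = insert j {- int m..<j}" using that by auto
    have "lf l (\<delta> j) = l (of_int j) - l (of_int (j + 1))" by (simp only: \<delta>_def lf_simps)
    also have "\<dots> = (\<Sum>j\<in>{- int m..<j + 1}. cc j) - (\<Sum>j\<in>{- int m..<j}. cc j)"
      using l_int[of j] l_int[of "j + 1"] that by linarith
    also have "\<dots> = cc j" unfolding 1 by simp
    finally show ?thesis .
  qed
  have Pdelta: "P (\<delta> j)" if "- int m \<le> j" "j \<le> -2" for j
    unfolding P_def l_delta[OF that] by (auto simp: cc_def levi_lattice_base)
  have l_bound: "\<bar>l r\<bar> \<le> real m + 1" if r: "r \<in> negI m" for r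
  proof -
    obtain i where i: "r = of_int i" "- int m \<le> i" "i \<le> -1" using negI_int[OF r] by blast
    have "(\<Sum>j\<in>{- int m..<i}. cc j) \<le> (\<Sum>j\<in>{- int m..<i}. 1)" by (intro sum_mono cc)
    also have "\<dots> \<le> real m" using i by simp
    finally have "(\<Sum>j\<in>{- int m..<i}. cc j) \<le> real m" .
    moreover have "(\<Sum>j\<in>{- int m..<i}. cc j) \<ge> 0" by (intro sum_nonneg cc)
    ultimately show ?thesis using b unfolding i(1) l_int[OF i(3)] by linarith
  qed
  have l_pos: "l r = - real (m + 3)" if "r \<in> halfN" for r
    using halfN_pos[OF that] by (simp add: l_def)
  have l_le: "l r \<le> real m + 1" if "r \<in> I_tilde m" for r
    using that l_bound[of r] l_pos[of r] by (auto simp: I_tilde_def)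
  have m_idx: "- rat_of_nat m = of_int (- int m)" by simp
  have P_neg: "P (eps (of_int i) - eps (of_int k))" if "- int m \<le> i" "i \<le> k" "k \<le> -1" for i k
    using that(2,3)
  proof (induction k rule: int_ge_induct)
    case base show ?case using P0 by simp
  next
    case (step k)
    have "P (eps (of_int i) - eps (of_int k) + \<delta> k)"
      using step that(1) by (intro Padd Pdelta) auto
    thus ?case by (simp add: \<delta>_def)
  qed
  have P1: "P (eps r - eps s)" if rs: "r \<in> I_tilde m" "s \<in> I_tilde m" "r < s" for r s
  proof (cases "s \<in> halfN")
    case s: True
    show ?thesis
    proof (cases "r \<in> halfN")
      case True thus ?thesis using s levi_lattice_pos[of r s Y0] by (simp add: P_def lf_simps l_pos)
    next
      case False
      hence "r \<in> negI m" using rs by (simp add: I_tilde_def)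
      thus ?thesis using l_bound[of r] l_pos[OF s] by (intro Ppos) (auto simp: lf_simps)
    qed
  next
    case False
    hence "s \<in> negI m" "r \<in> negI m" using rs halfN_pos I_tilde_neg by (force simp: I_tilde_def negI_def)+
    thus ?thesis using rs(3) negI_int[of s m] negI_int[of r m] P_neg by auto
  qed
  have half: "P (- eps r - eps s)" if "r \<in> halfN" "s \<in> I_tilde m" for r s
    using l_pos[OF that(1)] l_le[OF that(2)] by (intro Ppos) (simp add: lf_simps)
  have ms: "m \<ge> 1" if "r \<in> negI m" for r using that by (auto simp: negI_def)
  have l_m: "l (- rat_of_nat m) = b" if "m \<ge> 1"
    using l_int[of "- int m"] that by simp
  have P_sigma: "P \<sigma>" if "m \<ge> 1" "x = TD \<longrightarrow> m \<ge> 2"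
  proof -
    have "lf l \<sigma> = c0"
    proof (cases "x = TD")
      case True
      have "{- int m..<- int m + 1} = {- int m}" by auto
      hence "l (- rat_of_nat m + 1) = b - cc (- int m)"
        using l_int[of "- int m + 1"] that True by simp
      thus ?thesis using True l_m[OF that(1)] that by (simp add: \<sigma>_def lf_simps b_def field_simps)
    next
      case False
      thus ?thesis using l_m[OF that(1)] by (cases x) (simp_all add: \<sigma>_def lf_simps b_def)
    qed
    thus ?thesis by (auto simp: P_def c0_def levi_lattice_base)
  qed
  have P_from_m: "P (eps (- of_nat m) - eps r)" if "r \<in> negI m" for r
    using negI_int[OF that] P_neg[of "- int m"] by auto
  have P_single: "P (- eps r)" if "x = TB \<or> x = TBbul" "r \<in> I_tilde m" for r
  proof (cases "r \<in> halfN")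
    case True
    thus ?thesis using l_pos[OF True] by (intro Ppos) (simp add: lf_simps)
  next
    case False
    hence r: "r \<in> negI m" using that by (simp add: I_tilde_def)
    have "P (\<sigma> + (eps (- of_nat m) - eps r))"
      using that(1) by (intro Padd P_from_m r P_sigma ms[OF r]) auto
    moreover have "\<sigma> = - eps (- of_nat m)" using that by (auto simp: \<sigma>_def)
    ultimately show ?thesis by simp
  qed
  have comm: "- eps r - eps s = - eps s - eps r" for r s :: rat
    by (metis add.commute diff_conv_add_uminus)
  have P_double: "P (- eps r - eps s)"
    if rs: "r \<in> I_tilde m" "s \<in> I_tilde m" "x = TD \<longrightarrow> r \<noteq> s \<or> r \<in> halfN" for r s
  proof (cases "r \<in> halfN \<or> s \<in> halfN")
    case True
    thus ?thesis using half[of r s] half[of s r, unfolded comm[of s r]] rs(1,2) by blast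
  next
    case False
    hence n: "r \<in> negI m" "s \<in> negI m" using rs by (auto simp: I_tilde_def)
    consider "x = TB \<or> x = TBbul" | "x = TC" | "x = TD" by (cases x) auto
    thus ?thesis
    proof cases
      case 1 thus ?thesis using Padd[OF P_single P_single] rs by fastforce
    next
      case 2
      have "P (\<sigma> + (eps (- of_nat m) - eps r) + (eps (- of_nat m) - eps s))"
        using 2 n ms by (intro Padd P_from_m P_sigma) auto
      moreover have "\<sigma> = - (eps (- of_nat m) + eps (- of_nat m))" using 2 by (simp add: \<sigma>_def)
      ultimately show ?thesis by (simp add: algebra_simps)
    next
      case 3
      have *: "P (- eps r - eps s)" if n: "r \<in> negI m" "s \<in> negI m" "r < s" for r s
      proof -
        obtain i k where ik: "r = of_int i" "s = of_int k" "- int m \<le> i" "k \<le> -1" "i < k"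
          using negI_int[OF n(1)] negI_int[OF n(2)] n(3) by auto
        have "P (\<sigma> + (eps (- of_nat m) - eps r) + (eps (of_int (- int m + 1)) - eps (of_int k)))"
          using ik n ms by (intro Padd P_from_m P_sigma P_neg) auto
        moreover have "\<sigma> = - eps (- of_nat m) - eps (of_int (- int m + 1))" using 3 by (simp add: \<sigma>_def)
        ultimately show ?thesis using ik by (simp add: algebra_simps)
      qed
      have "r \<noteq> s" using rs(3) 3 False by auto
      thus ?thesis using *[OF n] *[OF n(2,1), unfolded comm[of s r]] by (cases r s rule: linorder_cases) auto
    qed
  qed
  \<comment> \<open>An entry of a root vector above the diagonal has one of five shapes, and its
    weight is a difference, a negated sum or a single negated \<epsilon>, as covered above.\<close>
  have P_root: "P \<alpha>" if "\<alpha> \<in> pos_roots x m" for \<alpha>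
  proof -
    have r: "\<alpha> \<in> roots x m" "lf (phi m) \<alpha> > 0" using that by (auto simp: pos_roots_iff)
    obtain X ab where X: "X \<in> root_space x m \<alpha>" "ab \<in> supp (fst X)" by (rule roots_obtain[OF r(1)])
    note e = root_space_entry[OF r(1) X]
    have less: "idx_less (fst ab) (snd ab)"
      using r(2) unfolding idx_less_iff[OF e(1,2)] e(4) lf_dwt by simp
    have \<alpha>: "\<alpha> = (iwt (fst ab) - iwt (snd ab), 0)" using e(4) by (simp add: dwt_def)
    have td: "x = TD \<longrightarrow> u \<noteq> v \<or> u \<in> halfN" if "ab = (Bar u, Ix v)" "u \<in> I_tilde m" for u v
      using TD_root[of \<alpha> m X u] r(1) X that by (auto simp: I_tilde_def)
    have E: "(- bas u - bas v, 0) = - eps u - eps v" "(bas u - bas v, 0) = eps u - eps v" "(- bas u, 0) = - eps u"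
      for u v by (simp_all add: eps_def)
    show ?thesis
    proof (cases "fst ab"; cases "snd ab")
      fix u v assume a: "fst ab = Ix u" "snd ab = Ix v"
      thus ?thesis using P1[of u v] e(1,2) less \<alpha> E by (auto simp: indices_def split: if_splits)
    next
      fix u v assume a: "fst ab = Bar u" "snd ab = Ix v"
      hence "ab = (Bar u, Ix v)" by (metis prod.collapse)
      thus ?thesis using P_double[of u v] td[of u v] e(1,2) less \<alpha> E by (auto simp: indices_def split: if_splits)
    next
      fix u v assume a: "fst ab = Bar u" "snd ab = Bar v"
      thus ?thesis using P1[of v u] e(1,2) less \<alpha> E by (auto simp: indices_def split: if_splits)
    next
      fix u assume a: "fst ab = Bar u" "snd ab = Bar0"
      thus ?thesis using P_single[of u] e(1,2) less \<alpha> E by (auto simp: indices_def split: if_splits)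
    next
      fix u assume a: "fst ab = Bar0" "snd ab = Ix u"
      thus ?thesis using P_single[of u] e(1,2) less \<alpha> E by (auto simp: indices_def split: if_splits)
    qed (use less in auto)
  qed
  have zero: "lf l \<alpha> = 0" if "\<alpha> \<in> levi_lattice Y0" for \<alpha>
    using that unfolding levi_lattice_def
  proof (induction rule: group_closure.induct)
    case (base s)
    then consider "s = 0" | "s \<in> Y0" | r where "s = eps r - eps (r + 1 / 2)" "r \<in> halfN" by auto
    thus ?case
    proof cases
      case 2
      hence "s \<in> Pi_k x m" using Y by auto
      hence m: "m \<ge> 1" "x = TD \<longrightarrow> m \<ge> 2" and s: "(\<exists>j. s = \<delta> j \<and> - int m \<le> j \<and> j \<le> -2) \<or> s = \<sigma>"
        by (auto simp: Pi_k_def \<delta>_def \<sigma>_def split: if_splits)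
      from s show ?thesis
      proof
        assume "\<exists>j. s = \<delta> j \<and> - int m \<le> j \<and> j \<le> -2"
        thus ?thesis using l_delta 2 by (auto simp: cc_def)
      next
        assume s: "s = \<sigma>"
        have "l (- rat_of_nat m + 1) = b - cc (- int m)" if "m \<ge> 2"
        proof -
          have "{- int m..<- int m + 1} = {- int m}" by auto
          thus ?thesis using l_int[of "- int m + 1"] that by simp
        qed
        hence "lf l \<sigma> = c0" using l_m[OF m(1)] m(2)
          by (cases x) (auto simp: \<sigma>_def lf_simps b_def field_simps)
        thus ?thesis using 2 s by (simp add: c0_def)
      qed
    next
      case (3 r)
      obtain n where "r = of_nat n / 2" "n \<ge> 1" using 3(2) by (auto simp: halfN_def)
      hence "r + 1 / 2 = of_nat (Suc n) / 2" "Suc n \<ge> 1" by (simp_all add: field_simps)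
      hence "r + 1 / 2 \<in> halfN" unfolding halfN_def by blast
      thus ?thesis using 3 by (simp add: lf_simps l_pos)
    qed (simp add: lf_simps)
  qed (simp add: lf_simps)
  show ?thesis using that[OF zero] P_root by (auto simp: P_def)
qed

section \<open>The nilradical and the Levi subalgebra\<close>

definition u_roots :: "ltype \<Rightarrow> nat \<Rightarrow> weight set \<Rightarrow> weight set"
  where "u_roots x m Y0 = {\<alpha> \<in> roots x m. - \<alpha> \<in> pos_roots x m \<and> \<alpha> \<notin> levi_lattice Y0}"

lemma u_tilde_minus_eq: "u_tilde_minus x m Y0 = gspan (\<Union>\<alpha>\<in>u_roots x m Y0. root_space x m \<alpha>)"
  by (simp add: u_tilde_minus_def u_roots_def)

lemma span_bracket:
  assumes "\<And>X Y. X \<in> A \<Longrightarrow> Y \<in> B \<Longrightarrow> bracket x X Y \<in> gspan C" "X \<in> gspan A" "Y \<in> gspan B"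
  shows "bracket x X Y \<in> gspan C"
proof -
  have 1: "bracket x X Y \<in> gspan C" if "X \<in> A" for X
    using assms(3)
    by (induction rule: gv.span_induct_alt)
      (auto simp: bracket_add bracket_gscale assms(1) that gv.span_zero intro!: gv.span_add gv.span_scale)
  show ?thesis
    using assms(2)
    by (induction rule: gv.span_induct_alt)
      (auto simp: bracket_add bracket_gscale 1 gv.span_zero intro!: gv.span_add gv.span_scale)
qed

lemma span_linear:
  assumes "\<And>X Y. f (X + Y) = f X + f Y" "\<And>c X. f (gscale c X) = gscale c (f X)"
    and "\<And>X. X \<in> A \<Longrightarrow> f X \<in> gspan C" "X \<in> gspan A"
  shows "f X \<in> gspan C"
proof -
  have 0: "f 0 = 0" using assms(2)[of 0 0] by simp
  show ?thesis
    using assms(4)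
    by (induction rule: gv.span_induct_alt)
      (auto simp: assms(1-3) 0 gv.span_zero intro!: gv.span_add gv.span_scale)
qed

text \<open>The sign of one additive functional cuts out the roots of the opposite nilradical;
  closure under brackets then becomes additivity. A root with negative value cannot be positive,
  hence its negative is.\<close>

lemma u_roots_obtain_functional:
  assumes "Y0 \<subseteq> Pi_k x m"
  obtains l where "\<And>\<alpha>. \<alpha> \<in> levi_lattice Y0 \<Longrightarrow> lf l \<alpha> = 0"
    "\<And>\<alpha>. \<alpha> \<in> u_roots x m Y0 \<longleftrightarrow> \<alpha> \<in> roots x m \<and> lf l \<alpha> < 0"
proof -
  obtain l where l: "\<And>\<alpha>. \<alpha> \<in> levi_lattice Y0 \<Longrightarrow> lf l \<alpha> = 0"
    "\<And>\<alpha>. \<alpha> \<in> pos_roots x m \<Longrightarrow> lf l \<alpha> \<ge> 0"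
    "\<And>\<alpha>. \<alpha> \<in> pos_roots x m \<Longrightarrow> lf l \<alpha> = 0 \<Longrightarrow> \<alpha> \<in> levi_lattice Y0"
    by (rule levi_functional[OF assms]) (rule that, blast+)
  have "\<alpha> \<in> u_roots x m Y0 \<longleftrightarrow> \<alpha> \<in> roots x m \<and> lf l \<alpha> < 0" for \<alpha>
  proof
    assume "\<alpha> \<in> u_roots x m Y0"
    thus "\<alpha> \<in> roots x m \<and> lf l \<alpha> < 0"
      using l(2)[of "- \<alpha>"] l(3)[of "- \<alpha>"] by (force simp: u_roots_def lf_simps)
  next
    assume a: "\<alpha> \<in> roots x m \<and> lf l \<alpha> < 0"
    hence "\<alpha> \<notin> pos_roots x m" using l(2)[of \<alpha>] by auto
    hence "lf (phi m) \<alpha> < 0" using a roots_phi[of \<alpha> x m] by (auto simp: pos_roots_iff)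
    hence "- \<alpha> \<in> pos_roots x m" using a roots_uminus by (auto simp: pos_roots_iff lf_simps)
    thus "\<alpha> \<in> u_roots x m Y0" using a l(1)[of \<alpha>] by (auto simp: u_roots_def)
  qed
  thus ?thesis using that l(1) by blast
qed

lemma u_roots_roots: "\<alpha> \<in> u_roots x m Y0 \<Longrightarrow> \<alpha> \<in> roots x m"
  by (simp add: u_roots_def)

text \<open>Serves both for closure of the nilradical and for its stability under the Levi
  subalgebra: the first root has value at most 0, the second a negative one, so the sum, if the
  bracket is nonzero, is again a root with negative value.\<close>

lemma u_roots_bracket:
  assumes Y: "Y0 \<subseteq> Pi_k x m" and \<alpha>: "\<alpha> \<in> u_roots x m Y0 \<or> \<alpha> \<in> roots x m \<inter> levi_lattice Y0"
    and \<beta>: "\<beta> \<in> u_roots x m Y0" and X: "X \<in> root_space x m \<alpha>" and Z: "Z \<in> root_space x m \<beta>"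
  shows "bracket x X Z \<in> u_tilde_minus x m Y0"
proof (cases "bracket x X Z = 0")
  case True
  thus ?thesis unfolding u_tilde_minus_eq by (simp add: gv.span_zero)
next
  case False
  obtain l where l: "\<And>\<alpha>. \<alpha> \<in> levi_lattice Y0 \<Longrightarrow> lf l \<alpha> = 0"
    "\<And>\<alpha>. \<alpha> \<in> u_roots x m Y0 \<longleftrightarrow> \<alpha> \<in> roots x m \<and> lf l \<alpha> < 0"
    by (rule u_roots_obtain_functional[OF Y]) blast
  have r: "\<alpha> \<in> roots x m" "\<beta> \<in> roots x m" using \<alpha> \<beta> u_roots_roots by blast+
  have neg: "lf l (\<alpha> + \<beta>) < 0"
    using \<alpha> \<beta> l(1)[of \<alpha>] l(2)[of \<alpha>] l(2)[of \<beta>] by (auto simp: lf_simps)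
  hence nz: "\<alpha> + \<beta> \<noteq> 0" using lf_simps(4)[of l] by force
  have b: "bracket x X Z \<in> root_space x m (\<alpha> + \<beta>)"
    by (rule root_space_bracket[OF roots_hdual[OF r(1)] roots_hdual[OF r(2)] X Z])
  have "\<alpha> + \<beta> \<in> u_roots x m Y0"
    unfolding l(2) using neg rootsI[OF hdual_add[OF roots_hdual[OF r(1)] roots_hdual[OF r(2)]] nz b False] by simp
  thus ?thesis unfolding u_tilde_minus_eq using b by (intro gv.span_base) blast
qed

lemma u_tilde_bracket:
  assumes "Y0 \<subseteq> Pi_k x m" "X \<in> u_tilde_minus x m Y0" "Z \<in> u_tilde_minus x m Y0"
  shows "bracket x X Z \<in> u_tilde_minus x m Y0"
  using assms(2,3) unfolding u_tilde_minus_eq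
proof (rule span_bracket[rotated])
  fix X Z assume "X \<in> (\<Union>\<alpha>\<in>u_roots x m Y0. root_space x m \<alpha>)" "Z \<in> (\<Union>\<alpha>\<in>u_roots x m Y0. root_space x m \<alpha>)"
  then obtain \<alpha> \<beta> where "\<alpha> \<in> u_roots x m Y0" "X \<in> root_space x m \<alpha>"
    "\<beta> \<in> u_roots x m Y0" "Z \<in> root_space x m \<beta>" by blast
  thus "bracket x X Z \<in> gspan (\<Union>\<alpha>\<in>u_roots x m Y0. root_space x m \<alpha>)"
    using u_roots_bracket[OF assms(1)] unfolding u_tilde_minus_eq by blast
qed

lemma levi_eq: "levi_tilde x m Y0 =
  gspan (insert KK (E_hat ` I_tilde m) \<union> (\<Union>\<alpha>\<in>roots x m \<inter> levi_lattice Y0. root_space x m \<alpha>))" (is "_ = gspan (?A \<union> ?B)")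
proof -
  have "gspan (gspan ?A \<union> ?B) = gspan (?A \<union> ?B)"
  proof
    show "gspan (gspan ?A \<union> ?B) \<subseteq> gspan (?A \<union> ?B)"
      by (rule gv.span_minimal) (use gv.span_mono[of ?A "?A \<union> ?B"] gv.span_superset[of "?A \<union> ?B"] in auto)
    show "gspan (?A \<union> ?B) \<subseteq> gspan (gspan ?A \<union> ?B)"
      by (rule gv.span_mono) (use gv.span_superset[of ?A] in auto)
  qed
  thus ?thesis by (simp add: levi_tilde_def cartan_def)
qed

lemma bracket_E_hat_root:
  assumes "X \<in> root_space x m \<alpha>" "r \<in> I_tilde m"
  shows "bracket x (E_hat r) X = gscale (coef (fst \<alpha>) r) X"
  using assms by (simp add: root_space_def)

lemma levi_u_bracket:
  assumes "Y0 \<subseteq> Pi_k x m" "X \<in> levi_tilde x m Y0" "Z \<in> u_tilde_minus x m Y0"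
  shows "bracket x X Z \<in> u_tilde_minus x m Y0"
  using assms(2,3) unfolding u_tilde_minus_eq levi_eq
proof (rule span_bracket[rotated])
  fix X Z assume X: "X \<in> insert KK (E_hat ` I_tilde m) \<union> (\<Union>\<alpha>\<in>roots x m \<inter> levi_lattice Y0. root_space x m \<alpha>)"
    and "Z \<in> (\<Union>\<alpha>\<in>u_roots x m Y0. root_space x m \<alpha>)"
  then obtain \<beta> where \<beta>: "\<beta> \<in> u_roots x m Y0" "Z \<in> root_space x m \<beta>" by auto
  from X consider "X = KK" | r where "r \<in> I_tilde m" "X = E_hat r"
    | \<alpha> where "\<alpha> \<in> roots x m \<inter> levi_lattice Y0" "X \<in> root_space x m \<alpha>" by auto
  thus "bracket x X Z \<in> gspan (\<Union>\<alpha>\<in>u_roots x m Y0. root_space x m \<alpha>)"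
  proof cases
    case 1 thus ?thesis by (simp add: gv.span_zero)
  next
    case (2 r)
    have "Z \<in> (\<Union>\<alpha>\<in>u_roots x m Y0. root_space x m \<alpha>)" using \<beta> by blast
    thus ?thesis using 2 bracket_E_hat_root[OF \<beta>(2) 2(1)] by (simp add: gv.span_scale gv.span_base)
  next
    case (3 \<alpha>)
    thus ?thesis using u_roots_bracket[OF assms(1) disjI2 \<beta>(1) _ \<beta>(2), of \<alpha> X] by (simp add: u_tilde_minus_eq)
  qed
qed

lemma u_tilde_g_tilde: "u_tilde_minus x m Y0 \<subseteq> g_tilde x m"
  unfolding u_tilde_minus_eq by (rule gv.span_minimal[OF _ g_tilde_subspace]) (auto intro: root_space_g_tilde)

lemma levi_g_tilde: "levi_tilde x m Y0 \<subseteq> g_tilde x m"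
  unfolding levi_eq
  by (rule gv.span_minimal[OF _ g_tilde_subspace]) (auto intro: root_space_g_tilde KK_g_tilde E_hat_g_tilde)

lemma u_tilde_comp:
  assumes "X \<in> u_tilde_minus x m Y0" "p < 2"
  shows "gt_comp x p X \<in> gspan (\<Union>\<alpha>\<in>u_roots x m Y0. root_space x m \<alpha> \<inter> gt_hom x p)"
proof (rule span_linear[OF gt_comp_add gt_comp_gscale _ assms(1)[unfolded u_tilde_minus_eq]])
  fix X assume "X \<in> (\<Union>\<alpha>\<in>u_roots x m Y0. root_space x m \<alpha>)"
  then obtain \<alpha> where "\<alpha> \<in> u_roots x m Y0" "X \<in> root_space x m \<alpha>" by auto
  thus "gt_comp x p X \<in> gspan (\<Union>\<alpha>\<in>u_roots x m Y0. root_space x m \<alpha> \<inter> gt_hom x p)"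
    using root_space_comp[OF roots_hdual[OF u_roots_roots] _ assms(2), of \<alpha> x m Y0 X]
    by (intro gv.span_base) auto
qed

lemma u_tilde_hom_span:
  assumes "X \<in> u_tilde_minus x m Y0" "X \<in> gt_hom x p" "p < 2"
  shows "X \<in> gspan (\<Union>\<alpha>\<in>u_roots x m Y0. root_space x m \<alpha> \<inter> gt_hom x p)"
  using u_tilde_comp[OF assms(1,3)] gt_comp_of_hom[OF assms(2), of p] by simp

lemma levi_comp:
  assumes "X \<in> levi_tilde x m Y0" "p < 2"
  shows "gt_comp x p X \<in> levi_tilde x m Y0"
  unfolding levi_eq
proof (rule span_linear[OF gt_comp_add gt_comp_gscale _ assms(1)[unfolded levi_eq]])
  let ?A = "insert KK (E_hat ` I_tilde m) \<union> (\<Union>\<alpha>\<in>roots x m \<inter> levi_lattice Y0. root_space x m \<alpha>)"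
  fix X assume X: "X \<in> ?A"
  show "gt_comp x p X \<in> gspan ?A"
  proof (cases "X \<in> insert KK (E_hat ` I_tilde m)")
    case True
    hence "X \<in> gt_hom x 0" using KK_hom E_hat_hom by auto
    hence "gt_comp x p X = X \<or> gt_comp x p X = 0" using gt_comp_of_hom by metis
    thus ?thesis using X by (auto simp: gv.span_zero intro: gv.span_base)
  next
    case False
    then obtain \<alpha> where "\<alpha> \<in> roots x m \<inter> levi_lattice Y0" "X \<in> root_space x m \<alpha>" using X by auto
    thus ?thesis using root_space_comp[OF roots_hdual _ assms(2), of \<alpha> x m X] by (intro gv.span_base) auto
  qed
qed

text \<open>The ordering leaves little room: a negative root with a negative coefficient at a
  positive index $r$ has the form $\<epsilon>_s - \<epsilon>_r$ with $s > r$. Such differences of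
  positive indices are roots of the Levi subalgebra, hence not of the nilradical.\<close>

lemma u_roots_nonneg:
  assumes "\<alpha> \<in> u_roots x m Y0" "r \<in> halfN"
  shows "0 \<le> Re (coef (fst \<alpha>) r)"
proof (rule ccontr)
  assume neg: "\<not> 0 \<le> Re (coef (fst \<alpha>) r)"
  have root: "\<alpha> \<in> roots x m" using assms(1) by (rule u_roots_roots)
  obtain X ab where X: "X \<in> root_space x m \<alpha>" "ab \<in> supp (fst X)" by (rule roots_obtain[OF root])
  note e = root_space_entry[OF root X]
  have less: "idx_less (snd ab) (fst ab)"
    using assms(1) unfolding u_roots_def idx_less_iff[OF e(2,1)] e(4) by (simp add: pos_roots_iff lf_simps lf_dwt)
  have \<alpha>: "\<alpha> = (iwt (fst ab) - iwt (snd ab), 0)" using e(4) by (simp add: dwt_def)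
  have c: "Re (coef (iwt (fst ab)) r) < Re (coef (iwt (snd ab)) r)"
    using neg by (simp add: \<alpha> lookup_minus)
  have "\<exists>s u. \<alpha> = eps s - eps u \<and> s \<in> halfN \<and> u \<in> halfN"
  proof (cases "fst ab"; cases "snd ab")
    fix s u assume a: "fst ab = Ix s" "snd ab = Ix u"
    hence "u = r" using c by (auto simp: coef_iwt simp del: iwt.simps split: if_splits)
    moreover have "s \<in> I_tilde m" "u < s" using a e(1) less by (auto simp: indices_def split: if_splits)
    ultimately show ?thesis using assms(2) halfN_pos[OF assms(2)] I_tilde_pos[of s m] \<alpha> a
      by (intro exI[of _ s] exI[of _ u]) (simp add: eps_def)
  next
    fix s u assume a: "fst ab = Bar s" "snd ab = Bar u"
    hence "s = r" using c by (auto simp: coef_iwt simp del: iwt.simps split: if_splits)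
    moreover have "u \<in> I_tilde m" "s < u" using a e(2) less by (auto simp: indices_def split: if_splits)
    ultimately show ?thesis using assms(2) halfN_pos[OF assms(2)] I_tilde_pos[of u m] \<alpha> a
      by (intro exI[of _ u] exI[of _ s]) (simp add: eps_def)
  qed (use c less in \<open>auto simp: coef_iwt simp del: iwt.simps split: if_splits\<close>)
  hence "\<alpha> \<in> levi_lattice Y0" using levi_lattice_pos by blast
  thus False using assms(1) by (simp add: u_roots_def)
qed

lemma roots_coef_int:
  assumes "\<alpha> \<in> roots x m"
  shows "coef (fst \<alpha>) r \<in> \<int>" "Re (coef (fst \<alpha>) r) \<le> 2" "- 2 \<le> Re (coef (fst \<alpha>) r)"
proof -
  obtain X ab where X: "X \<in> root_space x m \<alpha>" "ab \<in> supp (fst X)" by (rule roots_obtain[OF assms])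
  have "coef (fst \<alpha>) r = coef (iwt (fst ab)) r - coef (iwt (snd ab)) r"
    using root_space_entry(4)[OF assms X] by (simp add: dwt_def lookup_minus)
  moreover have "coef (iwt a) r = 0 \<or> coef (iwt a) r = 1 \<or> coef (iwt a) r = -1" for a
    by (cases a) (auto simp: coef_iwt simp del: iwt.simps)
  ultimately show "coef (fst \<alpha>) r \<in> \<int>" "Re (coef (fst \<alpha>) r) \<le> 2" "- 2 \<le> Re (coef (fst \<alpha>) r)"
    by (metis Ints_0 Ints_1 Ints_diff Ints_minus)
      (smt (verit, best) \<open>\<And>a. coef (iwt a) r = 0 \<or> coef (iwt a) r = 1 \<or> coef (iwt a) r = - 1\<close>
        \<open>coef (fst \<alpha>) r = coef (iwt (fst ab)) r - coef (iwt (snd ab)) r\<close> minus_complex.sel(1) one_complex.sel(1)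
        uminus_complex.sel(1) zero_complex.sel(1))+
qed

section \<open>Truncation of matrices\<close>

definition idx_of :: "rat set \<Rightarrow> index set"
  where "idx_of I = {Bar0} \<union> Ix ` I \<union> Bar ` I"

lemma g_supported_eq: "g_supported x m I = {X \<in> g_tilde x m. supp (fst X) \<subseteq> idx_of I \<times> idx_of I}"
  by (simp add: g_supported_def idx_of_def)

text \<open>Linear and parity preserving, but in general not compatible with brackets. On a root
  space it is either the identity or 0, according to whether the root is supported on
  \<open>I\<close>.\<close>

definition ptr :: "rat set \<Rightarrow> gt \<Rightarrow> gt"
  where "ptr I X = (linext (\<lambda>ab. pscale (if ab \<in> idx_of I \<times> idx_of I then 1 else 0) (bas ab)) (fst X), snd X)"

lemma coef_ptr: "coef (fst (ptr I X)) ab = (if ab \<in> idx_of I \<times> idx_of I then coef (fst X) ab else 0)"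
  by (simp add: ptr_def coef_linext_diag del: pscale_bas)

lemma snd_ptr [simp]: "snd (ptr I X) = snd X"
  by (simp add: ptr_def)

lemma ptr_add: "ptr I (X + Y) = ptr I X + ptr I Y"
  and ptr_gscale: "ptr I (gscale c X) = gscale c (ptr I X)"
  by (simp_all add: ptr_def linext_simps gscale_def)

lemma ptr_id: "supp (fst X) \<subseteq> idx_of I \<times> idx_of I \<Longrightarrow> ptr I X = X"
  by (auto simp: prod_eq_iff poly_mapping_eq_iff fun_eq_iff coef_ptr in_keys_iff subset_iff)

lemma ptr_hom: "X \<in> gt_hom x p \<Longrightarrow> ptr I X \<in> gt_hom x p"
proof -
  assume X: "X \<in> gt_hom x p"
  have "supp (fst (ptr I X)) \<subseteq> supp (fst X)"
    by (auto simp: in_keys_iff coef_ptr split: if_splits)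
  thus ?thesis using X by (auto simp: gt_hom_iff mat_hom_iff)
qed

text \<open>For distinct indices nothing cancels in \<open>iwt a - iwt b\<close>; for a dual pair
  the coefficient is doubled. So the weight of an off-diagonal entry remembers both of its indices,
  and truncating by indices amounts to truncating by weights.\<close>

lemma supp_dwt_iff:
  assumes "a \<noteq> b"
  shows "supp (dwt (a, b)) \<subseteq> I \<longleftrightarrow> a \<in> idx_of I \<and> b \<in> idx_of I"
proof -
  have "supp (dwt (a, b)) = supp (iwt a) \<union> supp (iwt b)"
    using assms by (cases a; cases b)
      (auto simp: dwt_def in_keys_iff lookup_minus coef_iwt simp del: iwt.simps split: if_splits)
  moreover have "supp (iwt c) \<subseteq> I \<longleftrightarrow> c \<in> idx_of I" for c
    by (cases c) (auto simp: idx_of_def)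
  ultimately show ?thesis by simp
qed

lemma root_space_supported:
  assumes "\<alpha> \<in> roots x m" "X \<in> root_space x m \<alpha>" "\<alpha> \<in> hdual I"
  shows "X \<in> g_supported x m I" "ptr I X = X"
proof -
  have "ab \<in> idx_of I \<times> idx_of I" if "ab \<in> supp (fst X)" for ab
  proof -
    note e = root_space_entry[OF assms(1,2) that]
    have "supp (dwt (fst ab, snd ab)) \<subseteq> I" using assms(3) e(4) by (simp add: hdual_def)
    thus ?thesis using supp_dwt_iff[OF e(3)] by (simp add: mem_Times_iff)
  qed
  hence *: "supp (fst X) \<subseteq> idx_of I \<times> idx_of I" by blast
  thus "X \<in> g_supported x m I" using root_space_g_tilde[OF assms(2)] by (simp add: g_supported_eq)
  show "ptr I X = X" by (rule ptr_id[OF *])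
qed

lemma root_space_not_supported:
  assumes "\<alpha> \<in> roots x m" "X \<in> root_space x m \<alpha>" "\<alpha> \<notin> hdual I"
  shows "ptr I X = 0"
proof -
  have "coef (fst (ptr I X)) ab = 0" for ab
  proof (cases "ab \<in> supp (fst X)")
    case True
    note e = root_space_entry[OF assms(1,2) True]
    have "\<not> supp (dwt (fst ab, snd ab)) \<subseteq> I" using assms(3) e(4) by (simp add: hdual_def)
    thus ?thesis unfolding supp_dwt_iff[OF e(3)] by (auto simp: coef_ptr mem_Times_iff)
  qed (simp add: coef_ptr in_keys_iff)
  thus ?thesis using root_space_snd[OF assms(1,2)] by (auto simp: prod_eq_iff intro!: poly_mapping_eqI)
qed

lemma g_supported_subspace: "gv.subspace (g_supported x m I)"
proof -
  have "supp (f + g) \<subseteq> A" if "supp f \<subseteq> A" "supp g \<subseteq> A" for f g :: mat and A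
    using keys_add[of f g] that by auto
  moreover have "supp (pscale c f) \<subseteq> A" if "supp f \<subseteq> A" for f :: mat and A c
    using supp_pscale[of c f] that by auto
  ultimately show ?thesis
    using g_tilde_subspace[of x m] unfolding gv.subspace_def g_supported_eq by simp
qed

lemma g_supported_bracket:
  assumes "X \<in> g_supported x m I" "Y \<in> g_supported x m I"
  shows "bracket x X Y \<in> g_supported x m I"
proof -
  have "supp (mat_bracket x (fst X) (fst Y)) \<subseteq> idx_of I \<times> idx_of I"
    by (rule order_trans[OF supp_mat_bracket]) (use assms in \<open>auto simp: g_supported_eq\<close>)
  thus ?thesis using assms g_tilde_bracket by (simp add: g_supported_eq bracket_eq)
qed

lemma g_supported_comp:
  assumes "X \<in> g_supported x m I" "p < 2"
  shows "gt_comp x p X \<in> g_supported x m I"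
  using assms g_tilde_comp[of X x m p] order_trans[OF supp_mat_comp, of "fst X" "idx_of I \<times> idx_of I" x p]
  by (simp add: g_supported_eq gt_comp_def)

lemma ptr_g_supported: "X \<in> g_supported x m I \<Longrightarrow> ptr I X = X"
  by (simp add: g_supported_eq ptr_id)

lemma ptr_u_tilde:
  assumes "X \<in> u_tilde_minus x m Y0"
  shows "ptr I X \<in> u_tilde_minus x m Y0 \<inter> g_supported x m I"
proof -
  have 1: "ptr I X \<in> gspan ((\<Union>\<alpha>\<in>u_roots x m Y0. root_space x m \<alpha>) \<inter> g_supported x m I)"
    (is "_ \<in> gspan ?C")
  proof (rule span_linear[OF ptr_add ptr_gscale _ assms[unfolded u_tilde_minus_eq]])
    fix X assume "X \<in> (\<Union>\<alpha>\<in>u_roots x m Y0. root_space x m \<alpha>)"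
    then obtain \<alpha> where \<alpha>: "\<alpha> \<in> u_roots x m Y0" "X \<in> root_space x m \<alpha>" by auto
    show "ptr I X \<in> gspan ?C"
    proof (cases "\<alpha> \<in> hdual I")
      case True
      thus ?thesis using root_space_supported[OF u_roots_roots[OF \<alpha>(1)] \<alpha>(2)] \<alpha> by (auto intro!: gv.span_base)
    next
      case False
      thus ?thesis using root_space_not_supported[OF u_roots_roots[OF \<alpha>(1)] \<alpha>(2)] by (simp add: gv.span_zero)
    qed
  qed
  have "gspan ?C \<subseteq> u_tilde_minus x m Y0" unfolding u_tilde_minus_eq by (rule gv.span_mono) auto
  moreover have "gspan ?C \<subseteq> g_supported x m I" by (rule gv.span_minimal[OF _ g_supported_subspace]) auto
  ultimately show ?thesis using 1 by blast
qed

text \<open>An intersection of spans is not described by generators directly. But \<open>X\<close>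
  is fixed by \<open>ptr\<close>, and applying \<open>ptr\<close> to an expansion of
  \<open>X\<close> over the generators of the whole Levi subalgebra removes exactly the unsupported
  ones.\<close>

lemma levi_supported_span:
  assumes X: "X \<in> levi_tilde x m Y0" "X \<in> g_supported x m I" and I: "I \<subseteq> I_tilde m"
  shows "X \<in> gspan (insert KK (E_hat ` I) \<union> (\<Union>\<alpha>\<in>roots x m \<inter> levi_lattice Y0 \<inter> hdual I. root_space x m \<alpha>))"
    (is "_ \<in> gspan ?C")
proof -
  have "ptr I X \<in> gspan ?C"
  proof (rule span_linear[OF ptr_add ptr_gscale _ X(1)[unfolded levi_eq]])
    fix X assume X: "X \<in> insert KK (E_hat ` I_tilde m) \<union> (\<Union>\<alpha>\<in>roots x m \<inter> levi_lattice Y0. root_space x m \<alpha>)"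
    from X consider "X = KK" | r where "r \<in> I_tilde m" "X = E_hat r"
      | \<alpha> where "\<alpha> \<in> roots x m \<inter> levi_lattice Y0" "X \<in> root_space x m \<alpha>" by auto
    thus "ptr I X \<in> gspan ?C"
    proof cases
      case 1
      have "ptr I KK = KK" by (rule ptr_id) (simp add: KK_def)
      thus ?thesis using 1 by (auto intro: gv.span_base)
    next
      case (2 r)
      show ?thesis
      proof (cases "r \<in> I")
        case True
        have "ptr I (E_hat r) = E_hat r"
          by (rule ptr_id, rule order_trans, simp add: E_hat_def, rule supp_diff) (use True in \<open>auto simp: idx_of_def\<close>)
        thus ?thesis using 2 True by (auto intro: gv.span_base)
      next
        case False
        have "ptr I (E_hat r) = 0"
          using False by (auto simp: prod_eq_iff coef_ptr E_hat_def idx_of_def lookup_minus lookup_single when_def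
              intro!: poly_mapping_eqI)
        thus ?thesis using 2 by (simp add: gv.span_zero)
      qed
    next
      case (3 \<alpha>)
      show ?thesis
      proof (cases "\<alpha> \<in> hdual I")
        case True
        thus ?thesis using root_space_supported[of \<alpha> x m X I] 3 by (auto intro!: gv.span_base)
      next
        case False
        thus ?thesis using root_space_not_supported[of \<alpha> x m X I] 3 by (simp add: gv.span_zero)
      qed
    qed
  qed
  thus ?thesis using ptr_g_supported[OF X(2)] by simp
qed

text \<open>Elements of the nilradical have neither diagonal entries nor a central part, so a
  nonzero one of some weight has a nonzero weight. Needed because weight symbols below record an
  arbitrary weight for each factor, not a root.\<close>

lemma u_tilde_root_space:
  assumes X: "X \<in> u_tilde_minus x m Y0" "X \<in> root_space x m \<alpha>" "\<alpha> \<in> hdual (I_tilde m)" "X \<noteq> 0"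
  shows "\<alpha> \<in> roots x m"
proof -
  have sub: "gv.subspace {X. snd X = 0 \<and> (\<forall>ab\<in>supp (fst X). fst ab \<noteq> snd ab)}"
    using keys_add supp_pscale by (force simp: gv.subspace_def)
  have "u_tilde_minus x m Y0 \<subseteq> {X. snd X = 0 \<and> (\<forall>ab\<in>supp (fst X). fst ab \<noteq> snd ab)}"
    unfolding u_tilde_minus_eq
  proof (rule gv.span_minimal[OF _ sub], rule subsetI)
    fix X assume "X \<in> (\<Union>\<alpha>\<in>u_roots x m Y0. root_space x m \<alpha>)"
    then obtain \<alpha> where "\<alpha> \<in> u_roots x m Y0" "X \<in> root_space x m \<alpha>" by blast
    thus "X \<in> {X. snd X = 0 \<and> (\<forall>ab\<in>supp (fst X). fst ab \<noteq> snd ab)}"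
      using root_space_entry(3)[OF u_roots_roots] root_space_snd[OF u_roots_roots] by blast
  qed
  hence e: "snd X = 0" "\<And>ab. ab \<in> supp (fst X) \<Longrightarrow> fst ab \<noteq> snd ab" using X(1) by auto
  hence "fst X \<noteq> 0" using X(4) by (auto simp: prod_eq_iff)
  then obtain ab where ab: "ab \<in> supp (fst X)" by (metis all_not_in_conv keys_eq_empty)
  hence i: "fst ab \<in> indices x m" "snd ab \<in> indices x m"
    using g_tilde_supp[OF root_space_g_tilde[OF X(2)]] by (auto simp: mem_Times_iff)
  have "dwt ab = fst \<alpha>" using X(2) ab unfolding root_space_iff[OF X(3)] by auto
  moreover have "dwt ab \<noteq> 0"
  proof
    assume "dwt ab = 0"
    hence "lf (phi m) (dwt ab, 0) = 0" by (simp add: lf_def)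
    thus False using ival_phi_inj[OF i e(2)[OF ab]] by (simp add: lf_dwt)
  qed
  ultimately have "\<alpha> \<noteq> 0" by auto
  thus ?thesis using rootsI X by blast
qed

section \<open>Chains modulo the relations of the exterior power\<close>

abbreviation sgn2 :: "nat \<Rightarrow> nat \<Rightarrow> complex"
  where "sgn2 p q \<equiv> (-1) ^ (p * q)"

lemma sgn2_sq [simp]: "sgn2 p q * sgn2 p q = 1" "sgn2 p q * (sgn2 p q * z) = z"
  by (simp_all add: minus_one_power_iff)

lemma sgn2_mod: "sgn2 ((p + q) mod 2) r = sgn2 p r * sgn2 q r" "sgn2 r ((p + q) mod 2) = sgn2 r p * sgn2 r q"
  by (simp_all add: minus_one_power_iff)

definition hom_part :: "ltype \<Rightarrow> gt set \<Rightarrow> nat \<Rightarrow> gt set"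
  where "hom_part x U p = U \<inter> gt_hom x p"

definition free_space :: "ltype \<Rightarrow> gt set \<Rightarrow> 'v smod \<Rightarrow> nat \<Rightarrow> (gt list \<times> 'v \<Rightarrow>\<^sub>0 complex) set"
  where "free_space x U M n = {f. supp f \<subseteq> gens x U M n}"

text \<open>Left multiplication by \<open>Y\<close> in the exterior power, at the level of
  symbols.\<close>

definition cns :: "gt \<Rightarrow> (gt list \<times> 'v \<Rightarrow>\<^sub>0 complex) \<Rightarrow> (gt list \<times> 'v \<Rightarrow>\<^sub>0 complex)"
  where "cns Y z = linext (\<lambda>(xs, v). bas (Y # xs, v)) z"

lemma cns_bas [simp]: "cns Y (bas (xs, v)) = bas (Y # xs, v)"
  by (simp add: cns_def)

lemma cns_simps: "cns Y (z + w) = cns Y z + cns Y w" "cns Y (z - w) = cns Y z - cns Y w"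
  "cns Y (- z) = - cns Y z" "cns Y (pscale c z) = pscale c (cns Y z)" "cns Y 0 = 0"
  by (simp_all add: cns_def linext_simps)

text \<open>The action of a homogeneous element of parity \<open>p\<close>, and the boundary, by recursion on the first factor.\<close>

fun sB :: "ltype \<Rightarrow> 'v smod \<Rightarrow> nat \<Rightarrow> gt \<Rightarrow> gt list \<Rightarrow> 'v \<Rightarrow> (gt list \<times> 'v \<Rightarrow>\<^sub>0 complex)" where
  "sB x M p X [] v = bas ([], act M X v)"
| "sB x M p X (Y # xs) v = bas (bracket x X Y # xs, v) + pscale (sgn2 p (deg x Y)) (cns Y (sB x M p X xs v))"

fun sD :: "ltype \<Rightarrow> 'v smod \<Rightarrow> gt list \<Rightarrow> 'v \<Rightarrow> (gt list \<times> 'v \<Rightarrow>\<^sub>0 complex)" where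
  "sD x M [] v = 0"
| "sD x M (Y # xs) v = - sB x M (deg x Y) Y xs v - cns Y (sD x M xs v)"

definition BB :: "ltype \<Rightarrow> 'v smod \<Rightarrow> nat \<Rightarrow> gt \<Rightarrow> (gt list \<times> 'v \<Rightarrow>\<^sub>0 complex) \<Rightarrow> (gt list \<times> 'v \<Rightarrow>\<^sub>0 complex)"
  where "BB x M p X = linext (\<lambda>(xs, v). sB x M p X xs v)"

definition DD :: "ltype \<Rightarrow> 'v smod \<Rightarrow> (gt list \<times> 'v \<Rightarrow>\<^sub>0 complex) \<Rightarrow> (gt list \<times> 'v \<Rightarrow>\<^sub>0 complex)"
  where "DD x M = linext (\<lambda>(xs, v). sD x M xs v)"

lemma BB_simps: "BB x M p X (z + w) = BB x M p X z + BB x M p X w" "BB x M p X (z - w) = BB x M p X z - BB x M p X w"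
  "BB x M p X (- z) = - BB x M p X z" "BB x M p X (pscale c z) = pscale c (BB x M p X z)" "BB x M p X 0 = 0"
  by (simp_all add: BB_def linext_simps)

lemma BB_bas [simp]: "BB x M p X (bas (xs, v)) = sB x M p X xs v"
  by (simp add: BB_def)

lemma DD_simps: "DD x M (z + w) = DD x M z + DD x M w" "DD x M (z - w) = DD x M z - DD x M w"
  "DD x M (- z) = - DD x M z" "DD x M (pscale c z) = pscale c (DD x M z)" "DD x M 0 = 0"
  by (simp_all add: DD_def linext_simps)

lemma DD_bas [simp]: "DD x M (bas (xs, v)) = sD x M xs v"
  by (simp add: DD_def)

lemma BB_cns: "BB x M p X (cns Y z) = cns (bracket x X Y) z + pscale (sgn2 p (deg x Y)) (cns Y (BB x M p X z))"
proof (rule linear_eq_on_bas[of pscale "\<lambda>z. BB x M p X (cns Y z)"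
      "\<lambda>z. cns (bracket x X Y) z + pscale (sgn2 p (deg x Y)) (cns Y (BB x M p X z))"])
  fix b :: "gt list \<times> 'a"
  show "BB x M p X (cns Y (bas b)) = cns (bracket x X Y) (bas b) + pscale (sgn2 p (deg x Y)) (cns Y (BB x M p X (bas b)))"
    by (cases b) simp
qed (auto intro!: linear_pI simp: BB_simps cns_simps pv.scale_right_distrib mult.commute)

text \<open>Cartan's formula relating multiplication by \<open>Y\<close>, the action of
  \<open>Y\<close> and the boundary. Together with the derivation rule \<open>BB_cns\<close> it
  drives all inductions on the number of factors.\<close>

lemma DD_cns: "DD x M (cns Y z) = - BB x M (deg x Y) Y z - cns Y (DD x M z)"
proof (rule linear_eq_on_bas[of pscale "\<lambda>z. DD x M (cns Y z)" "\<lambda>z. - BB x M (deg x Y) Y z - cns Y (DD x M z)"])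
  fix b :: "gt list \<times> 'a"
  show "DD x M (cns Y (bas b)) = - BB x M (deg x Y) Y (bas b) - cns Y (DD x M (bas b))"
    by (cases b) simp
qed (auto intro!: linear_pI simp: BB_simps DD_simps cns_simps pv.scale_right_diff_distrib)

section \<open>Supermodules and the relations of the exterior power\<close>

locale super_module =
  fixes x :: ltype and L :: "gt set" and M :: "'v smod" (structure)
  assumes smod: "is_smodule x L M"
begin

sublocale M: module CC M
  using smod by (simp add: is_smodule_def)

lemma CC_simps [simp]: "carrier CC = UNIV" "\<zero>\<^bsub>CC\<^esub> = 0" "\<one>\<^bsub>CC\<^esub> = 1" "a \<oplus>\<^bsub>CC\<^esub> b = a + b" "a \<otimes>\<^bsub>CC\<^esub> b = a * b"
  by (simp_all add: CC_def)

lemma smult_0 [simp]: "v \<in> carrier M \<Longrightarrow> 0 \<odot> v = \<zero>"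
  using M.smult_l_null by simp

lemma act_closed [simp]: "X \<in> L \<Longrightarrow> v \<in> carrier M \<Longrightarrow> act M X v \<in> carrier M"
proof -
  have "\<forall>X\<in>L. \<forall>v\<in>carrier M. act M X v \<in> carrier M" using smod unfolding is_smodule_def by (elim conjE) assumption
  thus "X \<in> L \<Longrightarrow> v \<in> carrier M \<Longrightarrow> act M X v \<in> carrier M" by blast
qed

lemma act_add: "X \<in> L \<Longrightarrow> v \<in> carrier M \<Longrightarrow> w \<in> carrier M \<Longrightarrow> act M X (v \<oplus> w) = act M X v \<oplus> act M X w"
proof -
  have "\<forall>X\<in>L. \<forall>v\<in>carrier M. \<forall>w\<in>carrier M. act M X (v \<oplus> w) = act M X v \<oplus> act M X w"
    using smod unfolding is_smodule_def by (elim conjE) assumption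
  thus "X \<in> L \<Longrightarrow> v \<in> carrier M \<Longrightarrow> w \<in> carrier M \<Longrightarrow> act M X (v \<oplus> w) = act M X v \<oplus> act M X w"
    by blast
qed

lemma act_smult: "X \<in> L \<Longrightarrow> v \<in> carrier M \<Longrightarrow> act M X (c \<odot> v) = c \<odot> act M X v"
  using smod unfolding is_smodule_def by blast

lemma act_add_left: "X \<in> L \<Longrightarrow> Y \<in> L \<Longrightarrow> v \<in> carrier M \<Longrightarrow> act M (X + Y) v = act M X v \<oplus> act M Y v"
  using smod unfolding is_smodule_def by blast

lemma act_gscale: "X \<in> L \<Longrightarrow> v \<in> carrier M \<Longrightarrow> act M (gscale c X) v = c \<odot> act M X v"
  using smod unfolding is_smodule_def by blast

lemma act_bracket: "X \<in> L \<Longrightarrow> Y \<in> L \<Longrightarrow> X \<in> gt_hom x p \<Longrightarrow> Y \<in> gt_hom x q \<Longrightarrow> p < 2 \<Longrightarrow> q < 2 \<Longrightarrow> v \<in> carrier M \<Longrightarrow>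
    act M (bracket x X Y) v = act M X (act M Y v) \<ominus> (sgn2 p q) \<odot> act M Y (act M X v)"
  using smod unfolding is_smodule_def by blast

end

text \<open>\<open>U\<close> is the algebra whose homology is taken and \<open>L\<close> a set of
  elements acting on the chains. \<open>L\<close> is kept as a mere set because it will be the union
  of the Levi subalgebra, which acts on homology, and of \<open>U\<close>, which enters through
  Cartan's formula.\<close>

locale chain_data = super_module x L M
  for x :: ltype and U L :: "gt set" and M :: "'v smod" (structure) +
  assumes UL: "U \<subseteq> L"
    and U_subspace: "gv.subspace U"
    and LU: "\<And>X Z. X \<in> L \<Longrightarrow> Z \<in> U \<Longrightarrow> bracket x X Z \<in> U"
    and L_comp: "\<And>X p. X \<in> L \<Longrightarrow> p < 2 \<Longrightarrow> gt_comp x p X \<in> L"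
begin

abbreviation "H \<equiv> hom_part x U"
abbreviation "HL \<equiv> hom_part x L"
abbreviation "F \<equiv> free_space x U M"
abbreviation "R \<equiv> wedge_rels x U M"

lemma H_iff: "X \<in> H p \<longleftrightarrow> X \<in> U \<and> X \<in> gt_hom x p"
  by (simp add: hom_part_def)

lemma HL_iff: "X \<in> HL p \<longleftrightarrow> X \<in> L \<and> X \<in> gt_hom x p"
  by (simp add: hom_part_def)

lemma H_HL: "X \<in> H p \<Longrightarrow> X \<in> HL p"
  using UL by (auto simp: hom_part_def)

lemma H_add: "X \<in> H p \<Longrightarrow> Y \<in> H p \<Longrightarrow> X + Y \<in> H p"
  by (simp add: H_iff gt_hom_add gv.subspace_add[OF U_subspace])

lemma H_gscale: "X \<in> H p \<Longrightarrow> gscale c X \<in> H p"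
  by (simp add: H_iff gt_hom_gscale gv.subspace_scale[OF U_subspace])

lemma H_0 [simp]: "0 \<in> H p"
  by (simp add: H_iff gv.subspace_0[OF U_subspace])

lemma H_bracket: "X \<in> HL p \<Longrightarrow> Y \<in> H q \<Longrightarrow> p < 2 \<Longrightarrow> q < 2 \<Longrightarrow> bracket x X Y \<in> H ((p + q) mod 2)"
  by (simp add: H_iff HL_iff LU bracket_in_hom)

lemma gens_Nil [simp]: "([], v) \<in> gens x U M n \<longleftrightarrow> n = 0 \<and> v \<in> carrier M"
  by (auto simp: gens_def)

lemma gens_0: "(xs, v) \<in> gens x U M 0 \<longleftrightarrow> xs = [] \<and> v \<in> carrier M"
  by (auto simp: gens_def)

lemma gens_Cons: "(Y # xs, v) \<in> gens x U M n \<longleftrightarrow> (\<exists>k p. n = Suc k \<and> p < 2 \<and> Y \<in> H p \<and> (xs, v) \<in> gens x U M k)"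
proof -
  have "Y \<in> gt_hom x 0 \<union> gt_hom x 1 \<longleftrightarrow> (\<exists>p<2. Y \<in> gt_hom x p)"
    using lt_2_cases by (auto intro: exI[of _ 0] exI[of _ "Suc 0"])
  thus ?thesis by (cases n) (auto simp: gens_def H_iff)
qed

lemma gens_ConsI: "Y \<in> H p \<Longrightarrow> p < 2 \<Longrightarrow> (xs, v) \<in> gens x U M n \<Longrightarrow> (Y # xs, v) \<in> gens x U M (Suc n)"
  by (auto simp: gens_Cons)

lemma gens_carrier: "(xs, v) \<in> gens x U M n \<Longrightarrow> v \<in> carrier M"
  by (simp add: gens_def)

lemma gens_v: "(xs, v) \<in> gens x U M n \<Longrightarrow> w \<in> carrier M \<Longrightarrow> (xs, w) \<in> gens x U M n"
  by (simp add: gens_def)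

lemma gens_update: "(xs, v) \<in> gens x U M n \<Longrightarrow> X \<in> H p \<Longrightarrow> p < 2 \<Longrightarrow> (xs[i := X], v) \<in> gens x U M n"
proof -
  assume a: "(xs, v) \<in> gens x U M n" "X \<in> H p" "p < 2"
  have "X \<in> U \<inter> (gt_hom x 0 \<union> gt_hom x 1)" using a(2,3) lt_2_cases[of p] by (auto simp: H_iff)
  thus ?thesis using a set_update_subset_insert[of xs i X] by (auto simp: gens_def)
qed

lemma F_subspace: "pv.subspace (F n)"
proof -
  have "supp (f + g) \<subseteq> A" if "supp f \<subseteq> A" "supp g \<subseteq> A" for f g :: "gt list \<times> 'v \<Rightarrow>\<^sub>0 complex" and A
    using keys_add[of f g] that by auto
  moreover have "supp (pscale c f) \<subseteq> A" if "supp f \<subseteq> A" for f :: "gt list \<times> 'v \<Rightarrow>\<^sub>0 complex" and A c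
    using supp_pscale[of c f] that by auto
  ultimately show ?thesis by (simp add: pv.subspace_def free_space_def)
qed

lemma F_eq_span: "F n = pv.span (bas ` gens x U M n)"
proof
  show "F n \<subseteq> pv.span (bas ` gens x U M n)" using mem_span_supp by (auto simp: free_space_def)
  show "pv.span (bas ` gens x U M n) \<subseteq> F n"
    by (rule pv.span_minimal[OF _ F_subspace]) (auto simp: free_space_def)
qed

lemma bas_F [simp]: "bas b \<in> F n \<longleftrightarrow> b \<in> gens x U M n"
  by (simp add: free_space_def)

lemma R_subspace: "pv.subspace (R n)"
  by (simp add: wedge_rels_def)

lemmas F_closed = pv.subspace_add[OF F_subspace] pv.subspace_diff[OF F_subspace] pv.subspace_scale[OF F_subspace]
  pv.subspace_0[OF F_subspace] pv.subspace_neg[OF F_subspace]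

lemmas R_closed = pv.subspace_add[OF R_subspace] pv.subspace_diff[OF R_subspace] pv.subspace_scale[OF R_subspace]
  pv.subspace_0[OF R_subspace] pv.subspace_neg[OF R_subspace]

lemma span_into:
  assumes "\<And>z w. f (z + w) = f z + f w" "\<And>c z. f (pscale c z) = pscale c (f z)"
    and "\<And>a. a \<in> A \<Longrightarrow> f a \<in> W" "pv.subspace W" "z \<in> pv.span A"
  shows "f z \<in> W"
proof -
  have 0: "f 0 = 0" using assms(2)[of 0 0] by simp
  show ?thesis using assms(5)
    by (induction rule: pv.span_induct_alt)
      (auto simp: assms(1-3) 0 pv.subspace_0[OF assms(4)] intro!: pv.subspace_add[OF assms(4)] pv.subspace_scale[OF assms(4)])
qed

lemma F_into:
  assumes "\<And>z w. f (z + w) = f z + f w" "\<And>c z. f (pscale c z) = pscale c (f z)"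
    and "\<And>xs v. (xs, v) \<in> gens x U M n \<Longrightarrow> f (bas (xs, v)) \<in> W" "pv.subspace W" "z \<in> F n"
  shows "f z \<in> W"
  by (rule span_into[OF assms(1,2) _ assms(4), of "bas ` gens x U M n"]) (use assms(3,5) in \<open>auto simp: F_eq_span\<close>)

lemma R_v_add: "(xs, v) \<in> gens x U M n \<Longrightarrow> (xs, w) \<in> gens x U M n \<Longrightarrow> bas (xs, v \<oplus> w) - bas (xs, v) - bas (xs, w) \<in> R n"
  unfolding wedge_rels_def by (rule pv.span_base) blast

lemma R_v_smult: "(xs, v) \<in> gens x U M n \<Longrightarrow> bas (xs, c \<odot> v) - pscale c (bas (xs, v)) \<in> R n"
  unfolding wedge_rels_def by (rule pv.span_base) blast

lemma R_v_0: "(xs, v) \<in> gens x U M n \<Longrightarrow> bas (xs, \<zero>) \<in> R n"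
  using R_v_smult[of xs v n 0] gens_carrier[of xs v n] by simp

lemma R_upd_add: "(xs, v) \<in> gens x U M n \<Longrightarrow> i < n \<Longrightarrow> p < 2 \<Longrightarrow> X \<in> H p \<Longrightarrow> Y \<in> H p \<Longrightarrow>
    bas (xs[i := X + Y], v) - bas (xs[i := X], v) - bas (xs[i := Y], v) \<in> R n"
  unfolding wedge_rels_def H_iff by (rule pv.span_base, intro UnI1) blast

lemma R_upd_gscale: "(xs, v) \<in> gens x U M n \<Longrightarrow> i < n \<Longrightarrow> p < 2 \<Longrightarrow> X \<in> H p \<Longrightarrow>
    bas (xs[i := gscale c X], v) - pscale c (bas (xs[i := X], v)) \<in> R n"
  unfolding wedge_rels_def H_iff by (rule pv.span_base) blast

lemma R_swap: "(xs, v) \<in> gens x U M n \<Longrightarrow> Suc i < n \<Longrightarrow>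
    bas (xs, v) + pscale (sgn2 (deg x (xs ! i)) (deg x (xs ! Suc i))) (bas (xs[i := xs ! Suc i, Suc i := xs ! i], v)) \<in> R n"
  unfolding wedge_rels_def by (rule pv.span_base) blast

lemma R_F: "R n \<subseteq> F n"
  unfolding wedge_rels_def
proof (rule pv.span_minimal[OF _ F_subspace], safe)
  fix xs v i X Y p
  assume a: "(xs, v) \<in> gens x U M n" "(p::nat) < 2" "X \<in> U" "X \<in> gt_hom x p"
  hence X: "X \<in> H p" by (simp add: H_iff)
  {
    assume b: "Y \<in> U" "Y \<in> gt_hom x p"
    hence Y: "Y \<in> H p" by (simp add: H_iff)
    show "bas (xs[i := X + Y], v) - bas (xs[i := X], v) - bas (xs[i := Y], v) \<in> F n"
      using gens_update[OF a(1) H_add[OF X Y] a(2)] gens_update[OF a(1) X a(2)] gens_update[OF a(1) Y a(2)]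
      by (auto intro!: F_closed)
  }
  fix c
  show "bas (xs[i := gscale c X], v) - pscale c (bas (xs[i := X], v)) \<in> F n"
    using gens_update[OF a(1) H_gscale[OF X] a(2)] gens_update[OF a(1) X a(2)]
    by (auto intro!: F_closed simp del: pscale_bas)
next
  fix xs v w
  assume a: "(xs, v) \<in> gens x U M n"
  {
    assume b: "(xs, w) \<in> gens x U M n"
    show "bas (xs, v \<oplus> w) - bas (xs, v) - bas (xs, w) \<in> F n"
      using a b gens_carrier[OF a] gens_carrier[OF b] gens_v[OF a] by (auto intro!: F_closed)
  }
  fix c
  show "bas (xs, c \<odot> v) - pscale c (bas (xs, v)) \<in> F n"
    using a gens_carrier[OF a] gens_v[OF a] by (auto intro!: F_closed simp del: pscale_bas)
next
  fix xs v i
  assume a: "(xs, v) \<in> gens x U M n" "Suc i < n"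
  have "set (xs[i := xs ! Suc i, Suc i := xs ! i]) \<subseteq> set xs"
    using a set_update_subset_insert[of "xs[i := xs ! Suc i]" "Suc i" "xs ! i"] set_update_subset_insert[of xs i "xs ! Suc i"]
    by (auto simp: gens_def)
  hence "(xs[i := xs ! Suc i, Suc i := xs ! i], v) \<in> gens x U M n" using a by (auto simp: gens_def)
  thus "bas (xs, v) + pscale (sgn2 (deg x (xs ! i)) (deg x (xs ! Suc i))) (bas (xs[i := xs ! Suc i, Suc i := xs ! i], v)) \<in> F n"
    using a by (auto intro!: F_closed simp del: pscale_bas)
qed

lemma cns_F: "Y \<in> H p \<Longrightarrow> p < 2 \<Longrightarrow> z \<in> F n \<Longrightarrow> cns Y z \<in> F (Suc n)"
  by (rule F_into[OF cns_simps(1,4) _ F_subspace]) (auto simp: gens_Cons)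

lemma cns_add_R: "X \<in> H p \<Longrightarrow> Y \<in> H p \<Longrightarrow> p < 2 \<Longrightarrow> z \<in> F n \<Longrightarrow> cns (X + Y) z - cns X z - cns Y z \<in> R (Suc n)"
proof (rule F_into[of "\<lambda>z. cns (X + Y) z - cns X z - cns Y z", OF _ _ _ R_subspace])
  fix xs v assume a: "X \<in> H p" "Y \<in> H p" "p < 2" "(xs, v) \<in> gens x U M n"
  show "cns (X + Y) (bas (xs, v)) - cns X (bas (xs, v)) - cns Y (bas (xs, v)) \<in> R (Suc n)"
    using R_upd_add[OF gens_ConsI[OF a(1,3,4)] _ a(3,1,2), of 0] by simp
qed (auto simp: cns_simps algebra_simps pv.scale_right_distrib pv.scale_right_diff_distrib)

lemma cns_gscale_R: "X \<in> H p \<Longrightarrow> p < 2 \<Longrightarrow> z \<in> F n \<Longrightarrow> cns (gscale c X) z - pscale c (cns X z) \<in> R (Suc n)"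
proof (rule F_into[of "\<lambda>z. cns (gscale c X) z - pscale c (cns X z)", OF _ _ _ R_subspace])
  fix xs v assume a: "X \<in> H p" "p < 2" "(xs, v) \<in> gens x U M n"
  show "cns (gscale c X) (bas (xs, v)) - pscale c (cns X (bas (xs, v))) \<in> R (Suc n)"
    using R_upd_gscale[OF gens_ConsI[OF a] _ a(2,1), of 0 c] by simp
qed (auto simp: cns_simps algebra_simps pv.scale_right_distrib pv.scale_right_diff_distrib)

lemma cns_0_R: "z \<in> F n \<Longrightarrow> cns 0 z \<in> R (Suc n)"
  using cns_gscale_R[of 0 0 z n 0] by simp

text \<open>The exchange relation with the parities under which the factors are known in place of
  their degrees. The two can differ only for a zero factor, and then each of the two products is a
  relation by itself.\<close>

lemma cns_swap_R:
  assumes "X \<in> H p" "Y \<in> H q" "p < 2" "q < 2" "z \<in> F n"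
  shows "cns X (cns Y z) + pscale (sgn2 p q) (cns Y (cns X z)) \<in> R (Suc (Suc n))"
proof (cases "X = 0 \<or> Y = 0")
  case True
  have "cns X (cns Y z) \<in> R (Suc (Suc n))" if "X = 0 \<or> Y = 0" "X \<in> H p" "p < 2" "Y \<in> H q" "q < 2" for X Y p q
  proof (cases "X = 0")
    case True thus ?thesis using cns_0_R[OF cns_F[OF that(4,5) assms(5)]] by simp
  next
    case False
    hence Y: "Y = 0" using that by simp
    have "cns X (cns 0 z) \<in> R (Suc (Suc n))"
    proof (rule F_into[OF _ _ _ R_subspace assms(5), of "\<lambda>z. cns X (cns 0 z)"])
      fix xs v assume "(xs, v) \<in> gens x U M n"
      hence g: "(X # 0 # xs, v) \<in> gens x U M (Suc (Suc n))" using that by (intro gens_ConsI[of _ p] gens_ConsI[of _ 0]) auto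
      show "cns X (cns 0 (bas (xs, v))) \<in> R (Suc (Suc n))"
        using R_upd_gscale[OF g, of 1 0 0 0] by simp
    qed (auto simp: cns_simps)
    thus ?thesis by (simp add: Y)
  qed
  from this[OF _ assms(1,3,2,4)] this[OF _ assms(2,4,1,3)] True show ?thesis by (auto intro!: R_closed)
next
  case False
  hence d: "deg x X = p" "deg x Y = q" using assms by (auto intro!: deg_eq simp: H_iff)
  show ?thesis
  proof (rule F_into[OF _ _ _ R_subspace assms(5), of "\<lambda>z. cns X (cns Y z) + pscale (sgn2 p q) (cns Y (cns X z))"])
    fix xs v assume "(xs, v) \<in> gens x U M n"
    hence g: "(X # Y # xs, v) \<in> gens x U M (Suc (Suc n))" using assms by (intro gens_ConsI[of _ p] gens_ConsI[of _ q]) auto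
    show "cns X (cns Y (bas (xs, v))) + pscale (sgn2 p q) (cns Y (cns X (bas (xs, v)))) \<in> R (Suc (Suc n))"
      using R_swap[OF g, of 0] d by simp
  qed (auto simp: cns_simps algebra_simps pv.scale_right_distrib)
qed

lemma pscale_deg_cns_R:
  assumes "Y \<in> H q" "q < 2" "z \<in> F n"
  shows "pscale (sgn2 p (deg x Y)) (cns Y z) - pscale (sgn2 p q) (cns Y z) \<in> R (Suc n)"
proof (cases "Y = 0")
  case True
  thus ?thesis using cns_0_R[OF assms(3)] by (auto intro!: R_closed)
next
  case False
  hence "deg x Y = q" using assms by (auto intro!: deg_eq simp: H_iff)
  thus ?thesis by (simp add: R_closed)
qed

lemma cns_R:
  assumes "Y \<in> H p" "p < 2" "r \<in> R n"
  shows "cns Y r \<in> R (Suc n)"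
  using assms(3) unfolding wedge_rels_def[of x U M n]
proof (rule span_into[OF cns_simps(1,4) _ R_subspace, rotated], safe)
  fix xs v i X Z q
  assume a: "(xs, v) \<in> gens x U M n" "i < n" "(q::nat) < 2" "X \<in> U" "X \<in> gt_hom x q"
  hence X: "X \<in> H q" by (simp add: H_iff)
  note g = gens_ConsI[OF assms(1,2) a(1)]
  {
    assume b: "Z \<in> U" "Z \<in> gt_hom x q"
    hence Y: "Z \<in> H q" by (simp add: H_iff)
    show "cns Y (bas (xs[i := X + Z], v) - bas (xs[i := X], v) - bas (xs[i := Z], v)) \<in> R (Suc n)"
      using R_upd_add[OF g _ a(3) X Y, of "Suc i"] a(2) by (simp add: cns_simps)
  }
  fix c
  show "cns Y (bas (xs[i := gscale c X], v) - pscale c (bas (xs[i := X], v))) \<in> R (Suc n)"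
    using R_upd_gscale[OF g _ a(3) X, of "Suc i" c] a(2) by (simp add: cns_simps del: pscale_bas)
next
  fix xs v w
  assume a: "(xs, v) \<in> gens x U M n"
  note g = gens_ConsI[OF assms(1,2)]
  {
    assume b: "(xs, w) \<in> gens x U M n"
    show "cns Y (bas (xs, v \<oplus> w) - bas (xs, v) - bas (xs, w)) \<in> R (Suc n)"
      using R_v_add[OF g[OF a] g[OF b]] by (simp add: cns_simps)
  }
  fix c
  show "cns Y (bas (xs, c \<odot> v) - pscale c (bas (xs, v))) \<in> R (Suc n)"
    using R_v_smult[OF g[OF a]] by (simp add: cns_simps del: pscale_bas)
next
  fix xs v i
  assume a: "(xs, v) \<in> gens x U M n" "Suc i < n"
  show "cns Y (bas (xs, v) + pscale (sgn2 (deg x (xs ! i)) (deg x (xs ! Suc i))) (bas (xs[i := xs ! Suc i, Suc i := xs ! i], v))) \<in> R (Suc n)"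
    using R_swap[OF gens_ConsI[OF assms(1,2) a(1)], of "Suc i"] a(2) by (simp add: cns_simps del: pscale_bas)
qed

text \<open>The generating relations for \<open>n + 1\<close> factors, sorted by what happens to the
  first factor: a relation among the remaining ones, linearity in the first, or an exchange of the
  first two. This is what makes induction on the number of factors possible.\<close>

definition step_rels :: "nat \<Rightarrow> (gt list \<times> 'v \<Rightarrow>\<^sub>0 complex) set"
  where "step_rels n = {cns Y r | Y r p. p < 2 \<and> Y \<in> H p \<and> r \<in> R n} \<union>
    {cns (X + Y) z - cns X z - cns Y z | X Y z p. p < 2 \<and> X \<in> H p \<and> Y \<in> H p \<and> z \<in> F n} \<union>
    {cns (gscale c X) z - pscale c (cns X z) | c X z p. p < 2 \<and> X \<in> H p \<and> z \<in> F n} \<union>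
    {cns X (cns Y z) + pscale (sgn2 p q) (cns Y (cns X z)) | X Y z p q k. n = Suc k \<and> p < 2 \<and> q < 2 \<and>
       X \<in> H p \<and> Y \<in> H q \<and> z \<in> F k}"

lemma gens_SucE:
  assumes "(xs, v) \<in> gens x U M (Suc n)"
  obtains Y ys p where "xs = Y # ys" "p < 2" "Y \<in> H p" "(ys, v) \<in> gens x U M n"
proof -
  obtain Y ys where xs: "xs = Y # ys" using assms by (cases xs) auto
  thus ?thesis using assms that[OF xs] unfolding xs gens_Cons by auto
qed

lemma R_Suc: "R (Suc n) \<subseteq> pv.span (step_rels n)"
proof -
  have c: "cns Y r \<in> pv.span (step_rels n)" if "p < 2" "Y \<in> H p" "r \<in> R n" for Y r p
    unfolding step_rels_def by (rule pv.span_base, intro UnI1) (use that in blast)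
  have "R N \<subseteq> pv.span (step_rels n)" if N: "N = Suc n" for N
    unfolding wedge_rels_def[of x U M N]
  proof (rule pv.span_minimal[OF _ pv.subspace_span], safe)
    fix xs v i X Z q
    assume a: "(xs, v) \<in> gens x U M N" "i < N" "(q::nat) < 2" "X \<in> U" "X \<in> gt_hom x q"
    hence X: "X \<in> H q" by (simp add: H_iff)
    obtain Y ys p where Y: "xs = Y # ys" "p < 2" "Y \<in> H p" "(ys, v) \<in> gens x U M n"
      by (rule gens_SucE[OF a(1)[unfolded N]])
    {
      assume b: "Z \<in> U" "Z \<in> gt_hom x q"
      hence Z: "Z \<in> H q" by (simp add: H_iff)
      show "bas (xs[i := X + Z], v) - bas (xs[i := X], v) - bas (xs[i := Z], v) \<in> pv.span (step_rels n)"
      proof (cases i)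
        case 0
        have "cns (X + Z) (bas (ys, v)) - cns X (bas (ys, v)) - cns Z (bas (ys, v)) \<in> step_rels n"
          unfolding step_rels_def using X Z Y(4) a(3) bas_F by blast
        thus ?thesis using pv.span_base by (simp add: Y(1) 0)
      next
        case (Suc j)
        have "bas (ys[j := X + Z], v) - bas (ys[j := X], v) - bas (ys[j := Z], v) \<in> R n"
          using a(2) N Suc by (intro R_upd_add[OF Y(4) _ a(3) X Z]) auto
        from c[OF Y(2,3) this] show ?thesis by (simp add: Y(1) Suc cns_simps)
      qed
    }
    fix k
    show "bas (xs[i := gscale k X], v) - pscale k (bas (xs[i := X], v)) \<in> pv.span (step_rels n)"
    proof (cases i)
      case 0
      have "cns (gscale k X) (bas (ys, v)) - pscale k (cns X (bas (ys, v))) \<in> step_rels n"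
        unfolding step_rels_def using X Y(4) a(3) bas_F by blast
      thus ?thesis using pv.span_base by (simp add: Y(1) 0)
    next
      case (Suc j)
      have "bas (ys[j := gscale k X], v) - pscale k (bas (ys[j := X], v)) \<in> R n"
        using a(2) N Suc by (intro R_upd_gscale[OF Y(4) _ a(3) X]) auto
      from c[OF Y(2,3) this] show ?thesis by (simp add: Y(1) Suc cns_simps del: pscale_bas)
    qed
  next
    fix xs v w
    assume a: "(xs, v) \<in> gens x U M N"
    obtain Y ys p where Y: "xs = Y # ys" "p < 2" "Y \<in> H p" "(ys, v) \<in> gens x U M n"
      by (rule gens_SucE[OF a(1)[unfolded N]])
    {
      assume b: "(xs, w) \<in> gens x U M N"
      have "bas (ys, v \<oplus> w) - bas (ys, v) - bas (ys, w) \<in> R n"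
        using gens_v[OF Y(4) gens_carrier[OF b]] by (intro R_v_add Y(4))
      from c[OF Y(2,3) this] show "bas (xs, v \<oplus> w) - bas (xs, v) - bas (xs, w) \<in> pv.span (step_rels n)"
        by (simp add: Y(1) cns_simps)
    }
    fix k
    from c[OF Y(2,3) R_v_smult[OF Y(4)]]
    show "bas (xs, k \<odot> v) - pscale k (bas (xs, v)) \<in> pv.span (step_rels n)"
      by (simp add: Y(1) cns_simps del: pscale_bas)
  next
    fix xs v i
    assume a: "(xs, v) \<in> gens x U M N" "Suc i < N"
    obtain Y ys p where Y: "xs = Y # ys" "p < 2" "Y \<in> H p" "(ys, v) \<in> gens x U M n"
      by (rule gens_SucE[OF a(1)[unfolded N]])
    show "bas (xs, v) + pscale (sgn2 (deg x (xs ! i)) (deg x (xs ! Suc i))) (bas (xs[i := xs ! Suc i, Suc i := xs ! i], v))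
       \<in> pv.span (step_rels n)"
    proof (cases i)
      case 0
      then obtain k where n: "n = Suc k" using a(2) N by (cases n) auto
      obtain Z zs q where Z: "ys = Z # zs" "q < 2" "Z \<in> H q" "(zs, v) \<in> gens x U M k"
        by (rule gens_SucE[OF Y(4)[unfolded n]])
      have "Y \<in> H (deg x Y)" "Z \<in> H (deg x Z)"
        using Y(2,3) Z(2,3) lt_2_cases[of p] lt_2_cases[of q] by (auto simp: H_iff intro!: in_hom_deg)
      hence "cns Y (cns Z (bas (zs, v))) + pscale (sgn2 (deg x Y) (deg x Z)) (cns Z (cns Y (bas (zs, v)))) \<in> step_rels n"
        unfolding step_rels_def
        by (intro UnI2 CollectI exI[of _ Y] exI[of _ Z] exI[of _ "bas (zs, v)"] exI[of _ "deg x Y"]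
            exI[of _ "deg x Z"] exI[of _ k]) (use Z(4) n in auto)
      thus ?thesis using pv.span_base by (simp add: Y(1) Z(1) 0)
    next
      case (Suc j)
      have "bas (ys, v) + pscale (sgn2 (deg x (ys ! j)) (deg x (ys ! Suc j))) (bas (ys[j := ys ! Suc j, Suc j := ys ! j], v)) \<in> R n"
        using a(2) N Suc by (intro R_swap[OF Y(4)]) auto
      from c[OF Y(2,3) this] show ?thesis by (simp add: Y(1) Suc cns_simps del: pscale_bas)
    qed
  qed
  thus ?thesis by blast
qed

lemma R_0: "R 0 \<subseteq> pv.span ({bas ([], v \<oplus> w) - bas ([], v) - bas ([], w) | v w. v \<in> carrier M \<and> w \<in> carrier M} \<union>
    {bas ([], c \<odot> v) - pscale c (bas ([], v)) | v c. v \<in> carrier M})"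
  unfolding wedge_rels_def by (rule pv.span_mono) (auto simp: gens_0)

section \<open>Action and boundary are well defined modulo the relations\<close>

lemma HL_0: "0 \<in> HL p"
  using UL gv.subspace_0[OF U_subspace] by (auto simp: HL_iff)

lemma sB_F:
  assumes "X \<in> HL p" "p < 2"
  shows "(xs, v) \<in> gens x U M n \<Longrightarrow> sB x M p X xs v \<in> F n"
proof (induction xs arbitrary: n)
  case Nil
  thus ?case using assms by (simp add: HL_iff)
next
  case (Cons Y xs)
  then obtain k q where k: "n = Suc k" "q < 2" "Y \<in> H q" "(xs, v) \<in> gens x U M k" by (auto simp: gens_Cons)
  have "(bracket x X Y # xs, v) \<in> gens x U M (Suc k)"
    by (rule gens_ConsI[OF H_bracket[OF assms(1) k(3) assms(2) k(2)] _ k(4)]) simp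
  thus ?case using cns_F[OF k(3,2) Cons.IH[OF k(4)]] k(1) by (auto intro!: F_closed)
qed

lemma BB_F:
  assumes "X \<in> HL p" "p < 2" "z \<in> F n"
  shows "BB x M p X z \<in> F n"
  by (rule F_into[OF BB_simps(1,4) _ F_subspace assms(3)]) (simp add: sB_F[OF assms(1,2)])

lemma H_deg: "Y \<in> H q \<Longrightarrow> q < 2 \<Longrightarrow> Y \<in> H (deg x Y)"
  using lt_2_cases[of q] by (auto simp: H_iff intro!: in_hom_deg)

lemma sD_F: "(xs, v) \<in> gens x U M n \<Longrightarrow> sD x M xs v \<in> F (n - 1)"
proof (induction xs arbitrary: n)
  case Nil
  thus ?case by (simp add: F_closed)
next
  case (Cons Y xs)
  then obtain k q where k: "n = Suc k" "q < 2" "Y \<in> H q" "(xs, v) \<in> gens x U M k" by (auto simp: gens_Cons)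
  have 1: "sB x M (deg x Y) Y xs v \<in> F k"
    by (rule sB_F[OF H_HL[OF H_deg[OF k(3,2)]] _ k(4)]) simp
  have "cns Y (sD x M xs v) \<in> F k"
  proof (cases k)
    case 0
    thus ?thesis using k(4) by (simp add: gens_0 cns_simps F_closed)
  next
    case (Suc j)
    thus ?thesis using cns_F[OF k(3,2) Cons.IH[OF k(4)]] by simp
  qed
  thus ?case using 1 k(1) by (auto intro!: F_closed)
qed

lemma DD_F: "z \<in> F n \<Longrightarrow> DD x M z \<in> F (n - 1)"
  by (rule F_into[OF DD_simps(1,4) _ F_subspace]) (simp_all only: DD_bas sD_F)

lemma DD_F_Suc: "z \<in> F (Suc n) \<Longrightarrow> DD x M z \<in> F n"
  using DD_F[of z "Suc n"] by simp

lemma DD_F_0: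
  assumes "z \<in> F 0"
  shows "DD x M z = 0"
proof -
  have "DD x M z \<in> {0}"
    by (rule F_into[OF DD_simps(1,4) _ _ assms]) (auto simp: gens_0 pv.subspace_def)
  thus ?thesis by simp
qed

lemma BB_cns_R:
  assumes "X \<in> HL p" "p < 2" "Y \<in> H q" "q < 2" "z \<in> F n"
  shows "BB x M p X (cns Y z) - (cns (bracket x X Y) z + pscale (sgn2 p q) (cns Y (BB x M p X z))) \<in> R (Suc n)"
  using pscale_deg_cns_R[OF assms(3,4) BB_F[OF assms(1,2,5)], of p] by (simp add: BB_cns)

lemma R_trans: "a - b \<in> R n \<Longrightarrow> b - c \<in> R n \<Longrightarrow> a - c \<in> R n"
  using R_closed(1)[of "a - b" n "b - c"] by simp

lemma R_sym: "a - b \<in> R n \<Longrightarrow> b - a \<in> R n"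
  using R_closed(5)[of "a - b" n] by simp

lemma R_mem: "a - b \<in> R n \<Longrightarrow> b \<in> R n \<Longrightarrow> a \<in> R n"
  using R_closed(1)[of "a - b" n b] by simp

text \<open>The derivation rule sends each kind of generator to relations of the same kind, applied
  either to the bracket with the first factors or to the image of the remaining chain. The claim for
  \<open>n\<close> factors is a hypothesis, so that this is precisely the induction step of
  \<open>BB_R\<close>.\<close>

lemma BB_step_R:
  assumes X: "X \<in> HL p" "p < 2" and IH: "\<And>r. r \<in> R n \<Longrightarrow> BB x M p X r \<in> R n"
    and "r \<in> R (Suc n)"
  shows "BB x M p X r \<in> R (Suc n)"
proof (rule span_into[OF BB_simps(1,4) _ R_subspace subsetD[OF R_Suc assms(4)]])
  fix g assume "g \<in> step_rels n"
  then consider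
    (1) Y r q where "g = cns Y r" "q < 2" "Y \<in> H q" "r \<in> R n"
    | (2) Y Z z q where "g = cns (Y + Z) z - cns Y z - cns Z z" "q < 2" "Y \<in> H q" "Z \<in> H q" "z \<in> F n"
    | (3) c Y z q where "g = cns (gscale c Y) z - pscale c (cns Y z)" "q < 2" "Y \<in> H q" "z \<in> F n"
    | (4) Y Z z q q' k where "g = cns Y (cns Z z) + pscale (sgn2 q q') (cns Z (cns Y z))" "n = Suc k"
        "q < 2" "q' < 2" "Y \<in> H q" "Z \<in> H q'" "z \<in> F k"
    unfolding step_rels_def by blast
  thus "BB x M p X g \<in> R (Suc n)"
  proof cases
    case 1
    have b: "bracket x X Y \<in> H ((p + q) mod 2)" by (rule H_bracket[OF X(1) 1(3) X(2) 1(2)])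
    show ?thesis unfolding 1(1) BB_cns
      by (intro R_closed(1,3) cns_R[OF b] cns_R[OF 1(3,2)] IH 1(4)) simp
  next
    case 2
    note b = H_bracket[OF X(1) 2(3) X(2) 2(2)] H_bracket[OF X(1) 2(4) X(2) 2(2)]
    let ?w = "BB x M p X z"
    have w: "?w \<in> F n" by (rule BB_F[OF X 2(5)])
    have e1: "BB x M p X (cns (Y + Z) z) - (cns (bracket x X Y + bracket x X Z) z + pscale (sgn2 p q) (cns (Y + Z) ?w)) \<in> R (Suc n)"
      using BB_cns_R[OF X H_add[OF 2(3,4)] 2(2,5)] by (simp add: bracket_add)
    have e2: "BB x M p X (cns Y z) - (cns (bracket x X Y) z + pscale (sgn2 p q) (cns Y ?w)) \<in> R (Suc n)"
      by (rule BB_cns_R[OF X 2(3,2,5)])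
    have e3: "BB x M p X (cns Z z) - (cns (bracket x X Z) z + pscale (sgn2 p q) (cns Z ?w)) \<in> R (Suc n)"
      by (rule BB_cns_R[OF X 2(4,2,5)])
    have e4: "cns (bracket x X Y + bracket x X Z) z - cns (bracket x X Y) z - cns (bracket x X Z) z \<in> R (Suc n)"
      by (rule cns_add_R[OF b _ 2(5)]) simp
    have e5: "pscale (sgn2 p q) (cns (Y + Z) ?w - cns Y ?w - cns Z ?w) \<in> R (Suc n)"
      by (intro R_closed(3) cns_add_R[OF 2(3,4,2) w])
    from R_closed(1)[OF R_closed(2)[OF R_closed(2)[OF e1 e2] e3] R_closed(1)[OF e4 e5]]
    show ?thesis unfolding 2(1) BB_simps by (simp add: pv.scale_right_diff_distrib algebra_simps)
  next
    case 3
    note b = H_bracket[OF X(1) 3(3) X(2) 3(2)]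
    let ?w = "BB x M p X z"
    have w: "?w \<in> F n" by (rule BB_F[OF X 3(4)])
    have e1: "BB x M p X (cns (gscale c Y) z) - (cns (gscale c (bracket x X Y)) z + pscale (sgn2 p q) (cns (gscale c Y) ?w)) \<in> R (Suc n)"
      using BB_cns_R[OF X H_gscale[OF 3(3)] 3(2,4)] by (simp add: bracket_gscale)
    have e2: "pscale c (BB x M p X (cns Y z) - (cns (bracket x X Y) z + pscale (sgn2 p q) (cns Y ?w))) \<in> R (Suc n)"
      by (intro R_closed(3) BB_cns_R[OF X 3(3,2,4)])
    have e4: "cns (gscale c (bracket x X Y)) z - pscale c (cns (bracket x X Y) z) \<in> R (Suc n)"
      by (rule cns_gscale_R[OF b _ 3(4)]) simp
    have e5: "pscale (sgn2 p q) (cns (gscale c Y) ?w - pscale c (cns Y ?w)) \<in> R (Suc n)"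
      by (intro R_closed(3) cns_gscale_R[OF 3(3,2) w])
    from R_closed(1)[OF R_closed(2)[OF e1 e2] R_closed(1)[OF e4 e5]]
    show ?thesis unfolding 3(1) BB_simps
      by (simp add: pv.scale_right_diff_distrib pv.scale_right_distrib algebra_simps)
  next
    case 4
    note b = H_bracket[OF X(1) 4(5) X(2) 4(3)] H_bracket[OF X(1) 4(6) X(2) 4(4)]
    let ?w = "BB x M p X z"
    have w: "?w \<in> F k" by (rule BB_F[OF X 4(7)])
    define A B C where "A = sgn2 q q'" and "B = sgn2 p q" and "C = sgn2 p q'"
    have sq: "A * A = 1" "B * B = 1" "C * C = 1" "A * (A * s) = s" "B * (B * s) = s" "C * (C * s) = s" for s
      by (simp_all add: A_def B_def C_def)
    have e: "BB x M p X (cns Y (cns Z z)) - (cns (bracket x X Y) (cns Z z) + pscale B (cns Y (cns (bracket x X Z) z))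
       + pscale (B * C) (cns Y (cns Z ?w))) \<in> R (Suc (Suc k))"
      if "Y \<in> H q" "Z \<in> H q'" "q < 2" "q' < 2" "B = sgn2 p q" "C = sgn2 p q'" for Y Z q q' B C
    proof -
      have 1: "BB x M p X (cns Y (cns Z z)) - (cns (bracket x X Y) (cns Z z) + pscale B (cns Y (BB x M p X (cns Z z)))) \<in> R (Suc (Suc k))"
        using BB_cns_R[OF X that(1,3) cns_F[OF that(2,4) 4(7)]] by (simp add: that)
      have 2: "pscale B (cns Y (BB x M p X (cns Z z) - (cns (bracket x X Z) z + pscale C (cns Z ?w)))) \<in> R (Suc (Suc k))"
        using BB_cns_R[OF X that(2,4) 4(7)] by (intro R_closed(3) cns_R[OF that(1,3)]) (simp add: that)
      from R_closed(1)[OF 1 2] show ?thesis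
        by (simp add: cns_simps pv.scale_right_diff_distrib pv.scale_right_distrib algebra_simps)
    qed
    note e1 = e[OF 4(5,6,3,4) B_def C_def] and e2 = R_closed(3)[OF e[OF 4(6,5,4,3) C_def B_def], of A]
    \<comment> \<open>The element \<open>X\<close> meets the first factor, the second one or the
      rest; each of the three resulting pairs is an exchange relation, with the sign adjusted by the
      parity of \<open>X\<close>.\<close>
    have s1: "cns (bracket x X Y) (cns Z z) + pscale (C * A) (cns Z (cns (bracket x X Y) z)) \<in> R (Suc (Suc k))"
      using cns_swap_R[OF b(1) 4(6) _ 4(4) 4(7)] by (simp add: sgn2_mod A_def C_def)
    have s2: "pscale B (cns Y (cns (bracket x X Z) z) + pscale (B * A) (cns (bracket x X Z) (cns Y z))) \<in> R (Suc (Suc k))"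
      using cns_swap_R[OF 4(5) b(2) 4(3) _ 4(7)] by (intro R_closed(3)) (simp add: sgn2_mod A_def B_def mult.commute)
    have s3: "pscale (B * C) (cns Y (cns Z ?w) + pscale A (cns Z (cns Y ?w))) \<in> R (Suc (Suc k))"
      using cns_swap_R[OF 4(5,6,3,4) w] by (intro R_closed(3)) (simp add: A_def)
    from R_closed(1)[OF R_closed(1)[OF e1 e2] R_closed(1)[OF s1 R_closed(1)[OF s2 s3]]]
    show ?thesis unfolding 4(1,2) BB_simps A_def[symmetric]
      by (simp add: pv.scale_right_diff_distrib pv.scale_right_distrib algebra_simps sq)
  qed
qed

lemma BB_R:
  assumes "X \<in> HL p" "p < 2" "r \<in> R n"
  shows "BB x M p X r \<in> R n"
  using assms(3)
proof (induction n arbitrary: r)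
  case 0
  have X: "X \<in> L" using assms by (simp add: HL_iff)
  show ?case
    by (rule span_into[OF BB_simps(1,4) _ R_subspace subsetD[OF R_0 0]])
      (auto simp: BB_simps act_add[OF X] act_smult[OF X] X intro!: R_v_add R_v_smult simp del: pscale_bas)
next
  case (Suc n)
  show ?case by (rule BB_step_R[OF assms(1,2) Suc.IH Suc.prems])
qed

lemma BB_add_R:
  assumes "X \<in> HL p" "X' \<in> HL p" "X + X' \<in> L" "p < 2" "z \<in> F n"
  shows "BB x M p (X + X') z - BB x M p X z - BB x M p X' z \<in> R n"
proof -
  have L: "X \<in> L" "X' \<in> L" "X \<in> gt_hom x p" "X' \<in> gt_hom x p" using assms by (auto simp: HL_iff)
  have s: "sB x M p (X + X') xs v - sB x M p X xs v - sB x M p X' xs v \<in> R n" if "(xs, v) \<in> gens x U M n" for xs v n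
    using that
  proof (induction xs arbitrary: n)
    case Nil
    thus ?case using L by (auto simp: act_add_left intro!: R_v_add)
  next
    case (Cons Y xs)
    then obtain k q where k: "n = Suc k" "q < 2" "Y \<in> H q" "(xs, v) \<in> gens x U M k" by (auto simp: gens_Cons)
    note b = H_bracket[OF assms(1) k(3) assms(4) k(2)] H_bracket[OF assms(2) k(3) assms(4) k(2)]
    have 1: "bas ((bracket x X Y + bracket x X' Y) # xs, v) - bas (bracket x X Y # xs, v) - bas (bracket x X' Y # xs, v) \<in> R (Suc k)"
      using cns_add_R[OF b, of "bas (xs, v)" k] k(4) by simp
    have 2: "pscale (sgn2 p (deg x Y)) (cns Y (sB x M p (X + X') xs v - sB x M p X xs v - sB x M p X' xs v)) \<in> R (Suc k)"
      by (intro R_closed(3) cns_R[OF k(3,2)] Cons.IH k(4))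
    from R_closed(1)[OF 1 2] show ?case
      by (simp add: k(1) bracket_add cns_simps pv.scale_right_diff_distrib algebra_simps)
  qed
  show ?thesis
  proof (rule F_into[OF _ _ _ R_subspace assms(5), of "\<lambda>z. BB x M p (X + X') z - BB x M p X z - BB x M p X' z"])
    fix xs v assume "(xs, v) \<in> gens x U M n"
    thus "BB x M p (X + X') (bas (xs, v)) - BB x M p X (bas (xs, v)) - BB x M p X' (bas (xs, v)) \<in> R n"
      using s by simp
  qed (simp_all add: BB_simps pv.scale_right_diff_distrib algebra_simps)
qed

lemma BB_gscale_R:
  assumes "X \<in> HL p" "p < 2" "z \<in> F n"
  shows "BB x M p (gscale c X) z - pscale c (BB x M p X z) \<in> R n"
proof -
  have L: "X \<in> L" "X \<in> gt_hom x p" using assms by (auto simp: HL_iff)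
  have s: "sB x M p (gscale c X) xs v - pscale c (sB x M p X xs v) \<in> R n" if "(xs, v) \<in> gens x U M n" for xs v n
    using that
  proof (induction xs arbitrary: n)
    case Nil
    thus ?case using L by (auto simp: act_gscale intro!: R_v_smult simp del: pscale_bas)
  next
    case (Cons Y xs)
    then obtain k q where k: "n = Suc k" "q < 2" "Y \<in> H q" "(xs, v) \<in> gens x U M k" by (auto simp: gens_Cons)
    note b = H_bracket[OF assms(1) k(3) assms(2) k(2)]
    have 1: "bas (gscale c (bracket x X Y) # xs, v) - pscale c (bas (bracket x X Y # xs, v)) \<in> R (Suc k)"
      using cns_gscale_R[OF b, of "bas (xs, v)" k c] k(4) by (simp del: pscale_bas)
    have 2: "pscale (sgn2 p (deg x Y)) (cns Y (sB x M p (gscale c X) xs v - pscale c (sB x M p X xs v))) \<in> R (Suc k)"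
      by (intro R_closed(3) cns_R[OF k(3,2)] Cons.IH k(4))
    from R_closed(1)[OF 1 2] show ?case
      by (simp add: k(1) bracket_gscale cns_simps pv.scale_right_diff_distrib pv.scale_right_distrib algebra_simps del: pscale_bas)
  qed
  show ?thesis
  proof (rule F_into[OF _ _ _ R_subspace assms(3), of "\<lambda>z. BB x M p (gscale c X) z - pscale c (BB x M p X z)"])
    fix xs v assume "(xs, v) \<in> gens x U M n"
    thus "BB x M p (gscale c X) (bas (xs, v)) - pscale c (BB x M p X (bas (xs, v))) \<in> R n"
      using s by simp
  qed (simp_all add: BB_simps pv.scale_right_diff_distrib pv.scale_right_distrib algebra_simps)
qed

lemma BB_0_R: "p < 2 \<Longrightarrow> z \<in> F n \<Longrightarrow> BB x M p 0 z \<in> R n"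
  using BB_gscale_R[OF HL_0, of p z n 0] by simp

lemma R_v_diff:
  assumes "(xs, b) \<in> gens x U M n" "c \<in> carrier M"
  shows "bas (xs, b \<ominus> k \<odot> c) - (bas (xs, b) - pscale k (bas (xs, c))) \<in> R n"
proof -
  have b: "b \<in> carrier M" using gens_carrier[OF assms(1)] .
  let ?d = "b \<ominus> k \<odot> c"
  have d: "?d \<in> carrier M" "?d \<oplus> k \<odot> c = b"
    using b assms(2) by (simp_all add: M.minus_eq M.a_assoc M.l_neg)
  have "bas (xs, ?d \<oplus> k \<odot> c) - bas (xs, ?d) - bas (xs, k \<odot> c) \<in> R n"
    using assms d by (intro R_v_add gens_v[OF assms(1)]) auto
  moreover have "bas (xs, k \<odot> c) - pscale k (bas (xs, c)) \<in> R n"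
    using assms by (intro R_v_smult gens_v[OF assms(1)]) auto
  ultimately have "- ((bas (xs, ?d \<oplus> k \<odot> c) - bas (xs, ?d) - bas (xs, k \<odot> c)) +
     (bas (xs, k \<odot> c) - pscale k (bas (xs, c)))) \<in> R n"
    by (intro R_closed(5)[OF R_closed(1)])
  thus ?thesis unfolding d(2) by (simp add: algebra_simps)
qed

text \<open>Induction on the number of factors. Expanding on a first factor \<open>Z\<close>, the
  terms in which only one of \<open>X\<close>, \<open>Y\<close> is bracketed with \<open>Z\<close>
  cancel, the terms with a double bracket match by the Jacobi identity, and those leaving
  \<open>Z\<close> alone are the induction hypothesis. Without factors it is the module
  axiom.\<close>

lemma BB_bracket_R:
  assumes X: "X \<in> HL p" "p < 2" and Y: "Y \<in> H q" "q < 2" and "z \<in> F n"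
  shows "BB x M p X (BB x M q Y z) - pscale (sgn2 p q) (BB x M q Y (BB x M p X z))
    - BB x M ((p + q) mod 2) (bracket x X Y) z \<in> R n"
proof -
  let ?XY = "bracket x X Y"
  define A where "A = sgn2 p q"
  have A': "A = sgn2 q p" by (simp add: A_def mult.commute)
  have XY: "?XY \<in> H ((p + q) mod 2)" by (rule H_bracket[OF X(1) Y(1) X(2) Y(2)])
  note YL = H_HL[OF Y(1)] and XYL = H_HL[OF XY]
  have lin: "BB x M p X (BB x M q Y (a + b)) - pscale A (BB x M q Y (BB x M p X (a + b))) - BB x M ((p + q) mod 2) ?XY (a + b) =
    (BB x M p X (BB x M q Y a) - pscale A (BB x M q Y (BB x M p X a)) - BB x M ((p + q) mod 2) ?XY a) +
    (BB x M p X (BB x M q Y b) - pscale A (BB x M q Y (BB x M p X b)) - BB x M ((p + q) mod 2) ?XY b)"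
    "BB x M p X (BB x M q Y (pscale c a)) - pscale A (BB x M q Y (BB x M p X (pscale c a))) - BB x M ((p + q) mod 2) ?XY (pscale c a) =
    pscale c (BB x M p X (BB x M q Y a) - pscale A (BB x M q Y (BB x M p X a)) - BB x M ((p + q) mod 2) ?XY a)" for a b c
    by (simp_all add: BB_simps pv.scale_right_distrib pv.scale_right_diff_distrib algebra_simps)
  have "BB x M p X (BB x M q Y z) - pscale A (BB x M q Y (BB x M p X z)) - BB x M ((p + q) mod 2) ?XY z \<in> R n"
    using assms(5)
  proof (induction n arbitrary: z)
    case 0
    show ?case
    proof (rule F_into[OF lin _ R_subspace 0])
      fix xs v assume "(xs, v) \<in> gens x U M 0"
      hence [simp]: "xs = []" and v: "v \<in> carrier M" by (auto simp: gens_0)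
      have L: "X \<in> L" "Y \<in> L" "X \<in> gt_hom x p" "Y \<in> gt_hom x q" using X YL by (auto simp: HL_iff)
      have "bas ([], act M X (act M Y v) \<ominus> A \<odot> act M Y (act M X v)) -
          (bas ([], act M X (act M Y v)) - pscale A (bas ([], act M Y (act M X v)))) \<in> R 0"
        using L v by (intro R_v_diff) auto
      from R_sym[OF this] show "BB x M p X (BB x M q Y (bas (xs, v))) - pscale A (BB x M q Y (BB x M p X (bas (xs, v))))
          - BB x M ((p + q) mod 2) ?XY (bas (xs, v)) \<in> R 0"
        using act_bracket[OF L(1,2,3,4) X(2) Y(2) v] by (simp add: A_def del: pscale_bas)
    qed
  next
    case (Suc n)
    show ?case
    proof (rule F_into[OF lin _ R_subspace Suc.prems])
      fix xs v assume "(xs, v) \<in> gens x U M (Suc n)"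
      then obtain Z ys r where Z: "xs = Z # ys" "r < 2" "Z \<in> H r" "(ys, v) \<in> gens x U M n" by (rule gens_SucE)
      define B C where "B = sgn2 p r" and "C = sgn2 q r"
      have sq: "A * A = 1" "B * B = 1" "C * C = 1" "A * (A * s) = s" "B * (B * s) = s" "C * (C * s) = s" for s
        by (simp_all add: A_def B_def C_def)
      define w where "w = (bas (ys, v) :: gt list \<times> 'v \<Rightarrow>\<^sub>0 complex)"
      have w: "w \<in> F n" using Z(4) by (simp add: w_def)
      note Yw = BB_F[OF YL Y(2) w] and Xw = BB_F[OF X w]
      note YZ = H_bracket[OF YL Z(3) Y(2) Z(2)] and XZ = H_bracket[OF X(1) Z(3) X(2) Z(2)]
      have m: "k mod 2 < (2::nat)" for k by simp
      have 1: "BB x M p X (BB x M q Y (cns Z w) - (cns (bracket x Y Z) w + pscale C (cns Z (BB x M q Y w)))) \<in> R (Suc n)"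
        using BB_cns_R[OF YL Y(2) Z(3,2) w] by (intro BB_R[OF X]) (simp add: C_def)
      have 2: "BB x M p X (cns (bracket x Y Z) w) - (cns (bracket x X (bracket x Y Z)) w + pscale (A * B) (cns (bracket x Y Z) (BB x M p X w))) \<in> R (Suc n)"
        using BB_cns_R[OF X YZ m w] by (simp add: sgn2_mod A_def B_def)
      have 3: "pscale C (BB x M p X (cns Z (BB x M q Y w)) - (cns (bracket x X Z) (BB x M q Y w) + pscale B (cns Z (BB x M p X (BB x M q Y w))))) \<in> R (Suc n)"
        using BB_cns_R[OF X Z(3,2) Yw] by (intro R_closed(3)) (simp add: B_def)
      have 4: "pscale A (BB x M q Y (BB x M p X (cns Z w) - (cns (bracket x X Z) w + pscale B (cns Z (BB x M p X w))))) \<in> R (Suc n)"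
        using BB_cns_R[OF X Z(3,2) w] by (intro R_closed(3) BB_R[OF YL Y(2)]) (simp add: B_def)
      have 5: "pscale A (BB x M q Y (cns (bracket x X Z) w) - (cns (bracket x Y (bracket x X Z)) w + pscale (A * C) (cns (bracket x X Z) (BB x M q Y w)))) \<in> R (Suc n)"
        using BB_cns_R[OF YL Y(2) XZ m w] by (intro R_closed(3)) (simp add: sgn2_mod A' C_def)
      have 6: "pscale (A * B) (BB x M q Y (cns Z (BB x M p X w)) - (cns (bracket x Y Z) (BB x M p X w) + pscale C (cns Z (BB x M q Y (BB x M p X w))))) \<in> R (Suc n)"
        using BB_cns_R[OF YL Y(2) Z(3,2) Xw] by (intro R_closed(3)) (simp add: C_def)
      have 7: "BB x M ((p + q) mod 2) ?XY (cns Z w) - (cns (bracket x ?XY Z) w + pscale (B * C) (cns Z (BB x M ((p + q) mod 2) ?XY w))) \<in> R (Suc n)"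
        using BB_cns_R[OF XYL m Z(3,2) w] by (simp add: sgn2_mod B_def C_def)
      have h: "bracket x ?XY Z \<in> H ((p + q + r) mod 2)" "bracket x Y (bracket x X Z) \<in> H ((p + q + r) mod 2)"
        using H_bracket[OF XYL Z(3) m Z(2)] H_bracket[OF YL XZ Y(2) m]
        by (simp_all add: mod_add_left_eq mod_add_right_eq ac_simps)
      have jac: "bracket x X (bracket x Y Z) = bracket x ?XY Z + gscale A (bracket x Y (bracket x X Z))"
        unfolding A_def by (rule bracket_jacobi[of X x p Y q Z r]) (use X Y Z in \<open>auto simp: H_iff HL_iff\<close>)
      have 8: "cns (bracket x X (bracket x Y Z)) w - cns (bracket x ?XY Z) w - cns (gscale A (bracket x Y (bracket x X Z))) w \<in> R (Suc n)"
        unfolding jac by (rule cns_add_R[OF h(1) H_gscale[OF h(2)] m w])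
      have 9: "cns (gscale A (bracket x Y (bracket x X Z))) w - pscale A (cns (bracket x Y (bracket x X Z)) w) \<in> R (Suc n)"
        by (rule cns_gscale_R[OF h(2) m w])
      have 10: "pscale (B * C) (cns Z (BB x M p X (BB x M q Y w) - pscale A (BB x M q Y (BB x M p X w)) - BB x M ((p + q) mod 2) ?XY w)) \<in> R (Suc n)"
        by (intro R_closed(3) cns_R[OF Z(3,2)] Suc.IH w)
      from R_closed(1)[OF R_closed(2)[OF R_closed(2)[OF R_closed(1)[OF R_closed(1)[OF 1 2] 3]
          R_closed(1)[OF R_closed(1)[OF 4 5] 6]] 7] R_closed(1)[OF R_closed(1)[OF 8 9] 10]]
      show "BB x M p X (BB x M q Y (bas (xs, v))) - pscale A (BB x M q Y (BB x M p X (bas (xs, v))))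
          - BB x M ((p + q) mod 2) ?XY (bas (xs, v)) \<in> R (Suc n)"
        unfolding Z(1) cns_bas[symmetric] w_def[symmetric]
        by (simp add: BB_simps cns_simps pv.scale_right_diff_distrib pv.scale_right_distrib algebra_simps sq)
    qed
  qed
  thus ?thesis by (simp add: A_def)
qed

lemma DD_cns_R:
  assumes "Y \<in> H q" "q < 2" "z \<in> F n"
  shows "DD x M (cns Y z) - (- BB x M q Y z - cns Y (DD x M z)) \<in> R n"
proof (cases "Y = 0")
  case True
  have "BB x M q 0 z - BB x M (deg x 0) 0 z \<in> R n"
    by (intro R_closed(2) BB_0_R assms) simp
  thus ?thesis by (simp add: DD_cns True)
next
  case False
  hence "deg x Y = q" using assms by (auto intro!: deg_eq simp: H_iff)
  thus ?thesis by (simp add: DD_cns R_closed)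
qed

text \<open>Absorbs the truncated subtraction in degrees: a boundary has one factor less, and in
  degree 0, where there is none to lose, it is 0.\<close>

lemma cns_DD_rel:
  assumes "\<And>z k. n = Suc k \<Longrightarrow> z \<in> F k \<Longrightarrow> f z \<in> R n" "f 0 = 0" "z \<in> F n"
  shows "f (DD x M z) \<in> R n"
proof (cases n)
  case 0
  thus ?thesis using DD_F_0 assms by (simp add: R_closed)
next
  case (Suc k)
  thus ?thesis using assms(1)[OF Suc DD_F_Suc] assms(3) by simp
qed

text \<open>The critical case is an exchange relation. Applying Cartan's formula twice, the terms
  with the action of \<open>Y\<close> or \<open>Z\<close> on the rest cancel in pairs, and the
  remaining brackets of \<open>Y\<close> with \<open>Z\<close> and of \<open>Z\<close> with
  \<open>Y\<close> cancel by antisymmetry.\<close>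

lemma DD_R: "r \<in> R n \<Longrightarrow> DD x M r \<in> R (n - 1)"
proof (induction n arbitrary: r)
  case 0
  thus ?case using DD_F_0[of r] R_F[of 0] by (auto simp: R_closed)
next
  case (Suc n)
  have "DD x M r \<in> R n"
  proof (rule span_into[OF DD_simps(1,4) _ R_subspace subsetD[OF R_Suc Suc.prems]])
    fix g assume "g \<in> step_rels n"
    then consider
      (1) Y r q where "g = cns Y r" "q < 2" "Y \<in> H q" "r \<in> R n"
      | (2) Y Z z q where "g = cns (Y + Z) z - cns Y z - cns Z z" "q < 2" "Y \<in> H q" "Z \<in> H q" "z \<in> F n"
      | (3) c Y z q where "g = cns (gscale c Y) z - pscale c (cns Y z)" "q < 2" "Y \<in> H q" "z \<in> F n"
      | (4) Y Z z q q' k where "g = cns Y (cns Z z) + pscale (sgn2 q q') (cns Z (cns Y z))" "n = Suc k"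
          "q < 2" "q' < 2" "Y \<in> H q" "Z \<in> H q'" "z \<in> F k"
      unfolding step_rels_def by blast
    thus "DD x M g \<in> R n"
    proof cases
      case 1
      have "r \<in> F n" using 1(4) R_F by blast
      have "cns Y (DD x M r) \<in> R n"
      proof (cases n)
        case 0
        thus ?thesis using DD_F_0[of r] \<open>r \<in> F n\<close> by (simp add: cns_simps R_closed)
      next
        case (Suc k)
        thus ?thesis using cns_R[OF 1(3,2)] Suc.IH[OF 1(4)] by simp
      qed
      moreover have "BB x M q Y r \<in> R n" by (rule BB_R[OF H_HL[OF 1(3)] 1(2,4)])
      ultimately have "- BB x M q Y r - cns Y (DD x M r) \<in> R n"
        by (intro R_closed(2)[OF R_closed(5)])
      thus ?thesis unfolding 1(1) using R_mem[OF DD_cns_R[OF 1(3,2) \<open>r \<in> F n\<close>]] by blast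
    next
      case 2
      have L: "Y + Z \<in> L" using H_add[OF 2(3,4)] UL by (auto simp: H_iff)
      have e4: "BB x M q (Y + Z) z - BB x M q Y z - BB x M q Z z \<in> R n"
        by (rule BB_add_R[OF H_HL[OF 2(3)] H_HL[OF 2(4)] L 2(2,5)])
      have e5: "cns (Y + Z) (DD x M z) - cns Y (DD x M z) - cns Z (DD x M z) \<in> R n"
        by (rule cns_DD_rel[of n "\<lambda>w. cns (Y + Z) w - cns Y w - cns Z w", OF _ _ 2(5)])
          (use cns_add_R[OF 2(3,4,2)] in \<open>auto simp: cns_simps\<close>)
      from R_closed(2)[OF R_closed(2)[OF R_closed(2)[OF DD_cns_R[OF H_add[OF 2(3,4)] 2(2,5)]
          DD_cns_R[OF 2(3,2,5)]] DD_cns_R[OF 2(4,2,5)]] R_closed(1)[OF e4 e5]]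
      show ?thesis unfolding 2(1) DD_simps by (simp add: algebra_simps)
    next
      case 3
      have e4: "BB x M q (gscale c Y) z - pscale c (BB x M q Y z) \<in> R n"
        by (rule BB_gscale_R[OF H_HL[OF 3(3)] 3(2,4)])
      have e5: "cns (gscale c Y) (DD x M z) - pscale c (cns Y (DD x M z)) \<in> R n"
        by (rule cns_DD_rel[of n "\<lambda>w. cns (gscale c Y) w - pscale c (cns Y w)", OF _ _ 3(4)])
          (use cns_gscale_R[OF 3(3,2)] in \<open>auto simp: cns_simps\<close>)
      from R_closed(2)[OF R_closed(2)[OF DD_cns_R[OF H_gscale[OF 3(3), of c] 3(2,4)]
          R_closed(3)[OF DD_cns_R[OF 3(3,2,4)], of c]] R_closed(1)[OF e4 e5]]
      show ?thesis unfolding 3(1) DD_simps by (simp add: pv.scale_right_diff_distrib algebra_simps)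
    next
      case 4
      define A where "A = sgn2 q q'"
      have sq: "A * A = 1" "A * (A * s) = s" for s by (simp_all add: A_def)
      have A': "sgn2 q' q = A" by (simp add: A_def mult.commute)
      note Yz = cns_F[OF 4(5,3,7)] and Zz = cns_F[OF 4(6,4,7)]
      have e: "DD x M (cns Y (cns Z z)) - (- (cns (bracket x Y Z) z + pscale (sgn2 q q') (cns Z (BB x M q Y z)))
          + cns Y (BB x M q' Z z) + cns Y (cns Z (DD x M z))) \<in> R (Suc k)"
        if "Y \<in> H q" "Z \<in> H q'" "q < 2" "q' < 2" for Y Z q q'
      proof -
        have "cns Y (DD x M (cns Z z) - (- BB x M q' Z z - cns Z (DD x M z))) \<in> R (Suc k)"
          by (intro cns_R[OF that(1,3)] DD_cns_R[OF that(2,4) 4(7)])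
        from R_closed(2)[OF DD_cns_R[OF that(1,3) cns_F[OF that(2,4) 4(7)]]
            R_closed(1)[OF this BB_cns_R[OF H_HL[OF that(1)] that(3,2,4) 4(7)]]]
        show ?thesis by (simp add: cns_simps algebra_simps)
      qed
      have e5: "cns Y (cns Z (DD x M z)) + pscale A (cns Z (cns Y (DD x M z))) \<in> R (Suc k)"
      proof (cases k)
        case 0
        thus ?thesis using DD_F_0[of z] 4(7) by (simp add: cns_simps R_closed)
      next
        case (Suc j)
        thus ?thesis using cns_swap_R[OF 4(5,6,3,4) DD_F_Suc] 4(7) by (simp add: A_def)
      qed
      have ant: "bracket x Z Y = gscale (- A) (bracket x Y Z)"
        unfolding A_def by (rule bracket_antisym[of Y x q Z q']) (use 4 in \<open>auto simp: H_iff\<close>)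
      have e6: "pscale A (cns (bracket x Z Y) z - pscale (- A) (cns (bracket x Y Z) z)) \<in> R (Suc k)"
        unfolding ant by (intro R_closed(3) cns_gscale_R[OF H_bracket[OF H_HL[OF 4(5)] 4(6,3,4)] _ 4(7)]) simp
      from R_closed(1)[OF R_closed(1)[OF e[OF 4(5,6,3,4)] R_closed(3)[OF e[OF 4(6,5,4,3)], of A]] R_closed(2)[OF e5 e6]]
      show ?thesis unfolding 4(1,2) DD_simps A_def[symmetric] A'
        by (simp add: pv.scale_right_diff_distrib pv.scale_right_distrib algebra_simps sq)
    qed
  qed
  thus ?case by simp
qed

text \<open>Cartan's formula on a first factor \<open>Y\<close> leaves the commutator of the actions
  of \<open>X\<close> and \<open>Y\<close> minus the action of their bracket, which is
  \<open>BB_bracket_R\<close>, and the same statement for the remaining factors.\<close>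

lemma DD_BB_R:
  assumes X: "X \<in> HL p" "p < 2" and "z \<in> F n"
  shows "DD x M (BB x M p X z) - BB x M p X (DD x M z) \<in> R (n - 1)"
proof -
  have lin: "DD x M (BB x M p X (a + b)) - BB x M p X (DD x M (a + b)) =
      (DD x M (BB x M p X a) - BB x M p X (DD x M a)) + (DD x M (BB x M p X b) - BB x M p X (DD x M b))"
    "DD x M (BB x M p X (pscale c a)) - BB x M p X (DD x M (pscale c a)) =
      pscale c (DD x M (BB x M p X a) - BB x M p X (DD x M a))" for a b c
    by (simp_all add: BB_simps DD_simps pv.scale_right_diff_distrib algebra_simps)
  show ?thesis using assms(3)
  proof (induction n arbitrary: z)
    case 0
    thus ?case using DD_F_0[OF BB_F[OF X 0]] DD_F_0[OF 0] by (simp add: BB_simps R_closed)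
  next
    case (Suc n)
    show ?case
    proof (rule F_into[OF lin _ R_subspace Suc.prems])
      fix xs v assume "(xs, v) \<in> gens x U M (Suc n)"
      then obtain Y ys q where Y: "xs = Y # ys" "q < 2" "Y \<in> H q" "(ys, v) \<in> gens x U M n" by (rule gens_SucE)
      define A where "A = sgn2 p q"
      define w where "w = (bas (ys, v) :: gt list \<times> 'v \<Rightarrow>\<^sub>0 complex)"
      have w: "w \<in> F n" using Y(4) by (simp add: w_def)
      have m: "k mod 2 < (2::nat)" for k by simp
      note Xw = BB_F[OF X w] and XY = H_bracket[OF X(1) Y(3) X(2) Y(2)] and YL = H_HL[OF Y(3)]
      have 1: "DD x M (BB x M p X (cns Y w) - (cns (bracket x X Y) w + pscale A (cns Y (BB x M p X w)))) \<in> R n"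
        using DD_R[OF BB_cns_R[OF X Y(3,2) w]] by (simp add: A_def)
      have 2: "DD x M (cns (bracket x X Y) w) - (- BB x M ((p + q) mod 2) (bracket x X Y) w - cns (bracket x X Y) (DD x M w)) \<in> R n"
        by (rule DD_cns_R[OF XY m w])
      have 3: "pscale A (DD x M (cns Y (BB x M p X w)) - (- BB x M q Y (BB x M p X w) - cns Y (DD x M (BB x M p X w)))) \<in> R n"
        by (intro R_closed(3) DD_cns_R[OF Y(3,2) Xw])
      have 4: "BB x M p X (DD x M (cns Y w) - (- BB x M q Y w - cns Y (DD x M w))) \<in> R n"
        by (intro BB_R[OF X] DD_cns_R[OF Y(3,2) w])
      have 5: "BB x M p X (cns Y (DD x M w)) - (cns (bracket x X Y) (DD x M w) + pscale A (cns Y (BB x M p X (DD x M w)))) \<in> R n"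
        unfolding A_def
        by (rule cns_DD_rel[of n "\<lambda>w. BB x M p X (cns Y w) - (cns (bracket x X Y) w + pscale (sgn2 p q) (cns Y (BB x M p X w)))", OF _ _ w])
          (use BB_cns_R[OF X Y(3,2)] in \<open>auto simp: cns_simps BB_simps\<close>)
      have 6: "BB x M p X (BB x M q Y w) - pscale A (BB x M q Y (BB x M p X w)) - BB x M ((p + q) mod 2) (bracket x X Y) w \<in> R n"
        using BB_bracket_R[OF X Y(3,2) w] by (simp add: A_def)
      have 7: "pscale A (cns Y (DD x M (BB x M p X w) - BB x M p X (DD x M w))) \<in> R n"
      proof (cases n)
        case 0
        thus ?thesis using DD_F_0[of "BB x M p X w"] DD_F_0[of w] Xw w by (simp add: BB_simps cns_simps R_closed)
      next
        case (Suc k)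
        thus ?thesis using cns_R[OF Y(3,2) Suc.IH[OF w, unfolded Suc, simplified]] by (simp add: R_closed)
      qed
      from R_closed(1)[OF R_closed(2)[OF R_closed(1)[OF R_closed(1)[OF R_closed(1)[OF 1 2] 3] 6] R_closed(1)[OF 7 4]] 5]
      show "DD x M (BB x M p X (bas (xs, v))) - BB x M p X (DD x M (bas (xs, v))) \<in> R (Suc n - 1)"
        unfolding Y(1) cns_bas[symmetric] w_def[symmetric]
        by (simp add: BB_simps DD_simps cns_simps pv.scale_right_diff_distrib pv.scale_right_distrib algebra_simps)
    qed
  qed
qed

text \<open>By Cartan's formula, dd(Yw) = -d(Y.w) + Y.dw + Y ddw; equivariance cancels the first two
  terms and induction treats the third.\<close>

lemma DD_DD_R:
  assumes "z \<in> F n"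
  shows "DD x M (DD x M z) \<in> R (n - 2)"
proof -
  have lin: "DD x M (DD x M (a + b)) = DD x M (DD x M a) + DD x M (DD x M b)"
    "DD x M (DD x M (pscale c a)) = pscale c (DD x M (DD x M a))" for a b c
    by (simp_all add: DD_simps)
  show ?thesis using assms
  proof (induction n arbitrary: z)
    case 0
    thus ?case using DD_F_0[OF 0] by (simp add: DD_simps R_closed)
  next
    case (Suc n)
    show ?case
    proof (rule F_into[OF lin _ R_subspace Suc.prems])
      fix xs v assume "(xs, v) \<in> gens x U M (Suc n)"
      then obtain Y ys q where Y: "xs = Y # ys" "q < 2" "Y \<in> H q" "(ys, v) \<in> gens x U M n" by (rule gens_SucE)
      define w where "w = (bas (ys, v) :: gt list \<times> 'v \<Rightarrow>\<^sub>0 complex)"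
      have w: "w \<in> F n" using Y(4) by (simp add: w_def)
      have 1: "DD x M (DD x M (cns Y w) - (- BB x M q Y w - cns Y (DD x M w))) \<in> R (n - 1)"
        by (intro DD_R DD_cns_R[OF Y(3,2) w])
      have 2: "DD x M (BB x M q Y w) - BB x M q Y (DD x M w) \<in> R (n - 1)"
        by (rule DD_BB_R[OF H_HL[OF Y(3)] Y(2) w])
      have 3: "DD x M (cns Y (DD x M w)) - (- BB x M q Y (DD x M w) - cns Y (DD x M (DD x M w))) \<in> R (n - 1)"
        by (rule DD_cns_R[OF Y(3,2) DD_F[OF w]])
      \<comment> \<open>For \<open>n < 2\<close> the truncated degree \<open>n - 2\<close> does not
        count factors correctly, but then the double boundary is 0.\<close>
      have 4: "cns Y (DD x M (DD x M w)) \<in> R (n - 1)"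
      proof (cases "n < 2")
        case True
        hence "DD x M (DD x M w) = 0" using DD_F_0[of "DD x M w"] DD_F[OF w] by (cases n) auto
        thus ?thesis by (simp add: cns_simps R_closed)
      next
        case False
        hence "n - 1 = Suc (n - 2)" by simp
        thus ?thesis using cns_R[OF Y(3,2) Suc.IH[OF w]] by simp
      qed
      from R_closed(1)[OF R_closed(2)[OF R_closed(2)[OF 1 2] 3] 4]
      show "DD x M (DD x M (bas (xs, v))) \<in> R (Suc n - 2)"
        unfolding Y(1) cns_bas[symmetric] w_def[symmetric]
        by (simp add: DD_simps numeral_2_eq_2 algebra_simps)
    qed
  qed
qed

section \<open>Agreement of the recursion with the explicit formulas for action and boundary\<close>

lemma cns_sum: "cns Y (sum f A) = (\<Sum>a\<in>A. cns Y (f a))"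
  by (simp add: cns_def linext_sum)

lemma sB_closed_form:
  "sB x M p X xs v = (\<Sum>i<length xs. pscale ((-1) ^ (p * (\<Sum>j<i. deg x (xs ! j)))) (bas (xs[i := bracket x X (xs ! i)], v)))
    + pscale ((-1) ^ (p * (\<Sum>j<length xs. deg x (xs ! j)))) (bas (xs, act M X v))"
proof (induction xs)
  case (Cons Y xs)
  show ?case
    by (simp add: Cons sum.lessThan_Suc_shift cns_simps cns_sum distrib_left power_add
        pv.scale_right_distrib pv.scale_sum_right del: pscale_bas sum.lessThan_Suc)
qed simp

lemma symbol_act_eq: "symbol_act x M X (xs, v) = (\<Sum>p<2. sB x M p (gt_comp x p X) xs v)"
  by (simp add: symbol_act_def sB_closed_form)

lemma gens_nth: "(xs, v) \<in> gens x U M n \<Longrightarrow> i < n \<Longrightarrow> xs ! i \<in> H (deg x (xs ! i))"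
proof -
  assume a: "(xs, v) \<in> gens x U M n" "i < n"
  hence "xs ! i \<in> set xs" "set xs \<subseteq> U \<inter> (gt_hom x 0 \<union> gt_hom x 1)" by (auto simp: gens_def)
  hence "xs ! i \<in> U \<inter> (gt_hom x 0 \<union> gt_hom x 1)" by blast
  thus ?thesis using in_hom_deg[of "xs ! i" x] by (auto simp: H_iff)
qed

lemma gens_nths:
  assumes "(xs, v) \<in> gens x U M n" "A \<subseteq> {..<n}"
  shows "(nths xs (- A), v) \<in> gens x U M (n - card A)"
proof -
  have "{i. i < length xs \<and> i \<in> - A} = {..<n} - A" using assms by (auto simp: gens_def)
  hence "length (nths xs (- A)) = n - card A"
    using assms(2) by (simp add: length_nths card_Diff_subset finite_subset[OF assms(2)])
  thus ?thesis using assms set_nths_subset[of xs "- A"] by (auto simp: gens_def)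
qed

text \<open>Each exchange with a neighbour contributes a minus sign and the sign of the two
  parities; for \<open>t\<close> exchanges these accumulate to the stated exponent.\<close>

lemma move_to_front_R:
  assumes "Z \<in> H q" "q < 2"
  shows "(xs, v) \<in> gens x U M n \<Longrightarrow> t < n \<Longrightarrow>
    bas (Z # nths xs (- {t}), v) - pscale ((-1) ^ (t + q * (\<Sum>j<t. deg x (xs ! j)))) (bas (xs[t := Z], v)) \<in> R n"
proof (induction t arbitrary: xs n)
  case 0
  then obtain k where k: "n = Suc k" by (cases n) auto
  obtain Y ys r where xs: "xs = Y # ys" by (rule gens_SucE[OF 0(1)[unfolded k]])
  have "nths xs (- {0}) = ys" by (simp add: xs nths_Cons nths_all)
  thus ?case by (simp add: xs R_closed)
next
  case (Suc t)
  then obtain k where k: "n = Suc k" by (cases n) auto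
  obtain Y ys r where Y: "xs = Y # ys" "r < 2" "Y \<in> H r" "(ys, v) \<in> gens x U M k"
    by (rule gens_SucE[OF Suc.prems(1)[unfolded k]])
  obtain j where j: "k = Suc j" using Suc.prems(2) k by (cases k) auto
  have s: "{j. Suc j \<in> - {Suc t}} = - {t}" "{j. j \<noteq> t} = - {t}" by auto
  have nths: "nths xs (- {Suc t}) = Y # nths ys (- {t})" by (simp add: Y(1) nths_Cons s)
  have g: "(nths ys (- {t}), v) \<in> gens x U M j"
    using gens_nths[OF Y(4), of "{t}"] Suc.prems(2) k j by simp
  have 1: "cns Z (cns Y (bas (nths ys (- {t}), v))) + pscale (sgn2 q (deg x Y)) (cns Y (cns Z (bas (nths ys (- {t}), v)))) \<in> R n"
    using cns_swap_R[OF assms(1) H_deg[OF Y(3,2)] assms(2) deg_lt_2, of "bas (nths ys (- {t}), v)" j] g k j by simp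
  have 2: "pscale (sgn2 q (deg x Y)) (cns Y (bas (Z # nths ys (- {t}), v)
     - pscale ((-1) ^ (t + q * (\<Sum>j<t. deg x (ys ! j)))) (bas (ys[t := Z], v)))) \<in> R n"
    unfolding k using Suc.prems(2) k by (intro R_closed(3) cns_R[OF Y(3,2)] Suc.IH[OF Y(4)]) simp
  from R_closed(2)[OF 1 2] show ?case
    unfolding nths by (simp add: Y(1) sum.lessThan_Suc_shift cns_simps distrib_left power_add
        pv.scale_right_distrib pv.scale_right_diff_distrib mult_ac del: sum.lessThan_Suc pscale_bas)
qed

text \<open>The explicit boundary satisfies Cartan's formula. Pairs containing the new factor
  \<open>Y\<close> yield the bracket terms of its action once the bracket is moved from the front to
  its place; all other pairs yield \<open>Y\<close> times a term of the old boundary once the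
  bracket and \<open>Y\<close> are exchanged.\<close>

lemma symbol_boundary_Cons_R:
  assumes Y: "Y \<in> H q" "q < 2" and g: "(xs, v) \<in> gens x U M n"
  shows "symbol_boundary x M (Y # xs, v) - (- sB x M (deg x Y) Y xs v - cns Y (symbol_boundary x M (xs, v))) \<in> R n"
proof -
  define d where "d j = deg x (xs ! j)" for j
  define e where "e = deg x Y"
  define S where "S t = (\<Sum>j<t. d j)" for t
  have len: "length xs = n" using g by (simp add: gens_def)
  \<comment> \<open>\<open>g0\<close>: pairs containing \<open>Y\<close>; \<open>g1\<close>: the
    other pairs, with \<open>Y\<close> among the factors; \<open>g2\<close> and \<open>h\<close>:
    the two kinds of terms in the boundary of \<open>xs\<close>; \<open>b0\<close>: the bracket
    terms in the action of \<open>Y\<close> on \<open>xs\<close>.\<close>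
  define g0 where "g0 t = pscale ((-1) ^ (Suc t + d t * (e + S t) + e * d t)) (bas (bracket x Y (xs ! t) # nths xs (- {t}), v))" for t
  define g1 where "g1 s t = pscale ((-1) ^ (s + t + d s * (e + S s) + d t * (e + S t) + d s * d t))
      (bas (bracket x (xs ! s) (xs ! t) # Y # nths xs (- {s, t}), v))" for s t
  define g2 where "g2 s t = pscale ((-1) ^ (s + t + d s * S s + d t * S t + d s * d t))
      (bas (bracket x (xs ! s) (xs ! t) # nths xs (- {s, t}), v))" for s t
  define h where "h s = pscale ((-1) ^ (Suc s + d s * (\<Sum>i\<in>{s<..<n}. d i))) (bas (nths xs (- {s}), act M (xs ! s) v))" for s
  define b0 where "b0 t = pscale ((-1) ^ (e * S t)) (bas (xs[t := bracket x Y (xs ! t)], v))" for t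
  have Ye: "Y \<in> H e" "e < 2" unfolding e_def using H_deg[OF Y] by auto
  have xsd: "xs ! t \<in> H (d t)" "d t < 2" if "t < n" for t
    using gens_nth[OF g that] by (auto simp: d_def)
  have shift: "(\<Sum>i\<in>{Suc s<..<Suc n}. deg x ((Y # xs) ! i)) = (\<Sum>i\<in>{s<..<n}. d i)" for s
    by (rule sum.reindex_bij_witness[of _ Suc "\<lambda>i. i - 1"]) (auto simp: d_def nth_Cons split: nat.splits)
  have shift0: "(\<Sum>i\<in>{0<..<Suc n}. deg x ((Y # xs) ! i)) = (\<Sum>i<n. d i)"
    by (rule sum.reindex_bij_witness[of _ Suc "\<lambda>i. i - 1"]) (auto simp: d_def nth_Cons split: nat.splits)
  have n0: "nths (Y # xs) (- {0}) = xs" by (simp add: nths_Cons nths_all)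
  have sets: "{j. Suc j \<in> - {Suc t}} = - {t}" "{j. Suc j \<in> - {0, Suc t}} = - {t}"
    "{j. Suc j \<in> - {Suc s, Suc t}} = - {s, t}" "{j. j \<noteq> t} = - {t}" "{j. j \<noteq> s \<and> j \<noteq> t} = - {s, t}" for s t by auto
  have S': "(\<Sum>j<Suc t. deg x ((Y # xs) ! j)) = e + S t" for t
    by (simp add: sum.lessThan_Suc_shift e_def S_def d_def del: sum.lessThan_Suc)
  have 1: "symbol_boundary x M (Y # xs, v) = (\<Sum>t<n. g0 t + (\<Sum>s<t. g1 s t)) +
      (- pscale ((-1) ^ (e * (\<Sum>i<n. d i))) (bas (xs, act M Y v)) - (\<Sum>s<n. cns Y (h s)))"
  proof -
    have "symbol_boundary x M (Y # xs, v) =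
      (\<Sum>t<n. (pscale ((-1) ^ (0 + Suc t + e * 0 + d t * (\<Sum>j<Suc t. deg x ((Y # xs) ! j)) + e * d t))
         (bas (bracket x Y (xs ! t) # nths (Y # xs) (- {0, Suc t}), v)))
       + (\<Sum>s<t. pscale ((-1) ^ (Suc s + Suc t + d s * (\<Sum>j<Suc s. deg x ((Y # xs) ! j)) + d t * (\<Sum>j<Suc t. deg x ((Y # xs) ! j)) + d s * d t))
          (bas (bracket x (xs ! s) (xs ! t) # nths (Y # xs) (- {Suc s, Suc t}), v)))) +
      (pscale ((-1) ^ (Suc 0 + e * (\<Sum>i\<in>{0<..<Suc n}. deg x ((Y # xs) ! i)))) (bas (nths (Y # xs) (- {0}), act M Y v))
       + (\<Sum>s<n. pscale ((-1) ^ (Suc (Suc s) + d s * (\<Sum>i\<in>{Suc s<..<Suc n}. deg x ((Y # xs) ! i))))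
          (bas (nths (Y # xs) (- {Suc s}), act M (xs ! s) v))))"
      unfolding symbol_boundary_def
      by (simp add: len sum.lessThan_Suc_shift[of _ n] sum.lessThan_Suc_shift[of _ t for t]
          d_def e_def del: sum.lessThan_Suc pscale_bas)
    also have "\<dots> = (\<Sum>t<n. g0 t + (\<Sum>s<t. g1 s t)) +
      (- pscale ((-1) ^ (e * (\<Sum>i<n. d i))) (bas (xs, act M Y v)) - (\<Sum>s<n. cns Y (h s)))"
      unfolding S' shift shift0 n0
      by (simp add: nths_Cons sets g0_def g1_def h_def cns_simps sum_negf del: pscale_bas) 
    finally show ?thesis .
  qed
  have 2: "cns Y (symbol_boundary x M (xs, v)) = (\<Sum>t<n. \<Sum>s<t. cns Y (g2 s t)) + (\<Sum>s<n. cns Y (h s))"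
    unfolding symbol_boundary_def
    by (simp add: len cns_simps cns_sum g2_def h_def d_def S_def del: pscale_bas)
  have 3: "sB x M (deg x Y) Y xs v = (\<Sum>t<n. b0 t) + pscale ((-1) ^ (e * (\<Sum>i<n. d i))) (bas (xs, act M Y v))"
    by (simp add: sB_closed_form len b0_def S_def d_def e_def)
  \<comment> \<open>The bracket is moved from the front to position \<open>t\<close>, and the signs
    combine to a minus.\<close>
  have A: "g0 t + b0 t \<in> R n" if t: "t < n" for t
  proof -
    have Z: "bracket x Y (xs ! t) \<in> H ((e + d t) mod 2)"
      by (rule H_bracket[OF H_HL[OF Ye(1)] xsd(1)[OF t] Ye(2) xsd(2)[OF t]])
    have "pscale ((-1) ^ (Suc t + d t * (e + S t) + e * d t)) (bas (bracket x Y (xs ! t) # nths xs (- {t}), v)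
       - pscale ((-1) ^ (t + (e + d t) mod 2 * (\<Sum>j<t. deg x (xs ! j)))) (bas (xs[t := bracket x Y (xs ! t)], v))) \<in> R n"
      using move_to_front_R[OF Z _ g t] by (intro R_closed(3)) simp
    moreover have "(-1) ^ (Suc t + d t * (e + S t) + e * d t) * (-1) ^ (t + (e + d t) mod 2 * (\<Sum>j<t. deg x (xs ! j))) = - ((-1 :: complex) ^ (e * S t))"
      unfolding d_def[symmetric] S_def[symmetric] by (auto simp: minus_one_power_iff)
    ultimately show ?thesis
      by (simp add: g0_def b0_def pv.scale_right_diff_distrib del: pscale_bas power_Suc)
  qed
  \<comment> \<open>One exchange of the bracket with \<open>Y\<close>; its parity is that of the two
    bracketed factors together, which accounts for the sign terms containing
    \<open>e\<close>.\<close>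
  have B: "g1 s t + cns Y (g2 s t) \<in> R n" if st: "s < t" "t < n" for s t
  proof -
    have s: "s < n" using st by simp
    have Z: "bracket x (xs ! s) (xs ! t) \<in> H ((d s + d t) mod 2)"
      by (rule H_bracket[OF H_HL[OF xsd(1)[OF s]] xsd(1)[OF st(2)] xsd(2)[OF s] xsd(2)[OF st(2)]])
    have "(nths xs (- {s, t}), v) \<in> gens x U M (n - card {s, t})" using st by (intro gens_nths[OF g]) auto
    hence "bas (nths xs (- {s, t}), v) \<in> F (n - 2)" using st by (simp add: numeral_2_eq_2)
    hence sw: "bas (bracket x (xs ! s) (xs ! t) # Y # nths xs (- {s, t}), v) +
        pscale (sgn2 ((d s + d t) mod 2) e) (bas (Y # bracket x (xs ! s) (xs ! t) # nths xs (- {s, t}), v)) \<in> R n"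
    proof -
      have "Suc (Suc (n - 2)) = n" using st by simp
      thus ?thesis using cns_swap_R[OF Z Ye(1) _ Ye(2) \<open>bas (nths xs (- {s, t}), v) \<in> F (n - 2)\<close>] by simp
    qed
    have "(-1) ^ (s + t + d s * (e + S s) + d t * (e + S t) + d s * d t) * sgn2 ((d s + d t) mod 2) e =
        ((-1 :: complex) ^ (s + t + d s * S s + d t * S t + d s * d t))"
      by (auto simp: minus_one_power_iff)
    thus ?thesis using R_closed(3)[OF sw, of "(-1) ^ (s + t + d s * (e + S s) + d t * (e + S t) + d s * d t)"]
      by (simp add: g1_def g2_def cns_simps pv.scale_right_distrib del: pscale_bas)
  qed
  have "(\<Sum>t<n. (g0 t + b0 t) + (\<Sum>s<t. g1 s t + cns Y (g2 s t))) \<in> R n"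
    by (intro pv.subspace_sum[OF R_subspace] R_closed(1) A B) auto
  also have "(\<Sum>t<n. (g0 t + b0 t) + (\<Sum>s<t. g1 s t + cns Y (g2 s t))) =
      symbol_boundary x M (Y # xs, v) - (- sB x M (deg x Y) Y xs v - cns Y (symbol_boundary x M (xs, v)))"
    unfolding 1 2 3 by (simp add: sum.distrib algebra_simps)
  finally show ?thesis .
qed

lemma symbol_boundary_R: "(xs, v) \<in> gens x U M n \<Longrightarrow> symbol_boundary x M (xs, v) - sD x M xs v \<in> R (n - 1)"
proof (induction xs arbitrary: n)
  case Nil
  thus ?case by (simp add: symbol_boundary_def R_closed)
next
  case (Cons Y xs)
  then obtain k q where k: "n = Suc k" "q < 2" "Y \<in> H q" "(xs, v) \<in> gens x U M k" by (auto simp: gens_Cons)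
  have "cns Y (symbol_boundary x M (xs, v) - sD x M xs v) \<in> R k"
  proof (cases k)
    case 0
    thus ?thesis using k(4) by (simp add: gens_0 symbol_boundary_def cns_simps R_closed)
  next
    case (Suc j)
    thus ?thesis using cns_R[OF k(3,2) Cons.IH[OF k(4)]] by simp
  qed
  from R_closed(2)[OF symbol_boundary_Cons_R[OF k(3,2,4)] this]
  show ?case by (simp add: k(1) cns_simps algebra_simps)
qed

end

section \<open>Subquotients of free chains\<close>

lemma cring_CC: "cring CC"
proof (rule cringI)
  show "abelian_group CC"
  proof (rule abelian_groupI)
    fix a assume "a \<in> carrier CC"
    show "\<exists>b\<in>carrier CC. b \<oplus>\<^bsub>CC\<^esub> a = \<zero>\<^bsub>CC\<^esub>"
      by (rule bexI[of _ "- a"]) (simp_all add: CC_def)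
  qed (simp_all add: CC_def)
  show "comm_monoid CC" by (rule comm_monoidI) (simp_all add: CC_def)
qed (simp_all add: CC_def algebra_simps)

text \<open>\<open>N\<close> is the quotient of \<open>Z\<close> by \<open>B\<close> with class map
  \<open>c\<close>, the action being induced by \<open>A\<close> and the graded parts being the
  images of the \<open>G p\<close>. Homology is a quotient of a submodule of a quotient, so its
  elements are sets of sets; abstracting the class map lets it be handled as a subquotient of the
  free chains.\<close>

locale presents =
  fixes L :: "gt set" and N :: "'w smod" and c :: "('b \<Rightarrow>\<^sub>0 complex) \<Rightarrow> 'w" and Z B :: "('b \<Rightarrow>\<^sub>0 complex) set"
    and A :: "gt \<Rightarrow> ('b \<Rightarrow>\<^sub>0 complex) \<Rightarrow> ('b \<Rightarrow>\<^sub>0 complex)" and G :: "nat \<Rightarrow> ('b \<Rightarrow>\<^sub>0 complex) set"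
  assumes subspace_Z: "pv.subspace Z"
    and subspace_B: "pv.subspace B"
    and B_le: "B \<subseteq> Z"
    and carrier_eq: "carrier N = c ` Z"
    and zero_eq: "\<zero>\<^bsub>N\<^esub> = c 0"
    and class_eq_iff: "\<And>z w. z \<in> Z \<Longrightarrow> w \<in> Z \<Longrightarrow> c z = c w \<longleftrightarrow> z - w \<in> B"
    and add_eq: "\<And>z w. z \<in> Z \<Longrightarrow> w \<in> Z \<Longrightarrow> c z \<oplus>\<^bsub>N\<^esub> c w = c (z + w)"
    and smult_eq: "\<And>k z. z \<in> Z \<Longrightarrow> k \<odot>\<^bsub>N\<^esub> c z = c (pscale k z)"
    and A_Z: "\<And>X z. X \<in> L \<Longrightarrow> z \<in> Z \<Longrightarrow> A X z \<in> Z"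
    and act_eq: "\<And>X z. X \<in> L \<Longrightarrow> z \<in> Z \<Longrightarrow> act N X (c z) = c (A X z)"
    and A_B: "\<And>X z. X \<in> L \<Longrightarrow> z \<in> B \<Longrightarrow> A X z \<in> B"
    and A_add: "\<And>X z w. A X (z + w) = A X z + A X w"
    and G_le: "\<And>p. G p \<subseteq> Z"
    and gr_eq: "\<And>p. gr N p = c ` G p"

lemmas presentsD = presents.subspace_Z presents.subspace_B presents.B_le presents.carrier_eq presents.zero_eq
  presents.class_eq_iff presents.add_eq presents.smult_eq presents.A_Z presents.act_eq presents.A_B
  presents.A_add presents.G_le presents.gr_eq

lemma presents_module:
  assumes "presents L N c Z B A G"
  shows "module CC N"
proof -
  note P = presentsD[OF assms]
  have 0: "0 \<in> Z" by (rule pv.subspace_0[OF P(1)])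
  note cl = pv.subspace_add[OF P(1)] pv.subspace_scale[OF P(1)]
  show ?thesis
  proof (rule moduleI[OF cring_CC])
    show "abelian_group N"
    proof (rule abelian_groupI)
      fix a assume "a \<in> carrier N"
      then obtain z where z: "a = c z" "z \<in> Z" by (auto simp: P(4))
      have "c (- z) \<oplus>\<^bsub>N\<^esub> a = \<zero>\<^bsub>N\<^esub>" using P(7)[of "- z" z] z pv.subspace_neg[OF P(1)] by (simp add: P(5))
      thus "\<exists>b\<in>carrier N. b \<oplus>\<^bsub>N\<^esub> a = \<zero>\<^bsub>N\<^esub>" using z pv.subspace_neg[OF P(1)] by (auto simp: P(4))
    qed (use 0 cl in \<open>auto simp: P(4,5,7) ac_simps\<close>)
  qed (use 0 cl in \<open>auto simp: P(4,7,8) CC_def pv.scale_left_distrib pv.scale_right_distrib\<close>)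
qed

text \<open>Iterated quotients: a coset of classes is described by representatives in
  \<open>Z\<close>, and two of them agree iff their difference lies in the larger subspace
  \<open>B'\<close>.\<close>

lemma presents_quot:
  assumes "presents L N c Z B A G" and B': "pv.subspace B'" "B \<subseteq> B'" "B' \<subseteq> Z"
    and AB: "\<And>X b. X \<in> L \<Longrightarrow> b \<in> B' \<Longrightarrow> A X b \<in> B'"
  shows "presents L (quot N (c ` B')) (\<lambda>z. (c ` B') +>\<^bsub>N\<^esub> c z) Z B' A G"
proof -
  note P = presentsD[OF assms(1)]
  define d where "d z = (c ` B') +>\<^bsub>N\<^esub> c z" for z
  have 0: "0 \<in> B'" "0 \<in> Z" using pv.subspace_0[OF B'(1)] B'(3) by auto
  have d: "d z = (\<lambda>b. c (b + z)) ` B'" if "z \<in> Z" for z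
    using that B'(3) P(7) by (force simp: d_def a_r_coset_def')
  have eq: "d z = d w" if zw: "z \<in> Z" "w \<in> Z" "z - w \<in> B'" for z w
  proof -
    have "d z \<subseteq> d w" if zw: "z \<in> Z" "w \<in> Z" "z - w \<in> B'" for z w
    proof
      fix y assume "y \<in> d z"
      then obtain b where b: "b \<in> B'" "y = c (b + z)" unfolding d[OF zw(1)] by auto
      have "b + (z - w) \<in> B'" by (rule pv.subspace_add[OF B'(1) b(1) zw(3)])
      moreover have "y = c (b + (z - w) + w)" using b by simp
      ultimately show "y \<in> d w" unfolding d[OF zw(2)] by blast
    qed
    from this[OF zw] this[OF zw(2,1)] pv.subspace_neg[OF B'(1) zw(3)] show ?thesis by auto
  qed
  have eq_iff: "d z = d w \<longleftrightarrow> z - w \<in> B'" if zw: "z \<in> Z" "w \<in> Z" for z w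
  proof
    assume "d z = d w"
    moreover have "c z \<in> d z" unfolding d[OF zw(1)] using 0 by (auto intro!: image_eqI[of _ _ 0])
    ultimately obtain b where b: "b \<in> B'" "c z = c (b + w)" unfolding d[OF zw(2)] by auto
    hence "b + w \<in> Z" using B'(3) zw(2) pv.subspace_add[OF P(1)] by blast
    hence "z - (b + w) \<in> B'" using P(6)[OF zw(1)] b B'(2) by auto
    from pv.subspace_add[OF B'(1) this b(1)] show "z - w \<in> B'" by simp
  qed (rule eq[OF zw])
  let ?Q = "quot N (c ` B')"
  have carr: "carrier ?Q = d ` Z"
    by (auto simp: quot_def A_RCOSETS_def' P(4) d_def)
  have zero: "\<zero>\<^bsub>?Q\<^esub> = d 0" unfolding d[OF 0(2)] by (simp add: quot_def)
  have add: "d z \<oplus>\<^bsub>?Q\<^esub> d w = d (z + w)" if zw: "z \<in> Z" "w \<in> Z" for z w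
  proof -
    have zw': "z + w \<in> Z" by (rule pv.subspace_add[OF P(1) zw])
    have cl: "b + y \<in> Z" if "b \<in> B'" "y \<in> Z" for b y using that B'(3) pv.subspace_add[OF P(1)] by blast
    have "d z \<oplus>\<^bsub>?Q\<^esub> d w = {c (b + z) \<oplus>\<^bsub>N\<^esub> c (b' + w) | b b'. b \<in> B' \<and> b' \<in> B'}"
      unfolding d[OF zw(1)] d[OF zw(2)] by (auto simp: quot_def set_add_def')
    also have "\<dots> = {c (b + b' + (z + w)) | b b'. b \<in> B' \<and> b' \<in> B'}"
    proof -
      have "c (b + z) \<oplus>\<^bsub>N\<^esub> c (b' + w) = c (b + b' + (z + w))" if "b \<in> B'" "b' \<in> B'" for b b'
        using P(7)[OF cl[OF that(1) zw(1)] cl[OF that(2) zw(2)]] by (simp add: algebra_simps)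
      thus ?thesis by (intro Collect_cong) (metis (no_types, lifting))
    qed
    also have "\<dots> = d (z + w)"
      unfolding d[OF zw'] using 0(1) pv.subspace_add[OF B'(1)]
      by (auto simp: image_def) (metis add.right_neutral)
    finally show ?thesis .
  qed
  have smult: "k \<odot>\<^bsub>?Q\<^esub> d z = d (pscale k z)" if z: "z \<in> Z" for k z
  proof -
    have "(c ` B') +>\<^bsub>N\<^esub> (k \<odot>\<^bsub>N\<^esub> y) = d (pscale k z)" if y: "y \<in> d z" for y
    proof -
      obtain b where b: "b \<in> B'" "y = c (b + z)" using y unfolding d[OF z] by auto
      have bz: "b + z \<in> Z" using b B'(3) z pv.subspace_add[OF P(1)] by blast
      have "(c ` B') +>\<^bsub>N\<^esub> (k \<odot>\<^bsub>N\<^esub> y) = d (pscale k (b + z))" by (simp add: b(2) P(8)[OF bz] d_def)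
      also have "pscale k (b + z) - pscale k z \<in> B'"
        using pv.subspace_scale[OF B'(1) b(1)] by (simp add: pv.scale_right_distrib)
      hence "d (pscale k (b + z)) = d (pscale k z)"
        by (intro eq pv.subspace_scale[OF P(1)] bz z)
      finally show ?thesis .
    qed
    moreover have "d z \<noteq> {}" unfolding d[OF z] using 0 by auto
    ultimately show ?thesis by (auto simp: quot_def)
  qed
  have act: "act ?Q X (d z) = d (A X z)" if z: "z \<in> Z" and X: "X \<in> L" for X z
  proof -
    have "(c ` B') +>\<^bsub>N\<^esub> act N X y = d (A X z)" if y: "y \<in> d z" for y
    proof -
      obtain b where b: "b \<in> B'" "y = c (b + z)" using y unfolding d[OF z] by auto
      have bz: "b + z \<in> Z" using b B'(3) z pv.subspace_add[OF P(1)] by blast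
      have "(c ` B') +>\<^bsub>N\<^esub> act N X y = d (A X (b + z))" by (simp add: b(2) P(10)[OF X bz] d_def)
      also have "\<dots> = d (A X z)"
        using P(9)[OF X bz] P(9)[OF X z] AB[OF X b(1)] by (intro eq) (auto simp: P(12))
      finally show ?thesis .
    qed
    moreover have "d z \<noteq> {}" unfolding d[OF z] using 0 by auto
    ultimately show ?thesis by (auto simp: quot_def)
  qed
  have gr: "gr ?Q p = d ` G p" for p
    by (auto simp: quot_def P(14) d_def)
  show ?thesis
    unfolding d_def[symmetric]
    by (rule presents.intro) (simp_all add: P(1,9,12,13) B'(1,3) AB carr zero eq_iff add smult act gr)
qed

text \<open>A class that is graded and lies in the submodule may need different representatives for
  the two properties, one in \<open>G p\<close> and one in \<open>Z'\<close>; this explains the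
  shape of the new grading.\<close>

lemma presents_restr:
  assumes "presents L N c Z B A G" and Z': "pv.subspace Z'" "B \<subseteq> Z'" "Z' \<subseteq> Z"
    and AZ: "\<And>X z. X \<in> L \<Longrightarrow> z \<in> Z' \<Longrightarrow> A X z \<in> Z'"
  shows "presents L (restr N (c ` Z')) c Z' B A (\<lambda>p. {z \<in> Z'. \<exists>g\<in>G p. z - g \<in> B})"
proof -
  note P = presentsD[OF assms(1)]
  have gr: "gr N p \<inter> c ` Z' = c ` {z \<in> Z'. \<exists>g\<in>G p. z - g \<in> B}" for p
  proof (intro equalityI subsetI)
    fix y assume "y \<in> gr N p \<inter> c ` Z'"
    then obtain z g where zg: "z \<in> Z'" "y = c z" "g \<in> G p" "y = c g" by (auto simp: P(14))
    hence "z - g \<in> B" using P(6)[of z g] P(13)[of p] Z'(3) by auto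
    thus "y \<in> c ` {z \<in> Z'. \<exists>g\<in>G p. z - g \<in> B}" using zg by auto
  next
    fix y assume "y \<in> c ` {z \<in> Z'. \<exists>g\<in>G p. z - g \<in> B}"
    then obtain z g where zg: "z \<in> Z'" "y = c z" "g \<in> G p" "z - g \<in> B" by auto
    hence "c z = c g" using P(6)[of z g] P(13)[of p] Z'(3) by auto
    hence "y \<in> gr N p" using zg by (auto simp: P(14))
    moreover have "y \<in> c ` Z'" using zg(1,2) by (rule image_eqI[rotated])
    ultimately show "y \<in> gr N p \<inter> c ` Z'" by simp
  qed
  have ZZ: "z \<in> Z" if "z \<in> Z'" for z using that Z'(3) by blast
  have G_le: "{z \<in> Z'. \<exists>g\<in>G p. z - g \<in> B} \<subseteq> Z'" for p by blast
  show ?thesis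
  proof (rule presents.intro, goal_cases)
    case 4 show ?case by (simp add: restr_def)
  next
    case 5 show ?case using P(5) by (simp add: restr_def)
  next
    case (7 z w) thus ?case using P(7)[OF ZZ ZZ] by (simp add: restr_def)
  next
    case (8 k z) thus ?case using P(8)[OF ZZ] by (simp add: restr_def)
  next
    case (10 X z) thus ?case using P(10)[OF _ ZZ] by (simp add: restr_def)
  next
    case (14 p) show ?case using gr[of p] by (simp add: restr_def)
  qed (use P(2,11,12) Z'(1,2) AZ G_le P(6)[OF ZZ ZZ] in auto)
qed

lemma presents_mono:
  assumes "presents L N c Z B A G" "L' \<subseteq> L"
  shows "presents L' N c Z B A G"
proof -
  note P = presentsD[OF assms(1)]
  have LL: "X \<in> L" if "X \<in> L'" for X using that assms(2) by blast
  show ?thesis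
  proof (rule presents.intro, goal_cases)
    case (9 X z) thus ?case using P(9)[OF LL] by simp
  next
    case (10 X z) thus ?case using P(10)[OF LL] by simp
  next
    case (11 X z) thus ?case using P(11)[OF LL] by simp
  qed (use P(1-8,12-14) in auto)
qed

lemma presents_mspan:
  assumes "presents L N c Z B A G" "W \<subseteq> Z"
  shows "mspan N (c ` W) = c ` pv.span W"
proof
  note P = presentsD[OF assms(1)]
  interpret module CC N by (rule presents_module[OF assms(1)])
  have WZ: "pv.span W \<subseteq> Z" by (rule pv.span_minimal[OF assms(2) P(1)])
  have neg: "\<ominus>\<^bsub>N\<^esub> c z = c (- z)" if "z \<in> Z" for z
    using that P(7)[of "- z" z] P(4,5) pv.subspace_neg[OF P(1)] by (intro minus_equality) auto
  show "mspan N (c ` W) \<subseteq> c ` pv.span W"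
    unfolding mspan_def
  proof (rule hull_minimal)
    show "c ` W \<subseteq> c ` pv.span W" using pv.span_superset by blast
    show "submodule (c ` pv.span W) CC N"
    proof (rule submoduleI)
      show "c ` pv.span W \<subseteq> carrier N" using WZ P(4) by blast
      show "\<zero>\<^bsub>N\<^esub> \<in> c ` pv.span W" using pv.span_zero P(5) by blast
    next
      fix a assume "a \<in> c ` pv.span W"
      then obtain z where "z \<in> pv.span W" "a = c z" by blast
      thus "\<ominus>\<^bsub>N\<^esub> a \<in> c ` pv.span W" using neg[of z] WZ pv.span_neg by (metis image_eqI subsetD)
    next
      fix a b assume "a \<in> c ` pv.span W" "b \<in> c ` pv.span W"
      then obtain z w where "z \<in> pv.span W" "a = c z" "w \<in> pv.span W" "b = c w" by blast
      thus "a \<oplus>\<^bsub>N\<^esub> b \<in> c ` pv.span W" using P(7)[of z w] WZ pv.span_add by (metis image_eqI subsetD)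
    next
      fix k b assume "b \<in> c ` pv.span W"
      then obtain z where "z \<in> pv.span W" "b = c z" by blast
      thus "k \<odot>\<^bsub>N\<^esub> b \<in> c ` pv.span W" using P(8)[of z k] WZ pv.span_scale by (metis image_eqI subsetD)
    qed
  qed
  have "z \<in> Z \<and> c z \<in> N'" if N': "submodule N' CC N" "c ` W \<subseteq> N'" and z: "z \<in> pv.span W" for N' z
    using z
  proof (induction rule: pv.span_induct_alt)
    case base
    show ?case using submoduleE[OF N'(1)] P(5) pv.subspace_0[OF P(1)]
      by (metis l_neg subsetD all_not_in_conv)
  next
    case (step k w y)
    have w: "w \<in> Z" using step assms(2) by auto
    hence kw: "pscale k w \<in> Z" by (rule pv.subspace_scale[OF P(1)])
    have "c (pscale k w) \<in> N'"
      using submoduleE(4)[OF N'(1), of k "c w"] N'(2) step(1) P(8)[OF w] by (auto simp: CC_def)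
    hence "c (pscale k w) \<oplus>\<^bsub>N\<^esub> c y \<in> N'" using submoduleE(5)[OF N'(1)] step by blast
    thus ?case using P(7)[OF kw] step(2) pv.subspace_add[OF P(1) kw] by simp
  qed
  thus "c ` pv.span W \<subseteq> mspan N (c ` W)" unfolding mspan_def hull_def by blast
qed

text \<open>The inclusion of \<open>Z2\<close> in \<open>Z1\<close> induces a map of quotients that
  is onto because every class of \<open>N1\<close> has a representative in \<open>Z2\<close>, and
  injective because \<open>B1\<close> and \<open>B2\<close> agree on \<open>Z2\<close>. The map
  \<open>f\<close> is its inverse, defined by choosing such representatives.\<close>

lemma presents_iso:
  assumes P1: "presents L N1 c1 Z1 B1 A G1" and P2: "presents L N2 c2 Z2 B2 A G2"
    and Z: "Z2 \<subseteq> Z1" "\<And>z. z \<in> Z1 \<Longrightarrow> \<exists>w\<in>Z2. z - w \<in> B1" and B: "\<And>z. z \<in> Z2 \<Longrightarrow> z \<in> B1 \<longleftrightarrow> z \<in> B2"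
    and G: "\<And>p z. z \<in> G1 p \<Longrightarrow> \<exists>w\<in>G2 p. z - w \<in> B1" "\<And>p z. z \<in> G2 p \<Longrightarrow> \<exists>w\<in>G1 p. z - w \<in> B1"
  shows "smod_iso L N1 N2"
proof -
  note P = presentsD[OF P1] and Q = presentsD[OF P2]
  define f where "f v = c2 (SOME w. w \<in> Z2 \<and> c1 w = v)" for v
  have f: "f (c1 w) = c2 w" if w: "w \<in> Z2" for w
  proof -
    let ?w = "SOME w'. w' \<in> Z2 \<and> c1 w' = c1 w"
    have s: "?w \<in> Z2 \<and> c1 ?w = c1 w" by (rule someI[of _ w]) (use w in auto)
    hence "?w - w \<in> B1" using P(6)[of ?w w] Z(1) w by blast
    moreover have "?w - w \<in> Z2" using s w pv.subspace_diff[OF Q(1)] by blast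
    ultimately have "?w - w \<in> B2" using B by blast
    thus ?thesis unfolding f_def using Q(6)[of ?w w] s w by blast
  qed
  have rep: "\<exists>w\<in>Z2. v = c1 w" if "v \<in> carrier N1" for v
  proof -
    obtain z where z: "v = c1 z" "z \<in> Z1" using \<open>v \<in> carrier N1\<close> by (auto simp: P(4))
    obtain w where "w \<in> Z2" "z - w \<in> B1" using Z(2)[OF z(2)] by blast
    thus ?thesis using P(6)[of z w] z Z(1) by blast
  qed
  have inj: "inj_on f (carrier N1)"
  proof (rule inj_onI)
    fix u v assume uv: "u \<in> carrier N1" "v \<in> carrier N1" "f u = f v"
    obtain z w where zw: "z \<in> Z2" "w \<in> Z2" "u = c1 z" "v = c1 w" using rep[OF uv(1)] rep[OF uv(2)] by blast
    hence "z - w \<in> B2" using uv(3) f Q(6) by simp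
    hence "z - w \<in> B1" using B pv.subspace_diff[OF Q(1) zw(1,2)] by blast
    thus "u = v" using P(6)[of z w] zw Z(1) by blast
  qed
  have surj: "f ` carrier N1 = carrier N2"
  proof
    show "f ` carrier N1 \<subseteq> carrier N2" using rep f by (auto simp: Q(4))
    show "carrier N2 \<subseteq> f ` carrier N1"
    proof
      fix v assume "v \<in> carrier N2"
      then obtain w where "w \<in> Z2" "v = c2 w" by (auto simp: Q(4))
      thus "v \<in> f ` carrier N1" using f[of w] Z(1) P(4) by (metis imageI subsetD)
    qed
  qed
  have add: "f (u \<oplus>\<^bsub>N1\<^esub> v) = f u \<oplus>\<^bsub>N2\<^esub> f v" if uv: "u \<in> carrier N1" "v \<in> carrier N1" for u v
  proof -
    obtain z w where zw: "z \<in> Z2" "w \<in> Z2" "u = c1 z" "v = c1 w" using rep[OF uv(1)] rep[OF uv(2)] by blast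
    have "z \<in> Z1" "w \<in> Z1" using zw Z(1) by auto
    thus ?thesis using zw f P(7) Q(7) pv.subspace_add[OF Q(1) zw(1,2)] by simp
  qed
  have smult: "f (k \<odot>\<^bsub>N1\<^esub> u) = k \<odot>\<^bsub>N2\<^esub> f u" if u: "u \<in> carrier N1" for k u
  proof -
    obtain z where z: "z \<in> Z2" "u = c1 z" using rep[OF u] by blast
    have "z \<in> Z1" using z Z(1) by auto
    thus ?thesis using z f P(8) Q(8) pv.subspace_scale[OF Q(1) z(1)] by simp
  qed
  have act: "f (act N1 X u) = act N2 X (f u)" if u: "u \<in> carrier N1" and X: "X \<in> L" for X u
  proof -
    obtain z where z: "z \<in> Z2" "u = c1 z" using rep[OF u] by blast
    have "z \<in> Z1" using z Z(1) by auto
    thus ?thesis using z f P(10)[OF X] Q(10)[OF X] Q(9)[OF X z(1)] by simp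
  qed
  have gr: "f ` gr N1 p = gr N2 p" for p
  proof
    show "f ` gr N1 p \<subseteq> gr N2 p"
    proof
      fix y assume "y \<in> f ` gr N1 p"
      then obtain z where z: "z \<in> G1 p" "y = f (c1 z)" by (auto simp: P(14))
      obtain w where w: "w \<in> G2 p" "z - w \<in> B1" using G(1)[OF z(1)] by blast
      have "c1 z = c1 w" using P(6)[of z w] z w P(13) Q(13) Z(1) by blast
      thus "y \<in> gr N2 p" using z w f[of w] Q(13,14) by (metis imageI subsetD)
    qed
    show "gr N2 p \<subseteq> f ` gr N1 p"
    proof
      fix y assume "y \<in> gr N2 p"
      then obtain z where z: "z \<in> G2 p" "y = c2 z" by (auto simp: Q(14))
      obtain w where w: "w \<in> G1 p" "z - w \<in> B1" using G(2)[OF z(1)] by blast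
      have "c1 z = c1 w" using P(6)[of z w] z w P(13) Q(13) Z(1) by blast
      moreover have "f (c1 z) = y" using f[of z] z Q(13) by blast
      ultimately show "y \<in> f ` gr N1 p" using w P(14) by (metis imageI)
    qed
  qed
  show ?thesis unfolding smod_iso_def bij_betw_def
    by (intro exI[of _ f] conjI allI ballI impI) (simp_all only: inj surj add smult act gr)
qed

section \<open>Homology as a subquotient of free chains\<close>

text \<open>The parity of the acting element enters the signs of \<open>BB\<close>, so an
  inhomogeneous element acts through its two components.\<close>

definition AA :: "ltype \<Rightarrow> 'v smod \<Rightarrow> gt \<Rightarrow> (gt list \<times> 'v \<Rightarrow>\<^sub>0 complex) \<Rightarrow> (gt list \<times> 'v \<Rightarrow>\<^sub>0 complex)"
  where "AA x M X z = (\<Sum>p<2. BB x M p (gt_comp x p X) z)"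

lemma AA_simps: "AA x M X (z + w) = AA x M X z + AA x M X w" "AA x M X (z - w) = AA x M X z - AA x M X w"
  "AA x M X (pscale c z) = pscale c (AA x M X z)" "AA x M X 0 = 0"
  by (simp_all add: AA_def BB_simps sum.distrib sum_subtractf pv.scale_sum_right)

context chain_data
begin

definition "gr_free n p = gr (free_chains x U M n) p"

text \<open>Cycles, and likewise \<open>boundaries\<close>, are taken as full preimages in the free
  chains: the boundary of a cycle has to vanish modulo relations only, and \<open>boundaries\<close>
  contains all relations.\<close>

definition "cycles n = {z \<in> F n. DD x M z \<in> R (n - 1)}"

definition "boundaries n = {DD x M z + r | z r. z \<in> F (Suc n) \<and> r \<in> R n}"

text \<open>The two coset maps in succession, modulo relations and then modulo boundaries.\<close>

definition "cls n z = ((\<lambda>z. R n +>\<^bsub>free_chains x U M n\<^esub> z) ` boundaries n) +>\<^bsub>restr (chains x U M n) ((\<lambda>z. R n +>\<^bsub>free_chains x U M n\<^esub> z) ` cycles n)\<^esub>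
    (R n +>\<^bsub>free_chains x U M n\<^esub> z)"

lemma L_comp_HL: "X \<in> L \<Longrightarrow> p < 2 \<Longrightarrow> gt_comp x p X \<in> HL p"
  by (simp add: HL_iff L_comp)

lemma AA_F: "X \<in> L \<Longrightarrow> z \<in> F n \<Longrightarrow> AA x M X z \<in> F n"
  unfolding AA_def by (intro pv.subspace_sum[OF F_subspace] BB_F L_comp_HL) auto

lemma AA_R: "X \<in> L \<Longrightarrow> z \<in> R n \<Longrightarrow> AA x M X z \<in> R n"
  unfolding AA_def by (intro pv.subspace_sum[OF R_subspace] BB_R L_comp_HL) auto

lemma DD_AA_R:
  assumes "X \<in> L" "z \<in> F n"
  shows "DD x M (AA x M X z) - AA x M X (DD x M z) \<in> R (n - 1)"
proof -
  have "(\<Sum>p<2. DD x M (BB x M p (gt_comp x p X) z) - BB x M p (gt_comp x p X) (DD x M z)) \<in> R (n - 1)"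
    by (intro pv.subspace_sum[OF R_subspace] DD_BB_R L_comp_HL assms) auto
  thus ?thesis by (simp add: AA_def sum_lt_2 DD_simps algebra_simps)
qed

lemma linext_symbol_act: "linext (symbol_act x M X) z = AA x M X z"
proof (rule linear_eq_on_bas[OF linear_linext])
  show "Vector_Spaces.linear pscale pscale (AA x M X)" by (rule linear_pI) (simp_all add: AA_simps)
  show "linext (symbol_act x M X) (bas b) = AA x M X (bas b)" for b
    by (cases b) (simp add: symbol_act_eq AA_def)
qed

lemma linext_symbol_boundary_R:
  assumes "z \<in> F n"
  shows "linext (symbol_boundary x M) z - DD x M z \<in> R (n - 1)"
  by (rule F_into[OF _ _ _ R_subspace assms, of "\<lambda>z. linext (symbol_boundary x M) z - DD x M z"])
    (simp_all add: linext_simps DD_simps pv.scale_right_diff_distrib symbol_boundary_R[simplified] algebra_simps)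

lemma free_simps: "add (free_chains x U M n) = (+)" "carrier (free_chains x U M n) = F n"
  "\<zero>\<^bsub>free_chains x U M n\<^esub> = 0" "smult (free_chains x U M n) = pscale"
  "act (free_chains x U M n) X = AA x M X" "gr (free_chains x U M n) p = gr_free n p"
  by (auto simp: free_chains_def free_space_def gr_free_def linext_symbol_act fun_eq_iff)

lemma gr_free_F: "gr_free n p \<subseteq> F n"
  by (auto simp: gr_free_def free_chains_def free_space_def)

lemma presents_free: "presents L (free_chains x U M n) (\<lambda>z. z) (F n) {0} (AA x M) (gr_free n)"
  by (rule presents.intro) (auto simp: free_simps AA_simps AA_F F_closed pv.subspace_single_0 F_subspace gr_free_F)

lemma presents_chains:
  "presents L (chains x U M n) (\<lambda>z. R n +>\<^bsub>free_chains x U M n\<^esub> z) (F n) (R n) (AA x M) (gr_free n)"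
  using presents_quot[OF presents_free R_subspace _ R_F AA_R, of n] R_closed(4)[of n]
  by (simp add: chains_def)

lemma cycles_subspace: "pv.subspace (cycles n)"
  unfolding pv.subspace_def cycles_def by (auto simp: DD_simps F_closed R_closed)

lemma boundaries_subspace: "pv.subspace (boundaries n)"
proof -
  have "boundaries n = pv.span (DD x M ` F (Suc n) \<union> R n)"
  proof -
    have "pv.subspace (DD x M ` F (Suc n))"
      unfolding pv.subspace_def by (auto simp: F_closed DD_simps[symmetric] intro!: imageI)
        (metis DD_simps(5) F_closed(4) imageI)
    thus ?thesis
      unfolding pv.span_Un pv.span_eq_iff[THEN iffD2, OF R_subspace] boundaries_def
      by (subst pv.span_eq_iff[THEN iffD2]) auto
  qed
  thus ?thesis by simp
qed

lemma R_boundaries: "R n \<subseteq> boundaries n"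
proof
  fix r assume "r \<in> R n"
  moreover have "r = DD x M 0 + r" by (simp add: DD_simps)
  ultimately show "r \<in> boundaries n" unfolding boundaries_def using F_closed(4) by blast
qed

lemma R_cycles: "R n \<subseteq> cycles n"
  using R_F DD_R by (auto simp: cycles_def)

lemma boundaries_cycles: "boundaries n \<subseteq> cycles n"
proof
  fix b assume "b \<in> boundaries n"
  then obtain z r where b: "b = DD x M z + r" "z \<in> F (Suc n)" "r \<in> R n" by (auto simp: boundaries_def)
  have "DD x M z \<in> cycles n" using DD_F_Suc[OF b(2)] DD_DD_R[OF b(2)] by (simp add: cycles_def numeral_2_eq_2)
  thus "b \<in> cycles n" unfolding b(1) using R_cycles b(3) by (intro pv.subspace_add[OF cycles_subspace]) auto
qed

lemma AA_cycles: "X \<in> L \<Longrightarrow> z \<in> cycles n \<Longrightarrow> AA x M X z \<in> cycles n"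
  using DD_AA_R[of X z n] AA_R[of X "DD x M z" "n - 1"] AA_F R_mem by (auto simp: cycles_def)

lemma AA_boundaries:
  assumes "X \<in> L" "b \<in> boundaries n"
  shows "AA x M X b \<in> boundaries n"
proof -
  obtain z r where b: "b = DD x M z + r" "z \<in> F (Suc n)" "r \<in> R n" using assms(2) by (auto simp: boundaries_def)
  have "DD x M (AA x M X z) - AA x M X (DD x M z) \<in> R n" using DD_AA_R[OF assms(1) b(2)] by simp
  hence "AA x M X r - (DD x M (AA x M X z) - AA x M X (DD x M z)) \<in> R n"
    by (rule R_closed(2)[OF AA_R[OF assms(1) b(3)]])
  moreover have "AA x M X b = DD x M (AA x M X z) + (AA x M X r - (DD x M (AA x M X z) - AA x M X (DD x M z)))"
    by (simp add: b(1) AA_simps)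
  ultimately show ?thesis unfolding boundaries_def using AA_F[OF assms(1) b(2)] by blast
qed

text \<open>The union defining \<open>boundary\<close> runs over a coset of the relations. All its
  members give the same class, because the explicit boundary agrees with \<open>DD\<close> modulo
  relations and \<open>DD\<close> respects these.\<close>

lemma boundary_class:
  assumes "z \<in> F n"
  shows "boundary x U M n (R n +>\<^bsub>free_chains x U M n\<^esub> z) = R (n - 1) +>\<^bsub>free_chains x U M (n - 1)\<^esub> DD x M z"
proof -
  let ?c = "\<lambda>z. R (n - 1) +>\<^bsub>free_chains x U M (n - 1)\<^esub> z"
  note P = presentsD(6)[OF presents_chains[of "n - 1"]]
  have e: "?c (linext (symbol_boundary x M) y) = ?c (DD x M z)" if y: "y \<in> R n +>\<^bsub>free_chains x U M n\<^esub> z" for y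
  proof -
    obtain r where r: "r \<in> R n" "y = r + z" using y by (auto simp: a_r_coset_def' free_simps)
    have y: "y \<in> F n" unfolding r(2) using r(1) R_F assms by (intro F_closed) auto
    have 1: "linext (symbol_boundary x M) y - DD x M y \<in> R (n - 1)" by (rule linext_symbol_boundary_R[OF y])
    have 2: "DD x M y - DD x M z \<in> R (n - 1)" using DD_R[OF r(1)] by (simp add: r(2) DD_simps)
    have 3: "linext (symbol_boundary x M) y - DD x M z \<in> R (n - 1)" by (rule R_trans[OF 1 2])
    have 4: "DD x M z \<in> F (n - 1)" by (rule DD_F[OF assms])
    hence 5: "linext (symbol_boundary x M) y \<in> F (n - 1)"
      using F_closed(1)[OF subsetD[OF R_F 3] 4] by simp
    show ?thesis using P[OF 5 4] 3 by simp
  qed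
  have "z \<in> R n +>\<^bsub>free_chains x U M n\<^esub> z"
    using R_closed(4)[of n] by (auto simp: a_r_coset_def' free_simps intro!: bexI[of _ 0])
  thus ?thesis unfolding boundary_def using e by blast
qed

lemma presents_homology:
  "presents L (homology x U M n) (cls n) (cycles n) (boundaries n) (AA x M) (\<lambda>p. {z \<in> cycles n. \<exists>g\<in>gr_free n p. z - g \<in> R n})"
proof -
  let ?c = "\<lambda>n z. R n +>\<^bsub>free_chains x U M n\<^esub> z"
  have carr: "carrier (chains x U M k) = ?c k ` F k" for k by (rule presentsD(4)[OF presents_chains])
  have zero: "\<zero>\<^bsub>chains x U M k\<^esub> = ?c k 0" for k by (rule presentsD(5)[OF presents_chains])
  have "boundary x U M n (?c n z) = \<zero>\<^bsub>chains x U M (n - 1)\<^esub> \<longleftrightarrow> z \<in> cycles n" if "z \<in> F n" for z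
    using presentsD(6)[OF presents_chains DD_F[OF that] F_closed(4)] that
    by (simp add: boundary_class zero cycles_def)
  hence 1: "{C \<in> carrier (chains x U M n). boundary x U M n C = \<zero>\<^bsub>chains x U M (n - 1)\<^esub>} = ?c n ` cycles n"
    unfolding carr by (auto simp: cycles_def)
  have 2: "boundary x U M (n + 1) ` carrier (chains x U M (n + 1)) = ?c n ` boundaries n"
  proof -
    have b: "boundary x U M (n + 1) (?c (n + 1) z) = ?c n (DD x M z)" if "z \<in> F (n + 1)" for z
      using boundary_class[OF that] by simp
    have e: "?c n (DD x M z + r) = ?c n (DD x M z)" if "z \<in> F (Suc n)" "r \<in> R n" for z r
      using presentsD(6)[OF presents_chains F_closed(1)[OF DD_F_Suc[OF that(1)] subsetD[OF R_F that(2)]] DD_F_Suc[OF that(1)]] that(2)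
      by simp
    have "boundary x U M (n + 1) ` carrier (chains x U M (n + 1)) = (\<lambda>z. ?c n (DD x M z)) ` F (Suc n)"
      unfolding carr image_image using b by simp
    also have "\<dots> = ?c n ` boundaries n"
    proof
      show "(\<lambda>z. ?c n (DD x M z)) ` F (Suc n) \<subseteq> ?c n ` boundaries n"
      proof
        fix y assume "y \<in> (\<lambda>z. ?c n (DD x M z)) ` F (Suc n)"
        then obtain z where z: "z \<in> F (Suc n)" "y = ?c n (DD x M z)" by blast
        have "DD x M z + 0 \<in> boundaries n" unfolding boundaries_def using z(1) R_closed(4) by blast
        thus "y \<in> ?c n ` boundaries n" using z(2) by simp
      qed
      show "?c n ` boundaries n \<subseteq> (\<lambda>z. ?c n (DD x M z)) ` F (Suc n)"
        unfolding boundaries_def using e by fast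
    qed
    finally show ?thesis .
  qed
  have r: "presents L (restr (chains x U M n) (?c n ` cycles n)) (?c n) (cycles n) (R n) (AA x M)
      (\<lambda>p. {z \<in> cycles n. \<exists>g\<in>gr_free n p. z - g \<in> R n})"
    by (rule presents_restr[OF presents_chains cycles_subspace R_cycles _ AA_cycles]) (auto simp: cycles_def)
  show ?thesis
    unfolding homology_def 1 2 cls_def[abs_def]
    by (rule presents_quot[OF r boundaries_subspace R_boundaries boundaries_cycles AA_boundaries])
qed

end

section \<open>Weights of modules\<close>

text \<open>The Cartan subalgebra is spanned by the \<open>hop h\<close>; \<open>None\<close> stands for the central element.\<close>

fun hop :: "rat option \<Rightarrow> gt" where
  "hop None = KK"
| "hop (Some r) = E_hat r"

fun hval :: "weight \<Rightarrow> rat option \<Rightarrow> complex" where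
  "hval \<gamma> None = snd \<gamma>"
| "hval \<gamma> (Some r) = coef (fst \<gamma>) r"

definition hidx :: "nat \<Rightarrow> rat option set"
  where "hidx m = insert None (Some ` I_tilde m)"

lemma hval_add: "hval (\<alpha> + \<beta>) h = hval \<alpha> h + hval \<beta> h"
  by (cases h) (simp_all add: lookup_add)

lemma hval_0 [simp]: "hval 0 h = 0"
  by (cases h) simp_all

lemma hval_inj:
  assumes "\<gamma> \<in> hdual (I_tilde m)" "\<delta> \<in> hdual (I_tilde m)" "\<And>h. h \<in> hidx m \<Longrightarrow> hval \<gamma> h = hval \<delta> h"
  shows "\<gamma> = \<delta>"
proof -
  have "coef (fst \<gamma>) r = coef (fst \<delta>) r" for r
  proof (cases "r \<in> I_tilde m")
    case True thus ?thesis using assms(3)[of "Some r"] by (simp add: hidx_def)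
  next
    case False
    hence "r \<notin> supp (fst \<gamma>)" "r \<notin> supp (fst \<delta>)" using assms(1,2) by (auto simp: hdual_def)
    thus ?thesis by (simp add: in_keys_iff)
  qed
  thus ?thesis using assms(3)[of None] by (auto simp: hidx_def prod_eq_iff intro!: poly_mapping_eqI)
qed

lemma hop_hom [simp]: "hop h \<in> gt_hom x 0"
  by (cases h) (simp_all add: KK_hom E_hat_hom)

lemma hop_g_tilde: "h \<in> hidx m \<Longrightarrow> hop h \<in> g_tilde x m"
  by (auto simp: hidx_def KK_g_tilde E_hat_g_tilde)

lemma bracket_hop: "X \<in> root_space x m \<alpha> \<Longrightarrow> h \<in> hidx m \<Longrightarrow> bracket x (hop h) X = gscale (hval \<alpha> h) X"
  by (auto simp: hidx_def root_space_def simp del: bracket_KK)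

lemma hop_root_space_0: "h \<in> hidx m \<Longrightarrow> hop h \<in> root_space x m 0"
  unfolding root_space_iff[OF hdual_0]
  using hop_g_tilde[of h m x]
  by (auto simp: hidx_def KK_def E_hat_def dwt_def in_keys_iff lookup_minus lookup_single when_def
      split: if_splits)

context super_module
begin

lemma carrier_smult [simp]: "v \<in> carrier M \<Longrightarrow> c \<odot> v \<in> carrier M"
  using M.smult_closed by simp

lemma smult_add_left: "v \<in> carrier M \<Longrightarrow> (a + b) \<odot> v = a \<odot> v \<oplus> b \<odot> v"
  using M.smult_l_distr[of a b v] by simp

lemma smult_add_right: "v \<in> carrier M \<Longrightarrow> w \<in> carrier M \<Longrightarrow> a \<odot> (v \<oplus> w) = a \<odot> v \<oplus> a \<odot> w"
  using M.smult_r_distr[of a v w] by simp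

lemma smult_smult: "v \<in> carrier M \<Longrightarrow> a \<odot> (b \<odot> v) = (a * b) \<odot> v"
  using M.smult_assoc1[of a b v] by simp

lemma smult_one [simp]: "v \<in> carrier M \<Longrightarrow> 1 \<odot> v = v"
  using M.smult_one by simp

lemma smult_zero [simp]: "c \<odot> \<zero> = \<zero>"
  using M.smult_r_null[of c] by simp

lemma minus_smult: "v \<in> carrier M \<Longrightarrow> \<ominus> v = (-1) \<odot> v"
proof -
  assume v: "v \<in> carrier M"
  have "(-1) \<odot> v \<oplus> v = \<zero>" using smult_add_left[OF v, of "-1" 1] v by simp
  thus ?thesis using v by (intro M.minus_equality) auto
qed

lemma diff_smult: "v \<in> carrier M \<Longrightarrow> w \<in> carrier M \<Longrightarrow> v \<ominus> c \<odot> w = v \<oplus> (- c) \<odot> w"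
  by (simp add: M.minus_eq minus_smult smult_smult)

lemma smult_eq_0: "v \<in> carrier M \<Longrightarrow> c \<odot> v = \<zero> \<Longrightarrow> c \<noteq> 0 \<Longrightarrow> v = \<zero>"
  using smult_smult[of v "inverse c" c] by simp

lemma act_zero [simp]: "X \<in> L \<Longrightarrow> act M X \<zero> = \<zero>"
  using act_smult[of X "\<zero>" 0] by simp

lemma act_0: "X \<in> L \<Longrightarrow> v \<in> carrier M \<Longrightarrow> act M 0 v = \<zero>"
  using act_gscale[of X v 0] by simp

lemma act_commute:
  assumes "X \<in> L" "Y \<in> L" "X \<in> gt_hom x p" "Y \<in> gt_hom x q" "p < 2" "q < 2" "v \<in> carrier M"
  shows "act M X (act M Y v) = act M (bracket x X Y) v \<oplus> sgn2 p q \<odot> act M Y (act M X v)"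
  using act_bracket[OF assms] assms by (simp add: M.minus_eq M.a_assoc M.l_neg)

lemma gr_submodule: "p < 2 \<Longrightarrow> submodule (gr M p) CC M"
  using smod lt_2_cases[of p] unfolding is_smodule_def by auto

lemma gr_Int: "gr M 0 \<inter> gr M (Suc 0) = {\<zero>}"
  using smod unfolding is_smodule_def by simp

lemma gr_carrier: "p < 2 \<Longrightarrow> v \<in> gr M p \<Longrightarrow> v \<in> carrier M"
  using M.submoduleE(1)[OF gr_submodule] by blast

lemma gr_zero: "p < 2 \<Longrightarrow> \<zero> \<in> gr M p"
  using gr_Int lt_2_cases[of p] by auto

lemma gr_add: "p < 2 \<Longrightarrow> v \<in> gr M p \<Longrightarrow> w \<in> gr M p \<Longrightarrow> v \<oplus> w \<in> gr M p"
  using M.submoduleE(5)[OF gr_submodule] by blast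

lemma gr_smult: "p < 2 \<Longrightarrow> v \<in> gr M p \<Longrightarrow> c \<odot> v \<in> gr M p"
  using M.submoduleE(4)[OF gr_submodule, of p c v] by simp

lemma gr_act: "X \<in> L \<Longrightarrow> X \<in> gt_hom x p \<Longrightarrow> p < 2 \<Longrightarrow> q < 2 \<Longrightarrow> v \<in> gr M q \<Longrightarrow> act M X v \<in> gr M ((p + q) mod 2)"
proof -
  have "\<forall>p<2. \<forall>q<2. \<forall>X\<in>L \<inter> gt_hom x p. \<forall>v\<in>gr M q. act M X v \<in> gr M ((p + q) mod 2)"
    using smod unfolding is_smodule_def by (elim conjE) assumption
  thus "X \<in> L \<Longrightarrow> X \<in> gt_hom x p \<Longrightarrow> p < 2 \<Longrightarrow> q < 2 \<Longrightarrow> v \<in> gr M q \<Longrightarrow> act M X v \<in> gr M ((p + q) mod 2)"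
    by blast
qed

lemma submodule_sum_unique:
  assumes A: "submodule A CC M" and B: "submodule B CC M" and AB: "A \<inter> B = {\<zero>}"
    and v: "v0 \<in> A" "v1 \<in> B" "w0 \<in> A" "w1 \<in> B" "v0 \<oplus> v1 = w0 \<oplus> w1"
  shows "v0 = w0" "v1 = w1"
proof -
  have cc: "v0 \<in> carrier M" "v1 \<in> carrier M" "w0 \<in> carrier M" "w1 \<in> carrier M"
    using M.submoduleE(1)[OF A] M.submoduleE(1)[OF B] v by auto
  have "v0 \<oplus> (\<ominus> w0) = w1 \<oplus> (\<ominus> v1)"
  proof -
    have "v0 \<oplus> (\<ominus> w0) = (v0 \<oplus> v1) \<oplus> (\<ominus> v1) \<oplus> (\<ominus> w0)"
      using cc by (simp add: M.a_assoc M.r_neg)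
    also have "\<dots> = (w0 \<oplus> w1) \<oplus> (\<ominus> v1) \<oplus> (\<ominus> w0)" by (simp add: v(5))
    also have "\<dots> = (\<ominus> w0 \<oplus> w0) \<oplus> (w1 \<oplus> (\<ominus> v1))"
      using cc by (simp add: M.a_ac del: M.l_neg M.r_neg M.r_neg1 M.r_neg2)
    also have "\<dots> = w1 \<oplus> (\<ominus> v1)" using cc by (simp add: M.l_neg)
    finally show ?thesis .
  qed
  moreover have "v0 \<oplus> (\<ominus> w0) \<in> A" "w1 \<oplus> (\<ominus> v1) \<in> B"
    using v M.submoduleE(3,5)[OF A] M.submoduleE(3,5)[OF B] by blast+
  ultimately have "v0 \<oplus> (\<ominus> w0) = \<zero>" "w1 \<oplus> (\<ominus> v1) = \<zero>" using AB by auto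
  thus "v0 = w0" "v1 = w1" using cc by (metis M.minus_equality M.minus_minus M.a_inv_closed M.a_comm)+
qed

lemma gr_unique:
  assumes "v0 \<in> gr M 0" "v1 \<in> gr M (Suc 0)" "w0 \<in> gr M 0" "w1 \<in> gr M (Suc 0)"
    and "v0 \<oplus> v1 = w0 \<oplus> w1"
  shows "v0 = w0" "v1 = w1"
  using submodule_sum_unique[OF gr_submodule gr_submodule gr_Int assms] by simp_all

lemma gr_split:
  assumes "v \<in> carrier M"
  obtains v0 v1 where "v0 \<in> gr M 0" "v1 \<in> gr M (Suc 0)" "v = v0 \<oplus> v1"
proof -
  have "\<forall>v\<in>carrier M. \<exists>v0\<in>gr M 0. \<exists>v1\<in>gr M 1. v = v0 \<oplus> v1"
    using smod unfolding is_smodule_def by (elim conjE) assumption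
  thus ?thesis using assms that by auto
qed

section \<open>Finite sums of module elements and spans\<close>

definition lsum :: "'v list \<Rightarrow> 'v"
  where "lsum ds = foldr (\<lambda>a b. a \<oplus> b) ds \<zero>"

lemma lsum_simps [simp]: "lsum [] = \<zero>" "lsum (d # ds) = d \<oplus> lsum ds"
  by (simp_all add: lsum_def)

lemma lsum_carrier [simp]: "set ds \<subseteq> carrier M \<Longrightarrow> lsum ds \<in> carrier M"
  by (induction ds) auto

lemma lsum_append: "set ds \<subseteq> carrier M \<Longrightarrow> set es \<subseteq> carrier M \<Longrightarrow> lsum (ds @ es) = lsum ds \<oplus> lsum es"
  by (induction ds) (auto simp: M.a_assoc)

lemma lsum_map:
  assumes "\<And>v w. v \<in> carrier M \<Longrightarrow> w \<in> carrier M \<Longrightarrow> T (v \<oplus> w) = T v \<oplus> T w" "T \<zero> = \<zero>"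
  shows "set ds \<subseteq> carrier M \<Longrightarrow> T (lsum ds) = lsum (map T ds)"
  by (induction ds) (auto simp: assms)

text \<open>If \<open>A\<close> is closed under scalars, as a union of weight spaces is, this is its
  linear span; the list of summands then gives something to do induction on.\<close>

definition LS :: "'v set \<Rightarrow> 'v set"
  where "LS A = lsum ` {ds. set ds \<subseteq> A}"

lemma LS_iff: "v \<in> LS A \<longleftrightarrow> (\<exists>ds. set ds \<subseteq> A \<and> v = lsum ds)"
  by (auto simp: LS_def)

lemma LS_carrier: "A \<subseteq> carrier M \<Longrightarrow> LS A \<subseteq> carrier M"
  by (auto simp: LS_def)

lemma LS_zero: "\<zero> \<in> LS A"
  unfolding LS_iff by (intro exI[of _ "[]"]) simp

lemma LS_base: "A \<subseteq> carrier M \<Longrightarrow> a \<in> A \<Longrightarrow> a \<in> LS A"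
  unfolding LS_iff by (intro exI[of _ "[a]"]) auto

lemma LS_add: "A \<subseteq> carrier M \<Longrightarrow> v \<in> LS A \<Longrightarrow> w \<in> LS A \<Longrightarrow> v \<oplus> w \<in> LS A"
proof -
  assume a: "A \<subseteq> carrier M" "v \<in> LS A" "w \<in> LS A"
  then obtain ds es where "set ds \<subseteq> A" "v = lsum ds" "set es \<subseteq> A" "w = lsum es" by (auto simp: LS_iff)
  thus ?thesis using a(1) by (auto simp: LS_iff lsum_append intro!: exI[of _ "ds @ es"])
qed

lemma LS_induct [consumes 2, case_names zero add]:
  assumes "v \<in> LS A" "A \<subseteq> carrier M" "P \<zero>" "\<And>a w. a \<in> A \<Longrightarrow> w \<in> LS A \<Longrightarrow> w \<in> carrier M \<Longrightarrow> P w \<Longrightarrow> P (a \<oplus> w)"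
  shows "P v"
proof -
  obtain ds where "set ds \<subseteq> A" "v = lsum ds" using assms(1) by (auto simp: LS_iff)
  moreover have "set ds \<subseteq> A \<Longrightarrow> P (lsum ds)" for ds
  proof (induction ds)
    case (Cons d ds)
    moreover have "lsum ds \<in> LS A" using Cons by (auto simp: LS_iff)
    ultimately show ?case using assms(2,4) by auto
  qed (simp add: assms(3))
  ultimately show ?thesis by simp
qed

lemma LS_map:
  assumes "A \<subseteq> carrier M" "v \<in> LS A"
    and "\<And>v w. v \<in> carrier M \<Longrightarrow> w \<in> carrier M \<Longrightarrow> T (v \<oplus> w) = T v \<oplus> T w" "T \<zero> = \<zero>"
    and "\<And>a. a \<in> A \<Longrightarrow> T a \<in> LS A'" "A' \<subseteq> carrier M"
  shows "T v \<in> LS A'"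
  using assms(2,1)
proof (induction rule: LS_induct)
  case zero show ?case using assms(4) by (simp add: LS_zero)
next
  case (add a w)
  have "T (a \<oplus> w) = T a \<oplus> T w" using add assms(1,3) by blast
  thus ?case using LS_add[OF assms(6) assms(5)[OF add(1)] add(4)] by simp
qed

lemma LS_submodule:
  assumes "A \<subseteq> carrier M" "\<And>c a. a \<in> A \<Longrightarrow> c \<odot> a \<in> A"
  shows "submodule (LS A) CC M"
proof (rule M.submoduleI)
  have sm: "c \<odot> v \<in> LS A" if "v \<in> LS A" for c v
    by (rule LS_map[OF assms(1) that, of "\<lambda>v. c \<odot> v"])
      (auto simp: smult_add_right assms intro!: LS_base[OF assms(1)])
  show "LS A \<subseteq> carrier M" by (rule LS_carrier[OF assms(1)])
  show "\<ominus> a \<in> LS A" if "a \<in> LS A" for a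
    using sm[OF that, of "-1"] LS_carrier[OF assms(1)] that by (auto simp: minus_smult)
  show "c \<odot> v \<in> LS A" if "v \<in> LS A" for c v by (rule sm[OF that])
qed (auto simp: LS_zero intro!: LS_add[OF assms(1)])

lemma LS_subset_submodule:
  assumes "submodule N CC M" "A \<subseteq> N"
  shows "LS A \<subseteq> N"
proof
  fix v assume "v \<in> LS A"
  moreover have "A \<subseteq> carrier M" using assms M.submoduleE(1) by blast
  ultimately show "v \<in> N"
  proof (induction rule: LS_induct)
    case zero
    obtain w where "w \<in> N" using M.submoduleE(2)[OF assms(1)] by blast
    hence "0 \<odot> w \<in> N" "w \<in> carrier M" using M.submoduleE(1,4)[OF assms(1)] by auto
    thus ?case by simp
  next
    case (add a w)
    thus ?case using M.submoduleE(5)[OF assms(1)] assms(2) by blast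
  qed
qed

lemma mspan_eq_LS:
  assumes "A \<subseteq> carrier M" "\<And>c a. a \<in> A \<Longrightarrow> c \<odot> a \<in> A"
  shows "mspan M A = LS A"
proof
  show "mspan M A \<subseteq> LS A"
    unfolding mspan_def by (rule hull_minimal) (auto intro: LS_base[OF assms(1)] LS_submodule[OF assms])
  show "LS A \<subseteq> mspan M A"
    unfolding mspan_def hull_def using LS_subset_submodule by blast
qed

lemma submodule_zero: "submodule N CC M \<Longrightarrow> \<zero> \<in> N"
  using LS_subset_submodule[of N "{}"] LS_zero[of "{}"] by blast

end

locale weight_module = super_module x "g_tilde x m" M for x m and M :: "'v smod" (structure)
begin

abbreviation "ws \<gamma> \<equiv> weight_space m M \<gamma>"

lemma ws_iff: "v \<in> ws \<gamma> \<longleftrightarrow> v \<in> carrier M \<and> (\<forall>h\<in>hidx m. act M (hop h) v = hval \<gamma> h \<odot> v)"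
  by (auto simp: weight_space_def hidx_def)

lemma ws_carrier: "v \<in> ws \<gamma> \<Longrightarrow> v \<in> carrier M"
  by (simp add: ws_iff)

lemma ws_zero [simp]: "\<zero> \<in> ws \<gamma>"
  by (simp add: ws_iff hop_g_tilde)

lemma ws_add: "v \<in> ws \<gamma> \<Longrightarrow> w \<in> ws \<gamma> \<Longrightarrow> v \<oplus> w \<in> ws \<gamma>"
  by (simp add: ws_iff hop_g_tilde act_add smult_add_right)

lemma ws_smult: "v \<in> ws \<gamma> \<Longrightarrow> c \<odot> v \<in> ws \<gamma>"
  by (simp add: ws_iff hop_g_tilde act_smult smult_smult mult.commute)

lemma ws_act_hom:
  assumes "X \<in> root_space x m \<alpha>" "X \<in> gt_hom x p" "p < 2" "v \<in> ws \<gamma>"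
  shows "act M X v \<in> ws (\<gamma> + \<alpha>)"
  unfolding ws_iff
proof (intro conjI ballI)
  note X = root_space_g_tilde[OF assms(1)]
  have v: "v \<in> carrier M" using assms(4) by (rule ws_carrier)
  show "act M X v \<in> carrier M" using X v by simp
  fix h assume h: "h \<in> hidx m"
  have "act M (hop h) (act M X v) = act M (bracket x (hop h) X) v \<oplus> sgn2 0 p \<odot> act M X (act M (hop h) v)"
    by (rule act_commute) (use X v h hop_g_tilde assms in auto)
  also have "\<dots> = hval \<alpha> h \<odot> act M X v \<oplus> hval \<gamma> h \<odot> act M X v"
    using assms(4) h X v by (simp add: bracket_hop[OF assms(1) h] act_gscale ws_iff act_smult)
  also have "\<dots> = hval (\<gamma> + \<alpha>) h \<odot> act M X v"
    using X v by (simp add: hval_add smult_add_left M.a_comm)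
  finally show "act M (hop h) (act M X v) = hval (\<gamma> + \<alpha>) h \<odot> act M X v" .
qed

lemma act_split: "X \<in> g_tilde x m \<Longrightarrow> v \<in> carrier M \<Longrightarrow>
    act M X v = act M (gt_comp x 0 X) v \<oplus> act M (gt_comp x (Suc 0) X) v"
  using act_add_left[of "gt_comp x 0 X" "gt_comp x (Suc 0) X" v] g_tilde_comp[of X x m 0] g_tilde_comp[of X x m "Suc 0"]
  by (simp add: gt_comp_sum)

lemma ws_act:
  assumes "\<alpha> \<in> hdual (I_tilde m)" "X \<in> root_space x m \<alpha>" "v \<in> ws \<gamma>"
  shows "act M X v \<in> ws (\<gamma> + \<alpha>)"
  unfolding act_split[OF root_space_g_tilde[OF assms(2)] ws_carrier[OF assms(3)]]
  by (intro ws_add ws_act_hom[OF root_space_comp[OF assms(1,2)] gt_comp_hom _ assms(3)]) auto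

text \<open>The Cartan subalgebra is even, so its eigenvalue equations hold for each parity
  component separately.\<close>

lemma ws_gr_split:
  assumes "v \<in> ws \<gamma>" "v0 \<in> gr M 0" "v1 \<in> gr M (Suc 0)" "v = v0 \<oplus> v1"
  shows "v0 \<in> ws \<gamma>" "v1 \<in> ws \<gamma>"
proof -
  have c: "v0 \<in> carrier M" "v1 \<in> carrier M" using gr_carrier[of 0 v0] gr_carrier[of "Suc 0" v1] assms by auto
  have "act M (hop h) v0 = hval \<gamma> h \<odot> v0 \<and> act M (hop h) v1 = hval \<gamma> h \<odot> v1" if h: "h \<in> hidx m" for h
  proof -
    note H = hop_g_tilde[OF h, of x]
    have "act M (hop h) v0 \<oplus> act M (hop h) v1 = hval \<gamma> h \<odot> v0 \<oplus> hval \<gamma> h \<odot> v1"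
    proof -
      have "act M (hop h) (v0 \<oplus> v1) = hval \<gamma> h \<odot> (v0 \<oplus> v1)"
        using assms(1) h unfolding ws_iff assms(4) by blast
      thus ?thesis using c by (simp add: act_add[OF H] smult_add_right)
    qed
    moreover have "act M (hop h) v0 \<in> gr M 0" using gr_act[OF H hop_hom _ _ assms(2)] by simp
    moreover have "act M (hop h) v1 \<in> gr M (Suc 0)" using gr_act[OF H hop_hom _ _ assms(3)] by simp
    moreover have "hval \<gamma> h \<odot> v0 \<in> gr M 0" "hval \<gamma> h \<odot> v1 \<in> gr M (Suc 0)"
      using assms(2,3) by (auto intro!: gr_smult)
    ultimately show ?thesis using gr_unique by blast
  qed
  thus "v0 \<in> ws \<gamma>" "v1 \<in> ws \<gamma>" using c by (auto simp: ws_iff)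
qed

definition shift_op :: "rat option \<Rightarrow> complex \<Rightarrow> 'v \<Rightarrow> 'v"
  where "shift_op h c v = act M (hop h) v \<oplus> (- c) \<odot> v"

lemma shift_op_ws: "h \<in> hidx m \<Longrightarrow> v \<in> ws \<gamma> \<Longrightarrow> shift_op h c v = (hval \<gamma> h - c) \<odot> v"
  using smult_add_left[of v "hval \<gamma> h" "- c"] by (simp add: shift_op_def ws_iff)

lemma shift_op_in_ws: "h \<in> hidx m \<Longrightarrow> v \<in> ws \<gamma> \<Longrightarrow> shift_op h c v \<in> ws \<gamma>"
  by (simp add: shift_op_ws ws_smult)

lemma shift_op_lsum: "h \<in> hidx m \<Longrightarrow> set ds \<subseteq> carrier M \<Longrightarrow> shift_op h c (lsum ds) = lsum (map (shift_op h c) ds)"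
  by (rule lsum_map) (auto simp: shift_op_def act_add hop_g_tilde smult_add_right M.a_ac)

text \<open>Choose a Cartan element separating \<tau> from the weight \<gamma> of the first summand.
  Subtracting its value at \<gamma> kills that summand, keeps the others in their weight spaces and
  multiplies \<open>t\<close> by a nonzero scalar, so induction on the number of summands
  applies.\<close>

lemma ws_independent:
  assumes "t \<in> ws \<tau>" "\<tau> \<in> hdual (I_tilde m)"
    and "t = lsum ds" "\<And>d. d \<in> set ds \<Longrightarrow> \<exists>\<gamma>\<in>hdual (I_tilde m) - {\<tau>}. d \<in> ws \<gamma>"
  shows "t = \<zero>"
  using assms(1,3,4)
proof (induction "length ds" arbitrary: t ds)
  case 0
  thus ?case by simp
next
  case (Suc n)
  then obtain d es where ds: "ds = d # es" "length es = n" by (cases ds) auto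
  obtain \<gamma> where \<gamma>: "\<gamma> \<in> hdual (I_tilde m)" "\<gamma> \<noteq> \<tau>" "d \<in> ws \<gamma>" using Suc.prems(3)[of d] ds by auto
  obtain h where h: "h \<in> hidx m" "hval \<gamma> h \<noteq> hval \<tau> h" using hval_inj[OF \<gamma>(1) assms(2)] \<gamma>(2) by blast
  let ?T = "shift_op h (hval \<gamma> h)"
  have car: "set ds \<subseteq> carrier M" using Suc.prems(3) ws_carrier by blast
  hence car': "set es \<subseteq> carrier M" by (simp add: ds)
  have "?T t = lsum (map ?T ds)" unfolding Suc.prems(2) by (rule shift_op_lsum[OF h(1) car])
  also have "\<dots> = ?T d \<oplus> lsum (map ?T es)" by (simp add: ds)
  also have "?T d = \<zero>" using shift_op_ws[OF h(1) \<gamma>(3)] ws_carrier[OF \<gamma>(3)] by simp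
  also have "\<zero> \<oplus> lsum (map ?T es) = lsum (map ?T es)"
    using shift_op_lsum[OF h(1) car', of "hval \<gamma> h", symmetric] lsum_carrier[OF car'] h(1)
    by (simp add: shift_op_def hop_g_tilde)
  finally have "?T t = lsum (map ?T es)" .
  moreover have "\<exists>\<gamma>\<in>hdual (I_tilde m) - {\<tau>}. e \<in> ws \<gamma>" if "e \<in> set (map ?T es)" for e
    using that Suc.prems(3) shift_op_in_ws[OF h(1)] ds by fastforce
  ultimately have "?T t = \<zero>"
    using ds by (intro Suc.hyps(1)[of "map ?T es"] shift_op_in_ws[OF h(1) Suc.prems(1)]) auto
  thus ?case using shift_op_ws[OF h(1) Suc.prems(1)] h(2) smult_eq_0[OF ws_carrier[OF Suc.prems(1)]] by simp
qed

text \<open>For the weight \<gamma> of the first summand on the \<Gamma> side, every operator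
  \<open>h - \<gamma>(h)\<close> leaves a vector with one summand less, still in both spans, hence 0
  by induction. So \<open>t\<close> itself is a weight vector of weight \<gamma>, and
  \<open>ws_independent\<close> applied to the \<Delta> side gives \<open>t = 0\<close>.\<close>

lemma LS_ws_disjoint:
  assumes "\<Gamma> \<subseteq> hdual (I_tilde m)" "\<Delta> \<subseteq> hdual (I_tilde m)" "\<Gamma> \<inter> \<Delta> = {}"
    and "t \<in> LS (\<Union>\<gamma>\<in>\<Gamma>. ws \<gamma>)" "t \<in> LS (\<Union>\<gamma>\<in>\<Delta>. ws \<gamma>)"
  shows "t = \<zero>"
proof -
  have ca: "(\<Union>\<gamma>\<in>\<Gamma>. ws \<gamma>) \<subseteq> carrier M" for \<Gamma> using ws_carrier by blast
  have "t = \<zero>" if "set ds \<subseteq> (\<Union>\<gamma>\<in>\<Gamma>. ws \<gamma>)" "t = lsum ds" "t \<in> LS (\<Union>\<gamma>\<in>\<Delta>. ws \<gamma>)" for ds t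
    using that
  proof (induction "length ds" arbitrary: t ds)
    case 0
    thus ?case by simp
  next
    case (Suc n)
    then obtain d es where ds: "ds = d # es" "length es = n" by (cases ds) auto
    then obtain \<gamma> where \<gamma>: "\<gamma> \<in> \<Gamma>" "d \<in> ws \<gamma>" using Suc.prems by auto
    have t: "t \<in> carrier M" using Suc.prems(3) LS_carrier[OF ca] by blast
    have "set es \<subseteq> (\<Union>\<gamma>\<in>\<Gamma>. ws \<gamma>)" using Suc.prems(1) ds by simp
    hence es: "set es \<subseteq> carrier M" by (rule order_trans[OF _ ca])
    have "shift_op h (hval \<gamma> h) t = \<zero>" if h: "h \<in> hidx m" for h
    proof (rule Suc.hyps(1))
      let ?T = "shift_op h (hval \<gamma> h)"
      show "n = length (map ?T es)" using ds by simp
      show "set (map ?T es) \<subseteq> (\<Union>\<gamma>\<in>\<Gamma>. ws \<gamma>)" using Suc.prems(1) ds shift_op_in_ws[OF h] by fastforce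
      show "?T t = lsum (map ?T es)"
      proof -
        have "?T t = ?T d \<oplus> lsum (map ?T es)"
          unfolding Suc.prems(2) ds(1) using shift_op_lsum[OF h, of "d # es"] es ws_carrier[OF \<gamma>(2)] by simp
        also have "?T d = \<zero>" using shift_op_ws[OF h \<gamma>(2)] ws_carrier[OF \<gamma>(2)] by simp
        also have "\<zero> \<oplus> lsum (map ?T es) = lsum (map ?T es)"
          using shift_op_lsum[OF h es, of "hval \<gamma> h", symmetric] lsum_carrier[OF es] h
          by (simp add: shift_op_def hop_g_tilde)
        finally show ?thesis .
      qed
      show "?T t \<in> LS (\<Union>\<gamma>\<in>\<Delta>. ws \<gamma>)"
      proof (rule LS_map[OF ca Suc.prems(3)])
        show "?T (v \<oplus> w) = ?T v \<oplus> ?T w" if "v \<in> carrier M" "w \<in> carrier M" for v w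
          using that h by (simp add: shift_op_def act_add hop_g_tilde smult_add_right M.a_ac)
        show "?T \<zero> = \<zero>" using h by (simp add: shift_op_def hop_g_tilde)
        show "?T a \<in> LS (\<Union>\<gamma>\<in>\<Delta>. ws \<gamma>)" if "a \<in> (\<Union>\<gamma>\<in>\<Delta>. ws \<gamma>)" for a
          using that shift_op_in_ws[OF h] by (intro LS_base[OF ca]) blast
      qed (rule ca)
    qed
    hence "act M (hop h) t = hval \<gamma> h \<odot> t" if "h \<in> hidx m" for h
    proof -
      have "act M (hop h) t \<oplus> (- hval \<gamma> h) \<odot> t = \<zero>"
        using \<open>\<And>h. h \<in> hidx m \<Longrightarrow> shift_op h (hval \<gamma> h) t = \<zero>\<close>[OF that] by (simp add: shift_op_def)
      moreover have "(hval \<gamma> h \<odot> t) \<oplus> (- hval \<gamma> h) \<odot> t = \<zero>"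
        using smult_add_left[OF t, of "hval \<gamma> h" "- hval \<gamma> h"] t by simp
      ultimately show ?thesis using t hop_g_tilde[OF that] M.add.right_cancel by (metis act_closed carrier_smult)
    qed
    hence tw: "t \<in> ws \<gamma>" using t by (simp add: ws_iff)
    obtain es' where es': "set es' \<subseteq> (\<Union>\<gamma>\<in>\<Delta>. ws \<gamma>)" "t = lsum es'" using Suc.prems(3) by (auto simp: LS_iff)
    show ?case
    proof (rule ws_independent[OF tw _ es'(2)])
      show "\<gamma> \<in> hdual (I_tilde m)" using \<gamma>(1) assms(1) by blast
      show "\<exists>\<gamma>'\<in>hdual (I_tilde m) - {\<gamma>}. d \<in> ws \<gamma>'" if "d \<in> set es'" for d
        using that es'(1) \<gamma>(1) assms(2,3) by blast
    qed
  qed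
  thus ?thesis using assms(4,5) by (auto simp: LS_iff)
qed

end

section \<open>Highest weight modules of the Levi subalgebra\<close>

text \<open>The values of \<open>phi\<close> separate the indices, so an entry of weight 0 is
  diagonal. Invariance of the form makes the entries at \<open>Ix r\<close> and \<open>Bar r\<close>
  opposite and the one at \<open>Bar0\<close> zero, which leaves a combination of the
  \<open>E_hat r\<close> and \<open>KK\<close>.\<close>

lemma root_space_0:
  assumes "X \<in> root_space x m 0"
  shows "X \<in> gspan (hop ` hidx m)"
proof -
  note X = assms[unfolded root_space_iff[OF hdual_0], simplified]
  have diag: "fst ab = snd ab" if "ab \<in> supp (fst X)" for ab
  proof (rule ccontr)
    assume ne: "fst ab \<noteq> snd ab"
    have i: "fst ab \<in> indices x m" "snd ab \<in> indices x m" using g_tilde_supp[of X x m] X that by (auto simp: mem_Times_iff)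
    have "lf (phi m) (dwt ab, 0) = 0" using X that by (auto simp: lf_def)
    thus False using ival_phi_inj[OF i ne] by (simp add: lf_dwt)
  qed
  have "(ipar x (fst ab) + ipar x (snd ab)) mod 2 = 0" if "ab \<in> supp (fst X)" for ab
    using diag[OF that] by (simp flip: mult_2)
  hence "fst X \<in> mat_hom x 0" by (auto simp: mat_hom_iff)
  hence G: "fst X \<in> G_hom x m 0" using X by (intro G_alg_hom) (auto simp: g_tilde_iff)
  define S where "S = {r \<in> I_tilde m. (Ix r, Ix r) \<in> supp (fst X)}"
  have "finite ((\<lambda>r. (Ix r, Ix r)) ` S)" by (rule finite_subset[OF _ finite_keys[of "fst X"]]) (auto simp: S_def)
  hence S: "finite S" by (rule finite_imageD) (auto simp: inj_on_def)
  define Y where "Y = (\<Sum>r\<in>S. gscale (coef (fst X) (Ix r, Ix r)) (E_hat r)) + gscale (snd X) KK"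
  have fst_sum: "fst (sum f S) = (\<Sum>r\<in>S. fst (f r))" "snd (sum f S) = (\<Sum>r\<in>S. snd (f r))" for f :: "rat \<Rightarrow> gt"
    using S by (induction rule: finite_induct) auto
  have supp: "supp (fst X) \<subseteq> indices x m \<times> indices x m" by (rule G_hom_supp[OF G])
  have bar: "coef (fst X) (Bar r, Bar r) = - coef (fst X) (Ix r, Ix r)" for r
  proof (cases "r \<in> I_tilde m")
    case True
    hence "Ix r \<in> indices x m" "Bar r \<in> indices x m" by (auto simp: indices_def)
    from G_hom_eq[OF G this] show ?thesis by simp
  next
    case False
    hence n: "Ix r \<notin> indices x m" "Bar r \<notin> indices x m" by (auto simp: indices_def split: if_splits)
    have "coef (fst X) (Bar r, Bar r) = 0" using supp n(2) by (auto simp: in_keys_iff subset_iff)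
    moreover have "coef (fst X) (Ix r, Ix r) = 0" using supp n(1) by (auto simp: in_keys_iff subset_iff)
    ultimately show ?thesis by simp
  qed
  have zero: "coef (fst X) (Bar0, Bar0) = 0"
  proof (cases "Bar0 \<in> indices x m")
    case True
    from G_hom_eq[OF G True True] show ?thesis by simp
  next
    case False
    thus ?thesis using supp by (auto simp: in_keys_iff subset_iff)
  qed
  have "X = Y"
  proof (rule prod_eqI)
    show "snd X = snd Y" by (simp add: Y_def fst_sum E_hat_def KK_def)
    show "fst X = fst Y"
    proof (rule poly_mapping_eqI)
      fix ab :: "index \<times> index"
      have Yc: "coef (fst Y) ab = (\<Sum>r\<in>S. coef (fst X) (Ix r, Ix r) * coef (bas (Ix r, Ix r) - bas (Bar r, Bar r)) ab)"
        by (simp add: Y_def fst_sum E_hat_def KK_def lookup_sum)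
      show "coef (fst X) ab = coef (fst Y) ab"
      proof (cases "fst ab = snd ab")
        case False
        hence "coef (fst X) ab = 0" using diag[of ab] in_keys_iff[of ab "fst X"] by blast
        moreover have "coef (bas (Ix r, Ix r) - bas (Bar r, Bar r)) ab = 0" for r
          using False by (auto simp: lookup_minus lookup_single when_def)
        ultimately show ?thesis unfolding Yc by simp
      next
        case True
        then obtain a where ab: "ab = (a, a)" by (metis prod.collapse)
        show ?thesis
        proof (cases a)
          case (Ix s)
          have "coef (fst Y) ab = (\<Sum>r\<in>S. if r = s then coef (fst X) (Ix r, Ix r) else 0)"
            unfolding Yc unfolding ab Ix by (rule sum.cong) (auto simp: lookup_minus lookup_single when_def)
          also have "\<dots> = coef (fst X) ab" using S supp unfolding ab Ix
            by (auto simp: sum.delta S_def in_keys_iff subset_iff indices_def split: if_splits)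
          finally show ?thesis by simp
        next
          case (Bar s)
          have "coef (fst Y) ab = (\<Sum>r\<in>S. if r = s then - coef (fst X) (Ix r, Ix r) else 0)"
            unfolding Yc unfolding ab Bar by (rule sum.cong) (auto simp: lookup_minus lookup_single when_def)
          also have "\<dots> = coef (fst X) ab" using S supp bar[of s] unfolding ab Bar
            by (auto simp: sum.delta S_def in_keys_iff subset_iff indices_def split: if_splits)
          finally show ?thesis by simp
        next
          case Bar0
          have "coef (fst Y) ab = 0"
            unfolding Yc unfolding ab Bar0 by (rule sum.neutral) (auto simp: lookup_minus lookup_single when_def)
          thus ?thesis using zero by (simp add: ab Bar0)
        qed
      qed
    qed
  qed
  moreover have "Y \<in> gspan (hop ` hidx m)"
    unfolding Y_def by (intro gv.span_add gv.span_sum gv.span_scale gv.span_base)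
      (auto simp: S_def hidx_def image_iff intro: bexI[of _ "Some _"] bexI[of _ None])
  ultimately show ?thesis by simp
qed

lemma (in weight_module) root_space_0_scalar:
  assumes "X \<in> root_space x m 0" "v \<in> ws \<gamma>"
  shows "\<exists>c. act M X v = c \<odot> v"
proof -
  have v: "v \<in> carrier M" using ws_carrier[OF assms(2)] .
  have sub: "gspan (hop ` hidx m) \<subseteq> g_tilde x m"
    by (rule gv.span_minimal[OF _ g_tilde_subspace]) (auto simp: hop_g_tilde)
  have "X \<in> gspan (hop ` hidx m)" by (rule root_space_0[OF assms(1)])
  hence "X \<in> g_tilde x m \<and> (\<exists>c. act M X v = c \<odot> v)"
  proof (induction rule: gv.span_induct_alt)
    case base
    have z: "(0 :: gt) \<in> g_tilde x m" by (rule gv.subspace_0[OF g_tilde_subspace])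
    hence "act M 0 v = 0 \<odot> v" using act_0[OF z v] v by simp
    thus ?case using z by blast
  next
    case (step c X Y)
    then obtain d where d: "act M Y v = d \<odot> v" and Y: "Y \<in> g_tilde x m" by blast
    obtain h where h: "h \<in> hidx m" "X = hop h" using step(1) by blast
    have X: "X \<in> g_tilde x m" using hop_g_tilde[OF h(1)] h(2) by simp
    have cX: "gscale c X \<in> g_tilde x m" by (rule gv.subspace_scale[OF g_tilde_subspace X])
    have "act M (gscale c X + Y) v = c \<odot> (hval \<gamma> h \<odot> v) \<oplus> d \<odot> v"
      using assms(2) h(1) v act_add_left[OF cX Y v] act_gscale[OF X v] by (simp add: d h(2) ws_iff)
    also have "\<dots> = (c * hval \<gamma> h + d) \<odot> v" using v by (simp add: smult_smult smult_add_left)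
    finally show ?case using gv.subspace_add[OF g_tilde_subspace cX Y] by blast
  qed
  thus ?thesis by blast
qed

locale levi_irreducible = weight_module x m M for x m and M :: "'v smod" (structure) +
  fixes Y0 :: "weight set" and N :: "'v set"
  assumes Y0: "Y0 \<subseteq> Pi_k x m"
    and sub: "is_subsmod (levi_tilde x m Y0) M N"
    and irr: "\<And>N'. is_subsmod (levi_tilde x m Y0) M N' \<Longrightarrow> N' \<subseteq> N \<Longrightarrow> N' = {\<zero>} \<or> N' = N"
begin

abbreviation "LR \<equiv> roots x m \<inter> levi_lattice Y0"

lemma LR_hdual: "\<alpha> \<in> LR \<or> \<alpha> = 0 \<Longrightarrow> \<alpha> \<in> hdual (I_tilde m)"
  using roots_hdual[of \<alpha> x m] by (elim disjE) (use hdual_0 in blast)+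

lemma N_submodule: "submodule N CC M"
  using sub by (simp add: is_subsmod_def)

lemma N_carrier: "v \<in> N \<Longrightarrow> v \<in> carrier M"
  using M.submoduleE(1)[OF N_submodule] by blast

lemma LR_levi: "\<alpha> \<in> LR \<Longrightarrow> X \<in> root_space x m \<alpha> \<Longrightarrow> X \<in> levi_tilde x m Y0"
  unfolding levi_eq by (rule gv.span_base) blast

lemma N_act: "\<alpha> \<in> LR \<Longrightarrow> X \<in> root_space x m \<alpha> \<Longrightarrow> v \<in> N \<Longrightarrow> act M X v \<in> N"
  using sub LR_levi unfolding is_subsmod_def by blast

lemma N_smult: "v \<in> N \<Longrightarrow> c \<odot> v \<in> N"
  using M.submoduleE(4)[OF N_submodule] by simp

lemma is_subsmodI:
  assumes "submodule D CC M" "\<And>v. v \<in> D \<Longrightarrow> \<exists>v0\<in>gr M 0 \<inter> D. \<exists>v1\<in>gr M 1 \<inter> D. v = v0 \<oplus> v1"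
    and D: "\<And>\<alpha> X p v. X \<in> root_space x m \<alpha> \<Longrightarrow> \<alpha> \<in> LR \<or> \<alpha> = 0 \<Longrightarrow> X \<in> gt_hom x p \<Longrightarrow> p < 2 \<Longrightarrow> v \<in> D \<Longrightarrow> act M X v \<in> D"
  shows "is_subsmod (levi_tilde x m Y0) M D"
  unfolding is_subsmod_def
proof (intro conjI ballI)
  show "submodule D CC M" by fact
  show "\<exists>v0\<in>gr M 0 \<inter> D. \<exists>v1\<in>gr M 1 \<inter> D. v = v0 \<oplus> v1" if "v \<in> D" for v using assms(2)[OF that] .
  fix X v assume X: "X \<in> levi_tilde x m Y0" and v: "v \<in> D"
  note Dc = M.submoduleE(1)[OF assms(1)]
  have gen: "act M X v \<in> D" if X: "X \<in> root_space x m \<alpha>" "\<alpha> \<in> LR \<or> \<alpha> = 0" for \<alpha> X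
  proof -
    have h: "\<alpha> \<in> hdual (I_tilde m)" by (rule LR_hdual[OF X(2)])
    have "act M (gt_comp x 0 X) v \<in> D" "act M (gt_comp x (Suc 0) X) v \<in> D"
      using root_space_comp[OF h X(1)] by (auto intro!: D[OF _ X(2) gt_comp_hom _ v])
    thus ?thesis using act_split[OF root_space_g_tilde[OF X(1)]] Dc v M.submoduleE(5)[OF assms(1)] by auto
  qed
  show "act M X v \<in> D"
  proof -
    have "X \<in> g_tilde x m \<and> act M X v \<in> D" using X unfolding levi_eq
    proof (induction rule: gv.span_induct_alt)
      case base
      thus ?case using gv.subspace_0[OF g_tilde_subspace[of x m]] act_0[OF gv.subspace_0[OF g_tilde_subspace[of x m]], of v] Dc v submodule_zero[OF assms(1)] by auto
    next
      case (step c X Y)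
      have X: "\<exists>\<alpha>. X \<in> root_space x m \<alpha> \<and> (\<alpha> \<in> LR \<or> \<alpha> = 0)"
      proof -
        have "KK \<in> root_space x m 0" "E_hat r \<in> root_space x m 0" if "r \<in> I_tilde m" for r
          using that hop_root_space_0[of None m x] hop_root_space_0[of "Some r" m x] by (auto simp: hidx_def)
        thus ?thesis using step(1) hop_root_space_0[of None m x] unfolding hidx_def by fastforce
      qed
      hence "act M X v \<in> D" "X \<in> g_tilde x m" using gen root_space_g_tilde by blast+
      moreover have Y: "Y \<in> g_tilde x m" "act M Y v \<in> D" using step(2) by blast+
      ultimately have "act M (gscale c X + Y) v = c \<odot> act M X v \<oplus> act M Y v"
        using v Dc gv.subspace_scale[OF g_tilde_subspace[of x m]] by (subst act_add_left) (auto simp: act_gscale)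
      thus ?case using \<open>act M X v \<in> D\<close> Y M.submoduleE(4,5)[OF assms(1)]
          gv.subspace_add[OF g_tilde_subspace gv.subspace_scale[OF g_tilde_subspace \<open>X \<in> g_tilde x m\<close>] Y(1)] by simp
    qed
    thus ?thesis by blast
  qed
qed

text \<open>Vectors obtained from multiples of \<open>u\<close> by repeatedly applying lowering
  operators. Their span replaces the submodule generated by \<open>u\<close> under the enveloping
  algebra of the negative part. Which roots are lowering is decided by \<open>l\<close>, so that the
  ordering can vary.\<close>

inductive_set D0 :: "(rat \<Rightarrow> real) \<Rightarrow> 'v \<Rightarrow> 'v set" for l u where
  base: "c \<odot> u \<in> D0 l u"
| step: "d \<in> D0 l u \<Longrightarrow> \<alpha> \<in> LR \<Longrightarrow> lf l \<alpha> < 0 \<Longrightarrow> X \<in> root_space x m \<alpha> \<Longrightarrow> X \<in> gt_hom x p \<Longrightarrow> p < 2 \<Longrightarrow> act M X d \<in> D0 l u"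

text \<open>A highest weight vector for the ordering given by \<open>l\<close>. It is required to be
  homogeneous so that everything generated from it by homogeneous operators is homogeneous, and the
  submodule it spans is graded.\<close>

definition singular :: "(rat \<Rightarrow> real) \<Rightarrow> weight \<Rightarrow> 'v \<Rightarrow> bool"
  where "singular l \<nu> u \<longleftrightarrow> u \<in> N \<and> u \<in> ws \<nu> \<and> \<nu> \<in> hdual (I_tilde m) \<and> (\<exists>q<2. u \<in> gr M q) \<and>
    (\<forall>\<alpha>\<in>LR. lf l \<alpha> > 0 \<longrightarrow> (\<forall>X\<in>root_space x m \<alpha>. \<forall>p<2. X \<in> gt_hom x p \<longrightarrow> act M X u = \<zero>))"

lemma bracket_LR:
  assumes "X \<in> root_space x m \<alpha>" "Z \<in> root_space x m \<beta>" "\<alpha> \<in> LR \<or> \<alpha> = 0" "\<beta> \<in> LR \<or> \<beta> = 0"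
  shows "bracket x X Z = 0 \<or> (bracket x X Z \<in> root_space x m (\<alpha> + \<beta>) \<and> (\<alpha> + \<beta> \<in> LR \<or> \<alpha> + \<beta> = 0))"
proof -
  have h: "\<alpha> \<in> hdual (I_tilde m)" "\<beta> \<in> hdual (I_tilde m)" by (rule LR_hdual[OF assms(3)], rule LR_hdual[OF assms(4)])
  have r: "bracket x X Z \<in> root_space x m (\<alpha> + \<beta>)" by (rule root_space_bracket[OF h assms(1,2)])
  have "\<alpha> + \<beta> \<in> levi_lattice Y0" using assms(3,4) levi_lattice_0 by (intro levi_lattice_add) auto
  thus ?thesis using rootsI[OF hdual_add[OF h] _ r] r by blast
qed

lemma D0_smult:
  assumes "u \<in> N" "d \<in> D0 l u"
  shows "c \<odot> d \<in> D0 l u"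
  using assms(2)
proof cases
  case (base k)
  thus ?thesis using N_carrier[OF assms(1)] D0.base[of "c * k" u l] by (simp add: smult_smult)
next
  case (step d' \<alpha> X p)
  have "d' \<in> carrier M"
    using step(2) by (induction rule: D0.induct) (use assms N_carrier root_space_g_tilde in auto)
  hence "c \<odot> d = act M (gscale c X) d'"
    using step(1) act_gscale[OF root_space_g_tilde[OF step(5)]] by simp
  moreover have "act M (gscale c X) d' \<in> D0 l u"
    by (rule D0.step[OF step(2,3,4) gv.subspace_scale[OF root_space_subspace step(5)] gt_hom_gscale[OF step(6)] step(7)])
  ultimately show ?thesis by simp
qed

text \<open>\<open>Q\<close> stands for any property of weights that survives adding roots negative
  for \<open>l\<close>; it is instantiated by bounds on linear functionals.\<close>

lemma D0_props:
  assumes "singular l \<nu> u" "d \<in> D0 l u" "Q \<nu>" "\<And>\<gamma> \<alpha>. Q \<gamma> \<Longrightarrow> \<alpha> \<in> LR \<Longrightarrow> lf l \<alpha> < 0 \<Longrightarrow> Q (\<gamma> + \<alpha>)"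
  shows "d \<in> N \<and> (\<exists>\<gamma>\<in>hdual (I_tilde m). Q \<gamma> \<and> d \<in> ws \<gamma>) \<and> (\<exists>q<2. d \<in> gr M q)"
  using assms(2)
proof (induction rule: D0.induct)
  case (base c)
  show ?case using assms(1,3) by (auto simp: singular_def intro: N_smult ws_smult gr_smult)
next
  case (step d \<alpha> X p)
  then obtain \<gamma> q where d: "d \<in> N" "\<gamma> \<in> hdual (I_tilde m)" "Q \<gamma>" "d \<in> ws \<gamma>" "q < 2" "d \<in> gr M q" by blast
  have "act M X d \<in> ws (\<gamma> + \<alpha>)" by (rule ws_act_hom[OF step(4-6) d(4)])
  moreover have "\<gamma> + \<alpha> \<in> hdual (I_tilde m)" using hdual_add[OF d(2) LR_hdual[OF disjI1[OF step(2)]]] .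
  moreover have "act M X d \<in> gr M ((p + q) mod 2)"
    by (rule gr_act[OF root_space_g_tilde[OF step(4)] step(5,6) d(5,6)])
  moreover have "(p + q) mod 2 < 2" by simp
  moreover have "Q (\<gamma> + \<alpha>)" by (rule assms(4)[OF d(3) step(2,3)])
  moreover have "act M X d \<in> N" by (rule N_act[OF step(2,4) d(1)])
  ultimately show ?case by blast
qed

lemma D0_carrier: "singular l \<nu> u \<Longrightarrow> D0 l u \<subseteq> carrier M"
  using D0_props[of l \<nu> u _ "\<lambda>_. True"] N_carrier by blast

text \<open>A raising operator \<open>X\<close> is commuted past the outermost lowering operator
  \<open>Z\<close>. Both the action of \<open>X\<close> and that of the bracket of \<open>X\<close>
  with \<open>Z\<close> on the shorter vector are covered by the induction hypothesis, as it is
  stated for all Levi roots and for weight 0.\<close>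

lemma D0_closed:
  assumes s: "singular l \<nu> u" and nz: "\<And>\<alpha>. \<alpha> \<in> LR \<Longrightarrow> lf l \<alpha> \<noteq> 0" and "d \<in> D0 l u"
    and "X \<in> root_space x m \<alpha>" "\<alpha> \<in> LR \<or> \<alpha> = 0" "X \<in> gt_hom x p" "p < 2"
  shows "act M X d \<in> LS (D0 l u)"
  using assms(3-7)
proof (induction arbitrary: \<alpha> X p rule: D0.induct)
  case (base c)
  have u: "u \<in> N" "u \<in> carrier M" using s N_carrier by (auto simp: singular_def)
  have X: "X \<in> g_tilde x m" by (rule root_space_g_tilde[OF base(1)])
  show ?case
  proof (cases "\<alpha> \<in> LR \<and> lf l \<alpha> < 0")
    case True
    thus ?thesis using D0.step[OF D0.base _ _ base(1,3,4)] by (intro LS_base[OF D0_carrier[OF s]]) blast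
  next
    case False
    show ?thesis
    proof (cases "\<alpha> = 0")
      case True
      then obtain k where "act M X (c \<odot> u) = k \<odot> (c \<odot> u)"
        using root_space_0_scalar[of X "c \<odot> u" \<nu>] base(1) s ws_smult by (auto simp: singular_def)
      thus ?thesis using D0_smult[OF u(1) D0.base] by (simp add: LS_base[OF D0_carrier[OF s]])
    next
      case nz0: False
      hence "\<alpha> \<in> LR" "lf l \<alpha> > 0" using False nz[of \<alpha>] base(2) by auto
      hence "act M X u = \<zero>" using s base by (auto simp: singular_def)
      thus ?thesis using u X by (simp add: act_smult LS_zero)
    qed
  qed
next
  case (step d \<beta> Z q)
  have u: "u \<in> N" using s by (auto simp: singular_def)
  have d: "d \<in> carrier M" using D0_carrier[OF s] step(1) by blast
  have Zd: "act M Z d \<in> D0 l u" by (rule D0.step[OF step(1-6)])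
  note G = root_space_g_tilde[OF step(4)] root_space_g_tilde[OF step(8)]
  show ?case
  proof (cases "\<alpha> \<in> LR \<and> lf l \<alpha> < 0")
    case True
    thus ?thesis using D0.step[OF Zd _ _ step(8,10,11)] by (intro LS_base[OF D0_carrier[OF s]]) blast
  next
    case False
    show ?thesis
    proof (cases "\<alpha> = 0")
      case True
      obtain \<gamma> where "act M Z d \<in> ws \<gamma>" using D0_props[OF s Zd, of "\<lambda>_. True"] by blast
      then obtain k where "act M X (act M Z d) = k \<odot> act M Z d"
        using root_space_0_scalar step(8) True by blast
      thus ?thesis using D0_smult[OF u Zd] by (simp add: LS_base[OF D0_carrier[OF s]])
    next
      case nz0: False
      have e: "act M X (act M Z d) = act M (bracket x X Z) d \<oplus> sgn2 p q \<odot> act M Z (act M X d)"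
        by (rule act_commute[OF G(2,1) step(10,5,11,6) d])
      have 1: "act M (bracket x X Z) d \<in> LS (D0 l u)"
      proof (cases "bracket x X Z = 0")
        case True
        thus ?thesis using act_0[OF G(1) d] by (simp add: LS_zero)
      next
        case False
        thus ?thesis using bracket_LR[OF step(8,4) step(9)] step(2) bracket_in_hom[OF step(10,5,11,6)]
          by (intro step.IH[of _ "\<alpha> + \<beta>" "(p + q) mod 2"]) auto
      qed
      have "act M X d \<in> LS (D0 l u)" by (rule step.IH[OF step(8-11)])
      hence "sgn2 p q \<odot> act M Z (act M X d) \<in> LS (D0 l u)"
      proof (rule LS_map[OF D0_carrier[OF s], of _ "\<lambda>v. sgn2 p q \<odot> act M Z v"])
        show "sgn2 p q \<odot> act M Z a \<in> LS (D0 l u)" if "a \<in> D0 l u" for a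
          using D0_smult[OF u D0.step[OF that step(2-6)]] by (intro LS_base[OF D0_carrier[OF s]])
      qed (use G in \<open>auto simp: act_add smult_add_right subsetD[OF D0_carrier[OF s]]\<close>)
      thus ?thesis unfolding e by (rule LS_add[OF D0_carrier[OF s] 1])
    qed
  qed
qed

lemma gr_split_LS:
  assumes "A \<subseteq> carrier M" "\<And>a. a \<in> A \<Longrightarrow> \<exists>q<2. a \<in> gr M q" "v \<in> LS A"
  shows "\<exists>v0\<in>gr M 0 \<inter> LS A. \<exists>v1\<in>gr M 1 \<inter> LS A. v = v0 \<oplus> v1"
  using assms(3,1)
proof (induction rule: LS_induct)
  case zero
  show ?case using gr_zero[of 0] gr_zero[of 1] LS_zero by (intro bexI[of _ "\<zero>"]) auto
next
  case (add a w)
  then obtain v0 v1 where v: "v0 \<in> gr M 0" "v0 \<in> LS A" "v1 \<in> gr M (Suc 0)" "v1 \<in> LS A" "w = v0 \<oplus> v1" by auto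
  have c: "a \<in> carrier M" "v0 \<in> carrier M" "v1 \<in> carrier M"
    using add(1) assms(1) gr_carrier[of 0 v0] gr_carrier[of "Suc 0" v1] v by auto
  have aL: "a \<in> LS A" by (rule LS_base[OF assms(1) add(1)])
  obtain q where "q < 2" "a \<in> gr M q" using assms(2)[OF add(1)] by blast
  then consider "a \<in> gr M 0" | "a \<in> gr M (Suc 0)" using lt_2_cases[of q] by auto
  thus ?case
  proof cases
    case 1
    have "a \<oplus> w = (a \<oplus> v0) \<oplus> v1" using c by (simp add: v(5) M.a_assoc)
    moreover have "a \<oplus> v0 \<in> gr M 0 \<inter> LS A" using gr_add[of 0] 1 v LS_add[OF assms(1) aL] by auto
    ultimately show ?thesis using v by auto
  next
    case 2
    have "a \<oplus> w = v0 \<oplus> (a \<oplus> v1)" using c by (simp add: v(5) M.a_lcomm)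
    moreover have "a \<oplus> v1 \<in> gr M (Suc 0) \<inter> LS A" using gr_add[of "Suc 0"] 2 v LS_add[OF assms(1) aL] by auto
    ultimately show ?thesis using v by auto
  qed
qed

text \<open>By irreducibility the span of the lowered vectors is all of \<open>N\<close>.
  Consequently every weight of \<open>N\<close> arises from \<nu> by adding roots negative for
  \<open>l\<close>, whichever ordering \<open>l\<close> and singular vector are used.\<close>

lemma singular_span:
  assumes s: "singular l \<nu> u" and nz: "\<And>\<alpha>. \<alpha> \<in> LR \<Longrightarrow> lf l \<alpha> \<noteq> 0" and u: "u \<noteq> \<zero>"
    and Q: "Q \<nu>" "\<And>\<gamma> \<alpha>. Q \<gamma> \<Longrightarrow> \<alpha> \<in> LR \<Longrightarrow> lf l \<alpha> < 0 \<Longrightarrow> Q (\<gamma> + \<alpha>)"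
  shows "N \<subseteq> LS {v \<in> N. \<exists>\<gamma>\<in>hdual (I_tilde m). Q \<gamma> \<and> v \<in> ws \<gamma>}"
proof -
  have uN: "u \<in> N" using s by (simp add: singular_def)
  note ca = D0_carrier[OF s] and pr = D0_props[OF s]
  have "is_subsmod (levi_tilde x m Y0) M (LS (D0 l u))"
  proof (rule is_subsmodI)
    show "submodule (LS (D0 l u)) CC M" by (rule LS_submodule[OF ca D0_smult[OF uN]])
    show "\<exists>v0\<in>gr M 0 \<inter> LS (D0 l u). \<exists>v1\<in>gr M 1 \<inter> LS (D0 l u). v = v0 \<oplus> v1" if "v \<in> LS (D0 l u)" for v
      by (rule gr_split_LS[OF ca _ that]) (use pr[of _ "\<lambda>_. True"] in blast)
    show "act M X v \<in> LS (D0 l u)"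
      if X: "X \<in> root_space x m \<alpha>" "\<alpha> \<in> LR \<or> \<alpha> = 0" "X \<in> gt_hom x p" "p < 2" and v: "v \<in> LS (D0 l u)" for \<alpha> X p v
      by (rule LS_map[OF ca v _ _ _ ca])
        (use D0_closed[OF s nz _ X] root_space_g_tilde[OF X(1)] in \<open>auto simp: act_add\<close>)
  qed
  moreover have "LS (D0 l u) \<subseteq> N"
    by (rule LS_subset_submodule[OF N_submodule]) (use pr[of _ "\<lambda>_. True"] in blast)
  moreover have "u \<in> LS (D0 l u)" using D0.base[of 1 u l] N_carrier[OF uN] by (intro LS_base[OF ca]) simp
  ultimately have "N = LS (D0 l u)" using irr[of "LS (D0 l u)"] u by blast
  also have "\<dots> \<subseteq> LS {v \<in> N. \<exists>\<gamma>\<in>hdual (I_tilde m). Q \<gamma> \<and> v \<in> ws \<gamma>}"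
    unfolding LS_def using pr[of _ Q, OF _ Q] by (intro image_mono) blast
  finally show ?thesis .
qed

lemma weight_of_span:
  assumes "N \<subseteq> LS {v \<in> N. \<exists>\<gamma>\<in>hdual (I_tilde m). Q \<gamma> \<and> v \<in> ws \<gamma>}"
    and "t \<in> N" "t \<in> ws \<tau>" "t \<noteq> \<zero>" "\<tau> \<in> hdual (I_tilde m)"
  shows "Q \<tau>"
proof (rule ccontr)
  assume q: "\<not> Q \<tau>"
  obtain ds where ds: "set ds \<subseteq> {v \<in> N. \<exists>\<gamma>\<in>hdual (I_tilde m). Q \<gamma> \<and> v \<in> ws \<gamma>}" "t = lsum ds"
    using subsetD[OF assms(1,2)] unfolding LS_iff by blast
  have "t = \<zero>" by (rule ws_independent[OF assms(3,5) ds(2)]) (use ds(1) q in blast)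
  thus False using assms(4) by simp
qed

end

section \<open>Weights of the irreducible Levi modules\<close>

lemma lf_cong: "(\<And>r. r \<in> supp (fst \<alpha>) \<Longrightarrow> l r = l' r) \<Longrightarrow> lf l \<alpha> = lf l' \<alpha>"
  unfolding lf_def dotp_def by (intro arg_cong[of _ _ Re] sum.cong) auto

lemma lf_nonneg:
  assumes "\<And>r. r \<in> supp (fst \<alpha>) \<Longrightarrow> 0 \<le> l r * Re (coef (fst \<alpha>) r)"
  shows "0 \<le> lf l \<alpha>"
  using assms unfolding lf_def dotp_def by (auto simp: mult.commute intro!: sum_nonneg)

text \<open>No generator of the lattice joins a negative to a positive index, and those on positive
  indices are differences, so the sum of the coefficients at positive indices is 0.\<close>

lemma lattice_cnt:
  assumes "Y0 \<subseteq> Pi_k x m" "\<alpha> \<in> levi_lattice Y0"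
  shows "lf (\<lambda>r. if r > 0 then 1 else 0) \<alpha> = 0"
proof -
  let ?l = "\<lambda>r. if r > (0 :: rat) then 1 else 0 :: real"
  have Y: "lf ?l \<beta> = 0" if "\<beta> \<in> Y0" for \<beta>
  proof -
    have "\<beta> \<in> Pi_k x m" using assms(1) that by blast
    thus ?thesis
      by (cases x) (auto simp: Pi_k_def lf_simps split: if_splits)
  qed
  show ?thesis
    using assms(2) unfolding levi_lattice_def
  proof (induction rule: group_closure.induct)
    case (base \<beta>)
    have "lf ?l (eps r - eps (r + 1 / 2)) = 0" if "r \<in> halfN" for r using halfN_pos[OF that] by (simp add: lf_simps)
    moreover have "lf ?l 0 = 0" by (simp add: lf_simps)
    ultimately show ?case using base Y by blast
  next
    case (diff \<beta> \<gamma>)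
    thus ?case by (simp add: lf_simps)
  qed
qed

lemma eps_diff_inj:
  assumes "eps c - eps d = eps a - eps b" "c \<noteq> d"
  shows "c = a \<and> d = b"
proof -
  have e: "coef (bas c - bas d) r = coef (bas a - bas b) r" for r
    using arg_cong[OF assms(1), of "\<lambda>w. coef (fst w) r"] by (simp add: eps_def)
  show ?thesis using e[of c] e[of d] e[of a] assms(2)
    by (auto simp: lookup_minus lookup_single when_def split: if_splits)
qed

text \<open>The position of \<open>r\<close> in the ordering of \<^const>\<open>halfN\<close> in which \<open>a\<close> is moved right behind \<open>a + j / 2\<close>.\<close>

definition pos :: "rat \<Rightarrow> nat \<Rightarrow> rat \<Rightarrow> rat"
  where "pos a j r = (if r = a then a + of_nat j / 2 + 1 / 4 else r)"

text \<open>The functional whose positive Levi roots belong to the modified ordering. The sign makes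
  earlier positions larger; on negative indices the original ordering is kept.\<close>

definition lfun :: "nat \<Rightarrow> rat \<Rightarrow> nat \<Rightarrow> rat \<Rightarrow> real"
  where "lfun m a j r = (if r \<le> 0 then phi m r else - of_rat (pos a j r))"

lemma lf_lfun_eps:
  assumes "c \<in> halfN" "d \<in> halfN"
  shows "lf (lfun m a j) (eps c - eps d) = of_rat (pos a j d - pos a j c)"
  using halfN_pos[OF assms(1)] halfN_pos[OF assms(2)] by (simp add: lf_simps lfun_def of_rat_diff)

text \<open>The offset 1/4 moves \<open>a\<close> off the grid of half-integers, so its position
  never coincides with another one.\<close>

lemma pos_neq:
  assumes "a \<in> halfN" "c \<in> halfN" "d \<in> halfN" "c \<noteq> d"
  shows "pos a j c \<noteq> pos a j d"
proof -
  obtain na nc nd :: nat where n: "a = of_nat na / 2" "c = of_nat nc / 2" "d = of_nat nd / 2"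
    using assms(1-3) by (auto simp: halfN_def)
  have *: "of_nat p / 2 \<noteq> of_nat q / 2 + of_nat j / 2 + (1/4 :: rat)" for p q :: nat
  proof
    assume "of_nat p / 2 = of_nat q / 2 + of_nat j / 2 + (1/4 :: rat)"
    hence "(of_nat (2 * p) :: rat) = of_nat (2 * q + 2 * j + 1)" by (simp add: field_simps)
    hence "2 * p = 2 * q + 2 * j + 1" unfolding of_nat_eq_iff .
    thus False by presburger
  qed
  show ?thesis using assms(4) *[of nc na] *[of nd na] *[of nc nd] unfolding pos_def n by auto
qed

text \<open>From \<open>j\<close> to \<open>j + 1\<close> the index \<open>a\<close> overtakes
  exactly one other index, namely \<open>a + (j + 1) / 2\<close>; all other comparisons are
  unchanged.\<close>

lemma pos_swap:
  assumes "a \<in> halfN" "c \<in> halfN" "d \<in> halfN" "c \<noteq> d"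
  shows "pos a (Suc j) c < pos a (Suc j) d \<longleftrightarrow>
    (pos a j c < pos a j d \<and> \<not> (c = a \<and> d = a + of_nat (Suc j) / 2)) \<or> (c = a + of_nat (Suc j) / 2 \<and> d = a)"
proof -
  obtain na nc nd :: nat where n: "a = of_nat na / 2" "c = of_nat nc / 2" "d = of_nat nd / 2"
    using assms(1-3) by (auto simp: halfN_def)
  have h: "of_nat p / 2 + of_nat k / 2 + 1 / 4 < (of_nat q / 2 :: rat) \<longleftrightarrow> p + k < q"
    "(of_nat q / 2 :: rat) < of_nat p / 2 + of_nat k / 2 + 1 / 4 \<longleftrightarrow> q \<le> p + k"
    "(of_nat q / 2 :: rat) = of_nat p / 2 + of_nat k / 2 \<longleftrightarrow> q = p + k" for p q k :: nat
  proof -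
    have "of_nat p / 2 + of_nat k / 2 + 1 / 4 < (of_nat q / 2 :: rat) \<longleftrightarrow> (of_nat (2 * p + 2 * k + 1) :: rat) < of_nat (2 * q)"
      by (auto simp: field_simps)
    thus "of_nat p / 2 + of_nat k / 2 + 1 / 4 < (of_nat q / 2 :: rat) \<longleftrightarrow> p + k < q"
      unfolding of_nat_less_iff by linarith
    have "(of_nat q / 2 :: rat) < of_nat p / 2 + of_nat k / 2 + 1 / 4 \<longleftrightarrow> (of_nat (2 * q) :: rat) < of_nat (2 * p + 2 * k + 1)"
      by (auto simp: field_simps)
    thus "(of_nat q / 2 :: rat) < of_nat p / 2 + of_nat k / 2 + 1 / 4 \<longleftrightarrow> q \<le> p + k"
      unfolding of_nat_less_iff by linarith
    have "(of_nat q / 2 :: rat) = of_nat p / 2 + of_nat k / 2 \<longleftrightarrow> (of_nat q :: rat) = of_nat (p + k)"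
      by (auto simp: field_simps)
    thus "(of_nat q / 2 :: rat) = of_nat p / 2 + of_nat k / 2 \<longleftrightarrow> q = p + k"
      unfolding of_nat_eq_iff .
  qed
  show ?thesis using assms(4) unfolding pos_def n
    by (simp only: h split: if_split) auto
qed

lemma halfN_add: "a \<in> halfN \<Longrightarrow> a + of_nat j / 2 \<in> halfN"
proof -
  assume "a \<in> halfN"
  then obtain n :: nat where n: "a = of_nat n / 2" "n \<ge> 1" by (auto simp: halfN_def)
  have "a + of_nat j / 2 = of_nat (n + j) / 2" by (simp add: n add_divide_distrib)
  thus ?thesis using n(2) unfolding halfN_def mem_Collect_eq by (intro exI[of _ "n + j"]) simp
qed

text \<open>Indices at an odd number of half-steps from \<open>a\<close> have the other parity. This
  is what makes the reflections in the chain below alternate between odd and even.\<close>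

lemma halfN_int_add: "a + of_nat n + 1 / 2 \<in> \<int> \<longleftrightarrow> a \<notin> \<int>" if aN: "a \<in> halfN" for a :: rat
proof -
  obtain k :: nat where a: "a = of_nat k / 2" using aN unfolding halfN_def by blast
  have *: "(of_nat k / 2 :: rat) \<in> \<int> \<longleftrightarrow> even k" for k :: nat
  proof
    assume "(of_nat k / 2 :: rat) \<in> \<int>"
    then obtain i :: int where "(of_nat k / 2 :: rat) = of_int i" by (auto simp: Ints_def)
    hence "(of_int (int k) :: rat) = of_int (2 * i)" by simp
    hence "int k = 2 * i" unfolding of_int_eq_iff .
    thus "even k" by presburger
  next
    assume "even k"
    then obtain i where "k = 2 * i" by (elim evenE)
    thus "(of_nat k / 2 :: rat) \<in> \<int>" by simp
  qed
  have "a + of_nat n + 1 / 2 = of_nat (k + 2 * n + 1) / 2" by (simp add: a field_simps)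
  hence "a + of_nat n + 1 / 2 \<in> \<int> \<longleftrightarrow> even (k + 2 * n + 1)" by (simp only: *)
  also have "\<dots> \<longleftrightarrow> a \<notin> \<int>" unfolding a * by simp
  finally show ?thesis .
qed

context levi_irreducible
begin

text \<open>By \<open>lattice_cnt\<close> the coefficients at positive indices sum to 0. A root has
  at most two indices, so it either avoids positive ones or is a difference of two of them.\<close>

lemma LR_cases:
  assumes "\<alpha> \<in> LR"
  shows "(\<forall>r\<in>halfN. coef (fst \<alpha>) r = 0) \<or> (\<exists>a\<in>halfN. \<exists>b\<in>halfN. a \<noteq> b \<and> \<alpha> = eps a - eps b)"
proof -
  have a: "\<alpha> \<in> roots x m" using assms by blast
  obtain X ab where X: "X \<in> root_space x m \<alpha>" "ab \<in> supp (fst X)" by (rule roots_obtain[OF a])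
  note e = root_space_entry[OF a X]
  let ?l = "\<lambda>r. if r > (0 :: rat) then 1 else 0 :: real"
  have "lf ?l \<alpha> = 0" using lattice_cnt[OF Y0] assms by blast
  hence eq: "ival ?l (fst ab) = ival ?l (snd ab)" unfolding e(4) lf_dwt by simp
  obtain p q where ab: "ab = (p, q)" by (cases ab)
  have pq: "p \<in> indices x m" "q \<in> indices x m" "p \<noteq> q" using e ab by auto
  have neg: "coef (iwt p) r = 0" if "ival ?l p = 0" "r \<in> halfN" for p r
    using that halfN_pos[OF that(2)] by (cases p) (auto simp: coef_iwt lookup_single when_def split: if_splits)
  show ?thesis
  proof (cases "ival ?l p = 0")
    case True
    hence "\<forall>r\<in>halfN. coef (fst \<alpha>) r = 0" using eq neg[of p] neg[of q] unfolding e(4) by (simp add: dwt_def ab lookup_minus)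
    thus ?thesis ..
  next
    case False
    have "(\<exists>a\<in>halfN. \<exists>b\<in>halfN. p = Ix a \<and> q = Ix b) \<or> (\<exists>a\<in>halfN. \<exists>b\<in>halfN. p = Bar b \<and> q = Bar a)"
      using False eq pq I_tilde_pos unfolding ab
      by (cases p; cases q) (auto simp: indices_def split: if_splits)
    thus ?thesis
    proof (elim disjE bexE conjE)
      fix a b assume "a \<in> halfN" "b \<in> halfN" "p = Ix a" "q = Ix b"
      thus ?thesis using pq(3) e(4) ab by (intro disjI2 bexI[of _ a] bexI[of _ b]) (auto simp: dwt_def eps_def)
    next
      fix a b assume "a \<in> halfN" "b \<in> halfN" "p = Bar b" "q = Bar a"
      thus ?thesis using pq(3) e(4) ab by (intro disjI2 bexI[of _ a] bexI[of _ b]) (auto simp: dwt_def eps_def)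
    qed
  qed
qed

lemma eps_diff_LR: "a \<in> halfN \<Longrightarrow> b \<in> halfN \<Longrightarrow> a \<noteq> b \<Longrightarrow> eps a - eps b \<in> LR"
  by (intro IntI levi_lattice_pos rootsI[OF eps_diff_hdual[OF halfN_I_tilde halfN_I_tilde] eps_diff_neq_0
    Eroot_root_space[OF halfN_I_tilde halfN_I_tilde] Eroot_neq_0])

lemma lf_lfun_zero:
  assumes "\<alpha> \<in> LR" "\<forall>r\<in>halfN. coef (fst \<alpha>) r = 0"
  shows "lf (lfun m a j) \<alpha> = lf (phi m) \<alpha>"
proof (rule lf_cong)
  fix r assume r: "r \<in> supp (fst \<alpha>)"
  have "r \<in> I_tilde m" using LR_hdual[OF disjI1[OF assms(1)]] r by (auto simp: hdual_def)
  moreover have "r \<notin> halfN" using r assms(2) by (auto simp: in_keys_iff)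
  ultimately have "r \<le> 0" using I_tilde_pos[of r m] by linarith
  thus "lfun m a j r = phi m r" by (simp add: lfun_def)
qed

lemma lfun_neq_0:
  assumes "a \<in> halfN" "\<alpha> \<in> LR"
  shows "lf (lfun m a j) \<alpha> \<noteq> 0"
  using LR_cases[OF assms(2)]
proof (elim disjE bexE conjE)
  assume "\<forall>r\<in>halfN. coef (fst \<alpha>) r = 0"
  thus ?thesis using lf_lfun_zero[OF assms(2)] roots_phi(1)[of \<alpha> x m] assms(2) by simp
next
  fix c d assume "c \<in> halfN" "d \<in> halfN" "c \<noteq> d" "\<alpha> = eps c - eps d"
  thus ?thesis using lf_lfun_eps[of c d m a j] pos_neq[OF assms(1), of c d j] by simp
qed

lemma lfun_swap:
  assumes "a \<in> halfN" "\<alpha> \<in> LR" and b: "b = a + of_nat (Suc j) / 2"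
  shows "lf (lfun m a (Suc j)) \<alpha> > 0 \<longleftrightarrow>
    (lf (lfun m a j) \<alpha> > 0 \<and> \<alpha> \<noteq> eps a - eps b) \<or> \<alpha> = - (eps a - eps b)"
  using LR_cases[OF assms(2)]
proof (elim disjE bexE conjE)
  assume z: "\<forall>r\<in>halfN. coef (fst \<alpha>) r = 0"
  have "a \<noteq> b" using b by simp
  hence "\<alpha> \<noteq> eps a - eps b" "\<alpha> \<noteq> - (eps a - eps b)"
    using bspec[OF z assms(1)] by (auto simp: lookup_minus lookup_single)
  thus ?thesis using lf_lfun_zero[OF assms(2) z] by simp
next
  fix c d assume cd: "c \<in> halfN" "d \<in> halfN" "c \<noteq> d" "\<alpha> = eps c - eps d"
  have "\<alpha> = eps a - eps b \<longleftrightarrow> c = a \<and> d = b" "\<alpha> = - (eps a - eps b) \<longleftrightarrow> c = b \<and> d = a"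
    using eps_diff_inj[of c d a b] eps_diff_inj[of c d b a] cd(3,4) by auto
  thus ?thesis using pos_swap[OF assms(1) cd(1-3), of j] unfolding cd(4) lf_lfun_eps[OF cd(1,2)] b by simp
qed

text \<open>All weights of \<open>N\<close> arise from \<nu> by adding roots with negative value, so
  \<nu> maximises \<open>l\<close>. In particular no singular vector for the same ordering can have
  a strictly lower value.\<close>

lemma singular_unique_weight:
  assumes s: "singular l \<nu> u" and u: "u \<noteq> \<zero>" and nz: "\<And>\<alpha>. \<alpha> \<in> LR \<Longrightarrow> lf l \<alpha> \<noteq> 0"
    and t: "t \<in> N" "t \<in> ws \<tau>" "t \<noteq> \<zero>" "\<tau> \<in> hdual (I_tilde m)"
  shows "lf l \<tau> \<le> lf l \<nu>"
proof (rule weight_of_span[OF singular_span[OF s nz u] t])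
  show "lf l (\<gamma> + \<alpha>) \<le> lf l \<nu>" if "lf l \<gamma> \<le> lf l \<nu>" "\<alpha> \<in> LR" "lf l \<alpha> < 0" for \<gamma> \<alpha>
    using that by (simp add: lf_simps)
qed auto

end

text \<open>Two orderings that differ in the transposition of the neighbours \<open>a\<close> and \<open>b\<close>.\<close>

locale reflection = levi_irreducible x m M Y0 N
  for x m and M :: "'v smod" (structure) and Y0 and N +
  fixes l l' :: "rat \<Rightarrow> real" and a b :: rat and \<beta> :: weight and e f :: gt and \<nu> :: weight and u :: 'v
  assumes ab: "a \<in> halfN" "b \<in> halfN" "a \<noteq> b" and \<beta>: "\<beta> = eps a - eps b" and l\<beta>: "lf l \<beta> > 0"
    and ef: "e = Eroot x a b" "f = Eroot x b a"
    and nz: "\<And>\<alpha>. \<alpha> \<in> LR \<Longrightarrow> lf l \<alpha> \<noteq> 0"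
    and l': "\<And>\<alpha>. \<alpha> \<in> LR \<Longrightarrow> lf l' \<alpha> > 0 \<longleftrightarrow> (lf l \<alpha> > 0 \<and> \<alpha> \<noteq> \<beta>) \<or> \<alpha> = - \<beta>"
    and u: "singular l \<nu> u" "u \<noteq> \<zero>"
begin

definition fp :: "nat \<Rightarrow> 'v" where "fp s = (act M f ^^ s) u"

lemma fp_simps: "fp 0 = u" "fp (Suc s) = act M f (fp s)"
  by (simp_all add: fp_def)

lemma roots_ab: "\<beta> \<in> LR" "- \<beta> \<in> LR" "e \<in> root_space x m \<beta>" "f \<in> root_space x m (- \<beta>)"
  "e \<in> g_tilde x m" "f \<in> g_tilde x m"
  using eps_diff_LR[OF ab] eps_diff_LR[OF ab(2,1)] ab Eroot_root_space[OF halfN_I_tilde[OF ab(1)] halfN_I_tilde[OF ab(2)]]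
    Eroot_root_space[OF halfN_I_tilde[OF ab(2)] halfN_I_tilde[OF ab(1)]]
    Eroot_g_tilde[OF halfN_I_tilde[OF ab(1)] halfN_I_tilde[OF ab(2)]] Eroot_g_tilde[OF halfN_I_tilde[OF ab(2)] halfN_I_tilde[OF ab(1)]]
  unfolding \<beta> ef by auto

definition "pr = (ipar x (Ix a) + ipar x (Ix b)) mod 2"

lemma pr: "pr < 2" "e \<in> gt_hom x pr" "f \<in> gt_hom x pr"
  using Eroot_hom[of x a b] Eroot_hom[of x b a] unfolding ef pr_def by (simp_all add: add.commute)

lemma u_facts: "u \<in> N" "u \<in> ws \<nu>" "\<nu> \<in> hdual (I_tilde m)"
  using u(1) by (auto simp: singular_def)

lemma fp_N: "fp s \<in> N"
  by (induction s) (use u_facts N_act[OF roots_ab(2,4)] in \<open>auto simp: fp_simps\<close>)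

lemma fp_carrier: "fp s \<in> carrier M"
  by (rule N_carrier[OF fp_N])

primrec fwt :: "nat \<Rightarrow> weight" where
  "fwt 0 = \<nu>"
| "fwt (Suc s) = fwt s + - \<beta>"

lemma fp_ws: "fp s \<in> ws (fwt s)" "fwt s \<in> hdual (I_tilde m)"
proof (induction s)
  case (Suc s)
  { case 1 show ?case unfolding fp_simps fwt.simps by (rule ws_act_hom[OF roots_ab(4) pr(3,1) Suc(1)]) }
  { case 2 show ?case unfolding fwt.simps by (rule hdual_add[OF Suc(2) LR_hdual[OF disjI1[OF roots_ab(2)]]]) }
qed (use u_facts in \<open>auto simp: fp_simps\<close>)

lemma fst_beta: "fst \<beta> = bas a - bas b"
  by (simp add: \<beta>)

lemma fwt_coef: "coef (fst (fwt s)) r = coef (fst \<nu>) r - of_nat s * (if r = a then 1 else if r = b then -1 else 0)"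
  by (induction s) (use ab(3) in \<open>auto simp: fwt.simps fst_beta lookup_add lookup_minus lookup_single when_def algebra_simps\<close>)

lemma fp_gr: "\<exists>q<2. fp s \<in> gr M q"
proof (induction s)
  case 0
  show ?case using u(1) by (simp add: singular_def fp_simps)
next
  case (Suc s)
  then obtain q where "q < 2" "fp s \<in> gr M q" by blast
  hence "act M f (fp s) \<in> gr M ((pr + q) mod 2)" by (intro gr_act[OF roots_ab(6) pr(3,1)])
  thus ?case unfolding fp_simps by (intro exI[of _ "(pr + q) mod 2"]) simp
qed

text \<open>The root \<beta> is simple for \<open>l\<close>, a fact contained in the hypothesis
  \<open>l'\<close>: if \<alpha> is positive for \<open>l\<close> and differs from \<beta>, then
  \<alpha> and -\<beta> are positive for \<open>l'\<close>, so \<alpha> - \<beta>, if it is a root,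
  is positive for both functionals and again differs from \<beta>. Hence the bracket of
  \<open>X\<close> with \<open>f\<close> is covered by the induction hypothesis.\<close>

lemma fp_kill:
  assumes "\<alpha> \<in> LR" "lf l \<alpha> > 0" "\<alpha> \<noteq> \<beta>" "X \<in> root_space x m \<alpha>" "X \<in> gt_hom x p" "p < 2"
  shows "act M X (fp s) = \<zero>"
  using assms
proof (induction s arbitrary: \<alpha> X p)
  case 0
  show ?case using u(1) 0 unfolding singular_def fp_simps by blast
next
  case (Suc s)
  have X: "X \<in> g_tilde x m" by (rule root_space_g_tilde[OF Suc.prems(4)])
  have "act M (bracket x X f) (fp s) = \<zero>"
  proof (cases "bracket x X f = 0")
    case True
    thus ?thesis using act_0[OF X fp_carrier] by simp
  next
    case False
    have br: "bracket x X f \<in> root_space x m (\<alpha> + - \<beta>)" "\<alpha> + - \<beta> \<in> LR \<or> \<alpha> + - \<beta> = 0"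
      using bracket_LR[OF Suc.prems(4) roots_ab(4) disjI1[OF Suc.prems(1)] disjI1[OF roots_ab(2)]] False by blast+
    have L: "\<alpha> + - \<beta> \<in> LR"
      using br(2) Suc.prems(3) by (metis add.right_inverse add_right_cancel)
    have "lf l' \<alpha> > 0" using l'[OF Suc.prems(1)] Suc.prems by blast
    moreover have "lf l' (- \<beta>) > 0" using l'[OF roots_ab(2)] by blast
    ultimately have "lf l' (\<alpha> + - \<beta>) > 0" by (simp add: lf_simps)
    moreover have "\<alpha> + - \<beta> \<noteq> - \<beta>" using Suc.prems(2) by (auto simp: lf_simps)
    ultimately have "lf l (\<alpha> + - \<beta>) > 0" "\<alpha> + - \<beta> \<noteq> \<beta>" using l'[OF L] by blast+
    thus ?thesis
      by (rule Suc.IH[OF L _ _ br(1) bracket_in_hom[OF Suc.prems(5) pr(3) Suc.prems(6) pr(1)]]) simp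
  qed
  moreover have "act M X (fp s) = \<zero>" by (rule Suc.IH[OF Suc.prems])
  ultimately show ?case unfolding fp_simps
    using act_commute[OF X roots_ab(6) Suc.prems(5) pr(3) Suc.prems(6) pr(1) fp_carrier[of s]] roots_ab(6) by simp
qed

text \<open>By \<open>fp_kill\<close> only the root \<beta> itself is left to check, and its root
  space is spanned by \<open>e\<close>.\<close>

lemma singular_l:
  assumes "act M e (fp s) = \<zero>"
  shows "singular l (fwt s) (fp s)"
  unfolding singular_def
proof (intro conjI ballI impI allI)
  fix \<alpha> X p assume h: "\<alpha> \<in> LR" "lf l \<alpha> > 0" "X \<in> root_space x m \<alpha>" "p < 2" "X \<in> gt_hom x p"
  show "act M X (fp s) = \<zero>"
  proof (cases "\<alpha> = \<beta>")
    case True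
    then obtain c where "X = gscale c e"
      using root_space_eps_diff[OF halfN_I_tilde[OF ab(1)] halfN_I_tilde[OF ab(2)] ab(3)] h(3) unfolding \<beta> ef by blast
    thus ?thesis using act_gscale[OF roots_ab(5) fp_carrier] assms by simp
  qed (rule fp_kill[OF h(1,2) _ h(3,5,4)])
qed (use fp_N fp_ws fp_gr in auto)

lemma singular_l':
  assumes "act M f (fp s) = \<zero>"
  shows "singular l' (fwt s) (fp s)"
  unfolding singular_def
proof (intro conjI ballI impI allI)
  fix \<alpha> X p assume h: "\<alpha> \<in> LR" "lf l' \<alpha> > 0" "X \<in> root_space x m \<alpha>" "p < 2" "X \<in> gt_hom x p"
  show "act M X (fp s) = \<zero>"
  proof (cases "\<alpha> = - \<beta>")
    case True
    hence "\<alpha> = eps b - eps a" unfolding \<beta> by simp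
    then obtain c where "X = gscale c f"
      using root_space_eps_diff[OF halfN_I_tilde[OF ab(2)] halfN_I_tilde[OF ab(1)]] ab(3) h(3) unfolding ef by blast
    thus ?thesis using act_gscale[OF roots_ab(6) fp_carrier] assms by simp
  next
    case False
    hence "lf l \<alpha> > 0" "\<alpha> \<noteq> \<beta>" using l'[OF h(1)] h(2) by blast+
    thus ?thesis by (rule fp_kill[OF h(1) _ _ h(3,5,4)])
  qed
qed (use fp_N fp_ws fp_gr in auto)

text \<open>Otherwise it would be a singular vector for \<open>l\<close> with a value strictly below
  that of \<nu>, contrary to \<open>singular_unique_weight\<close>.\<close>

lemma fp_zero:
  assumes "act M e (fp (Suc s)) = \<zero>"
  shows "fp (Suc s) = \<zero>"
proof (rule ccontr)
  assume "fp (Suc s) \<noteq> \<zero>"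
  from singular_unique_weight[OF singular_l[OF assms] this nz u_facts(1,2) u(2) u_facts(3)]
  have "lf l \<nu> \<le> lf l (fwt (Suc s))" .
  moreover have "lf l (fwt s) \<le> lf l \<nu>" using l\<beta> by (induction s) (auto simp: lf_simps)
  ultimately show False using l\<beta> by (simp add: lf_simps)
qed

lemma E_hat_fp: "r \<in> I_tilde m \<Longrightarrow> act M (E_hat r) (fp s) = coef (fst (fwt s)) r \<odot> fp s"
  using fp_ws(1)[of s] unfolding weight_space_def by blast

lemma ef_bracket:
  "act M (bracket x e f) (fp s) = (coef (fst (fwt s)) a - (-1) ^ pr * coef (fst (fwt s)) b) \<odot> fp s"
proof -
  have G: "E_hat a \<in> g_tilde x m" "E_hat b \<in> g_tilde x m" using ab halfN_I_tilde E_hat_g_tilde by blast+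
  have "bracket x e f = E_hat a + gscale (- ((-1) ^ pr)) (E_hat b)"
    unfolding ef bracket_Eroot[OF ab] pr_def by (simp add: prod_eq_iff)
  moreover have "gscale (- ((-1) ^ pr)) (E_hat b) \<in> g_tilde x m" by (rule gv.subspace_scale[OF g_tilde_subspace G(2)])
  ultimately have "act M (bracket x e f) (fp s) =
      coef (fst (fwt s)) a \<odot> fp s \<oplus> (- ((-1) ^ pr)) \<odot> (coef (fst (fwt s)) b \<odot> fp s)"
    using act_add_left[OF G(1) _ fp_carrier] act_gscale[OF G(2) fp_carrier]
      E_hat_fp[OF halfN_I_tilde[OF ab(1)]] E_hat_fp[OF halfN_I_tilde[OF ab(2)]] by (simp only:)
  thus ?thesis using fp_carrier[of s] by (simp add: smult_smult flip: smult_add_left)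
qed

lemma e_fp_0: "act M e (fp 0) = \<zero>"
  using u(1) roots_ab l\<beta> pr unfolding singular_def fp_simps by blast

text \<open>Here \<open>f\<close> squares to 0 on \<open>u\<close>, and \<open>e f u\<close> is
  \<open>u\<close> times the sum of the coefficients of \<nu> at \<open>a\<close> and
  \<open>b\<close>. If this sum is nonzero, \<open>f u\<close> is nonzero and singular for the new
  ordering; if it is 0, then \<open>f u = 0\<close> by \<open>fp_zero\<close> and \<open>u\<close>
  itself stays singular.\<close>

lemma odd_reflection:
  assumes p: "pr = 1"
  shows "\<exists>s u'. singular l' (fwt s) u' \<and> u' \<noteq> \<zero> \<and> s = (if coef (fst \<nu>) a + coef (fst \<nu>) b = 0 then 0 else 1)"
proof -
  have "act M e (fp 1) = act M (bracket x e f) (fp 0)"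
    using act_commute[OF roots_ab(5,6) pr(2,3) pr(1) pr(1) fp_carrier[of 0]] e_fp_0 roots_ab(5,6) fp_carrier[of 0]
      act_closed[OF g_tilde_bracket[OF roots_ab(5,6)] fp_carrier[of 0]] by (simp add: fp_simps)
  hence e1: "act M e (fp 1) = (coef (fst \<nu>) a + coef (fst \<nu>) b) \<odot> fp 0"
    by (simp add: ef_bracket p)
  \<comment> \<open>The bracket would have weight -2\<beta>, whose coefficient 2 at \<open>b\<close>
    occurs in no Levi root.\<close>
  have "bracket x f f = 0"
  proof (rule ccontr)
    assume ne: "bracket x f f \<noteq> 0"
    have "- \<beta> + - \<beta> \<in> LR \<or> - \<beta> + - \<beta> = 0"
      using bracket_LR[OF roots_ab(4,4) disjI1[OF roots_ab(2)] disjI1[OF roots_ab(2)]] ne by blast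
    moreover have ba: "coef (fst (- \<beta> + - \<beta>)) b = 2" 
      unfolding fst_add fst_uminus fst_beta lookup_add lookup_uminus lookup_minus using ab(3) by (simp add: lookup_single)
    moreover have "- \<beta> + - \<beta> \<noteq> 0" using ba by (metis fst_zero lookup_zero zero_neq_numeral)
    ultimately have "- \<beta> + - \<beta> \<in> LR" by blast
    from LR_cases[OF this] show False
    proof (elim disjE bexE conjE)
      assume "\<forall>r\<in>halfN. coef (fst (- \<beta> + - \<beta>)) r = 0"
      thus False using ba ab(2) by (metis zero_neq_numeral)
    next
      fix c d assume "- \<beta> + - \<beta> = eps c - eps d"
      hence "coef (bas c - bas d) b = 2" using ba by simp
      thus False by (simp add: lookup_minus lookup_single when_def split: if_splits)
    qed
  qed
  hence "\<zero> = act M f (fp 1) \<ominus> (-1) \<odot> act M f (fp 1)"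
    using act_bracket[OF roots_ab(6,6) pr(3,3) pr(1,1) fp_carrier[of 0]] act_0[OF roots_ab(6) fp_carrier[of 0]]
    by (simp add: p fp_simps)
  hence "(2 :: complex) \<odot> act M f (fp 1) = \<zero>"
    using fp_carrier[of 2] smult_add_left[of "act M f (fp 1)" 1 1]
    by (simp add: diff_smult fp_simps numeral_2_eq_2)
  hence ff: "act M f (fp 1) = \<zero>"
    using smult_eq_0[of "act M f (fp 1)" 2] fp_carrier[of 2] by (simp add: fp_simps numeral_2_eq_2)
  show ?thesis
  proof (cases "coef (fst \<nu>) a + coef (fst \<nu>) b = 0")
    case True
    hence "act M e (fp (Suc 0)) = \<zero>" using e1 fp_carrier[of 0] by simp
    hence "act M f (fp 0) = \<zero>" using fp_zero[of 0] by (simp add: fp_simps)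
    hence "singular l' (fwt 0) (fp 0)" by (rule singular_l')
    thus ?thesis using u(2) True by (intro exI[of _ 0] exI[of _ u]) (simp add: fp_simps)
  next
    case False
    have "fp 1 \<noteq> \<zero>"
    proof
      assume "fp 1 = \<zero>"
      hence "(coef (fst \<nu>) a + coef (fst \<nu>) b) \<odot> fp 0 = \<zero>" using e1 roots_ab(5) by simp
      thus False using smult_eq_0[OF fp_carrier[of 0] _ False] u(2) by (simp add: fp_simps)
    qed
    thus ?thesis using singular_l'[OF ff] False by auto
  qed
qed

text \<open>The computation for sl2: $e f^{s+1} u = (s+1)(k-s) f^s u$. The scalar is nonzero for $s
  < k$, so $f^k u$ does not vanish; it is 0 for $s = k$, so $f^{k+1} u = 0$ by
  \<open>fp_zero\<close>. Hence $f^k u$ is singular for the new ordering.\<close>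

lemma even_reflection:
  assumes p: "pr = 0" and k: "coef (fst \<nu>) a - coef (fst \<nu>) b = of_nat k"
  shows "\<exists>u'. singular l' (fwt k) u' \<and> u' \<noteq> \<zero>"
proof -
  have step: "act M e (fp (Suc s)) = (of_nat (Suc s) * (of_nat k - of_nat s)) \<odot> fp s" for s
  proof (induction s)
    case 0
    have "act M e (fp (Suc 0)) = act M (bracket x e f) (fp 0)"
      using act_commute[OF roots_ab(5,6) pr(2,3) pr(1) pr(1) fp_carrier[of 0]] e_fp_0 roots_ab(5,6) fp_carrier[of 0]
        act_closed[OF g_tilde_bracket[OF roots_ab(5,6)] fp_carrier[of 0]] by (simp add: fp_simps)
    thus ?case using k by (simp add: ef_bracket p)
  next
    case (Suc s)
    have co: "coef (fst (fwt (Suc s))) a - coef (fst (fwt (Suc s))) b = of_nat k - 2 * of_nat (Suc s)"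
      using k ab(3) unfolding fwt_coef by (simp add: algebra_simps)
    have "act M e (fp (Suc (Suc s))) = act M (bracket x e f) (fp (Suc s)) \<oplus> act M f (act M e (fp (Suc s)))"
      using act_commute[OF roots_ab(5,6) pr(2,3) pr(1) pr(1) fp_carrier[of "Suc s"]] roots_ab(5,6) fp_carrier[of "Suc s"]
      by (simp add: fp_simps p)
    also have "\<dots> = (of_nat k - 2 * of_nat (Suc s)) \<odot> fp (Suc s) \<oplus> (of_nat (Suc s) * (of_nat k - of_nat s)) \<odot> fp (Suc s)"
      unfolding Suc ef_bracket p using co act_smult[OF roots_ab(6) fp_carrier] by (simp add: fp_simps)
    also have "\<dots> = (of_nat k - 2 * of_nat (Suc s) + of_nat (Suc s) * (of_nat k - of_nat s)) \<odot> fp (Suc s)"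
      using smult_add_left[OF fp_carrier] by simp
    also have "of_nat k - 2 * of_nat (Suc s) + of_nat (Suc s) * (of_nat k - of_nat s) =
        (of_nat (Suc (Suc s)) * (of_nat k - of_nat (Suc s)) :: complex)"
      by (simp add: algebra_simps)
    finally show ?case .
  qed
  have "act M f (fp k) = \<zero>"
    using fp_zero[of k] step[of k] fp_carrier[of k] by (simp add: fp_simps)
  moreover have "fp s \<noteq> \<zero>" if "s \<le> k" for s
    using that
  proof (induction s)
    case 0
    show ?case using u(2) by (simp add: fp_simps)
  next
    case (Suc s)
    show ?case
    proof
      assume "fp (Suc s) = \<zero>"
      hence "(of_nat (Suc s) * (of_nat k - of_nat s)) \<odot> fp s = \<zero>" using step[of s] roots_ab(5) by simp
      moreover have "(of_nat (Suc s) * (of_nat k - of_nat s) :: complex) \<noteq> 0"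
        using Suc.prems of_nat_neq_0[of s, where 'a = complex] by (auto simp del: of_nat_Suc)
      ultimately have "fp s = \<zero>" by (rule smult_eq_0[OF fp_carrier[of s]])
      thus False using Suc by simp
    qed
  qed
  ultimately show ?thesis using singular_l' by blast
qed

end

section \<open>Moving one index behind others by successive reflections\<close>

context levi_irreducible
begin

lemma reflection_lfun:
  assumes a: "a \<in> halfN" and b: "b = a + of_nat (Suc j) / 2" and u: "singular (lfun m a j) \<nu> u" "u \<noteq> \<zero>"
  shows "reflection x m M Y0 N (lfun m a j) (lfun m a (Suc j)) a b (eps a - eps b) (Eroot x a b) (Eroot x b a) \<nu> u"
proof (rule reflection.intro[OF levi_irreducible_axioms reflection_axioms.intro])
  show bN: "b \<in> halfN" unfolding b by (rule halfN_add[OF a])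
  show "a \<noteq> b" using b by simp
  have "pos a j b - pos a j a = 1 / 4" by (simp add: pos_def b field_simps)
  thus "0 < lf (lfun m a j) (eps a - eps b)" unfolding lf_lfun_eps[OF a bN] by simp
  show "lf (lfun m a j) \<alpha> \<noteq> 0" if "\<alpha> \<in> LR" for \<alpha> by (rule lfun_neq_0[OF a that])
  show "0 < lf (lfun m a (Suc j)) \<alpha> \<longleftrightarrow> (0 < lf (lfun m a j) \<alpha> \<and> \<alpha> \<noteq> eps a - eps b) \<or> \<alpha> = - (eps a - eps b)"
    if "\<alpha> \<in> LR" for \<alpha> by (rule lfun_swap[OF a that b])
qed (use a u in auto)

text \<open>Invariant: after \<open>2 * i\<close> reflections the coefficient at \<open>a\<close> is
  the one the highest weight had at \<open>a + i\<close>. With \<open>c = a + i\<close>, the odd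
  reflection with \<open>c + 1/2\<close> lowers the coefficient \<open>k c\<close> by 1 unless it is
  0, and the even one with \<open>c + 1\<close> exchanges the two coefficients. Coefficients beyond
  the indices passed so far are untouched.\<close>

lemma reflection_chain:
  assumes a: "a \<in> halfN" and base: "singular (lfun m a 0) lam v" "v \<noteq> \<zero>"
    and k: "\<And>r. r \<in> halfN \<Longrightarrow> coef (fst lam) r = of_nat (k r)"
    and C1: "\<And>r. r \<in> halfN \<Longrightarrow> k r = 0 \<Longrightarrow> k (r + 1 / 2) = 0"
    and C2: "\<And>r. r \<in> halfN \<Longrightarrow> k r > 0 \<Longrightarrow> k (r + 1) < k r"
  shows "\<exists>\<nu> u. singular (lfun m a (2 * i)) \<nu> u \<and> u \<noteq> \<zero> \<and> coef (fst \<nu>) a = of_nat (k (a + of_nat i)) \<and>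
    (\<forall>r\<in>halfN. r > a + of_nat i \<longrightarrow> coef (fst \<nu>) r = of_nat (k r))"
proof (induction i)
  case 0
  show ?case using base k a by (intro exI[of _ lam] exI[of _ v]) simp
next
  case (Suc i)
  then obtain \<nu> u where u: "singular (lfun m a (2 * i)) \<nu> u" "u \<noteq> \<zero>"
    and \<nu>: "coef (fst \<nu>) a = of_nat (k (a + of_nat i))"
      "\<And>r. r \<in> halfN \<Longrightarrow> r > a + of_nat i \<Longrightarrow> coef (fst \<nu>) r = of_nat (k r)" by blast
  define c b1 b2 where c: "c = a + of_nat i" and b1: "b1 = a + of_nat (Suc (2 * i)) / 2"
    and b2: "b2 = a + of_nat (Suc (Suc (2 * i))) / 2"
  have b12: "b1 = c + 1 / 2" "b2 = c + 1" "c + 1 / 2 + 1 / 2 = c + 1" by (simp_all add: c b1 b2 field_simps)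
  have cN: "c \<in> halfN" using halfN_add[OF a, of "2 * i"] by (simp add: c)
  have bN: "b1 \<in> halfN" "b2 \<in> halfN" unfolding b1 b2 by (rule halfN_add[OF a])+
  have ca: "a \<le> c" by (simp add: c)
  note R1 = reflection_lfun[OF a b1 u]
  have p1: "reflection.pr x a b1 = 1"
    using halfN_int_add[OF a, of i] unfolding reflection.pr_def[OF R1] by (simp add: b12(1) c)
  have n1: "coef (fst \<nu>) b1 = of_nat (k b1)" using \<nu>(2)[OF bN(1)] b12 c by simp
  define s where "s = (if coef (fst \<nu>) a + coef (fst \<nu>) b1 = 0 then 0 else 1 :: nat)"
  define \<nu>1 where "\<nu>1 = reflection.fwt (eps a - eps b1) \<nu> s"
  obtain u1 where u1: "singular (lfun m a (Suc (2 * i))) \<nu>1 u1" "u1 \<noteq> \<zero>"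
    using reflection.odd_reflection[OF R1 p1] unfolding s_def \<nu>1_def by blast
  \<comment> \<open>The odd step is trivial when both coefficients vanish; by \<open>C1\<close> this
    happens as soon as the one belonging to \<open>a\<close> does.\<close>
  have s: "s = (if k c = 0 then 0 else 1)"
  proof (cases "k c = 0")
    case True
    thus ?thesis using C1[OF cN] \<nu>(1) n1 b12 by (simp add: s_def c)
  next
    case False
    have "(of_nat (k c) + of_nat (k b1) :: complex) = of_nat (k c + k b1)" by simp
    also have "\<dots> \<noteq> 0" using False unfolding of_nat_eq_0_iff by simp
    finally show ?thesis using False \<nu>(1) n1 by (simp add: s_def c)
  qed
  have \<nu>1a: "coef (fst \<nu>1) a = of_nat (k c - 1)"
    unfolding \<nu>1_def reflection.fwt_coef[OF R1] \<nu>(1) by (cases "k c") (auto simp: s c[symmetric])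
  have \<nu>1r: "coef (fst \<nu>1) r = of_nat (k r)" if "r \<in> halfN" "r > b1" for r
    unfolding \<nu>1_def reflection.fwt_coef[OF R1] using \<nu>(2)[OF that(1)] that ca b12 by (auto simp: c[symmetric])
  note R2 = reflection_lfun[OF a b2 u1]
  have p2: "reflection.pr x a b2 = 0"
  proof -
    have "b2 = a + of_nat (Suc i)" using b12 by (simp add: c)
    hence "b2 \<in> \<int> \<longleftrightarrow> a \<in> \<int>" by (metis Ints_add Ints_diff Ints_of_nat add_diff_cancel_right')
    thus ?thesis unfolding reflection.pr_def[OF R2] by simp
  qed
  \<comment> \<open>The number of lowering steps in the even reflection. It is a true difference:
    \<open>C2\<close> gives \<open>k b2 < k c\<close> when \<open>k c\<close> is positive, and
    otherwise \<open>C1\<close>, used twice, makes all three coefficients 0.\<close>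
  define kk where "kk = k c - 1 - k b2"
  have le: "k b2 \<le> k c - 1"
  proof (cases "k c = 0")
    case True
    hence "k b1 = 0" using C1[OF cN] b12 by simp
    hence "k b2 = 0" using C1[OF bN(1)] b12 by simp
    thus ?thesis by simp
  next
    case False
    thus ?thesis using C2[OF cN] b12 by simp
  qed
  have "b1 < b2" using b12 by simp
  hence "coef (fst \<nu>1) a - coef (fst \<nu>1) b2 = of_nat kk"
    unfolding \<nu>1a \<nu>1r[OF bN(2) \<open>b1 < b2\<close>] kk_def using of_nat_diff[OF le, where 'a = complex] by simp
  from reflection.even_reflection[OF R2 p2 this] obtain u2
    where u2: "singular (lfun m a (Suc (Suc (2 * i)))) (reflection.fwt (eps a - eps b2) \<nu>1 kk) u2" "u2 \<noteq> \<zero>" by blast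
  let ?\<nu> = "reflection.fwt (eps a - eps b2) \<nu>1 kk"
  have "coef (fst ?\<nu>) a = of_nat (k c - 1) - of_nat kk"
    unfolding reflection.fwt_coef[OF R2] \<nu>1a by simp
  also have "\<dots> = of_nat (k c - 1 - kk)" by (rule of_nat_diff[symmetric]) (simp add: kk_def)
  also have "k c - 1 - kk = k b2" using le by (simp add: kk_def)
  finally have 1: "coef (fst ?\<nu>) a = of_nat (k (a + of_nat (Suc i)))" using b12 by (simp add: c add.commute add.left_commute)
  have "coef (fst ?\<nu>) r = of_nat (k r)" if "r \<in> halfN" "r > a + of_nat (Suc i)" for r
  proof -
    have "r > b2" using that b12 by (simp add: c)
    thus ?thesis unfolding reflection.fwt_coef[OF R2] using \<nu>1r[OF that(1)] ca b12 by auto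
  qed
  thus ?case using u2 1 by (intro exI[of _ ?\<nu>] exI[of _ u2]) simp
qed

lemma weights_nonneg:
  assumes a: "a \<in> halfN" and base: "singular (lfun m a 0) lam v" "v \<noteq> \<zero>"
    and k: "\<And>r. r \<in> halfN \<Longrightarrow> coef (fst lam) r = of_nat (k r)"
    and C1: "\<And>r. r \<in> halfN \<Longrightarrow> k r = 0 \<Longrightarrow> k (r + 1 / 2) = 0"
    and C2: "\<And>r. r \<in> halfN \<Longrightarrow> k r > 0 \<Longrightarrow> k (r + 1) < k r"
    and t: "t \<in> N" "t \<in> ws \<tau>" "t \<noteq> \<zero>" "\<tau> \<in> hdual (I_tilde m)"
  shows "0 \<le> Re (coef (fst \<tau>) a)"
proof -
  have fin: "finite (supp (fst \<tau>))" by simp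
  \<comment> \<open>So far out that \<tau> has no coefficient beyond \<open>a + i\<close>; the
    functional \<open>?c\<close> below then reduces on \<tau> to the coefficient at
    \<open>a\<close>.\<close>
  obtain i where i: "\<forall>r\<in>supp (fst \<tau>). r \<le> a + of_nat i"
  proof -
    obtain i :: nat where "Max (insert 0 (supp (fst \<tau>))) \<le> of_nat i" using real_arch_simple by blast
    hence "\<forall>r\<in>supp (fst \<tau>). r \<le> of_nat i" using fin by auto
    thus thesis using that[of i] halfN_pos[OF a] by force
  qed
  \<comment> \<open>The indices with value 1 form a final segment of the positive indices in the
    ordering reached after \<open>2 * i\<close> steps. A negative root moves weight to a later index
    and so cannot decrease this sum.\<close>
  let ?c = "\<lambda>r. if r = a \<or> r > a + of_nat i then 1 else 0 :: real"
  obtain \<nu> u where u: "singular (lfun m a (2 * i)) \<nu> u" "u \<noteq> \<zero>"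
    and \<nu>: "coef (fst \<nu>) a = of_nat (k (a + of_nat i))"
      "\<And>r. r \<in> halfN \<Longrightarrow> r > a + of_nat i \<Longrightarrow> coef (fst \<nu>) r = of_nat (k r)"
    using reflection_chain[OF a base k C1 C2, of i] by blast
  have \<nu>h: "\<nu> \<in> hdual (I_tilde m)" using u(1) by (simp add: singular_def)
  have "0 \<le> lf ?c \<tau>"
  proof (rule weight_of_span[OF singular_span[OF u(1) _ u(2)] t])
    show "lf (lfun m a (2 * i)) \<alpha> \<noteq> 0" if "\<alpha> \<in> LR" for \<alpha> by (rule lfun_neq_0[OF a that])
    show "0 \<le> lf ?c \<nu>"
    proof (rule lf_nonneg)
      fix r assume r: "r \<in> supp (fst \<nu>)"
      have "r \<in> halfN" if "r > a + of_nat i"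
        using that r \<nu>h I_tilde_pos[of r m] halfN_pos[OF a] by (auto simp: hdual_def)
      thus "0 \<le> ?c r * Re (coef (fst \<nu>) r)" using \<nu> by auto
    qed
    show "0 \<le> lf ?c (\<gamma> + \<alpha>)" if g: "0 \<le> lf ?c \<gamma>" "\<alpha> \<in> LR" "lf (lfun m a (2 * i)) \<alpha> < 0" for \<gamma> \<alpha>
    proof -
      have "0 \<le> lf ?c \<alpha>"
        using LR_cases[OF g(2)]
      proof (elim disjE bexE conjE)
        assume z: "\<forall>r\<in>halfN. coef (fst \<alpha>) r = 0"
        show ?thesis
        proof (rule lf_nonneg)
          fix r assume r: "r \<in> supp (fst \<alpha>)"
          have "r \<in> I_tilde m" using LR_hdual[OF disjI1[OF g(2)]] r by (auto simp: hdual_def)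
          moreover have "r \<notin> halfN" using r z by (auto simp: in_keys_iff)
          ultimately have "r \<le> 0" using I_tilde_pos[of r m] by linarith
          hence "\<not> (r = a \<or> r > a + of_nat i)" using halfN_pos[OF a] by auto
          thus "0 \<le> ?c r * Re (coef (fst \<alpha>) r)" by simp
        qed
      next
        fix c d assume cd: "c \<in> halfN" "d \<in> halfN" "c \<noteq> d" "\<alpha> = eps c - eps d"
        have "pos a (2 * i) d < pos a (2 * i) c" using g(3) unfolding cd(4) lf_lfun_eps[OF cd(1,2)] by simp
        hence "?c d \<le> ?c c" by (auto simp: pos_def split: if_splits)
        thus ?thesis by (simp add: cd(4) lf_simps)
      qed
      thus ?thesis using g(1) by (simp add: lf_simps)
    qed
  qed
  moreover have "lf ?c \<tau> = lf (\<lambda>r. if r = a then 1 else 0) \<tau>"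
    by (rule lf_cong) (use i in force)
  moreover have "lf (\<lambda>r. if r = a then 1 else 0) \<tau> = Re (coef (fst \<tau>) a)"
    using fin by (simp add: lf_def dotp_def if_distrib[of complex_of_real] if_distrib[of "\<lambda>z. _ * z"] in_keys_iff cong: if_cong)
  ultimately show ?thesis by simp
qed

text \<open>For \<open>j = 0\<close> the position \<open>a + 1/4\<close> overtakes no index, so the
  ordering is the original one. The given highest weight vector may be inhomogeneous; root vectors
  of definite parity kill its two components separately, and one of these is nonzero.\<close>

lemma highest_weight_singular:
  assumes a: "a \<in> halfN" and v: "v \<in> N" "v \<in> ws lam" "v \<noteq> \<zero>" "lam \<in> hdual (I_tilde m)"
    and kill: "\<And>\<alpha> X. \<alpha> \<in> pos_roots x m \<Longrightarrow> X \<in> root_space x m \<alpha> \<inter> levi_tilde x m Y0 \<Longrightarrow> act M X v = \<zero>"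
  shows "\<exists>w. singular (lfun m a 0) lam w \<and> w \<noteq> \<zero>"
proof -
  obtain w0 w1 where w: "w0 \<in> gr M 0" "w0 \<in> N" "w1 \<in> gr M (Suc 0)" "w1 \<in> N" "v = w0 \<oplus> w1"
    using sub v(1) unfolding is_subsmod_def by force
  note W = ws_gr_split[OF v(2) w(1,3,5)]
  have c: "w0 \<in> carrier M" "w1 \<in> carrier M" using W ws_carrier by blast+
  have K: "act M X w0 = \<zero> \<and> act M X w1 = \<zero>"
    if h: "\<alpha> \<in> LR" "lf (lfun m a 0) \<alpha> > 0" "X \<in> root_space x m \<alpha>" "X \<in> gt_hom x p" "p < 2" for \<alpha> X p
  proof -
    have "lf (phi m) \<alpha> > 0"
      using LR_cases[OF h(1)]
    proof (elim disjE bexE conjE)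
      assume "\<forall>r\<in>halfN. coef (fst \<alpha>) r = 0"
      thus ?thesis using lf_lfun_zero[OF h(1)] h(2) by simp
    next
      fix p d assume cd: "p \<in> halfN" "d \<in> halfN" "p \<noteq> d" "\<alpha> = eps p - eps d"
      obtain na np nd :: nat where n: "a = of_nat na / 2" "p = of_nat np / 2" "d = of_nat nd / 2"
        using a cd(1,2) by (auto simp: halfN_def)
      have *: "of_nat q / 2 + 1 / 4 < (of_nat q' / 2 :: rat) \<longleftrightarrow> q < q'"
        "(of_nat q' / 2 :: rat) < of_nat q / 2 + 1 / 4 \<longleftrightarrow> q' \<le> q" for q q' :: nat
      proof -
        have "of_nat q / 2 + 1 / 4 < (of_nat q' / 2 :: rat) \<longleftrightarrow> (of_nat (2 * q + 1) :: rat) < of_nat (2 * q')"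
          by (auto simp: field_simps)
        thus "of_nat q / 2 + 1 / 4 < (of_nat q' / 2 :: rat) \<longleftrightarrow> q < q'" unfolding of_nat_less_iff by linarith
        have "(of_nat q' / 2 :: rat) < of_nat q / 2 + 1 / 4 \<longleftrightarrow> (of_nat (2 * q') :: rat) < of_nat (2 * q + 1)"
          by (auto simp: field_simps)
        thus "(of_nat q' / 2 :: rat) < of_nat q / 2 + 1 / 4 \<longleftrightarrow> q' \<le> q" unfolding of_nat_less_iff by linarith
      qed
      have "pos a 0 p < pos a 0 d" using h(2) unfolding cd(4) lf_lfun_eps[OF cd(1,2)] by simp
      hence "p < d" using cd(3) * unfolding pos_def n by (auto split: if_splits)
      thus ?thesis using phi_strict[OF halfN_I_tilde[OF cd(1)] halfN_I_tilde[OF cd(2)]] unfolding cd(4) lf_simps by simp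
    qed
    hence "act M X v = \<zero>" using kill[of \<alpha> X] h LR_levi[OF h(1,3)] by (auto simp: pos_roots_iff)
    moreover have X: "X \<in> g_tilde x m" by (rule root_space_g_tilde[OF h(3)])
    ultimately have z: "act M X w0 \<oplus> act M X w1 = \<zero> \<oplus> \<zero>" using c by (simp add: w(5) act_add)
    have g: "act M X w0 \<in> gr M ((p + 0) mod 2)" "act M X w1 \<in> gr M ((p + 1) mod 2)"
      using gr_act[OF X h(4,5) _ w(1)] gr_act[OF X h(4,5) _ w(3)] by simp_all
    from lt_2_cases[OF h(5)] show ?thesis
    proof
      assume "p = 0"
      thus ?thesis using gr_unique[OF _ _ gr_zero gr_zero z] g by simp
    next
      assume p: "p = Suc 0"
      have "act M X w1 \<oplus> act M X w0 = \<zero> \<oplus> \<zero>" using z c X by (simp add: M.a_comm)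
      thus ?thesis using gr_unique[OF _ _ gr_zero gr_zero] g p by simp
    qed
  qed
  have "w0 \<noteq> \<zero> \<or> w1 \<noteq> \<zero>" using v(3) w(5) by auto
  thus ?thesis
  proof
    assume "w0 \<noteq> \<zero>"
    thus ?thesis using w(1,2) W(1) v(4) K unfolding singular_def by (intro exI[of _ w0]) (auto intro!: exI[of _ 0])
  next
    assume "w1 \<noteq> \<zero>"
    thus ?thesis using w(3,4) W(2) v(4) K unfolding singular_def by (intro exI[of _ w1]) (auto intro!: exI[of _ "Suc 0"])
  qed
qed

end

section \<open>Partitions and the hook conditions on their \<theta>-coordinates\<close>

lemma card_conj_le: "is_partition \<mu> \<Longrightarrow> conj_part \<mu> (Suc j) \<le> conj_part \<mu> j" if "j \<ge> 1"
  unfolding conj_part_def is_partition_def using that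
  by (intro card_mono) (auto elim!: finite_subset[rotated])

lemma partition_antimono:
  assumes "is_partition \<mu>" "1 \<le> i" "i \<le> j"
  shows "\<mu> j \<le> \<mu> i"
  using assms(3,1,2) by (induction rule: dec_induct) (auto simp: is_partition_def intro: le_trans)

lemma conj_part_less:
  assumes "is_partition \<mu>" "i \<ge> 1" "\<mu> i < j"
  shows "conj_part \<mu> j < i"
proof -
  have "{k. k \<ge> 1 \<and> \<mu> k \<ge> j} \<subseteq> {1..<i}"
    using partition_antimono[OF assms(1,2)] assms(3) by (force simp: not_less[symmetric])
  hence "conj_part \<mu> j \<le> card {1..<i}" unfolding conj_part_def by (rule card_mono[rotated]) simp
  thus ?thesis using assms(2) by simp
qed

lemma conj_part_ge:
  assumes "is_partition \<mu>" "i \<ge> 1" "j \<ge> 1" "j \<le> \<mu> i"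
  shows "i \<le> conj_part \<mu> j"
proof -
  have "{1..i} \<subseteq> {k. k \<ge> 1 \<and> \<mu> k \<ge> j}" using partition_antimono[OF assms(1)] assms(4) by force
  moreover have "finite {k. k \<ge> 1 \<and> \<mu> k \<ge> j}"
    using assms(1,3) unfolding is_partition_def by (auto elim!: finite_subset[rotated])
  ultimately have "card {1..i} \<le> conj_part \<mu> j" unfolding conj_part_def by (rule card_mono[rotated])
  thus ?thesis by simp
qed

lemma halfN_cases:
  assumes "r \<in> halfN"
  obtains i where "i \<ge> 1" "r = of_nat i" | i where "i \<ge> 1" "r = of_nat i - 1 / 2"
proof -
  obtain n :: nat where n: "r = of_nat n / 2" "n \<ge> 1" using assms unfolding halfN_def by blast
  show thesis
  proof (cases "even n")
    case True
    then obtain i where "n = 2 * i" by (elim evenE)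
    thus thesis using n that(1)[of i] by simp
  next
    case False
    then obtain i where "n = 2 * i + 1" by (elim oddE)
    thus thesis using n that(2)[of "Suc i"] by (simp add: field_simps)
  qed
qed

lemma theta_part_int: "theta_part \<mu> (of_nat i) = \<mu> i - i"
  by (simp add: theta_part_def)

lemma theta_part_half: "theta_part \<mu> (of_nat i - 1 / 2) = conj_part \<mu> i + 1 - i"
proof -
  have "(of_nat i - 1 / 2 :: rat) \<notin> \<int>"
  proof
    assume "(of_nat i - 1 / 2 :: rat) \<in> \<int>"
    hence "of_nat i - (of_nat i - 1 / 2 :: rat) \<in> \<int>" by (intro Ints_diff) auto
    then obtain k :: int where "(1 / 2 :: rat) = of_int k" by (auto simp: Ints_def)
    hence "(of_int 1 :: rat) = of_int (2 * k)" by simp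
    thus False unfolding of_int_eq_iff by presburger
  qed
  moreover have "nat \<lceil>of_nat i - 1 / 2 :: rat\<rceil> = i"
  proof -
    have "\<lceil>of_nat i - 1 / 2 :: rat\<rceil> = int i" by (rule ceiling_unique) auto
    thus ?thesis by simp
  qed
  ultimately show ?thesis by (simp add: theta_part_def)
qed

text \<open>At \<open>i - 1/2\<close> and \<open>i\<close> one counts the boxes of the diagram from
  \<open>(i,i)\<close> downwards and strictly to the right of \<open>(i,i)\<close>. If one of these
  sets is empty, the diagram has no box that could start the next. Each of the two sequences
  subtracts a growing index from a decreasing one, hence drops strictly as long as it is
  positive.\<close>

lemma theta_part_hook:
  assumes \<mu>: "is_partition \<mu>" and r: "r \<in> halfN"
  shows "theta_part \<mu> r = 0 \<Longrightarrow> theta_part \<mu> (r + 1 / 2) = 0"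
    and "theta_part \<mu> r > 0 \<Longrightarrow> theta_part \<mu> (r + 1) < theta_part \<mu> r"
proof -
  have e: "of_nat i + 1 / 2 = (of_nat (Suc i) - 1 / 2 :: rat)" "of_nat i - 1 / 2 + 1 / 2 = (of_nat i :: rat)"
    "of_nat i - 1 / 2 + 1 = (of_nat (Suc i) - 1 / 2 :: rat)" "of_nat i + 1 = (of_nat (Suc i) :: rat)" for i
    by (simp_all add: field_simps)
  from r have "(theta_part \<mu> r = 0 \<longrightarrow> theta_part \<mu> (r + 1 / 2) = 0) \<and> (theta_part \<mu> r > 0 \<longrightarrow> theta_part \<mu> (r + 1) < theta_part \<mu> r)"
  proof (cases rule: halfN_cases)
    case (1 i)
    show ?thesis unfolding 1 e theta_part_int theta_part_half
      using conj_part_less[OF \<mu> 1(1), of "Suc i"] partition_antimono[OF \<mu> 1(1), of "Suc i"] by auto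
  next
    case (2 i)
    show ?thesis unfolding 2 e theta_part_int theta_part_half
      using conj_part_ge[OF \<mu> 2(1) 2(1)] card_conj_le[OF 2(1) \<mu>] by fastforce
  qed
  thus "theta_part \<mu> r = 0 \<Longrightarrow> theta_part \<mu> (r + 1 / 2) = 0"
    "theta_part \<mu> r > 0 \<Longrightarrow> theta_part \<mu> (r + 1) < theta_part \<mu> r" by blast+
qed

lemma theta_part_finite:
  assumes \<mu>: "is_partition \<mu>"
  shows "finite {r \<in> halfN. theta_part \<mu> r \<noteq> 0}"
proof (rule finite_subset)
  show "{r \<in> halfN. theta_part \<mu> r \<noteq> 0} \<subseteq> of_nat ` {i. i \<ge> 1 \<and> \<mu> i \<noteq> 0} \<union> (\<lambda>i. of_nat i - 1 / 2) ` {..\<mu> 1}"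
  proof
    fix r assume "r \<in> {r \<in> halfN. theta_part \<mu> r \<noteq> 0}"
    hence r: "r \<in> halfN" "theta_part \<mu> r \<noteq> 0" by auto
    from r(1) show "r \<in> of_nat ` {i. i \<ge> 1 \<and> \<mu> i \<noteq> 0} \<union> (\<lambda>i. of_nat i - 1 / 2) ` {..\<mu> 1}"
    proof (cases rule: halfN_cases)
      case (1 i)
      have "\<mu> i \<noteq> 0" using r(2) unfolding 1(2) theta_part_int by auto
      thus ?thesis using 1 by blast
    next
      case (2 i)
      have "i \<le> \<mu> 1"
      proof (rule ccontr)
        assume "\<not> i \<le> \<mu> 1"
        hence "conj_part \<mu> i < 1" using conj_part_less[OF \<mu>, of 1 i] by simp
        thus False using r(2) 2(1) unfolding 2(2) theta_part_half by simp
      qed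
      thus ?thesis using 2(2) by blast
    qed
  qed
  show "finite (of_nat ` {i. i \<ge> 1 \<and> \<mu> i \<noteq> 0} \<union> (\<lambda>i. of_nat i - 1 / 2 :: rat) ` {..\<mu> 1})"
    using \<mu> by (simp add: is_partition_def)
qed

lemma P_plus_theta:
  assumes "lam \<in> P_plus x m Y0"
  shows "is_partition (plus_part lam)" "theta lam \<in> hdual (I_tilde m)"
    "r \<in> halfN \<Longrightarrow> coef (fst (theta lam)) r = of_nat (theta_part (plus_part lam) r)"
proof -
  obtain \<mu> where \<mu>: "is_partition \<mu>" "\<And>j. j \<ge> 1 \<Longrightarrow> coef (fst lam) (of_nat j) = of_nat (\<mu> j)"
    and h: "lam \<in> hdual (I_plus m)"
    using assms unfolding P_plus_def by blast
  have p: "plus_part lam j = \<mu> j" if "j \<ge> 1" for j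
    unfolding plus_part_def \<mu>(2)[OF that] by (rule the_equality) auto
  have "{i. i \<ge> 1 \<and> plus_part lam i \<noteq> 0} = {i. i \<ge> 1 \<and> \<mu> i \<noteq> 0}" using p by auto
  thus P: "is_partition (plus_part lam)" using \<mu>(1) p unfolding is_partition_def by simp
  let ?A = "{r \<in> supp (fst lam). r < 0}" and ?B = "{r \<in> halfN. theta_part (plus_part lam) r \<noteq> 0}"
  have fin: "finite ?A" "finite ?B" using theta_part_finite[OF P] by simp_all
  have co: "coef (fst (theta lam)) r = (if r \<in> ?A then coef (fst lam) r else 0)
      + (if r \<in> ?B then of_nat (theta_part (plus_part lam) r) else 0)" for r
    using fin by (simp add: theta_def lookup_add lookup_sum lookup_single when_def)
  show "r \<in> halfN \<Longrightarrow> coef (fst (theta lam)) r = of_nat (theta_part (plus_part lam) r)"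
    unfolding co using halfN_pos[of r] by auto
  have "?A \<subseteq> I_tilde m" using h by (auto simp: hdual_def I_plus_def I_tilde_def)
  moreover have "?B \<subseteq> I_tilde m" using halfN_I_tilde by blast
  ultimately show "theta lam \<in> hdual (I_tilde m)"
    unfolding hdual_def by (auto simp: in_keys_iff co split: if_splits)
qed

text \<open>Real parts are enough here: in \<open>hdual_I_split\<close> such a coefficient is added
  to a natural number, and a sum equal to 0 then forces both to vanish.\<close>

definition poly_wt :: "weight \<Rightarrow> bool"
  where "poly_wt \<gamma> \<longleftrightarrow> (\<forall>r\<in>halfN. 0 \<le> Re (coef (fst \<gamma>) r))"

lemma O_tilde_weight_module:
  assumes "in_O_tilde x m Y0 M"
  shows "weight_module x m M"
  using assms unfolding in_O_tilde_def weight_module_def super_module_def by (elim conjE)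

text \<open>The claim holds for every weight vector in one irreducible summand. The module is the
  sum of these, so \<open>t\<close> is a sum of vectors of such weights, and independence of weight
  spaces forces \<tau> to be one of them.\<close>

lemma O_tilde_poly_wt:
  assumes Y: "Y0 \<subseteq> Pi_k x m" and O: "in_O_tilde x m Y0 M"
    and t: "t \<in> weight_space m M \<tau>" "\<tau> \<in> hdual (I_tilde m)" "t \<noteq> \<zero>\<^bsub>M\<^esub>"
  shows "poly_wt \<tau>"
proof -
  interpret weight_module x m M by (rule O_tilde_weight_module[OF O])
  obtain \<N> where N: "mspan M (\<Union>\<N>) = carrier M" "\<And>N. N \<in> \<N> \<Longrightarrow> \<exists>\<mu>\<in>P_plus x m Y0. is_irred_hw x m Y0 M N (theta \<mu>)"
    using O unfolding in_O_tilde_def internal_direct_sum_def by (elim conjE exE) metis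
  define A where "A = {v. \<exists>\<gamma>\<in>hdual (I_tilde m). poly_wt \<gamma> \<and> v \<in> ws \<gamma>}"
  have A1: "A \<subseteq> carrier M" unfolding A_def using ws_carrier by blast
  have A2: "c \<odot>\<^bsub>M\<^esub> a \<in> A" if "a \<in> A" for c a
    using that unfolding A_def mem_Collect_eq by (elim bexE conjE, intro bexI conjI ws_smult)
  note A = A1 A2
  have "N \<subseteq> LS A" if NN: "N \<in> \<N>" for N
  proof -
    obtain \<mu> where \<mu>: "\<mu> \<in> P_plus x m Y0" "is_irred_hw x m Y0 M N (theta \<mu>)" using N(2)[OF NN] by blast
    interpret levi_irreducible x m M Y0 N
      by unfold_locales (use Y \<mu>(2) in \<open>auto simp: is_irred_hw_def\<close>)
    note P = P_plus_theta[OF \<mu>(1)]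
    obtain v where v: "v \<in> N" "v \<in> ws (theta \<mu>)" "v \<noteq> \<zero>\<^bsub>M\<^esub>"
      "\<And>\<alpha> X. \<alpha> \<in> pos_roots x m \<Longrightarrow> X \<in> root_space x m \<alpha> \<inter> levi_tilde x m Y0 \<Longrightarrow> act M X v = \<zero>\<^bsub>M\<^esub>"
      using \<mu>(2) unfolding is_irred_hw_def by blast
    have hw: "\<exists>w. singular (lfun m a 0) (theta \<mu>) w \<and> w \<noteq> \<zero>\<^bsub>M\<^esub>" if "a \<in> halfN" for a
      by (rule highest_weight_singular[OF that v(1-3) P(2) v(4)])
    \<comment> \<open>Any positive index would do: one ordering with a singular vector already shows
      that \<open>N\<close> is spanned by weight vectors.\<close>
    have one: "1 / 2 \<in> halfN" unfolding halfN_def by (auto intro: exI[of _ 1])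
    obtain w where w: "singular (lfun m (1 / 2) 0) (theta \<mu>) w" "w \<noteq> \<zero>\<^bsub>M\<^esub>" using hw[OF one] by blast
    have poly: "poly_wt \<gamma>" if g: "t \<in> N" "t \<in> ws \<gamma>" "t \<noteq> \<zero>\<^bsub>M\<^esub>" "\<gamma> \<in> hdual (I_tilde m)" for t \<gamma>
      unfolding poly_wt_def
    proof
      fix a assume a: "a \<in> halfN"
      obtain w where w: "singular (lfun m a 0) (theta \<mu>) w" "w \<noteq> \<zero>\<^bsub>M\<^esub>" using hw[OF a] by blast
      show "0 \<le> Re (coef (fst \<gamma>) a)"
        by (rule weights_nonneg[OF a w P(3) theta_part_hook[OF P(1)] g])
    qed
    have "N \<subseteq> LS {v \<in> N. \<exists>\<gamma>\<in>hdual (I_tilde m). True \<and> v \<in> ws \<gamma>}"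
      by (rule singular_span[OF w(1) lfun_neq_0[OF one] w(2)]) auto
    also have "\<dots> \<subseteq> LS A"
      unfolding LS_def
    proof (intro image_mono Collect_mono impI subsetI)
      fix ds v assume ds: "set ds \<subseteq> {v \<in> N. \<exists>\<gamma>\<in>hdual (I_tilde m). True \<and> v \<in> ws \<gamma>}" "v \<in> set ds"
      then obtain \<gamma> where g: "v \<in> N" "\<gamma> \<in> hdual (I_tilde m)" "v \<in> ws \<gamma>" by blast
      show "v \<in> A"
      proof (cases "v = \<zero>\<^bsub>M\<^esub>")
        case True
        have "poly_wt 0" by (simp add: poly_wt_def)
        thus ?thesis using True ws_zero[of 0] hdual_0[of "I_tilde m"] unfolding A_def by blast
      next
        case False
        thus ?thesis using poly[OF g(1,3) _ g(2)] g unfolding A_def by blast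
      qed
    qed
    finally show ?thesis .
  qed
  hence "mspan M (\<Union>\<N>) \<subseteq> LS A"
    unfolding mspan_def by (intro hull_minimal LS_submodule[OF A]) auto
  hence "t \<in> LS A" using N(1) ws_carrier[OF t(1)] by blast
  then obtain ds where ds: "set ds \<subseteq> A" "t = lsum ds" unfolding LS_iff by blast
  show ?thesis
  proof (rule ccontr)
    assume n: "\<not> poly_wt \<tau>"
    have "t = \<zero>\<^bsub>M\<^esub>" by (rule ws_independent[OF t(1,2) ds(2)]) (use ds(1) n in \<open>unfold A_def, blast\<close>)
    thus False using t(3) by simp
  qed
qed

section \<open>Truncation\<close>

lemma (in super_module) LS_gr_split:
  assumes A: "A \<subseteq> carrier M" and sp: "\<And>a. a \<in> A \<Longrightarrow> \<exists>a0\<in>gr M 0 \<inter> A. \<exists>a1\<in>gr M (Suc 0) \<inter> A. a = a0 \<oplus> a1"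
    and v: "v \<in> LS A"
  shows "\<exists>v0\<in>gr M 0 \<inter> LS A. \<exists>v1\<in>gr M (Suc 0) \<inter> LS A. v = v0 \<oplus> v1"
  using v A
proof (induction rule: LS_induct)
  case zero
  show ?case using gr_zero[of 0] gr_zero[of "Suc 0"] LS_zero[of A] by (intro bexI[of _ "\<zero>"]) auto
next
  case (add a w)
  obtain a0 a1 where a: "a0 \<in> gr M 0" "a0 \<in> A" "a1 \<in> gr M (Suc 0)" "a1 \<in> A" "a = a0 \<oplus> a1" using sp[OF add(1)] by blast
  obtain w0 w1 where w: "w0 \<in> gr M 0" "w0 \<in> LS A" "w1 \<in> gr M (Suc 0)" "w1 \<in> LS A" "w = w0 \<oplus> w1" using add(4) by blast
  have c: "a0 \<in> carrier M" "a1 \<in> carrier M" "w0 \<in> carrier M" "w1 \<in> carrier M"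
    using gr_carrier[of 0] gr_carrier[of "Suc 0"] a w by simp_all
  have "a \<oplus> w = (a0 \<oplus> w0) \<oplus> (a1 \<oplus> w1)" using c by (simp add: a(5) w(5) M.a_ac)
  moreover have "a0 \<oplus> w0 \<in> gr M 0" "a1 \<oplus> w1 \<in> gr M (Suc 0)" using gr_add[of 0] gr_add[of "Suc 0"] a w by simp_all
  moreover have "a0 \<oplus> w0 \<in> LS A" "a1 \<oplus> w1 \<in> LS A" using LS_add[OF A] LS_base[OF A] a w by simp_all
  ultimately show ?case by blast
qed

lemma sB_act_cong: "act M = act M' \<Longrightarrow> sB x M p X xs v = sB x M' p X xs v"
  by (induction xs) simp_all

lemma sD_act_cong: "act M = act M' \<Longrightarrow> sD x M xs v = sD x M' xs v"
  by (induction xs) (simp_all add: sB_act_cong[of M M'])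

text \<open>The argument of \<open>ws_independent\<close> relative to a stable subspace
  \<open>V\<close>, with eigenvectors only modulo \<open>V\<close>. It is applied with the relations
  and with the boundaries as \<open>V\<close>, which gives weight components in chains and in
  homology.\<close>

lemma eigen_independent:
  fixes T :: "'h \<Rightarrow> ('b \<Rightarrow>\<^sub>0 complex) \<Rightarrow> ('b \<Rightarrow>\<^sub>0 complex)" and ev :: "'w \<Rightarrow> 'h \<Rightarrow> complex"
  assumes V: "pv.subspace V"
    and T: "\<And>h z w. T h (z + w) = T h z + T h w" "\<And>h z w. T h (z - w) = T h z - T h w"
      "\<And>h c z. T h (pscale c z) = pscale c (T h z)"
    and TV: "\<And>h z. h \<in> Hs \<Longrightarrow> z \<in> V \<Longrightarrow> T h z \<in> V"
    and fin: "finite \<Gamma>"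
    and t: "\<And>h. h \<in> Hs \<Longrightarrow> T h t - pscale (ev \<tau> h) t \<in> V"
    and s: "\<And>\<gamma> h. \<gamma> \<in> \<Gamma> \<Longrightarrow> h \<in> Hs \<Longrightarrow> T h (s \<gamma>) - pscale (ev \<gamma> h) (s \<gamma>) \<in> V"
    and sep: "\<And>\<gamma>. \<gamma> \<in> \<Gamma> \<Longrightarrow> \<exists>h\<in>Hs. ev \<gamma> h \<noteq> ev \<tau> h"
    and "t - sum s \<Gamma> \<in> V"
  shows "t \<in> V"
  using fin t s sep assms(10)
proof (induction \<Gamma> arbitrary: t s rule: finite_induct)
  case empty
  thus ?case by simp
next
  case (insert \<delta> \<Gamma>)
  note cl = pv.subspace_add[OF V] pv.subspace_diff[OF V] pv.subspace_scale[OF V]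
  obtain h where h: "h \<in> Hs" "ev \<delta> h \<noteq> ev \<tau> h" using insert.prems(3) by blast
  \<comment> \<open>Modulo \<open>V\<close> this operator kills \<open>s \<delta>\<close> and
    rescales the other eigenvectors; the factor on \<open>t\<close> is nonzero by the choice of
    \<open>h\<close>.\<close>
  define N where "N z = T h z - pscale (ev \<delta> h) z" for z
  have N: "N (z + w) = N z + N w" "N (z - w) = N z - N w" for z w
    by (simp_all add: N_def T pv.scale_right_distrib pv.scale_right_diff_distrib)
  have Nsum: "N (sum s \<Gamma>) = (\<Sum>\<gamma>\<in>\<Gamma>. N (s \<gamma>))"
    using insert.hyps(1) by (induction rule: finite_induct) (use N(2)[of 0 0] in \<open>simp_all add: N(1)\<close>)
  define t' where "t' = pscale (ev \<tau> h - ev \<delta> h) t"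
  define s' where "s' = (\<lambda>\<gamma>. pscale (ev \<gamma> h - ev \<delta> h) (s \<gamma>))"
  have "t' \<in> V"
  proof (rule insert.IH[of t' s'])
    show "T k t' - pscale (ev \<tau> k) t' \<in> V" if "k \<in> Hs" for k
    proof -
      have "T k t' - pscale (ev \<tau> k) t' = pscale (ev \<tau> h - ev \<delta> h) (T k t - pscale (ev \<tau> k) t)"
        by (simp add: t'_def T pv.scale_right_diff_distrib mult.commute)
      thus ?thesis using cl(3)[OF insert.prems(1)[OF that]] by simp
    qed
    show "T k (s' \<gamma>) - pscale (ev \<gamma> k) (s' \<gamma>) \<in> V" if "\<gamma> \<in> \<Gamma>" "k \<in> Hs" for k \<gamma>
    proof -
      have "T k (s' \<gamma>) - pscale (ev \<gamma> k) (s' \<gamma>) = pscale (ev \<gamma> h - ev \<delta> h) (T k (s \<gamma>) - pscale (ev \<gamma> k) (s \<gamma>))"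
        by (simp add: s'_def T pv.scale_right_diff_distrib mult.commute)
      thus ?thesis using cl(3)[OF insert.prems(2)[OF insertI2[OF that(1)] that(2)]] by simp
    qed
    show "\<exists>h\<in>Hs. ev \<gamma> h \<noteq> ev \<tau> h" if "\<gamma> \<in> \<Gamma>" for \<gamma> using insert.prems(3) that by blast
    have d: "N z - pscale (c - ev \<delta> h) z = T h z - pscale c z" for z c
      by (simp add: N_def pv.scale_left_diff_distrib)
    have 1: "N (t - sum s (insert \<delta> \<Gamma>)) \<in> V"
      unfolding N_def by (rule cl(2)[OF TV[OF h(1) insert.prems(4)] cl(3)[OF insert.prems(4)]])
    have 2: "N t - t' \<in> V" unfolding t'_def d by (rule insert.prems(1)[OF h(1)])
    have 3: "N (s \<delta>) \<in> V" unfolding N_def by (rule insert.prems(2)[OF insertI1 h(1)])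
    have 4: "(\<Sum>\<gamma>\<in>\<Gamma>. N (s \<gamma>) - s' \<gamma>) \<in> V"
      by (rule pv.subspace_sum[OF V]) (use insert.prems(2)[OF insertI2 h(1)] in \<open>simp add: s'_def d\<close>)
    note cl(1)[OF cl(1)[OF cl(2)[OF 1 2] 3] 4]
    moreover have "N (t - sum s (insert \<delta> \<Gamma>)) - (N t - t') + N (s \<delta>) + (\<Sum>\<gamma>\<in>\<Gamma>. N (s \<gamma>) - s' \<gamma>) = t' - sum s' \<Gamma>"
      using insert.hyps by (simp add: N Nsum sum_subtractf)
    ultimately show "t' - sum s' \<Gamma> \<in> V" by simp
  qed
  hence "pscale (1 / (ev \<tau> h - ev \<delta> h)) t' \<in> V" by (rule cl(3))
  thus ?case using h(2) by (simp add: t'_def)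
qed

text \<open>The conditions on \<open>I\<close> cover \<open>I_plus m\<close> and
  \<open>I_bar m\<close>, so both parts of the theorem are instances of one argument.\<close>

locale truncation = weight_module x m M for x m and M :: "'v smod" (structure) +
  fixes Y0 :: "weight set" and I :: "rat set"
  assumes Y0: "Y0 \<subseteq> Pi_k x m" and I: "negI m \<subseteq> I" "I \<subseteq> I_tilde m"
    and ws_gen: "mspan M (\<Union>\<gamma>\<in>hdual (I_tilde m). ws \<gamma>) = carrier M"
    and ws_poly: "\<And>\<gamma> t. \<gamma> \<in> hdual (I_tilde m) \<Longrightarrow> t \<in> ws \<gamma> \<Longrightarrow> t \<noteq> \<zero> \<Longrightarrow> poly_wt \<gamma>"
begin

abbreviation "U \<equiv> u_tilde_minus x m Y0"
abbreviation "L \<equiv> levi_tilde x m Y0 \<union> U"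
abbreviation "gI \<equiv> g_supported x m I"
abbreviation "UI \<equiv> U \<inter> gI"
abbreviation "LI \<equiv> (levi_tilde x m Y0 \<inter> gI) \<union> UI"
abbreviation "WI \<equiv> (\<Union>\<gamma>\<in>hdual I. ws \<gamma>)"
abbreviation "WC \<equiv> (\<Union>\<gamma>\<in>hdual (I_tilde m) - hdual I. ws \<gamma>)"
abbreviation "MI \<equiv> restr M (LS WI)"

section \<open>The projection of the module onto the selected weight spaces\<close>

lemma hdual_I: "hdual I \<subseteq> hdual (I_tilde m)"
  by (rule hdual_mono[OF I(2)])

lemma W_carrier: "(\<Union>\<gamma>\<in>\<Gamma>. ws \<gamma>) \<subseteq> carrier M"
  using ws_carrier by blast

lemma W_smult: "a \<in> (\<Union>\<gamma>\<in>\<Gamma>. ws \<gamma>) \<Longrightarrow> c \<odot> a \<in> (\<Union>\<gamma>\<in>\<Gamma>. ws \<gamma>)"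
  using ws_smult by blast

lemma W_submodule: "submodule (LS (\<Union>\<gamma>\<in>\<Gamma>. ws \<gamma>)) CC M"
  by (rule LS_submodule[OF W_carrier W_smult])

lemma W_Int: "LS WI \<inter> LS WC = {\<zero>}"
proof -
  have "t = \<zero>" if "t \<in> LS WI" "t \<in> LS WC" for t
    by (rule LS_ws_disjoint[OF hdual_I _ _ that]) auto
  thus ?thesis using LS_zero by blast
qed

lemma truncate_eq: "truncate m I M = MI"
proof -
  have "mspan M WI = LS WI" by (rule mspan_eq_LS[OF W_carrier W_smult])
  thus ?thesis unfolding truncate_def by simp
qed

lemma carrier_LS: "carrier M = LS (\<Union>\<gamma>\<in>hdual (I_tilde m). ws \<gamma>)"
  using ws_gen mspan_eq_LS[OF W_carrier W_smult] by simp

lemma W_split: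
  assumes "v \<in> carrier M"
  shows "\<exists>w\<in>LS WI. \<exists>c\<in>LS WC. v = w \<oplus> c"
proof -
  have "v \<in> LS (\<Union>\<gamma>\<in>hdual (I_tilde m). ws \<gamma>)" using assms carrier_LS by simp
  thus ?thesis using W_carrier
  proof (induction rule: LS_induct)
    case zero
    show ?case using LS_zero[of WI] LS_zero[of WC] by (intro bexI[of _ "\<zero>"]) auto
  next
    case (add a u)
    then obtain w c where wc: "w \<in> LS WI" "c \<in> LS WC" "u = w \<oplus> c" by blast
    have cc: "a \<in> carrier M" "w \<in> carrier M" "c \<in> carrier M"
      using add(1) W_carrier wc subsetD[OF LS_carrier[OF W_carrier]] by blast+
    from add(1) have "a \<in> WI \<or> a \<in> WC" by blast
    thus ?case
    proof
      assume "a \<in> WI"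
      hence "a \<oplus> w \<in> LS WI" by (intro LS_add[OF W_carrier _ wc(1)] LS_base[OF W_carrier])
      thus ?thesis using wc cc by (intro bexI[of _ "a \<oplus> w"] bexI[of _ c]) (simp_all add: M.a_assoc)
    next
      assume "a \<in> WC"
      hence "a \<oplus> c \<in> LS WC" by (intro LS_add[OF W_carrier _ wc(2)] LS_base[OF W_carrier])
      thus ?thesis using wc cc by (intro bexI[of _ w] bexI[of _ "a \<oplus> c"]) (simp_all add: M.a_lcomm)
    qed
  qed
qed

text \<open>The projection along the remaining weight spaces. The choice is in fact unique, since
  the two sums of weight spaces meet only in zero.\<close>

definition q :: "'v \<Rightarrow> 'v" where "q v = (SOME w. w \<in> LS WI \<and> (\<exists>c\<in>LS WC. v = w \<oplus> c))"

lemma q_obtain: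
  assumes "v \<in> carrier M"
  shows "q v \<in> LS WI" "\<exists>c\<in>LS WC. v = q v \<oplus> c"
proof -
  have "\<exists>w. w \<in> LS WI \<and> (\<exists>c\<in>LS WC. v = w \<oplus> c)" using W_split[OF assms] by blast
  from someI_ex[OF this] show "q v \<in> LS WI" "\<exists>c\<in>LS WC. v = q v \<oplus> c" unfolding q_def by blast+
qed

lemma W_LS_carrier: "v \<in> LS (\<Union>\<gamma>\<in>\<Gamma>. ws \<gamma>) \<Longrightarrow> v \<in> carrier M"
  using LS_carrier[OF W_carrier] by blast

lemma q_eqI:
  assumes "w \<in> LS WI" "c \<in> LS WC" "v = w \<oplus> c"
  shows "q v = w"
proof -
  have "v \<in> carrier M" using assms(3) W_LS_carrier[OF assms(1)] W_LS_carrier[OF assms(2)] by simp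
  from q_obtain[OF this] obtain c' where c: "q v \<in> LS WI" "c' \<in> LS WC" "v = q v \<oplus> c'" by blast
  have "q v \<oplus> c' = w \<oplus> c" using c(3) assms(3) by simp
  thus ?thesis by (rule submodule_sum_unique(1)[OF W_submodule W_submodule W_Int c(1,2) assms(1,2)])
qed

lemma q_id: "v \<in> LS WI \<Longrightarrow> q v = v"
  by (rule q_eqI[OF _ LS_zero]) (simp_all add: W_LS_carrier)

lemma q_0: "v \<in> LS WC \<Longrightarrow> q v = \<zero>"
  by (rule q_eqI[OF LS_zero _ M.l_zero[OF W_LS_carrier, symmetric]])

lemma q_add:
  assumes "v \<in> carrier M" "w \<in> carrier M"
  shows "q (v \<oplus> w) = q v \<oplus> q w"
proof -
  obtain c d where c: "c \<in> LS WC" "v = q v \<oplus> c" and d: "d \<in> LS WC" "w = q w \<oplus> d"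
    using q_obtain(2)[OF assms(1)] q_obtain(2)[OF assms(2)] by blast
  have cc: "q v \<in> carrier M" "q w \<in> carrier M" "c \<in> carrier M" "d \<in> carrier M"
    using q_obtain(1)[OF assms(1)] q_obtain(1)[OF assms(2)] c(1) d(1) W_LS_carrier by blast+
  have e: "v \<oplus> w = (q v \<oplus> q w) \<oplus> (c \<oplus> d)"
    by (subst c(2), subst d(2)) (use cc in \<open>simp add: M.a_ac\<close>)
  show ?thesis
    by (rule q_eqI[OF LS_add[OF W_carrier] LS_add[OF W_carrier] e]) (use q_obtain(1) assms c(1) d(1) in blast)+
qed

lemma q_smult:
  assumes "v \<in> carrier M"
  shows "q (k \<odot> v) = k \<odot> q v"
proof -
  obtain c where c: "c \<in> LS WC" "v = q v \<oplus> c" using q_obtain(2)[OF assms] by blast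
  have cc: "q v \<in> carrier M" "c \<in> carrier M" using q_obtain(1)[OF assms] c(1) W_LS_carrier by blast+
  have e: "k \<odot> v = k \<odot> q v \<oplus> k \<odot> c"
    by (subst c(2)) (use cc in \<open>simp add: smult_add_right\<close>)
  show ?thesis
    by (rule q_eqI[OF _ _ e]) (use q_obtain(1)[OF assms] c(1) M.submoduleE(4)[OF W_submodule] in simp_all)
qed

lemma W_gr_split:
  assumes "v \<in> LS (\<Union>\<gamma>\<in>\<Gamma>. ws \<gamma>)"
  shows "\<exists>v0\<in>gr M 0 \<inter> LS (\<Union>\<gamma>\<in>\<Gamma>. ws \<gamma>). \<exists>v1\<in>gr M (Suc 0) \<inter> LS (\<Union>\<gamma>\<in>\<Gamma>. ws \<gamma>). v = v0 \<oplus> v1"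
proof (rule LS_gr_split[OF W_carrier _ assms])
  fix a assume "a \<in> (\<Union>\<gamma>\<in>\<Gamma>. ws \<gamma>)"
  then obtain \<gamma> where g: "\<gamma> \<in> \<Gamma>" "a \<in> ws \<gamma>" by blast
  obtain a0 a1 where a: "a0 \<in> gr M 0" "a1 \<in> gr M (Suc 0)" "a = a0 \<oplus> a1" by (rule gr_split[OF ws_carrier[OF g(2)]])
  from ws_gr_split[OF g(2) a] show "\<exists>a0\<in>gr M 0 \<inter> (\<Union>\<gamma>\<in>\<Gamma>. ws \<gamma>). \<exists>a1\<in>gr M (Suc 0) \<inter> (\<Union>\<gamma>\<in>\<Gamma>. ws \<gamma>). a = a0 \<oplus> a1"
    using a g(1) by blast
qed

text \<open>Kernel and image of the projection are both graded because weight spaces are, so the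
  decomposition of a homogeneous vector consists of homogeneous vectors.\<close>

lemma q_gr:
  assumes p: "p < 2" and v: "v \<in> gr M p"
  shows "q v \<in> gr M p"
proof -
  have vc: "v \<in> carrier M" by (rule gr_carrier[OF p v])
  obtain c where c: "c \<in> LS WC" "v = q v \<oplus> c" using q_obtain(2)[OF vc] by blast
  obtain w0 w1 where w: "w0 \<in> gr M 0" "w0 \<in> LS WI" "w1 \<in> gr M (Suc 0)" "w1 \<in> LS WI" "q v = w0 \<oplus> w1"
    using W_gr_split[OF q_obtain(1)[OF vc]] by blast
  obtain c0 c1 where d: "c0 \<in> gr M 0" "c0 \<in> LS WC" "c1 \<in> gr M (Suc 0)" "c1 \<in> LS WC" "c = c0 \<oplus> c1"
    using W_gr_split[OF c(1)] by blast
  have cc: "w0 \<in> carrier M" "w1 \<in> carrier M" "c0 \<in> carrier M" "c1 \<in> carrier M" using w d W_LS_carrier by blast+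
  have e: "v = (w0 \<oplus> c0) \<oplus> (w1 \<oplus> c1)" by (subst c(2)) (use cc in \<open>simp add: w(5) d(5) M.a_ac\<close>)
  have g: "w0 \<oplus> c0 \<in> gr M 0" "w1 \<oplus> c1 \<in> gr M (Suc 0)" using gr_add[of 0] gr_add[of "Suc 0"] w d by simp_all
  have z: "a = \<zero>" if "a \<in> LS WI" "b \<in> LS WC" "a \<oplus> b = \<zero>" for a b
    using submodule_sum_unique(1)[OF W_submodule W_submodule W_Int that(1,2) LS_zero LS_zero] that(3) by simp
  from lt_2_cases[OF p] show ?thesis
  proof
    assume p: "p = 0"
    have "v \<oplus> \<zero> = (w0 \<oplus> c0) \<oplus> (w1 \<oplus> c1)" using e vc by simp
    from gr_unique(2)[OF _ gr_zero g this] v p have "w1 \<oplus> c1 = \<zero>" by simp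
    hence "w1 = \<zero>" by (rule z[OF w(4) d(4)])
    thus ?thesis using w(1,5) cc p by simp
  next
    assume p: "p = Suc 0"
    have "\<zero> \<oplus> v = (w0 \<oplus> c0) \<oplus> (w1 \<oplus> c1)" using e vc by simp
    from gr_unique(1)[OF gr_zero _ g this] v p have "w0 \<oplus> c0 = \<zero>" by simp
    hence "w0 = \<zero>" by (rule z[OF w(2) d(2)])
    thus ?thesis using w(3,5) cc p by simp
  qed
qed

section \<open>The truncated module\<close>

lemma MI_simps: "carrier MI = LS WI" "add MI = add M" "smult MI = smult M" "\<zero>\<^bsub>MI\<^esub> = \<zero>" "act MI = act M"
  "gr MI p = gr M p \<inter> LS WI"
  by (simp_all add: restr_def)

lemma L_g_tilde: "L \<subseteq> g_tilde x m"
  using levi_g_tilde u_tilde_g_tilde by blast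

lemma LI_g_tilde: "LI \<subseteq> g_tilde x m"
  using L_g_tilde by blast

lemma act_supported_span:
  assumes "X \<in> gspan (\<Union>\<alpha>\<in>hdual I. root_space x m \<alpha>)" "v \<in> LS WI"
  shows "act M X v \<in> LS WI"
proof -
  have v: "v \<in> carrier M" by (rule W_LS_carrier[OF assms(2)])
  have gen: "act M X v \<in> LS WI" if X: "X \<in> root_space x m \<alpha>" "\<alpha> \<in> hdual I" for X \<alpha>
  proof (rule LS_map[OF W_carrier assms(2) _ _ _ W_carrier])
    have G: "X \<in> g_tilde x m" by (rule root_space_g_tilde[OF X(1)])
    show "act M X (v \<oplus> w) = act M X v \<oplus> act M X w" if "v \<in> carrier M" "w \<in> carrier M" for v w
      by (rule act_add[OF G that])
    show "act M X \<zero> = \<zero>" by (rule act_zero[OF G])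
    fix a assume "a \<in> WI"
    then obtain \<gamma> where "\<gamma> \<in> hdual I" "a \<in> ws \<gamma>" by blast
    hence "act M X a \<in> ws (\<gamma> + \<alpha>)" "\<gamma> + \<alpha> \<in> hdual I"
      using ws_act[OF subsetD[OF hdual_I X(2)] X(1)] hdual_add[OF _ X(2)] by blast+
    thus "act M X a \<in> LS WI" by (intro LS_base[OF W_carrier]) blast
  qed
  have "X \<in> g_tilde x m \<and> act M X v \<in> LS WI" using assms(1)
  proof (induction rule: gv.span_induct_alt)
    case base
    have z: "(0 :: gt) \<in> g_tilde x m" by (rule gv.subspace_0[OF g_tilde_subspace])
    thus ?case using act_0[OF z v] LS_zero by simp
  next
    case (step c X Y)
    then obtain \<alpha> where X: "X \<in> root_space x m \<alpha>" "\<alpha> \<in> hdual I" by blast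
    have G: "X \<in> g_tilde x m" "Y \<in> g_tilde x m" using root_space_g_tilde[OF X(1)] step(2) by blast+
    have cX: "gscale c X \<in> g_tilde x m" by (rule gv.subspace_scale[OF g_tilde_subspace G(1)])
    have "act M (gscale c X + Y) v = c \<odot> act M X v \<oplus> act M Y v"
      using act_add_left[OF cX G(2) v] act_gscale[OF G(1) v] by simp
    moreover have "c \<odot> act M X v \<oplus> act M Y v \<in> LS WI"
      using gen[OF X] step(2) M.submoduleE(4,5)[OF W_submodule] by simp
    ultimately show ?case using gv.subspace_add[OF g_tilde_subspace cX G(2)] by simp
  qed
  thus ?thesis by blast
qed

text \<open>Cartan elements have weight 0, and truncation keeps only the root spaces whose roots are
  supported on \<open>I\<close>. Acting with such elements does not lead out of the selected
  weights, which is why the truncated module is stable.\<close>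

lemma LI_span: "LI \<subseteq> gspan (\<Union>\<alpha>\<in>hdual I. root_space x m \<alpha>)"
proof
  fix X assume "X \<in> LI"
  thus "X \<in> gspan (\<Union>\<alpha>\<in>hdual I. root_space x m \<alpha>)"
  proof
    assume X: "X \<in> levi_tilde x m Y0 \<inter> gI"
    have "insert KK (E_hat ` I) \<union> (\<Union>\<alpha>\<in>roots x m \<inter> levi_lattice Y0 \<inter> hdual I. root_space x m \<alpha>)
        \<subseteq> (\<Union>\<alpha>\<in>hdual I. root_space x m \<alpha>)"
    proof -
      have "KK \<in> root_space x m 0" using hop_root_space_0[of None m x] by (simp add: hidx_def)
      moreover have "E_hat r \<in> root_space x m 0" if "r \<in> I" for r
        using hop_root_space_0[of "Some r" m x] that I(2) by (auto simp: hidx_def)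
      ultimately show ?thesis using hdual_0[of I] by blast
    qed
    from gv.span_mono[OF this] show ?thesis using levi_supported_span[OF _ _ I(2), of X x Y0] X by blast
  next
    assume X: "X \<in> UI"
    have "ptr I X \<in> gspan (\<Union>\<alpha>\<in>hdual I. root_space x m \<alpha>)"
    proof (rule span_linear[OF ptr_add ptr_gscale])
      show "X \<in> gspan (\<Union>\<alpha>\<in>u_roots x m Y0. root_space x m \<alpha>)" using X u_tilde_minus_eq by blast
      fix Z assume "Z \<in> (\<Union>\<alpha>\<in>u_roots x m Y0. root_space x m \<alpha>)"
      then obtain \<alpha> where a: "\<alpha> \<in> roots x m" "Z \<in> root_space x m \<alpha>" using u_roots_roots by blast
      show "ptr I Z \<in> gspan (\<Union>\<alpha>\<in>hdual I. root_space x m \<alpha>)"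
      proof (cases "\<alpha> \<in> hdual I")
        case True
        thus ?thesis using root_space_supported(2)[OF a True] a(2) by (intro gv.span_base) auto
      next
        case False
        thus ?thesis using root_space_not_supported[OF a False] by (simp add: gv.span_zero)
      qed
    qed
    thus ?thesis using ptr_g_supported[of X x m I] X by auto
  qed
qed

lemma act_MI: "X \<in> LI \<Longrightarrow> v \<in> LS WI \<Longrightarrow> act M X v \<in> LS WI"
  using act_supported_span LI_span by blast

lemma module_MI: "module CC MI"
proof (rule moduleI[OF cring_CC])
  note S = M.submoduleE[OF W_submodule]
  note c = W_LS_carrier
  show "abelian_group MI"
  proof (rule abelian_groupI)
    fix a assume a: "a \<in> carrier MI"
    hence "\<ominus> a \<in> carrier MI" "\<ominus> a \<oplus>\<^bsub>MI\<^esub> a = \<zero>\<^bsub>MI\<^esub>"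
      using S(3) c[of a] M.l_neg[of a] by (simp_all add: MI_simps)
    thus "\<exists>b\<in>carrier MI. b \<oplus>\<^bsub>MI\<^esub> a = \<zero>\<^bsub>MI\<^esub>" by blast
  qed (use S(5) c LS_zero in \<open>auto simp: MI_simps M.a_ac\<close>)
qed (use M.submoduleE(4)[OF W_submodule] W_LS_carrier in
    \<open>auto simp: MI_simps CC_def smult_add_left smult_add_right smult_smult\<close>)

text \<open>Additive inverses are defined relative to a carrier, so subtraction in the restricted
  module has to be compared with the one in \<open>M\<close>.\<close>

lemma minus_MI:
  assumes "v \<in> LS WI" "w \<in> LS WI"
  shows "v \<ominus>\<^bsub>MI\<^esub> w = v \<ominus> w"
proof -
  interpret MI: module CC MI by (rule module_MI)
  have "\<ominus>\<^bsub>MI\<^esub> w = \<ominus> w"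
    using assms(2) M.submoduleE(3)[OF W_submodule] W_LS_carrier[OF assms(2)]
    by (intro MI.minus_equality) (auto simp: MI_simps M.l_neg)
  thus ?thesis by (simp add: a_minus_def MI_simps)
qed

lemma gr_MI_submodule: "p < 2 \<Longrightarrow> submodule (gr MI p) CC MI"
proof -
  assume p: "p < 2"
  interpret MI: module CC MI by (rule module_MI)
  note G = M.submoduleE[OF gr_submodule[OF p]] and S = M.submoduleE[OF W_submodule]
  show "submodule (gr MI p) CC MI"
  proof (rule MI.submoduleI)
    fix a assume a: "a \<in> gr MI p"
    have "\<ominus>\<^bsub>MI\<^esub> a = \<ominus> a"
      using a S(3) W_LS_carrier[of a] by (intro MI.minus_equality) (auto simp: MI_simps M.l_neg)
    thus "\<ominus>\<^bsub>MI\<^esub> a \<in> gr MI p" using a G(3) S(3) by (simp add: MI_simps)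
  qed (use G(4,5) S(4,5) gr_zero[OF p] LS_zero in \<open>auto simp: MI_simps\<close>)
qed

lemma smodule_MI: "is_smodule x LI MI"
  unfolding is_smodule_def
proof (intro conjI ballI allI impI)
  show "module CC MI" by (rule module_MI)
  show "submodule (gr MI 0) CC MI" "submodule (gr MI 1) CC MI" by (rule gr_MI_submodule; simp)+
  show "gr MI 0 \<inter> gr MI 1 = {\<zero>\<^bsub>MI\<^esub>}" using gr_Int LS_zero by (auto simp: MI_simps)
  have LI: "X \<in> g_tilde x m" if "X \<in> LI" for X using that LI_g_tilde by blast
  show "\<exists>v0\<in>gr MI 0. \<exists>v1\<in>gr MI 1. v = v0 \<oplus>\<^bsub>MI\<^esub> v1" if "v \<in> carrier MI" for v
    using W_gr_split[of v "hdual I"] that by (simp add: MI_simps)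
  show "act MI X v \<in> carrier MI" if "X \<in> LI" "v \<in> carrier MI" for X v
    using act_MI[OF that(1)] that(2) unfolding MI_simps .
  show "act MI X (v \<oplus>\<^bsub>MI\<^esub> w) = act MI X v \<oplus>\<^bsub>MI\<^esub> act MI X w" if "X \<in> LI" "v \<in> carrier MI" "w \<in> carrier MI" for X v w
    using that act_add[OF LI] W_LS_carrier unfolding MI_simps by blast
  show "act MI X (c \<odot>\<^bsub>MI\<^esub> v) = c \<odot>\<^bsub>MI\<^esub> act MI X v" if "X \<in> LI" "v \<in> carrier MI" for X v c
    using that act_smult[OF LI] W_LS_carrier unfolding MI_simps by blast
  show "act MI (X + Y) v = act MI X v \<oplus>\<^bsub>MI\<^esub> act MI Y v" if "X \<in> LI" "Y \<in> LI" "v \<in> carrier MI" for X Y v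
    using that act_add_left[OF LI LI] W_LS_carrier unfolding MI_simps by blast
  show "act MI (gscale c X) v = c \<odot>\<^bsub>MI\<^esub> act MI X v" if "X \<in> LI" "v \<in> carrier MI" for X v c
    using that act_gscale[OF LI] W_LS_carrier unfolding MI_simps by blast
  show "act MI X v \<in> gr MI ((p + r) mod 2)"
    if "p < 2" "r < 2" "X \<in> LI \<inter> gt_hom x p" "v \<in> gr MI r" for p r X v
    using gr_act[OF LI, of X p r v] act_MI[of X v] that unfolding MI_simps by blast
  show "act MI (bracket x X Y) v = act MI X (act MI Y v) \<ominus>\<^bsub>MI\<^esub> (-1) ^ (p * r) \<odot>\<^bsub>MI\<^esub> act MI Y (act MI X v)"
    if "p < 2" "r < 2" "X \<in> LI \<inter> gt_hom x p" "Y \<in> LI \<inter> gt_hom x r" "v \<in> carrier MI" for p r X Y v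
  proof -
    have X: "X \<in> LI" "X \<in> gt_hom x p" and Y: "Y \<in> LI" "Y \<in> gt_hom x r" and v: "v \<in> LS WI"
      using that(3-5) unfolding MI_simps by blast+
    have 1: "act M X (act M Y v) \<in> LS WI" "act M Y (act M X v) \<in> LS WI"
      by (rule act_MI[OF X(1) act_MI[OF Y(1) v]], rule act_MI[OF Y(1) act_MI[OF X(1) v]])
    have 2: "(-1) ^ (p * r) \<odot> act M Y (act M X v) \<in> LS WI" using M.submoduleE(4)[OF W_submodule] 1(2) by simp
    show ?thesis unfolding MI_simps minus_MI[OF 1(1) 2]
      by (rule act_bracket[OF LI[OF X(1)] LI[OF Y(1)] X(2) Y(2) that(1,2) W_LS_carrier[OF v]])
  qed
qed

section \<open>The two chain complexes and the projection between them\<close>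

lemma U_subspace: "gv.subspace U"
  by (simp add: u_tilde_minus_def)

lemma U_comp: "X \<in> U \<Longrightarrow> p < 2 \<Longrightarrow> gt_comp x p X \<in> U"
proof -
  assume "X \<in> U" "p < 2"
  hence "gt_comp x p X \<in> gspan (\<Union>\<alpha>\<in>u_roots x m Y0. root_space x m \<alpha> \<inter> gt_hom x p)" by (rule u_tilde_comp)
  moreover have "gspan (\<Union>\<alpha>\<in>u_roots x m Y0. root_space x m \<alpha> \<inter> gt_hom x p) \<subseteq> U"
    unfolding u_tilde_minus_eq by (rule gv.span_mono) blast
  ultimately show ?thesis by blast
qed

lemma smodule_L: "is_smodule x L M"
proof -
  have sub: "X \<in> g_tilde x m" if "X \<in> L" for X using that L_g_tilde by blast
  show ?thesis using smod unfolding is_smodule_def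
    by (elim conjE, intro conjI) (assumption | (intro ballI allI impI, meson sub Int_iff))+
qed

sublocale til: chain_data x U L M
proof (rule chain_data.intro)
  show "super_module x L M" by (rule super_module.intro[OF smodule_L])
  show "chain_data_axioms x U L"
  proof
    show "bracket x X Z \<in> U" if "X \<in> L" "Z \<in> U" for X Z
      using that levi_u_bracket[OF Y0] u_tilde_bracket[OF Y0] by blast
    show "gt_comp x p X \<in> L" if "X \<in> L" "p < 2" for X p
      using that levi_comp U_comp by blast
  qed (use U_subspace in auto)
qed

sublocale sub: chain_data x UI LI MI
proof (rule chain_data.intro)
  show "super_module x LI MI" by (rule super_module.intro[OF smodule_MI])
  show "chain_data_axioms x UI LI"
  proof
    show "gv.subspace UI" by (rule gv.subspace_inter[OF U_subspace g_supported_subspace])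
    show "bracket x X Z \<in> UI" if "X \<in> LI" "Z \<in> UI" for X Z
      using that levi_u_bracket[OF Y0] u_tilde_bracket[OF Y0] g_supported_bracket by blast
    show "gt_comp x p X \<in> LI" if "X \<in> LI" "p < 2" for X p
      using that levi_comp U_comp g_supported_comp by blast
  qed auto
qed

lemma DD_MI: "DD x MI = DD x M"
  by (rule ext) (simp add: DD_def sD_act_cong[of MI M, OF MI_simps(5)])

lemma AA_MI: "AA x MI = AA x M"
  by (intro ext) (simp add: AA_def BB_def sB_act_cong[of MI M, OF MI_simps(5)])

lemma gens_sub: "gens x UI MI n \<subseteq> gens x U M n"
  using W_LS_carrier by (auto simp: gens_def MI_simps)

lemma F_sub: "sub.F n \<subseteq> til.F n"
  using gens_sub by (auto simp: free_space_def)

definition proj :: "(gt list \<times> 'v \<Rightarrow>\<^sub>0 complex) \<Rightarrow> (gt list \<times> 'v \<Rightarrow>\<^sub>0 complex)"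
  where "proj z = linext (\<lambda>(xs, v). bas (map (ptr I) xs, q v)) z"

lemma proj_simps: "proj (z + w) = proj z + proj w" "proj (z - w) = proj z - proj w"
  "proj (pscale c z) = pscale c (proj z)" "proj 0 = 0"
  by (simp_all add: proj_def linext_add linext_diff linext_pscale)

lemma proj_bas [simp]: "proj (bas (xs, v)) = bas (map (ptr I) xs, q v)"
  by (simp add: proj_def)

lemma gens_proj:
  assumes "(xs, v) \<in> gens x U M n"
  shows "(map (ptr I) xs, q v) \<in> gens x UI MI n"
proof -
  have xs: "length xs = n" "\<And>X. X \<in> set xs \<Longrightarrow> X \<in> U" "\<And>X. X \<in> set xs \<Longrightarrow> X \<in> gt_hom x 0 \<union> gt_hom x 1" and v: "v \<in> carrier M"
    using assms unfolding gens_def by auto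
  have "ptr I X \<in> UI \<inter> (gt_hom x 0 \<union> gt_hom x 1)" if "X \<in> set xs" for X
    using ptr_u_tilde[OF xs(2)[OF that], of I] xs(3)[OF that] ptr_hom[of X x _ I] by blast
  hence "set (map (ptr I) xs) \<subseteq> UI \<inter> (gt_hom x 0 \<union> gt_hom x 1)" unfolding set_map by blast
  thus ?thesis using xs(1) q_obtain(1)[OF v] by (simp add: gens_def MI_simps)
qed

lemma proj_F: "z \<in> til.F n \<Longrightarrow> proj z \<in> sub.F n"
  by (rule til.F_into[OF proj_simps(1,3) _ sub.F_subspace]) (simp_all add: gens_proj)

lemma proj_id:
  assumes "z \<in> sub.F n"
  shows "proj z = z"
proof -
  have "linext (\<lambda>(xs, v). bas (map (ptr I) xs, q v)) z = linext bas z"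
  proof (rule linext_cong)
    fix b assume "b \<in> supp z"
    hence b: "b \<in> gens x UI MI n" using assms by (auto simp: free_space_def)
    obtain xs v where bb: "b = (xs, v)" by (cases b)
    have "map (ptr I) xs = xs" using b bb ptr_g_supported by (intro map_idI) (auto simp: gens_def)
    moreover have "q v = v" using b bb by (intro q_id) (auto simp: gens_def MI_simps)
    ultimately show "(case b of (xs, v) \<Rightarrow> bas (map (ptr I) xs, q v)) = bas b" by (simp add: bb)
  qed
  thus ?thesis by (simp add: proj_def)
qed

lemma sub_zero_R:
  assumes "(xs, v) \<in> gens x UI MI n" "i < n" "xs ! i = 0"
  shows "bas (xs, v) \<in> sub.R n"
proof -
  have "bas (xs[i := gscale 0 0], v) - pscale 0 (bas (xs[i := 0], v)) \<in> sub.R n"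
    by (rule sub.R_upd_gscale[OF assms(1,2), of 0]) simp_all
  moreover have "xs[i := 0] = xs" using assms(3) list_update_id[of xs i] by simp
  ultimately show ?thesis by simp
qed

lemma ptr_deg: "X \<in> gt_hom x 0 \<union> gt_hom x 1 \<Longrightarrow> ptr I X \<noteq> 0 \<Longrightarrow> deg x (ptr I X) = deg x X"
proof -
  assume X: "X \<in> gt_hom x 0 \<union> gt_hom x 1" and ne: "ptr I X \<noteq> 0"
  have "X \<in> gt_hom x (deg x X)" by (rule in_hom_deg[OF X])
  from deg_eq[OF ptr_hom[OF this] deg_lt_2 ne] show ?thesis .
qed

text \<open>Only the exchange relation needs care, as its sign depends on degrees. Truncation
  preserves the degree of a factor unless it kills the factor, and in that case both terms are
  relations by themselves.\<close>

lemma proj_R: "r \<in> til.R n \<Longrightarrow> proj r \<in> sub.R n"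
proof -
  assume r: "r \<in> til.R n"
  have pH: "ptr I X \<in> sub.H p" if "X \<in> U" "X \<in> gt_hom x p" for X p
    using ptr_u_tilde[OF that(1), of I] ptr_hom[OF that(2), of I] unfolding sub.H_iff by blast
  show ?thesis
  proof (rule sub.span_into[OF proj_simps(1,3) _ sub.R_subspace r[unfolded wedge_rels_def]], safe)
    fix xs v i X Y p
    assume a: "(xs, v) \<in> gens x U M n" "i < n" "(p :: nat) < 2" "X \<in> U" "X \<in> gt_hom x p" "Y \<in> U" "Y \<in> gt_hom x p"
    show "proj (bas (xs[i := X + Y], v) - bas (xs[i := X], v) - bas (xs[i := Y], v)) \<in> sub.R n"
      unfolding proj_simps proj_bas map_update ptr_add
      by (rule sub.R_upd_add[OF gens_proj[OF a(1)] a(2,3) pH[OF a(4,5)] pH[OF a(6,7)]])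
  next
    fix xs v i X c p
    assume a: "(xs, v) \<in> gens x U M n" "i < n" "(p :: nat) < 2" "X \<in> U" "X \<in> gt_hom x p"
    show "proj (bas (xs[i := gscale c X], v) - pscale c (bas (xs[i := X], v))) \<in> sub.R n"
      unfolding proj_simps proj_bas map_update ptr_gscale
      by (rule sub.R_upd_gscale[OF gens_proj[OF a(1)] a(2,3) pH[OF a(4,5)]])
  next
    fix xs v w
    assume a: "(xs, v) \<in> gens x U M n" "(xs, w) \<in> gens x U M n"
    have c: "v \<in> carrier M" "w \<in> carrier M" using a til.gens_carrier by blast+
    show "proj (bas (xs, v \<oplus> w) - bas (xs, v) - bas (xs, w)) \<in> sub.R n"
      unfolding proj_simps proj_bas q_add[OF c]
      using sub.R_v_add[OF gens_proj[OF a(1)] gens_proj[OF a(2)]] unfolding MI_simps .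
  next
    fix xs v c
    assume a: "(xs, v) \<in> gens x U M n"
    show "proj (bas (xs, c \<odot> v) - pscale c (bas (xs, v))) \<in> sub.R n"
      unfolding proj_simps proj_bas q_smult[OF til.gens_carrier[OF a]]
      using sub.R_v_smult[OF gens_proj[OF a]] unfolding MI_simps .
  next
    fix xs v i
    assume a: "(xs, v) \<in> gens x U M n" "Suc i < n"
    let ?ys = "map (ptr I) xs"
    have len: "length xs = n" using a(1) by (simp add: gens_def)
    have g: "(?ys, q v) \<in> gens x UI MI n" by (rule gens_proj[OF a(1)])
    have nth: "?ys ! i = ptr I (xs ! i)" "?ys ! Suc i = ptr I (xs ! Suc i)" using a(2) len by simp_all
    have hom: "xs ! j \<in> gt_hom x 0 \<union> gt_hom x 1" if "j < n" for j
      using a(1) that len unfolding gens_def by (auto dest!: nth_mem[of j xs])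
    let ?zs = "?ys[i := ?ys ! Suc i, Suc i := ?ys ! i]"
    have gz: "(?zs, q v) \<in> gens x UI MI n"
      using sub.gens_update[OF sub.gens_update[OF g sub.gens_nth[OF g a(2)] deg_lt_2] sub.gens_nth[OF g] deg_lt_2] a(2) by simp
    have e: "proj (bas (xs, v) + pscale c (bas (xs[i := xs ! Suc i, Suc i := xs ! i], v))) =
        bas (?ys, q v) + pscale c (bas (?zs, q v))" for c
      unfolding proj_simps proj_bas map_update nth ..
    show "proj (bas (xs, v) + pscale ((- 1) ^ (deg x (xs ! i) * deg x (xs ! Suc i)))
        (bas (xs[i := xs ! Suc i, Suc i := xs ! i], v))) \<in> sub.R n"
    proof (cases "ptr I (xs ! i) = 0 \<or> ptr I (xs ! Suc i) = 0")
      case False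
      hence "deg x (?ys ! i) = deg x (xs ! i)" "deg x (?ys ! Suc i) = deg x (xs ! Suc i)"
        unfolding nth using ptr_deg[OF hom] a(2) by simp_all
      thus ?thesis unfolding e using sub.R_swap[OF g a(2)] by simp
    next
      case True
      have "bas (?ys, q v) \<in> sub.R n"
        using True sub_zero_R[OF g, of i] sub_zero_R[OF g, of "Suc i"] a(2) nth by fastforce
      moreover have "bas (?zs, q v) \<in> sub.R n"
        using True sub_zero_R[OF gz, of i] sub_zero_R[OF gz, of "Suc i"] a(2) nth len by fastforce
      ultimately show ?thesis unfolding e
        by (intro pv.subspace_add[OF sub.R_subspace] pv.subspace_scale[OF sub.R_subspace])
    qed
  qed
qed

lemma R_sub: "sub.R n \<subseteq> til.R n"
proof -
  have ui: "X \<in> U" if "X \<in> UI" for X using that by blast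
  show ?thesis
    unfolding wedge_rels_def[of x UI MI n]
  proof (rule pv.span_minimal[OF _ til.R_subspace], safe)
    fix xs v i X Y p
    assume a: "(xs, v) \<in> gens x UI MI n" "i < n" "(p :: nat) < 2" "X \<in> U" "X \<in> gt_hom x p" "Y \<in> U" "Y \<in> gt_hom x p"
    show "bas (xs[i := X + Y], v) - bas (xs[i := X], v) - bas (xs[i := Y], v) \<in> til.R n"
      by (rule til.R_upd_add[OF subsetD[OF gens_sub a(1)] a(2,3)]) (use a(4-7) in \<open>simp_all add: til.H_iff\<close>)
  next
    fix xs v i X c p
    assume a: "(xs, v) \<in> gens x UI MI n" "i < n" "(p :: nat) < 2" "X \<in> U" "X \<in> gt_hom x p"
    show "bas (xs[i := gscale c X], v) - pscale c (bas (xs[i := X], v)) \<in> til.R n"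
      by (rule til.R_upd_gscale[OF subsetD[OF gens_sub a(1)] a(2,3)]) (use a(4,5) in \<open>simp_all add: til.H_iff\<close>)
  next
    fix xs v w assume a: "(xs, v) \<in> gens x UI MI n" "(xs, w) \<in> gens x UI MI n"
    show "bas (xs, v \<oplus>\<^bsub>MI\<^esub> w) - bas (xs, v) - bas (xs, w) \<in> til.R n"
      unfolding MI_simps by (rule til.R_v_add[OF subsetD[OF gens_sub a(1)] subsetD[OF gens_sub a(2)]])
  next
    fix xs v c assume a: "(xs, v) \<in> gens x UI MI n"
    show "bas (xs, c \<odot>\<^bsub>MI\<^esub> v) - pscale c (bas (xs, v)) \<in> til.R n"
      unfolding MI_simps by (rule til.R_v_smult[OF subsetD[OF gens_sub a]])
  next
    fix xs v i assume a: "(xs, v) \<in> gens x UI MI n" "Suc i < n"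
    show "bas (xs, v) + pscale ((- 1) ^ (deg x (xs ! i) * deg x (xs ! Suc i)))
        (bas (xs[i := xs ! Suc i, Suc i := xs ! i], v)) \<in> til.R n"
      by (rule til.R_swap[OF subsetD[OF gens_sub a(1)] a(2)])
  qed
qed


subsection \<open>Weights of chains\<close>

text \<open>In contrast to the set of roots of the nilradical this set is closed under addition, so
  a bracket of weight vectors, even a vanishing one, keeps a weight in it.\<close>

definition Kwt :: "weight set"
  where "Kwt = {\<alpha> \<in> hdual (I_tilde m). \<forall>r\<in>halfN. \<exists>k::nat. coef (fst \<alpha>) r = of_nat k}"

lemma Kwt_hdual: "\<alpha> \<in> Kwt \<Longrightarrow> \<alpha> \<in> hdual (I_tilde m)"
  by (simp add: Kwt_def)

lemma Kwt_add: "\<alpha> \<in> Kwt \<Longrightarrow> \<beta> \<in> Kwt \<Longrightarrow> \<alpha> + \<beta> \<in> Kwt"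
  unfolding Kwt_def mem_Collect_eq
proof (elim conjE, intro conjI ballI)
  fix r assume a: "\<forall>r\<in>halfN. \<exists>k::nat. coef (fst \<alpha>) r = of_nat k" "\<forall>r\<in>halfN. \<exists>k::nat. coef (fst \<beta>) r = of_nat k" "r \<in> halfN"
  then obtain k l :: nat where "coef (fst \<alpha>) r = of_nat k" "coef (fst \<beta>) r = of_nat l" by blast
  hence "coef (fst (\<alpha> + \<beta>)) r = of_nat (k + l)" by (simp add: lookup_add)
  thus "\<exists>k::nat. coef (fst (\<alpha> + \<beta>)) r = of_nat k" ..
qed (rule hdual_add)

lemma u_roots_Kwt: "\<alpha> \<in> u_roots x m Y0 \<Longrightarrow> \<alpha> \<in> Kwt"
  unfolding Kwt_def mem_Collect_eq
proof (intro conjI ballI)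
  assume a: "\<alpha> \<in> u_roots x m Y0"
  show "\<alpha> \<in> hdual (I_tilde m)" by (rule roots_hdual[OF u_roots_roots[OF a]])
  fix r assume r: "r \<in> halfN"
  obtain k :: int where k: "coef (fst \<alpha>) r = of_int k"
    using roots_coef_int(1)[OF u_roots_roots[OF a], of r] by (auto simp: Ints_def)
  have "k \<ge> 0" using u_roots_nonneg[OF a r] unfolding k by simp
  thus "\<exists>k::nat. coef (fst \<alpha>) r = of_nat k" unfolding k by (intro exI[of _ "nat k"]) simp
qed

lemma poly_wt_Kwt: "\<alpha> \<in> Kwt \<Longrightarrow> poly_wt \<alpha>"
  unfolding Kwt_def poly_wt_def mem_Collect_eq by (elim conjE, intro ballI) (metis Re_complex_of_real of_real_of_nat_eq of_nat_0_le_iff)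

lemma poly_wt_add: "poly_wt \<alpha> \<Longrightarrow> poly_wt \<beta> \<Longrightarrow> poly_wt (\<alpha> + \<beta>)"
  unfolding poly_wt_def by (simp add: lookup_add)

text \<open>There is no cancellation between nonnegative coefficients.\<close>

lemma hdual_I_split:
  assumes "\<alpha> \<in> Kwt" "\<gamma> \<in> hdual (I_tilde m)" "poly_wt \<gamma>" "\<alpha> + \<gamma> \<in> hdual I"
  shows "\<alpha> \<in> hdual I" "\<gamma> \<in> hdual I"
proof -
  have "coef (fst \<alpha>) r = 0 \<and> coef (fst \<gamma>) r = 0" if r: "r \<notin> I" for r
  proof (cases "r \<in> I_tilde m")
    case False
    thus ?thesis using assms(2) Kwt_hdual[OF assms(1)] by (auto simp: hdual_def in_keys_iff subset_iff)
  next
    case True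
    hence h: "r \<in> halfN" using r I(1) by (auto simp: I_tilde_def)
    obtain k :: nat where k: "coef (fst \<alpha>) r = of_nat k" using assms(1) h unfolding Kwt_def by blast
    have "coef (fst (\<alpha> + \<gamma>)) r = 0" using assms(4) r by (auto simp: hdual_def in_keys_iff subset_iff)
    hence e: "coef (fst \<gamma>) r = - of_nat k" using k by (simp add: lookup_add eq_neg_iff_add_eq_0 add.commute)
    have "0 \<le> Re (coef (fst \<gamma>) r)" using assms(3) h unfolding poly_wt_def by blast
    hence "k = 0" unfolding e by simp
    thus ?thesis using e k by simp
  qed
  thus "\<alpha> \<in> hdual I" "\<gamma> \<in> hdual I" by (auto simp: hdual_def in_keys_iff)
qed

text \<open>Symbols built from weight vectors, together with their total weight. The weight is
  recorded, not computed: a zero factor may carry any weight in \<open>Kwt\<close>, which is what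
  brackets require.\<close>

inductive wsym :: "nat \<Rightarrow> weight \<Rightarrow> gt list \<Rightarrow> 'v \<Rightarrow> bool" where
  Nil: "\<gamma> \<in> hdual (I_tilde m) \<Longrightarrow> poly_wt \<gamma> \<Longrightarrow> v \<in> ws \<gamma> \<Longrightarrow> wsym 0 \<gamma> [] v"
| Cons: "\<alpha> \<in> Kwt \<Longrightarrow> Y \<in> U \<Longrightarrow> Y \<in> root_space x m \<alpha> \<Longrightarrow> Y \<in> gt_hom x p \<Longrightarrow> p < 2 \<Longrightarrow> wsym n \<gamma> xs v \<Longrightarrow>
    wsym (Suc n) (\<alpha> + \<gamma>) (Y # xs) v"

definition wsp :: "nat \<Rightarrow> weight \<Rightarrow> (gt list \<times> 'v \<Rightarrow>\<^sub>0 complex) set"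
  where "wsp n \<gamma> = pv.span {bas (xs, v) | xs v. wsym n \<gamma> xs v}"

lemma wsym_wt: "wsym n \<gamma> xs v \<Longrightarrow> \<gamma> \<in> hdual (I_tilde m) \<and> poly_wt \<gamma>"
  by (induction rule: wsym.induct) (blast intro: hdual_add Kwt_hdual poly_wt_add poly_wt_Kwt)+

lemma wsym_gens: "wsym n \<gamma> xs v \<Longrightarrow> (xs, v) \<in> gens x U M n"
  by (induction rule: wsym.induct) (auto simp: ws_carrier til.H_iff intro!: til.gens_ConsI)

lemma wsp_subspace: "pv.subspace (wsp n \<gamma>)"
  by (simp add: wsp_def)

lemma wsp_base: "wsym n \<gamma> xs v \<Longrightarrow> bas (xs, v) \<in> wsp n \<gamma>"
  unfolding wsp_def by (rule pv.span_base) blast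

lemma wsp_into:
  assumes "\<And>z w. f (z + w) = f z + f w" "\<And>c z. f (pscale c z) = pscale c (f z)"
    and "\<And>xs v. wsym n \<gamma> xs v \<Longrightarrow> f (bas (xs, v)) \<in> W" "pv.subspace W" "z \<in> wsp n \<gamma>"
  shows "f z \<in> W"
  by (rule til.span_into[OF assms(1,2) _ assms(4) assms(5)[unfolded wsp_def]]) (use assms(3) in blast)

lemma wsp_F: "z \<in> wsp n \<gamma> \<Longrightarrow> z \<in> til.F n"
  by (rule wsp_into[of "\<lambda>z. z", OF _ _ _ til.F_subspace]) (auto simp: wsym_gens)

lemma cns_wsp:
  assumes "\<alpha> \<in> Kwt" "Y \<in> U" "Y \<in> root_space x m \<alpha>" "Y \<in> gt_hom x p" "p < 2" "z \<in> wsp n \<gamma>"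
  shows "cns Y z \<in> wsp (Suc n) (\<alpha> + \<gamma>)"
  by (rule wsp_into[OF cns_simps(1,4) _ wsp_subspace assms(6)]) (simp add: wsp_base wsym.Cons[OF assms(1-5)])

lemma sB_wsp:
  assumes "wsym n \<gamma> xs v"
    and X: "\<alpha> \<in> Kwt" "X \<in> U" "X \<in> root_space x m \<alpha>" "X \<in> gt_hom x p" "p < 2"
  shows "sB x M p X xs v \<in> wsp n (\<alpha> + \<gamma>)"
  using assms(1)
proof (induction rule: wsym.induct)
  case (Nil \<gamma> v)
  have "act M X v \<in> ws (\<gamma> + \<alpha>)" by (rule ws_act_hom[OF X(3-5) Nil(3)])
  hence "wsym 0 (\<alpha> + \<gamma>) [] (act M X v)"
    using Nil hdual_add[OF Kwt_hdual[OF X(1)] Nil(1)] poly_wt_add[OF poly_wt_Kwt[OF X(1)] Nil(2)]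
    by (intro wsym.Nil) (simp_all only: add.commute)
  thus ?case by (simp add: wsp_base)
next
  case (Cons \<beta> Y r n \<gamma> xs v)
  have "wsym (Suc n) ((\<alpha> + \<beta>) + \<gamma>) (bracket x X Y # xs) v"
  proof (rule wsym.Cons[OF Kwt_add[OF X(1) Cons(1)] _ _ bracket_in_hom[OF X(4) Cons(4) X(5) Cons(5)] _ Cons(6)])
    show "bracket x X Y \<in> U" by (rule u_tilde_bracket[OF Y0 X(2) Cons(2)])
    show "bracket x X Y \<in> root_space x m (\<alpha> + \<beta>)"
      by (rule root_space_bracket[OF Kwt_hdual[OF X(1)] Kwt_hdual[OF Cons(1)] X(3) Cons(3)])
  qed simp
  hence 1: "bas (bracket x X Y # xs, v) \<in> wsp (Suc n) (\<alpha> + (\<beta> + \<gamma>))" by (simp add: wsp_base add.assoc)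
  have "cns Y (sB x M p X xs v) \<in> wsp (Suc n) (\<beta> + (\<alpha> + \<gamma>))" by (rule cns_wsp[OF Cons(1-5) Cons.IH])
  hence 2: "cns Y (sB x M p X xs v) \<in> wsp (Suc n) (\<alpha> + (\<beta> + \<gamma>))" by (simp only: add.left_commute)
  show ?case unfolding sB.simps by (intro pv.subspace_add[OF wsp_subspace] pv.subspace_scale[OF wsp_subspace] 1 2)
qed

lemma sD_wsp: "wsym n \<gamma> xs v \<Longrightarrow> sD x M xs v \<in> wsp (n - 1) \<gamma>"
proof (induction rule: wsym.induct)
  case (Nil \<gamma> v)
  show ?case by (simp add: pv.subspace_0[OF wsp_subspace])
next
  case (Cons \<beta> Y r n \<gamma> xs v)
  have "Y \<in> gt_hom x 0 \<union> gt_hom x 1" using Cons(4) lt_2_cases[OF Cons(5)] by auto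
  from sB_wsp[OF Cons(6) Cons(1-3) in_hom_deg[OF this] deg_lt_2]
  have 1: "sB x M (deg x Y) Y xs v \<in> wsp n (\<beta> + \<gamma>)" .
  have 2: "cns Y (sD x M xs v) \<in> wsp n (\<beta> + \<gamma>)"
  proof (cases n)
    case 0
    hence "xs = []" using wsym_gens[OF Cons(6)] by (simp add: gens_def)
    thus ?thesis by (simp add: pv.subspace_0[OF wsp_subspace] cns_simps)
  next
    case (Suc k)
    thus ?thesis using cns_wsp[OF Cons(1-5) Cons.IH] by simp
  qed
  have "- sB x M (deg x Y) Y xs v - cns Y (sD x M xs v) \<in> wsp n (\<beta> + \<gamma>)"
    by (intro pv.subspace_diff[OF wsp_subspace] pv.subspace_neg[OF wsp_subspace] 1 2)
  thus ?case by simp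
qed

lemma DD_wsp: "z \<in> wsp n \<gamma> \<Longrightarrow> DD x M z \<in> wsp (n - 1) \<gamma>"
  by (rule wsp_into[OF DD_simps(1,4) _ wsp_subspace]) (simp_all add: sD_wsp[simplified])

text \<open>A Cartan element multiplies each factor by the value of its weight. Pulling these
  scalars out of the factors, and summing them to the total weight, is possible only modulo the
  multilinearity relations.\<close>

lemma sB_hop:
  assumes "wsym n \<gamma> xs v" "h \<in> hidx m"
  shows "sB x M 0 (hop h) xs v - pscale (hval \<gamma> h) (bas (xs, v)) \<in> til.R n"
  using assms(1)
proof (induction rule: wsym.induct)
  case (Nil \<gamma> v)
  have "act M (hop h) v = hval \<gamma> h \<odot> v" using Nil(3) assms(2) ws_iff by blast
  thus ?case using til.R_v_smult[of "[]" v 0 "hval \<gamma> h"] ws_carrier[OF Nil(3)] by (simp del: pscale_bas)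
next
  case (Cons \<beta> Y p n \<gamma> xs v)
  have YH: "Y \<in> til.H p" using Cons(2,4) by (simp add: til.H_iff)
  have g: "bas (xs, v) \<in> til.F n" using wsym_gens[OF Cons(6)] by simp
  have 1: "cns (gscale (hval \<beta> h) Y) (bas (xs, v)) - pscale (hval \<beta> h) (cns Y (bas (xs, v))) \<in> til.R (Suc n)"
    by (rule til.cns_gscale_R[OF YH Cons(5) g])
  have 2: "cns Y (sB x M 0 (hop h) xs v - pscale (hval \<gamma> h) (bas (xs, v))) \<in> til.R (Suc n)"
    by (rule til.cns_R[OF YH Cons(5) Cons.IH])
  have e: "sB x M 0 (hop h) (Y # xs) v - pscale (hval (\<beta> + \<gamma>) h) (bas (Y # xs, v)) =
      (cns (gscale (hval \<beta> h) Y) (bas (xs, v)) - pscale (hval \<beta> h) (cns Y (bas (xs, v))))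
      + cns Y (sB x M 0 (hop h) xs v - pscale (hval \<gamma> h) (bas (xs, v)))"
    unfolding cns_simps sB.simps bracket_hop[OF Cons(3) assms(2)] hval_add
    by (simp add: pv.scale_left_distrib del: pscale_bas)
  show ?case unfolding e by (rule pv.subspace_add[OF til.R_subspace 1 2])
qed

lemma hop_L: "h \<in> hidx m \<Longrightarrow> hop h \<in> levi_tilde x m Y0"
  unfolding levi_eq by (rule gv.span_base) (auto simp: hidx_def)

lemma AA_hop:
  assumes "z \<in> wsp n \<gamma>" "h \<in> hidx m"
  shows "AA x M (hop h) z - pscale (hval \<gamma> h) z \<in> til.R n"
proof -
  have "BB x M 0 (hop h) z - pscale (hval \<gamma> h) z \<in> til.R n"
  proof (rule wsp_into[of "\<lambda>z. BB x M 0 (hop h) z - pscale (hval \<gamma> h) z", OF _ _ _ til.R_subspace assms(1)])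
    show "BB x M 0 (hop h) (bas (xs, v)) - pscale (hval \<gamma> h) (bas (xs, v)) \<in> til.R n" if "wsym n \<gamma> xs v" for xs v
      using sB_hop[OF that assms(2)] by (simp del: pscale_bas)
  qed (simp_all add: BB_simps pv.scale_right_distrib pv.scale_right_diff_distrib mult.commute)
  \<comment> \<open>The odd component of a Cartan element is 0, but the action of 0 on symbols gives
    symbols with a zero entry; these are relations and not literally 0.\<close>
  moreover have "BB x M (Suc 0) 0 z \<in> til.R n" by (rule til.BB_0_R[OF _ wsp_F[OF assms(1)]]) simp
  moreover have "AA x M (hop h) z = BB x M 0 (hop h) z + BB x M (Suc 0) 0 z"
    unfolding AA_def sum_lt_2 gt_comp_of_hom[OF hop_hom] by simp
  ultimately have "(BB x M 0 (hop h) z - pscale (hval \<gamma> h) z) + BB x M (Suc 0) 0 z \<in> til.R n"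
    and e: "AA x M (hop h) z = BB x M 0 (hop h) z + BB x M (Suc 0) 0 z"
    by (blast intro: pv.subspace_add[OF til.R_subspace])+
  thus ?thesis unfolding e by (simp only: diff_add_eq)
qed

definition "wall n = pv.span (\<Union>\<gamma>\<in>hdual (I_tilde m). wsp n \<gamma>)"

lemma wall_base: "wsym n \<gamma> xs v \<Longrightarrow> bas (xs, v) \<in> wall n"
  unfolding wall_def by (rule pv.span_base, rule UN_I[OF conjunct1[OF wsym_wt] wsp_base])

lemma wall_into:
  assumes "\<And>z w. f (z + w) = f z + f w" "\<And>c z. f (pscale c z) = pscale c (f z)"
    and "\<And>\<gamma> xs v. wsym n \<gamma> xs v \<Longrightarrow> f (bas (xs, v)) \<in> W" "pv.subspace W" "z \<in> wall n"
  shows "f z \<in> W"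
proof (rule til.span_into[OF assms(1,2) _ assms(4) assms(5)[unfolded wall_def]])
  fix a assume "a \<in> (\<Union>\<gamma>\<in>hdual (I_tilde m). wsp n \<gamma>)"
  then obtain \<gamma> where a: "a \<in> wsp n \<gamma>" by blast
  show "f a \<in> W" by (rule wsp_into[OF assms(1,2) _ assms(4) a]) (rule assms(3))
qed

definition "wallR n = {y + r | y r. y \<in> wall n \<and> r \<in> til.R n}"

lemma wallR_subspace: "pv.subspace (wallR n)"
  unfolding wallR_def by (rule pv.subspace_sums) (simp_all add: wall_def til.R_subspace)

lemma wallR_wall: "y \<in> wall n \<Longrightarrow> y \<in> wallR n"
  unfolding wallR_def mem_Collect_eq by (intro exI[of _ y] exI[of _ 0]) (simp add: pv.subspace_0[OF til.R_subspace])

lemma wallR_R: "r \<in> til.R n \<Longrightarrow> r \<in> wallR n"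
  unfolding wallR_def mem_Collect_eq by (intro exI[of _ 0] exI[of _ r]) (simp add: wall_def pv.span_zero)

lemma wallR_mem: "a - b \<in> til.R n \<Longrightarrow> b \<in> wallR n \<Longrightarrow> a \<in> wallR n"
  using pv.subspace_add[OF wallR_subspace wallR_R, of "a - b" n b] by simp

lemma cns_wallR:
  assumes Y: "Y \<in> U" "Y \<in> gt_hom x p" "p < 2" and s: "wsym n \<gamma> xs v"
  shows "cns Y (bas (xs, v)) \<in> wallR (Suc n)"
proof -
  have g: "bas (xs, v) \<in> til.F n" using wsym_gens[OF s] by simp
  have "Y \<in> til.H p \<and> cns Y (bas (xs, v)) \<in> wallR (Suc n)"
    using u_tilde_hom_span[OF Y]
  proof (induction rule: gv.span_induct_alt)
    case base
    show ?case using wallR_R[OF til.cns_0_R[OF g]] til.H_0 by blast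
  next
    case (step c X Z)
    then obtain \<alpha> where a: "\<alpha> \<in> u_roots x m Y0" "X \<in> root_space x m \<alpha>" "X \<in> gt_hom x p" by blast
    have XU: "X \<in> U" unfolding u_tilde_minus_eq using a by (intro gv.span_base) blast
    have XH: "X \<in> til.H p" and ZH: "Z \<in> til.H p" and Z: "cns Z (bas (xs, v)) \<in> wallR (Suc n)"
      using XU a(3) step(2) til.H_iff by blast+
    have "wsym (Suc n) (\<alpha> + \<gamma>) (X # xs) v" by (rule wsym.Cons[OF u_roots_Kwt[OF a(1)] XU a(2,3) Y(3) s])
    hence X: "cns X (bas (xs, v)) \<in> wallR (Suc n)" using wallR_wall[OF wall_base] by simp
    have cX: "cns (gscale c X) (bas (xs, v)) \<in> wallR (Suc n)"
      by (rule wallR_mem[OF til.cns_gscale_R[OF XH Y(3) g] pv.subspace_scale[OF wallR_subspace X]])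
    have "cns (gscale c X + Z) (bas (xs, v)) - (cns (gscale c X) (bas (xs, v)) + cns Z (bas (xs, v))) \<in> til.R (Suc n)"
      using til.cns_add_R[OF til.H_gscale[OF XH] ZH Y(3) g] by (simp only: diff_diff_eq)
    hence "cns (gscale c X + Z) (bas (xs, v)) \<in> wallR (Suc n)"
      by (rule wallR_mem) (rule pv.subspace_add[OF wallR_subspace cX Z])
    thus ?case using til.H_add[OF til.H_gscale[OF XH] ZH] by blast
  qed
  thus ?thesis by blast
qed

text \<open>The module element is a sum of weight vectors and each homogeneous factor a combination
  of root vectors; expanding a symbol accordingly, from the last entry to the first, uses
  multilinearity, hence the relations.\<close>

lemma F_wallR: "z \<in> til.F n \<Longrightarrow> z \<in> wallR n"
proof -
  have sym: "bas (xs, v) \<in> wallR n" if "(xs, v) \<in> gens x U M n" for xs v n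
    using that
  proof (induction xs arbitrary: n)
    case Nil
    hence n: "n = 0" and "v \<in> carrier M" by auto
    hence "v \<in> LS (\<Union>\<gamma>\<in>hdual (I_tilde m). ws \<gamma>)" using carrier_LS by simp
    hence "v \<in> carrier M \<and> bas ([], v) \<in> wallR 0" using W_carrier
    proof (induction rule: LS_induct)
      case zero
      show ?case using wallR_R[OF til.R_v_0[of "[]" "\<zero>" 0]] by simp
    next
      case (add a w)
      then obtain \<gamma> where a: "\<gamma> \<in> hdual (I_tilde m)" "a \<in> ws \<gamma>" by blast
      have ac: "a \<in> carrier M" by (rule ws_carrier[OF a(2)])
      have A: "bas ([], a) \<in> wallR 0"
      proof (cases "a = \<zero>")
        case True
        thus ?thesis using wallR_R[OF til.R_v_0[of "[]" "\<zero>" 0]] by simp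
      next
        case False
        thus ?thesis using wallR_wall[OF wall_base[OF wsym.Nil[OF a(1) ws_poly[OF a False] a(2)]]] by simp
      qed
      have "bas ([], a \<oplus> w) - (bas ([], a) + bas ([], w)) \<in> til.R 0"
        using til.R_v_add[of "[]" a 0 w] ac add(3) by (simp add: diff_diff_eq)
      hence "bas ([], a \<oplus> w) \<in> wallR 0"
        by (rule wallR_mem) (rule pv.subspace_add[OF wallR_subspace A], use add(4) in blast)
      thus ?case using ac add(3) by simp
    qed
    thus ?case using n by simp
  next
    case (Cons Y ys)
    then obtain k p where k: "n = Suc k" "p < 2" "Y \<in> til.H p" "(ys, v) \<in> gens x U M k"
      unfolding til.gens_Cons by blast
    obtain y r where yr: "bas (ys, v) = y + r" "y \<in> wall k" "r \<in> til.R k" using Cons.IH[OF k(4)] unfolding wallR_def by blast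
    have YU: "Y \<in> U" "Y \<in> gt_hom x p" using k(3) til.H_iff by blast+
    have "cns Y y \<in> wallR (Suc k)"
      by (rule wall_into[OF cns_simps(1,4) cns_wallR[OF YU k(2)] wallR_subspace yr(2)])
    moreover have "cns Y r \<in> wallR (Suc k)" by (rule wallR_R[OF til.cns_R[OF k(3,2) yr(3)]])
    moreover have "bas (Y # ys, v) = cns Y y + cns Y r" using arg_cong[OF yr(1), of "cns Y"] by (simp add: cns_simps)
    ultimately show ?case using k(1) pv.subspace_add[OF wallR_subspace] by simp
  qed
  assume "z \<in> til.F n"
  thus ?thesis by (rule til.F_into[of "\<lambda>z. z", OF _ _ sym wallR_subspace, rotated -1]) auto
qed

lemma wall_decomp:
  assumes "z \<in> wall n"
  shows "\<exists>\<Gamma> f. finite \<Gamma> \<and> \<Gamma> \<subseteq> hdual (I_tilde m) \<and> (\<forall>\<gamma>. f \<gamma> \<in> wsp n \<gamma>) \<and> z = sum f \<Gamma>"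
proof -
  \<comment> \<open>The induction also carries that \<open>f\<close> vanishes outside \<Gamma>, so
    that a new summand can be added whether or not its weight has occurred before.\<close>
  have "\<exists>\<Gamma> f. finite \<Gamma> \<and> \<Gamma> \<subseteq> hdual (I_tilde m) \<and> (\<forall>\<gamma>. f \<gamma> \<in> wsp n \<gamma>) \<and> (\<forall>\<gamma>. \<gamma> \<notin> \<Gamma> \<longrightarrow> f \<gamma> = 0) \<and> z = sum f \<Gamma>"
    using assms unfolding wall_def
  proof (induction rule: pv.span_induct_alt)
    case base
    show ?case by (rule exI[of _ "{}"], rule exI[of _ "\<lambda>_. 0"]) (simp add: pv.subspace_0[OF wsp_subspace])
  next
    case (step c y z)
    obtain \<Gamma> f where f: "finite \<Gamma>" "\<Gamma> \<subseteq> hdual (I_tilde m)" "\<forall>\<gamma>. f \<gamma> \<in> wsp n \<gamma>" "\<forall>\<gamma>. \<gamma> \<notin> \<Gamma> \<longrightarrow> f \<gamma> = 0" "z = sum f \<Gamma>"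
      using step(2) by (elim exE conjE)
    obtain \<delta> where d: "\<delta> \<in> hdual (I_tilde m)" "y \<in> wsp n \<delta>" using step(1) by blast
    define g where "g = (\<lambda>\<gamma>. f \<gamma> + (if \<gamma> = \<delta> then pscale c y else 0))"
    have "sum g (insert \<delta> \<Gamma>) = sum f (insert \<delta> \<Gamma>) + pscale c y" unfolding g_def using f(1) by (simp add: sum.distrib)
    also have "sum f (insert \<delta> \<Gamma>) = sum f \<Gamma>" using f(1,4) by (intro sum.mono_neutral_right) auto
    finally have "pscale c y + z = sum g (insert \<delta> \<Gamma>)" using f(5) by (simp add: add.commute)
    moreover have "\<forall>\<gamma>. g \<gamma> \<in> wsp n \<gamma>"
    proof
      fix \<gamma>
      have "f \<delta> + pscale c y \<in> wsp n \<delta>" using f(3) by (intro pv.subspace_add[OF wsp_subspace] pv.subspace_scale[OF wsp_subspace d(2)]) blast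
      moreover have "f \<gamma> \<in> wsp n \<gamma>" using f(3) by blast
      ultimately show "g \<gamma> \<in> wsp n \<gamma>" unfolding g_def by (cases "\<gamma> = \<delta>") simp_all
    qed
    moreover have "\<forall>\<gamma>. \<gamma> \<notin> insert \<delta> \<Gamma> \<longrightarrow> g \<gamma> = 0"
    proof (intro allI impI)
      fix \<gamma> assume "\<gamma> \<notin> insert \<delta> \<Gamma>"
      hence "\<gamma> \<noteq> \<delta>" "f \<gamma> = 0" using spec[OF f(4), of \<gamma>] by blast+
      thus "g \<gamma> = 0" unfolding g_def by simp
    qed
    moreover have "finite (insert \<delta> \<Gamma>)" "insert \<delta> \<Gamma> \<subseteq> hdual (I_tilde m)" using f(1,2) d(1) by simp_all
    ultimately show ?case by (intro exI[of _ "insert \<delta> \<Gamma>"] exI[of _ g] conjI)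
  qed
  thus ?thesis by (elim exE conjE, intro exI conjI)
qed

lemma wsym_supported:
  "wsym n \<gamma> xs v \<Longrightarrow> \<gamma> \<in> hdual I \<Longrightarrow> (xs, v) \<in> gens x UI MI n"
proof (induction rule: wsym.induct)
  case (Nil \<gamma> v)
  thus ?case using LS_base[OF W_carrier, of v "hdual I"] by (auto simp: MI_simps)
next
  case (Cons \<alpha> Y p n \<gamma> xs v)
  note w = wsym_wt[OF Cons(6)]
  have h: "\<alpha> \<in> hdual I" "\<gamma> \<in> hdual I" by (rule hdual_I_split[OF Cons(1) _ _ Cons.prems]; use w in blast)+
  \<comment> \<open>A zero factor has to be treated separately, because its recorded weight need not
    be a root.\<close>
  have "Y \<in> gI"
  proof (cases "Y = 0")
    case True
    thus ?thesis using gv.subspace_0[OF g_supported_subspace] by simp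
  next
    case False
    thus ?thesis using root_space_supported(1)[OF u_tilde_root_space[OF Cons(2,3) Kwt_hdual[OF Cons(1)]] Cons(3) h(1)] by blast
  qed
  hence "Y \<in> sub.H p" using Cons(2,4) sub.H_iff by blast
  thus ?case by (rule sub.gens_ConsI[OF _ Cons(5) Cons.IH[OF h(2)]])
qed

text \<open>If the total weight is not supported on \<open>I\<close>, then neither is the weight of
  some factor or of the module element. That entry is projected to zero, and a symbol with a zero
  entry is a relation.\<close>

lemma wsym_killed:
  "wsym n \<gamma> xs v \<Longrightarrow> \<gamma> \<notin> hdual I \<Longrightarrow> bas (map (ptr I) xs, q v) \<in> sub.R n"
proof (induction rule: wsym.induct)
  case (Nil \<gamma> v)
  have "v \<in> LS WC" using Nil by (intro LS_base[OF W_carrier]) blast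
  hence "q v = \<zero>\<^bsub>MI\<^esub>" by (simp add: q_0 MI_simps)
  thus ?case using sub.R_v_0[of "[]" "\<zero>\<^bsub>MI\<^esub>" 0] LS_zero by (simp add: MI_simps)
next
  case (Cons \<alpha> Y p n \<gamma> xs v)
  have g: "(map (ptr I) xs, q v) \<in> gens x UI MI n" by (rule gens_proj[OF wsym_gens[OF Cons(6)]])
  have pY: "ptr I Y \<in> sub.H p" using ptr_u_tilde[OF Cons(2), of I] ptr_hom[OF Cons(4), of I] sub.H_iff by blast
  show ?case
  proof (cases "\<alpha> \<in> hdual I")
    case True
    hence "\<gamma> \<notin> hdual I" using Cons.prems hdual_add by blast
    hence "cns (ptr I Y) (bas (map (ptr I) xs, q v)) \<in> sub.R (Suc n)" by (intro sub.cns_R[OF pY Cons(5)] Cons.IH)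
    thus ?thesis by simp
  next
    case False
    have "ptr I Y = 0"
    proof (cases "Y = 0")
      case True
      thus ?thesis by (simp add: ptr_def prod_eq_iff)
    next
      case ne: False
      show ?thesis
        by (rule root_space_not_supported[OF u_tilde_root_space[OF Cons(2,3) Kwt_hdual[OF Cons(1)] ne] Cons(3) False])
    qed
    moreover have "cns 0 (bas (map (ptr I) xs, q v)) \<in> sub.R (Suc n)" by (rule sub.cns_0_R) (simp add: g)
    ultimately show ?thesis by simp
  qed
qed

lemma wsp_sub_F: "z \<in> wsp n \<gamma> \<Longrightarrow> \<gamma> \<in> hdual I \<Longrightarrow> z \<in> sub.F n"
  by (rule wsp_into[of "\<lambda>z. z", OF _ _ _ sub.F_subspace]) (auto simp: wsym_supported)

lemma wsp_proj_R: "z \<in> wsp n \<gamma> \<Longrightarrow> \<gamma> \<notin> hdual I \<Longrightarrow> proj z \<in> sub.R n"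
  by (rule wsp_into[OF proj_simps(1,3) _ sub.R_subspace]) (simp_all add: wsym_killed)

lemma proj_DD:
  assumes "z \<in> til.F n"
  shows "proj (DD x M z) - DD x M (proj z) \<in> sub.R (n - 1)"
proof -
  \<comment> \<open>Boundary and projection both respect relations, so the remainder
    \<open>r\<close> is harmless and only weight chains have to be examined.\<close>
  obtain y r where yr: "z = y + r" "y \<in> wall n" "r \<in> til.R n" using F_wallR[OF assms] unfolding wallR_def by blast
  let ?f = "\<lambda>z. proj (DD x M z) - DD x M (proj z)"
  have subR: "DD x M s \<in> sub.R (n - 1)" if "s \<in> sub.R n" for s using sub.DD_R[OF that] by (simp add: DD_MI)
  have "?f r \<in> sub.R (n - 1)"
    by (intro pv.subspace_diff[OF sub.R_subspace] proj_R til.DD_R subR yr(3))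
  moreover have "?f y \<in> sub.R (n - 1)"
  proof (rule wall_into[of ?f, OF _ _ _ sub.R_subspace yr(2)])
    fix \<gamma> xs v assume s: "wsym n \<gamma> xs v"
    have w: "bas (xs, v) \<in> wsp n \<gamma>" by (rule wsp_base[OF s])
    show "?f (bas (xs, v)) \<in> sub.R (n - 1)"
    proof (cases "\<gamma> \<in> hdual I")
      case True
      have "proj (DD x M (bas (xs, v))) = DD x M (bas (xs, v))" by (rule proj_id[OF wsp_sub_F[OF DD_wsp[OF w] True]])
      moreover have "proj (bas (xs, v)) = bas (xs, v)" by (rule proj_id[OF wsp_sub_F[OF w True]])
      ultimately show ?thesis by (simp only: diff_self pv.subspace_0[OF sub.R_subspace])
    next
      case False
      show ?thesis
        by (intro pv.subspace_diff[OF sub.R_subspace] subR wsp_proj_R[OF DD_wsp[OF w] False] wsp_proj_R[OF w False])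
    qed
  qed (simp_all add: proj_simps DD_simps pv.scale_right_diff_distrib)
  ultimately have "?f r + ?f y \<in> sub.R (n - 1)" by (rule pv.subspace_add[OF sub.R_subspace])
  thus ?thesis unfolding yr(1) by (simp add: proj_simps DD_simps algebra_simps)
qed

subsection \<open>Comparison of the homology\<close>

lemma weight_independent:
  assumes V: "pv.subspace V" "til.R n \<subseteq> V" "\<And>h z. h \<in> hidx m \<Longrightarrow> z \<in> V \<Longrightarrow> AA x M (hop h) z \<in> V"
    and G: "finite \<Gamma>" "\<Gamma> \<subseteq> hdual (I_tilde m)" "\<tau> \<in> hdual (I_tilde m)" "\<tau> \<notin> \<Gamma>"
    and t: "\<And>h. h \<in> hidx m \<Longrightarrow> AA x M (hop h) t - pscale (hval \<tau> h) t \<in> V"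
    and s: "\<And>\<gamma>. \<gamma> \<in> \<Gamma> \<Longrightarrow> s \<gamma> \<in> wsp n \<gamma>" and "t - sum s \<Gamma> \<in> V"
  shows "t \<in> V"
proof (rule eigen_independent[where T = "\<lambda>h. AA x M (hop h)" and ev = hval and Hs = "hidx m", OF V(1) AA_simps(1,2,3) V(3) G(1) t _ _ assms(10)])
  show "AA x M (hop h) (s \<gamma>) - pscale (hval \<gamma> h) (s \<gamma>) \<in> V" if "\<gamma> \<in> \<Gamma>" "h \<in> hidx m" for \<gamma> h
    using AA_hop[OF s[OF that(1)] that(2)] V(2) by blast
  show "\<exists>h\<in>hidx m. hval \<gamma> h \<noteq> hval \<tau> h" if "\<gamma> \<in> \<Gamma>" for \<gamma>
    using hval_inj[OF subsetD[OF G(2) that] G(3)] that G(4) by blast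
qed

lemma hop_LL: "h \<in> hidx m \<Longrightarrow> hop h \<in> L"
  using hop_L by blast

text \<open>The relations are stable under the Cartan subalgebra, so with a sum of chains of
  distinct weights they contain each summand.\<close>

lemma components_R:
  assumes "finite \<Gamma>" "\<Gamma> \<subseteq> hdual (I_tilde m)" "\<And>\<gamma>. \<gamma> \<in> \<Gamma> \<Longrightarrow> f \<gamma> \<in> wsp n \<gamma>" "sum f \<Gamma> \<in> til.R n" and t: "\<tau> \<in> \<Gamma>"
  shows "f \<tau> \<in> til.R n"
proof (rule weight_independent[where \<Gamma> = "\<Gamma> - {\<tau>}" and \<tau> = \<tau> and s = "\<lambda>\<gamma>. - f \<gamma>", OF til.R_subspace subset_refl])
  show "AA x M (hop h) z \<in> til.R n" if "h \<in> hidx m" "z \<in> til.R n" for h z by (rule til.AA_R[OF hop_LL[OF that(1)] that(2)])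
  show "AA x M (hop h) (f \<tau>) - pscale (hval \<tau> h) (f \<tau>) \<in> til.R n" if "h \<in> hidx m" for h
    by (rule AA_hop[OF assms(3)[OF t] that])
  show "- f \<gamma> \<in> wsp n \<gamma>" if "\<gamma> \<in> \<Gamma> - {\<tau>}" for \<gamma>
    using that by (intro pv.subspace_neg[OF wsp_subspace] assms(3)) blast
  have "f \<tau> - (\<Sum>\<gamma>\<in>\<Gamma> - {\<tau>}. - f \<gamma>) = sum f \<Gamma>" using assms(1) t by (simp add: sum_negf sum.remove)
  thus "f \<tau> - (\<Sum>\<gamma>\<in>\<Gamma> - {\<tau>}. - f \<gamma>) \<in> til.R n" using assms(4) by simp
  show "\<Gamma> - {\<tau>} \<subseteq> hdual (I_tilde m)" "\<tau> \<in> hdual (I_tilde m)" using assms(2) t by blast+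
qed (use assms(1) in simp_all)

text \<open>The projection is a retraction onto the supported chains and respects relations, so the
  large complex imposes no new relations on them.\<close>

lemma R_sub_F: "z \<in> til.R n \<Longrightarrow> z \<in> sub.F n \<Longrightarrow> z \<in> sub.R n"
  using proj_R[of z n] proj_id[of z n] by simp

lemma cycles_sub_iff: "z \<in> sub.cycles n \<longleftrightarrow> z \<in> til.cycles n \<and> z \<in> sub.F n"
proof
  assume "z \<in> sub.cycles n"
  hence "z \<in> sub.F n" "DD x M z \<in> sub.R (n - 1)" unfolding sub.cycles_def DD_MI by blast+
  thus "z \<in> til.cycles n \<and> z \<in> sub.F n" unfolding til.cycles_def using F_sub R_sub by blast
next
  assume z: "z \<in> til.cycles n \<and> z \<in> sub.F n"
  have "DD x M z \<in> sub.F (n - 1)" using sub.DD_F[of z n] z unfolding DD_MI by blast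
  hence "DD x M z \<in> sub.R (n - 1)" using z unfolding til.cycles_def by (intro R_sub_F) blast+
  thus "z \<in> sub.cycles n" using z unfolding sub.cycles_def DD_MI by blast
qed

lemma proj_boundaries: "b \<in> til.boundaries n \<Longrightarrow> proj b \<in> sub.boundaries n"
proof -
  assume "b \<in> til.boundaries n"
  then obtain z r where b: "b = DD x M z + r" "z \<in> til.F (Suc n)" "r \<in> til.R n" unfolding til.boundaries_def by blast
  let ?r = "(proj (DD x M z) - DD x M (proj z)) + proj r"
  have "?r \<in> sub.R n" using proj_DD[OF b(2)] proj_R[OF b(3)] pv.subspace_add[OF sub.R_subspace] by simp
  moreover have "proj b = DD x MI (proj z) + ?r" by (simp add: b(1) proj_simps DD_MI)
  ultimately show ?thesis unfolding sub.boundaries_def using proj_F[OF b(2)] by blast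
qed

lemma boundaries_sub: "sub.boundaries n \<subseteq> til.boundaries n"
  unfolding til.boundaries_def sub.boundaries_def DD_MI using F_sub R_sub by blast

text \<open>The same retraction argument: a supported chain that bounds in the large complex is its
  own projection, hence bounds in the small one. This gives injectivity on homology.\<close>

lemma boundaries_iff: "z \<in> sub.F n \<Longrightarrow> z \<in> til.boundaries n \<longleftrightarrow> z \<in> sub.boundaries n"
  using proj_boundaries[of z n] proj_id[of z n] boundaries_sub by auto

text \<open>The cycles whose class in homology is a weight vector of a weight supported on
  \<open>I\<close>; the eigenvalue equations hold modulo boundaries.\<close>

definition Wt :: "nat \<Rightarrow> (gt list \<times> 'v \<Rightarrow>\<^sub>0 complex) set"
  where "Wt n = {z \<in> til.cycles n. \<exists>\<gamma>\<in>hdual I. \<forall>h\<in>hidx m. AA x M (hop h) z - pscale (hval \<gamma> h) z \<in> til.boundaries n}"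

definition "SZ n = {w + b | w b. w \<in> sub.cycles n \<and> b \<in> til.boundaries n}"

lemma SZ_subspace: "pv.subspace (SZ n)"
  unfolding SZ_def by (rule pv.subspace_sums[OF sub.cycles_subspace til.boundaries_subspace])

lemma SZ_boundaries: "til.boundaries n \<subseteq> SZ n"
proof
  fix b assume b: "b \<in> til.boundaries n"
  thus "b \<in> SZ n" unfolding SZ_def mem_Collect_eq
    by (intro exI[of _ 0] exI[of _ b]) (simp add: pv.subspace_0[OF sub.cycles_subspace])
qed

lemma SZ_cycles_sub: "sub.cycles n \<subseteq> SZ n"
proof
  fix z assume "z \<in> sub.cycles n"
  thus "z \<in> SZ n" unfolding SZ_def mem_Collect_eq
    by (intro exI[of _ z] exI[of _ 0]) (simp add: pv.subspace_0[OF til.boundaries_subspace])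
qed

lemma SZ_cycles: "SZ n \<subseteq> til.cycles n"
proof
  fix z assume "z \<in> SZ n"
  then obtain w b where "z = w + b" "w \<in> sub.cycles n" "b \<in> til.boundaries n" unfolding SZ_def by blast
  thus "z \<in> til.cycles n" using cycles_sub_iff til.boundaries_cycles pv.subspace_add[OF til.cycles_subspace] by blast
qed

lemma F_decomp:
  assumes "z \<in> til.F n"
  shows "\<exists>\<Gamma> f. finite \<Gamma> \<and> \<Gamma> \<subseteq> hdual (I_tilde m) \<and> (\<forall>\<gamma>. f \<gamma> \<in> wsp n \<gamma>) \<and> z - sum f \<Gamma> \<in> til.R n"
proof -
  obtain y r where yr: "z = y + r" "y \<in> wall n" "r \<in> til.R n" using F_wallR[OF assms] unfolding wallR_def by blast
  obtain \<Gamma> f where f: "finite \<Gamma>" "\<Gamma> \<subseteq> hdual (I_tilde m)" "\<forall>\<gamma>. f \<gamma> \<in> wsp n \<gamma>" "y = sum f \<Gamma>"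
    using wall_decomp[OF yr(2)] by (elim exE conjE)
  have "z - sum f \<Gamma> \<in> til.R n" using yr f(4) by simp
  with f(1-3) show ?thesis by (intro exI conjI)
qed

text \<open>Split off from \<open>z\<close> its component \<open>w\<close> of weight \<gamma>. What
  is left has weight \<gamma> modulo boundaries and is at the same time, modulo relations, a sum of
  components of other weights, so it is a boundary. And \<open>w\<close> is supported on
  \<open>I\<close> because \<gamma> is.\<close>

lemma Wt_SZ: "Wt n \<subseteq> SZ n"
proof
  fix z assume "z \<in> Wt n"
  then obtain \<gamma> where z: "z \<in> til.cycles n" "\<gamma> \<in> hdual I"
    "\<And>h. h \<in> hidx m \<Longrightarrow> AA x M (hop h) z - pscale (hval \<gamma> h) z \<in> til.boundaries n" unfolding Wt_def by blast
  have "z \<in> til.F n" using z(1) unfolding til.cycles_def by blast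
  from F_decomp[OF this] obtain \<Gamma> f where f: "finite \<Gamma>" "\<Gamma> \<subseteq> hdual (I_tilde m)" "\<forall>\<gamma>. f \<gamma> \<in> wsp n \<gamma>" "z - sum f \<Gamma> \<in> til.R n"
    by (elim exE conjE)
  \<comment> \<open>The component may be absent from the decomposition; then \<gamma> is no weight
    of the chain and 0 takes its place.\<close>
  define w where "w = (if \<gamma> \<in> \<Gamma> then f \<gamma> else 0)"
  have w: "w \<in> wsp n \<gamma>" unfolding w_def using spec[OF f(3), of \<gamma>] pv.subspace_0[OF wsp_subspace] by simp
  have wF: "w \<in> sub.F n" by (rule wsp_sub_F[OF w z(2)])
  note B = til.boundaries_subspace[of n] and RB = til.R_boundaries[of n]
  have tB: "z - w \<in> til.boundaries n"
  proof (rule weight_independent[OF B RB, of "\<Gamma> - {\<gamma>}" \<gamma> _ f])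
    show "AA x M (hop h) z \<in> til.boundaries n" if "h \<in> hidx m" "z \<in> til.boundaries n" for h z
      by (rule til.AA_boundaries[OF hop_LL[OF that(1)] that(2)])
    show "AA x M (hop h) (z - w) - pscale (hval \<gamma> h) (z - w) \<in> til.boundaries n" if "h \<in> hidx m" for h
    proof -
      have "(AA x M (hop h) z - pscale (hval \<gamma> h) z) - (AA x M (hop h) w - pscale (hval \<gamma> h) w) \<in> til.boundaries n"
        by (rule pv.subspace_diff[OF B z(3)[OF that] subsetD[OF RB AA_hop[OF w that]]])
      thus ?thesis by (simp add: AA_simps pv.scale_right_diff_distrib algebra_simps)
    qed
    have "z - w - sum f (\<Gamma> - {\<gamma>}) = z - sum f \<Gamma>"
      using f(1) by (cases "\<gamma> \<in> \<Gamma>") (simp_all add: w_def sum.remove diff_diff_eq)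
    thus "z - w - sum f (\<Gamma> - {\<gamma>}) \<in> til.boundaries n" using subsetD[OF RB f(4)] by (simp only:)
    show "\<gamma> \<in> hdual (I_tilde m)" using z(2) hdual_I by blast
    show "\<Gamma> - {\<gamma>} \<subseteq> hdual (I_tilde m)" using f(2) by blast
    show "f \<delta> \<in> wsp n \<delta>" for \<delta> using f(3) by blast
  qed (use f(1) in simp_all)
  have "z - (z - w) \<in> til.cycles n"
    by (rule pv.subspace_diff[OF til.cycles_subspace z(1) subsetD[OF til.boundaries_cycles tB]])
  hence "w \<in> sub.cycles n" using wF cycles_sub_iff by simp
  moreover have "z = w + (z - w)" by simp
  ultimately show "z \<in> SZ n" unfolding SZ_def using tB by blast
qed

lemma boundaries_Wt: "til.boundaries n \<subseteq> Wt n"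
proof
  fix b assume b: "b \<in> til.boundaries n"
  have "AA x M (hop h) b - pscale (hval 0 h) b \<in> til.boundaries n" if "h \<in> hidx m" for h
    using til.AA_boundaries[OF hop_LL[OF that] b] by simp
  thus "b \<in> Wt n" unfolding Wt_def using til.boundaries_cycles b hdual_0[of I] by blast
qed

text \<open>A supported cycle is, modulo relations, the sum of its components of supported weights.
  The boundary preserves weights, so each component is a cycle by itself and its class is a weight
  vector.\<close>

lemma cycles_sub_Wt: "sub.cycles n \<subseteq> pv.span (Wt n)"
proof
  fix z assume zZ: "z \<in> sub.cycles n"
  hence z: "z \<in> til.cycles n" "z \<in> sub.F n" using cycles_sub_iff by blast+
  have "z \<in> til.F n" using z(2) F_sub by blast
  from F_decomp[OF this] obtain \<Gamma> f where f: "finite \<Gamma>" "\<Gamma> \<subseteq> hdual (I_tilde m)" "\<forall>\<gamma>. f \<gamma> \<in> wsp n \<gamma>" "z - sum f \<Gamma> \<in> til.R n"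
    by (elim exE conjE)
  define \<Delta> where "\<Delta> = \<Gamma> \<inter> hdual I"
  have D: "finite \<Delta>" "\<Delta> \<subseteq> hdual (I_tilde m)" "\<Delta> \<subseteq> hdual I" unfolding \<Delta>_def using f(1,2) by auto
  have proj_sum: "proj (sum f A) = (\<Sum>\<gamma>\<in>A. proj (f \<gamma>))" if "finite A" for A
    using that by (induction rule: finite_induct) (simp_all add: proj_simps)
  \<comment> \<open>The projection fixes \<open>z\<close> and the supported components and turns the
    others into relations; comparing the decomposition with its projection discards the
    latter.\<close>
  have zD: "z - sum f \<Delta> \<in> til.R n"
  proof -
    have split: "sum f \<Gamma> = sum f \<Delta> + sum f (\<Gamma> - \<Delta>)" using sum.subset_diff[of \<Delta> \<Gamma> f] f(1) unfolding \<Delta>_def by (simp add: add.commute)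
    have pD: "proj (sum f \<Delta>) = sum f \<Delta>"
      by (rule proj_id, rule pv.subspace_sum[OF sub.F_subspace]) (use f(3) D(3) wsp_sub_F in blast)
    have pC: "proj (sum f (\<Gamma> - \<Delta>)) \<in> sub.R n"
      unfolding proj_sum[OF finite_Diff[OF f(1)]]
      by (rule pv.subspace_sum[OF sub.R_subspace], rule wsp_proj_R[OF spec[OF f(3)]]) (simp add: \<Delta>_def)
    have "proj (z - sum f \<Gamma>) \<in> sub.R n" by (rule proj_R[OF f(4)])
    hence "proj (z - sum f \<Gamma>) + proj (sum f (\<Gamma> - \<Delta>)) \<in> sub.R n" using pC by (rule pv.subspace_add[OF sub.R_subspace])
    moreover have "proj (z - sum f \<Gamma>) + proj (sum f (\<Gamma> - \<Delta>)) = z - sum f \<Delta>"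
      unfolding split proj_simps pD proj_id[OF z(2)] by simp
    ultimately show ?thesis using R_sub by auto
  qed
  have Dsum: "DD x M (sum f \<Delta>) = (\<Sum>\<gamma>\<in>\<Delta>. DD x M (f \<gamma>))"
    using D(1) by (induction rule: finite_induct) (simp_all add: DD_simps)
  have "DD x M z - DD x M (z - sum f \<Delta>) \<in> til.R (n - 1)"
    using z(1) til.DD_R[OF zD] unfolding til.cycles_def by (intro pv.subspace_diff[OF til.R_subspace]) blast+
  hence "(\<Sum>\<gamma>\<in>\<Delta>. DD x M (f \<gamma>)) \<in> til.R (n - 1)" by (simp add: DD_simps Dsum)
  \<comment> \<open>The boundaries of the components have distinct weights and add up to a relation,
    so each of them is one.\<close>
  hence DR: "DD x M (f \<gamma>) \<in> til.R (n - 1)" if "\<gamma> \<in> \<Delta>" for \<gamma>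
    by (rule components_R[OF D(1,2) DD_wsp[OF spec[OF f(3)]] _ that])
  have "f \<gamma> \<in> Wt n" if g: "\<gamma> \<in> \<Delta>" for \<gamma>
  proof -
    have "f \<gamma> \<in> til.cycles n" unfolding til.cycles_def using wsp_F[OF spec[OF f(3)]] DR[OF g] by blast
    moreover have "AA x M (hop h) (f \<gamma>) - pscale (hval \<gamma> h) (f \<gamma>) \<in> til.boundaries n" if "h \<in> hidx m" for h
      by (rule subsetD[OF til.R_boundaries AA_hop[OF spec[OF f(3)] that]])
    ultimately show ?thesis unfolding Wt_def using subsetD[OF D(3) g] by blast
  qed
  hence "sum f \<Delta> \<in> pv.span (Wt n)" by (intro pv.span_sum pv.span_base)
  moreover have "z - sum f \<Delta> \<in> pv.span (Wt n)"
    using zD til.R_boundaries boundaries_Wt by (intro pv.span_base) blast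
  ultimately have "sum f \<Delta> + (z - sum f \<Delta>) \<in> pv.span (Wt n)" by (rule pv.span_add)
  thus "z \<in> pv.span (Wt n)" by simp
qed

text \<open>Truncated homology consists of the classes of supported cycles: the subspace given by
  eigenvalue conditions becomes one given by supports, which can be compared with the small
  complex.\<close>

lemma span_Wt: "pv.span (Wt n) = SZ n"
proof
  show "pv.span (Wt n) \<subseteq> SZ n" by (rule pv.span_minimal[OF Wt_SZ SZ_subspace])
  show "SZ n \<subseteq> pv.span (Wt n)"
  proof
    fix z assume "z \<in> SZ n"
    then obtain w b where "z = w + b" "w \<in> sub.cycles n" "b \<in> til.boundaries n" unfolding SZ_def by blast
    thus "z \<in> pv.span (Wt n)"
      using pv.span_add[OF subsetD[OF cycles_sub_Wt] pv.span_base[OF subsetD[OF boundaries_Wt]]] by simp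
  qed
qed

section \<open>Weight spaces and parity of homology, and the isomorphism\<close>

lemma homology_weight_spaces:
  "(\<Union>\<gamma>\<in>hdual I. weight_space m (homology x U M n) \<gamma>) = til.cls n ` Wt n"
proof -
  note P = presentsD[OF til.presents_homology[of n]]
  let ?H = "homology x U M n"
  have ws: "v \<in> weight_space m ?H \<gamma> \<longleftrightarrow> v \<in> carrier ?H \<and> (\<forall>h\<in>hidx m. act ?H (hop h) v = hval \<gamma> h \<odot>\<^bsub>?H\<^esub> v)" for v \<gamma>
    by (simp add: weight_space_def hidx_def)
  have eq: "act ?H (hop h) (til.cls n z) = hval \<gamma> h \<odot>\<^bsub>?H\<^esub> til.cls n z \<longleftrightarrow>
      AA x M (hop h) z - pscale (hval \<gamma> h) z \<in> til.boundaries n" if "z \<in> til.cycles n" "h \<in> hidx m" for z h \<gamma>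
    unfolding P(10)[OF hop_LL[OF that(2)] that(1)] P(8)[OF that(1)]
    by (rule P(6)[OF P(9)[OF hop_LL[OF that(2)] that(1)] pv.subspace_scale[OF P(1) that(1)]])
  show ?thesis
  proof (intro equalityI subsetI)
    fix v assume "v \<in> (\<Union>\<gamma>\<in>hdual I. weight_space m ?H \<gamma>)"
    then obtain \<gamma> where g: "\<gamma> \<in> hdual I" "v \<in> carrier ?H" "\<And>h. h \<in> hidx m \<Longrightarrow> act ?H (hop h) v = hval \<gamma> h \<odot>\<^bsub>?H\<^esub> v"
      unfolding UN_iff ws by blast
    obtain z where z: "z \<in> til.cycles n" "v = til.cls n z" using g(2) unfolding P(4) by blast
    have "z \<in> Wt n" unfolding Wt_def using g(1,3) z eq by blast
    thus "v \<in> til.cls n ` Wt n" using z(2) by blast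
  next
    fix v assume "v \<in> til.cls n ` Wt n"
    then obtain z where z: "z \<in> Wt n" "v = til.cls n z" by blast
    then obtain \<gamma> where g: "z \<in> til.cycles n" "\<gamma> \<in> hdual I"
      "\<And>h. h \<in> hidx m \<Longrightarrow> AA x M (hop h) z - pscale (hval \<gamma> h) z \<in> til.boundaries n" unfolding Wt_def by blast
    have "v \<in> weight_space m ?H \<gamma>" unfolding ws z(2) P(4) using g(1,3) eq by blast
    thus "v \<in> (\<Union>\<gamma>\<in>hdual I. weight_space m ?H \<gamma>)" using g(2) by blast
  qed
qed

text \<open>If truncation kills an odd factor, the recorded degree of the symbol changes. Such a
  symbol is a relation, so parity is preserved modulo relations, which is all that the grading on
  classes requires.\<close>

lemma proj_gr:
  assumes "g \<in> til.gr_free n p" "p < 2"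
  shows "\<exists>g'\<in>sub.gr_free n p. proj g - g' \<in> sub.R n"
proof -
  define A where "A = {y + r | y r. y \<in> sub.gr_free n p \<and> r \<in> sub.R n}"
  have gsub: "pv.subspace (sub.gr_free n p)"
    unfolding sub.gr_free_def free_chains_def
  proof (simp, intro pv.subspaceI)
    let ?S = "{(xs, v). (xs, v) \<in> gens x UI MI n \<and> (\<exists>q<2. v \<in> gr MI q \<and> (sum_list (map (deg x) xs) + q) mod 2 = p)}"
    show "f + g \<in> {f. supp f \<subseteq> ?S}" if "f \<in> {f. supp f \<subseteq> ?S}" "g \<in> {f. supp f \<subseteq> ?S}" for f g
      unfolding mem_Collect_eq by (rule order_trans[OF keys_add]) (use that in blast)
    show "pscale c f \<in> {f. supp f \<subseteq> ?S}" if "f \<in> {f. supp f \<subseteq> ?S}" for c f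
      unfolding mem_Collect_eq by (rule order_trans[OF supp_pscale]) (use that in blast)
  qed simp
  have A: "pv.subspace A" unfolding A_def by (rule pv.subspace_sums[OF gsub sub.R_subspace])
  have A1: "y \<in> A" if "y \<in> sub.gr_free n p" for y
    unfolding A_def mem_Collect_eq using that by (intro exI[of _ y] exI[of _ 0]) (simp add: pv.subspace_0[OF sub.R_subspace])
  have A2: "r \<in> A" if "r \<in> sub.R n" for r
    unfolding A_def mem_Collect_eq using that by (intro exI[of _ 0] exI[of _ r]) (simp add: pv.subspace_0[OF gsub])
  have "g \<in> pv.span (bas ` supp g)" by (rule mem_span_supp) simp
  hence "proj g \<in> A"
  proof (rule til.span_into[OF proj_simps(1,3) _ A, rotated])
    fix a assume "a \<in> bas ` supp g"
    then obtain xs v where a: "a = bas (xs, v)" "(xs, v) \<in> supp g" by auto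
    obtain s where s: "(xs, v) \<in> gens x U M n" "s < 2" "v \<in> gr M s" "(sum_list (map (deg x) xs) + s) mod 2 = p"
      using a(2) assms(1) unfolding til.gr_free_def free_chains_def by auto
    have g: "(map (ptr I) xs, q v) \<in> gens x UI MI n" by (rule gens_proj[OF s(1)])
    have hom: "X \<in> gt_hom x 0 \<union> gt_hom x 1" if "X \<in> set xs" for X using s(1) that unfolding gens_def by blast
    have len: "length xs = n" using s(1) by (simp add: gens_def)
    show "proj a \<in> A"
    proof (cases "0 \<in> set (map (ptr I) xs)")
      case True
      then obtain i where "i < n" "map (ptr I) xs ! i = 0" using len unfolding in_set_conv_nth by auto
      thus ?thesis unfolding a(1) proj_bas by (intro A2 sub_zero_R[OF g])
    next
      case False
      have "map (deg x) (map (ptr I) xs) = map (deg x) xs"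
        unfolding map_map using False ptr_deg[OF hom] by (intro map_cong[OF refl]) force
      moreover have "q v \<in> gr MI s" using q_gr[OF s(2,3)] q_obtain(1)[OF gr_carrier[OF s(2,3)]] by (simp add: MI_simps)
      ultimately have "s < 2 \<and> q v \<in> gr MI s \<and> (sum_list (map (deg x) (map (ptr I) xs)) + s) mod 2 = p"
        using s(2,4) by (simp only:)
      hence "\<exists>s<2. q v \<in> gr MI s \<and> (sum_list (map (deg x) (map (ptr I) xs)) + s) mod 2 = p" by (rule exI)
      hence "bas (map (ptr I) xs, q v) \<in> sub.gr_free n p"
        using g unfolding sub.gr_free_def free_chains_def by simp
      thus ?thesis unfolding a(1) proj_bas by (rule A1)
    qed
  qed
  then obtain y r where "proj g = y + r" "y \<in> sub.gr_free n p" "r \<in> sub.R n" unfolding A_def by blast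
  thus ?thesis by (intro bexI[of _ y]) simp_all
qed

lemma gr_free_sub: "sub.gr_free n p \<subseteq> til.gr_free n p"
proof
  fix f assume f: "f \<in> sub.gr_free n p"
  have "b \<in> {(xs, v). (xs, v) \<in> gens x U M n \<and> (\<exists>q<2. v \<in> gr M q \<and> (sum_list (map (deg x) xs) + q) mod 2 = p)}"
    if "b \<in> supp f" for b
  proof -
    obtain xs v where b: "b = (xs, v)" by (cases b)
    have "(xs, v) \<in> gens x UI MI n" "\<exists>q<2. v \<in> gr MI q \<and> (sum_list (map (deg x) xs) + q) mod 2 = p"
      using f that unfolding sub.gr_free_def free_chains_def b by auto
    thus ?thesis unfolding b MI_simps using gens_sub by auto
  qed
  thus "f \<in> til.gr_free n p" unfolding til.gr_free_def free_chains_def by auto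
qed

text \<open>\<open>SZ n\<close> modulo \<open>til.boundaries n\<close> presents the truncated
  homology, and supported cycles modulo supported boundaries present the homology of the truncated
  complex. The inclusion of the supported cycles in \<open>SZ n\<close> induces the isomorphism,
  with \<open>proj\<close> choosing representatives.\<close>

lemma homology_iso:
  "smod_iso (levi_tilde x m Y0 \<inter> gI) (truncate m I (homology x U M n)) (homology x UI MI n)"
proof -
  let ?L = "levi_tilde x m Y0 \<inter> gI"
  let ?H = "homology x U M n"
  have "mspan ?H (til.cls n ` Wt n) = til.cls n ` SZ n"
    unfolding span_Wt[symmetric] by (rule presents_mspan[OF til.presents_homology]) (auto simp: Wt_def)
  hence tr: "truncate m I ?H = restr ?H (til.cls n ` SZ n)"
    unfolding truncate_def homology_weight_spaces by simp
  have P1: "presents ?L (truncate m I ?H) (til.cls n) (SZ n) (til.boundaries n) (AA x M)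
     (\<lambda>p. {z \<in> SZ n. \<exists>g\<in>{z \<in> til.cycles n. \<exists>g\<in>til.gr_free n p. z - g \<in> til.R n}. z - g \<in> til.boundaries n})"
    unfolding tr
  proof (rule presents_restr[OF presents_mono[OF til.presents_homology] SZ_subspace SZ_boundaries SZ_cycles])
    show "?L \<subseteq> L" by blast
    fix X z assume X: "X \<in> ?L" and "z \<in> SZ n"
    then obtain w b where z: "z = w + b" "w \<in> sub.cycles n" "b \<in> til.boundaries n" unfolding SZ_def by blast
    have "AA x M X w \<in> sub.cycles n" using sub.AA_cycles[of X w n] X z(2) unfolding AA_MI by blast
    moreover have "AA x M X b \<in> til.boundaries n" using til.AA_boundaries[of X b n] X z(3) by blast
    ultimately show "AA x M X z \<in> SZ n" unfolding SZ_def z(1) AA_simps by blast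
  qed
  have P2: "presents ?L (homology x UI MI n) (sub.cls n) (sub.cycles n) (sub.boundaries n) (AA x M)
     (\<lambda>p. {z \<in> sub.cycles n. \<exists>g\<in>sub.gr_free n p. z - g \<in> sub.R n})"
    using presents_mono[OF sub.presents_homology, of ?L] unfolding AA_MI by blast
  note Bc = pv.subspace_add[OF til.boundaries_subspace] pv.subspace_diff[OF til.boundaries_subspace] pv.subspace_neg[OF til.boundaries_subspace]
  note Rc = pv.subspace_add[OF sub.R_subspace] pv.subspace_diff[OF sub.R_subspace]
  have proj_cycles: "proj z \<in> sub.cycles n \<and> z - proj z \<in> til.boundaries n" if "z \<in> SZ n" for z
  proof -
    obtain w b where z: "z = w + b" "w \<in> sub.cycles n" "b \<in> til.boundaries n" using \<open>z \<in> SZ n\<close> unfolding SZ_def by blast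
    have "proj w = w" by (rule proj_id) (use z(2) cycles_sub_iff in blast)
    hence e: "proj z = w + proj b" by (simp add: z(1) proj_simps)
    have pb: "proj b \<in> sub.boundaries n" by (rule proj_boundaries[OF z(3)])
    have "proj z \<in> sub.cycles n" unfolding e
      by (rule pv.subspace_add[OF sub.cycles_subspace z(2) subsetD[OF sub.boundaries_cycles pb]])
    moreover have "z - proj z = b - proj b" by (simp only: e) (simp add: z(1))
    ultimately show ?thesis using Bc(2)[OF z(3) subsetD[OF boundaries_sub pb]] by simp
  qed
  show ?thesis
  proof (rule presents_iso[OF P1 P2 SZ_cycles_sub])
    show "\<exists>w\<in>sub.cycles n. z - w \<in> til.boundaries n" if "z \<in> SZ n" for z
      using proj_cycles[OF that] by blast
    show "z \<in> til.boundaries n \<longleftrightarrow> z \<in> sub.boundaries n" if "z \<in> sub.cycles n" for z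
      by (rule boundaries_iff) (use that cycles_sub_iff in blast)
  next
    fix p z
    assume "z \<in> {z \<in> SZ n. \<exists>g\<in>{z \<in> til.cycles n. \<exists>g\<in>til.gr_free n p. z - g \<in> til.R n}. z - g \<in> til.boundaries n}"
    then obtain g g' where z: "z \<in> SZ n" "g' \<in> til.gr_free n p" "g - g' \<in> til.R n" "z - g \<in> til.boundaries n" by blast
    show "\<exists>w\<in>{z \<in> sub.cycles n. \<exists>g\<in>sub.gr_free n p. z - g \<in> sub.R n}. z - w \<in> til.boundaries n"
    proof (cases "p < 2")
      case True
      have d: "z - g' \<in> til.boundaries n"
        using Bc(1)[OF z(4) subsetD[OF til.R_boundaries z(3)]] by simp
      have pd: "proj z - proj g' \<in> sub.boundaries n" using proj_boundaries[OF d] by (simp add: proj_simps)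
      have "proj z - (proj z - proj g') \<in> sub.cycles n"
        by (rule pv.subspace_diff[OF sub.cycles_subspace conjunct1[OF proj_cycles[OF z(1)]] subsetD[OF sub.boundaries_cycles pd]])
      hence "proj g' \<in> sub.cycles n" by simp
      moreover have "(z - proj z) + (proj z - proj g') \<in> til.boundaries n"
        using proj_cycles[OF z(1)] subsetD[OF boundaries_sub pd] by (intro Bc(1)) blast+
      ultimately show ?thesis using proj_gr[OF z(2) True] by (intro bexI[of _ "proj g'"]) simp_all
    next
      case False
      \<comment> \<open>The grading is a function on all natural numbers, but a parity is taken mod
        2; for \<open>p\<close> at least 2 only the zero chain is left.\<close>
      have "supp g' = {}"
      proof -
        have "(k :: nat) mod 2 \<noteq> p" for k using False mod_less_divisor[of 2 k] by linarith
        thus ?thesis using z(2) unfolding til.gr_free_def free_chains_def by auto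
      qed
      hence "g' = 0" by simp
      hence "z \<in> til.boundaries n" using Bc(1)[OF z(4) subsetD[OF til.R_boundaries z(3)]] by simp
      moreover have "0 \<in> sub.gr_free n p" unfolding sub.gr_free_def free_chains_def by simp
      moreover have "0 \<in> sub.cycles n" "(0 :: gt list \<times> 'v \<Rightarrow>\<^sub>0 complex) - 0 \<in> sub.R n"
        using pv.subspace_0[OF sub.cycles_subspace] pv.subspace_0[OF sub.R_subspace] by simp_all
      ultimately show ?thesis by (intro bexI[of _ 0]) (simp, blast)
    qed
  next
    fix p z
    assume "z \<in> {z \<in> sub.cycles n. \<exists>g\<in>sub.gr_free n p. z - g \<in> sub.R n}"
    then obtain g where z: "z \<in> sub.cycles n" "g \<in> sub.gr_free n p" "z - g \<in> sub.R n" by blast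
    have "g \<in> til.gr_free n p" "z - g \<in> til.R n" "z \<in> til.cycles n" "z \<in> SZ n" "z - z \<in> til.boundaries n"
      using subsetD[OF gr_free_sub z(2)] subsetD[OF R_sub z(3)] z(1) cycles_sub_iff subsetD[OF SZ_cycles_sub z(1)]
        pv.subspace_0[OF til.boundaries_subspace] by simp_all
    thus "\<exists>w\<in>{z \<in> SZ n. \<exists>g\<in>{z \<in> til.cycles n. \<exists>g\<in>til.gr_free n p. z - g \<in> til.R n}. z - g \<in> til.boundaries n}.
        z - w \<in> til.boundaries n" by blast
  qed
qed

end

theorem theorem4p11:
  fixes x :: ltype and m n :: nat and Y0 :: "weight set" and Mt :: "'v smod"
  assumes "Y0 \<subseteq> Pi_k x m"
    and "in_O_tilde x m Y0 Mt"
  shows "smod_iso (levi_plus x m Y0)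
           (T_plus m (homology x (u_tilde_minus x m Y0) Mt n))
           (homology x (u_plus_minus x m Y0) (T_plus m Mt) n)
       \<and> smod_iso (levi_bar x m Y0)
           (T_bar m (homology x (u_tilde_minus x m Y0) Mt n))
           (homology x (u_bar_minus x m Y0) (T_bar m Mt) n)"
proof -
  \<comment> \<open>Membership in the category enters through two consequences only: the module is
    spanned by its weight spaces, and its weights have nonnegative coefficients at positive
    indices.\<close>
  have tr: "truncation x m Mt Y0 I" if "negI m \<subseteq> I" "I \<subseteq> I_tilde m" for I
  proof (rule truncation.intro[OF O_tilde_weight_module[OF assms(2)] truncation_axioms.intro[OF assms(1) that]])
    show "mspan Mt (\<Union>\<gamma>\<in>hdual (I_tilde m). weight_space m Mt \<gamma>) = carrier Mt"
      using assms(2) unfolding in_O_tilde_def by (elim conjE)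
    show "poly_wt \<gamma>" if "\<gamma> \<in> hdual (I_tilde m)" "t \<in> weight_space m Mt \<gamma>" "t \<noteq> \<zero>\<^bsub>Mt\<^esub>" for \<gamma> t
      by (rule O_tilde_poly_wt[OF assms that(2,1,3)])
  qed
  have "of_nat k \<in> halfN" if "k \<ge> 1" for k
    unfolding halfN_def mem_Collect_eq using that by (intro exI[of _ "2 * k"]) simp
  hence I1: "I_plus m \<subseteq> I_tilde m" unfolding I_plus_def I_tilde_def by blast
  have "1 / 2 + of_nat k \<in> halfN" for k
    unfolding halfN_def mem_Collect_eq by (intro exI[of _ "2 * k + 1"]) (simp add: field_simps)
  hence I2: "I_bar m \<subseteq> I_tilde m" unfolding I_bar_def I_tilde_def by blast
  have "truncation x m Mt Y0 (I_plus m)" "truncation x m Mt Y0 (I_bar m)"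
    by (rule tr[OF _ I1], simp add: I_plus_def, rule tr[OF _ I2], simp add: I_bar_def)
  from this[THEN truncation.homology_iso, of n] this[THEN truncation.truncate_eq] show ?thesis
    unfolding levi_plus_def levi_bar_def u_plus_minus_def u_bar_minus_def g_plus_def g_bar_def T_plus_def T_bar_def
    by simp
qed

end
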